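(* Let $k$ be an algebraically closed field, let $G$ be a finite group, let $A=\bigoplus_{g\in G}A_g$ be a finite dimensional $G$-graded $k$-algebra, and let $B=A\#k[G]^*$. Then $$\mathrm{Odim}\,B\leq \mathrm{Odim}\,A.$$ Furthermore, if $A$ is separably graded, then $$\mathrm{Odim}\,B=\mathrm{Odim}\,A,$$ and in this case $\mathrm{rep.dim}\,B\geq\mathrm{Odim}\,A+2$.
   Context: Smash product. Let $G$ be a finite group with identity $e$ and $A=\bigoplus_{g\in G}A_g$ a $G$-graded $k$-algebra. For $a\in A$ and $g\in G$, $a_g$ denotes the degree-$g$ component of $a$, and $p_g:G\to k$ denotes the function $h\mapsto\delta_{h,g}$. The smash product is the $k$-algebra $A\#k[G]^*=\bigoplus_{g\in G}Ap_g$ with multiplication $ap_g\cdot bp_h=ab_{gh^{-1}}p_h$ for $a,b\in A$, $g,h\in G$ (its identity is $\sum_{g\in G}p_g$). Separably graded. $A$ is called separably graded if there is a family $\{x^g\mid g\in G\}$ of elements of the center of $A_e$ such that (1) $\sum_{g\in G}x^g=1$ and (2) $rx^g=x^{hg}r$ for all $h,g\in G$ and all $r\in A_h$. Oppermann dimension. $\mathrm{mod}\,A$ is the category of finitely generated left $A$-modules. Let $R=k[x_1,\dots,x_d]$ be the polynomial ring in $d$ variables and $\mathrm{Max}\,R$ its set of maximal ideals with the Zariski topology. For $\alpha\in\mathrm{Max}\,R$, let $R_\alpha$ be the localization of $R$ at $\alpha$ and $S_\alpha$ the corresponding simple $R$-module; let $\mathrm{fin}\,R$ be the category of finite length $R$-modules.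 A $d$-dimensional lattice for $A$ is a finitely generated $A\otimes_kR$-module $L$ that is projective as an $R$-module. Then $L\otimes_R-:\mathrm{fin}\,R\to\mathrm{mod}\,A$ is exact, and it induces maps $\mathrm{Ext}^d_R(M,N)\to\mathrm{Ext}^d_A(L\otimes_RM,L\otimes_RN)$, $[\epsilon]\mapsto[L\otimes_R\epsilon]$, on (Yoneda) extension classes. The $k$-module $\mathrm{Ext}^d_R(S_\alpha,S_\alpha)$ is generated by the class of a long exact sequence $\epsilon_\alpha:0\to S_\alpha\to M_1\to\cdots\to M_d\to S_\alpha\to0$ with $R_\alpha$-modules $M_i$ that are indecomposable of length 2. Put $O^d_A(L)=\{\alpha\in\mathrm{Max}\,R\mid [L\otimes_R\epsilon_\alpha]\neq0\text{ in }\mathrm{Ext}^d_A(L\otimes_RS_\alpha,L\otimes_RS_\alpha)\}$. The lattice $L$ is a $d$-dimensional Oppermann lattice for $A$ if $O^d_A(L)$ is dense in $\mathrm{Max}\,R$. The Oppermann dimension $\mathrm{Odim}\,A$ is the supremum of all $d$ such that there exists a $d$-dimensional Oppermann lattice for $A$. Representation dimension. For a finite dimensional $k$-algebra $A$, $M\in\mathrm{mod}\,A$ is a generator-cogenerator if $A\in\mathrm{add}\,M$ and $DA\in\mathrm{add}\,M$, where $D=\mathrm{Hom}_k(-,k)$ and $\mathrm{add}\,M$ consists of all direct summands of finite direct sums of copies of $M$. Then $\mathrm{rep.dim}\,A=\inf\{\mathrm{gl.dim}\,\mathrm{End}_A(M)\mid M\text{ a generator-cogenerator in }\mathrm{mod}\,A\}$,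 where $\mathrm{gl.dim}$ denotes global dimension. *)

theory Defs
  imports
    "HOL-Library.Extended_Real"
    "HOL-Analysis.Abstract_Topology"
    "HOL-Algebra.Algebra"
begin

section \<open>Modules over not necessarily commutative rings\<close>

text \<open>
  Modules use the record of \<^theory>\<open>HOL-Algebra.Module\<close>; its fields \<^const>\<open>monoid.mult\<close> and
  \<^const>\<open>monoid.one\<close> carry no meaning unless the record is an algebra. The locale
  \<^locale>\<open>Module.module\<close> is restricted to commutative rings of scalars.
\<close>

locale left_module = R?: ring R + M?: abelian_group M
  for R :: "('r, 'z) ring_scheme" (structure) and M :: "('r, 'm, 'w) module_scheme" (structure) +
  assumes smult_closed:
      "\<lbrakk>a \<in> carrier R; x \<in> carrier M\<rbrakk> \<Longrightarrow> a \<odot>\<^bsub>M\<^esub> x \<in> carrier M"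
    and smult_l_distr:
      "\<lbrakk>a \<in> carrier R; b \<in> carrier R; x \<in> carrier M\<rbrakk> \<Longrightarrow>
        (a \<oplus>\<^bsub>R\<^esub> b) \<odot>\<^bsub>M\<^esub> x = a \<odot>\<^bsub>M\<^esub> x \<oplus>\<^bsub>M\<^esub> b \<odot>\<^bsub>M\<^esub> x"
    and smult_r_distr:
      "\<lbrakk>a \<in> carrier R; x \<in> carrier M; y \<in> carrier M\<rbrakk> \<Longrightarrow>
        a \<odot>\<^bsub>M\<^esub> (x \<oplus>\<^bsub>M\<^esub> y) = a \<odot>\<^bsub>M\<^esub> x \<oplus>\<^bsub>M\<^esub> a \<odot>\<^bsub>M\<^esub> y"
    and smult_assoc1:
      "\<lbrakk>a \<in> carrier R; b \<in> carrier R; x \<in> carrier M\<rbrakk> \<Longrightarrow>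
        (a \<otimes>\<^bsub>R\<^esub> b) \<odot>\<^bsub>M\<^esub> x = a \<odot>\<^bsub>M\<^esub> (b \<odot>\<^bsub>M\<^esub> x)"
    and smult_one: "x \<in> carrier M \<Longrightarrow> \<one>\<^bsub>R\<^esub> \<odot>\<^bsub>M\<^esub> x = x"

definition module_span ::
    "('r, 'z) ring_scheme \<Rightarrow> ('r, 'm, 'w) module_scheme \<Rightarrow> 'm set \<Rightarrow> 'm set" where
  "module_span R M S = \<Inter>{N. submodule N R M \<and> S \<subseteq> N}"

definition fin_gen :: "('r, 'z) ring_scheme \<Rightarrow> ('r, 'm, 'w) module_scheme \<Rightarrow> bool" where
  "fin_gen R M \<longleftrightarrow> (\<exists>S. finite S \<and> S \<subseteq> carrier M \<and> module_span R M S = carrier M)"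

definition lin_maps ::
    "('r, 'z) ring_scheme \<Rightarrow> ('r, 'm, 'w) module_scheme \<Rightarrow> ('r, 'n, 'v) module_scheme
      \<Rightarrow> ('m \<Rightarrow> 'n) set" where
  "lin_maps R M N = {f \<in> carrier M \<rightarrow> carrier N.
     (\<forall>x\<in>carrier M. \<forall>y\<in>carrier M. f (x \<oplus>\<^bsub>M\<^esub> y) = f x \<oplus>\<^bsub>N\<^esub> f y) \<and>
     (\<forall>r\<in>carrier R. \<forall>x\<in>carrier M. f (r \<odot>\<^bsub>M\<^esub> x) = r \<odot>\<^bsub>N\<^esub> f x)}"

definition regular_module :: "('r, 'z) ring_scheme \<Rightarrow> ('r, 'r) module" where
  "regular_module R = \<lparr>carrier = carrier R, monoid.mult = monoid.mult R, monoid.one = \<one>\<^bsub>R\<^esub>,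
     ring.zero = \<zero>\<^bsub>R\<^esub>, ring.add = ring.add R, module.smult = monoid.mult R\<rparr>"

definition restrict_scalars ::
    "('r \<Rightarrow> 's) \<Rightarrow> ('s, 'm, 'w) module_scheme \<Rightarrow> ('r, 'm) module" where
  "restrict_scalars \<phi> M = \<lparr>carrier = carrier M, monoid.mult = monoid.mult M, monoid.one = \<one>\<^bsub>M\<^esub>,
     ring.zero = \<zero>\<^bsub>M\<^esub>, ring.add = ring.add M, module.smult = (\<lambda>r. module.smult M (\<phi> r))\<rparr>"

text \<open>\<open>R\<close>-linear split embedding, i.e. \<open>P\<close> is isomorphic to a direct summand of \<open>M\<close>.\<close>

definition direct_summand ::
    "('r, 'z) ring_scheme \<Rightarrow> ('r, 'p, 'w) module_scheme \<Rightarrow> ('r, 'm, 'v) module_scheme \<Rightarrow> bool" where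
  "direct_summand R P M \<longleftrightarrow>
     (\<exists>i \<in> lin_maps R P M. \<exists>p \<in> lin_maps R M P. \<forall>x\<in>carrier P. p (i x) = x)"

definition free_module :: "('r, 'z) ring_scheme \<Rightarrow> 'x set \<Rightarrow> ('r, 'x \<Rightarrow> 'r) module" where
  "free_module R B = \<lparr>carrier = {f \<in> B \<rightarrow>\<^sub>E carrier R. finite {x \<in> B. f x \<noteq> \<zero>\<^bsub>R\<^esub>}},
     monoid.mult = undefined, monoid.one = undefined,
     ring.zero = (\<lambda>x\<in>B. \<zero>\<^bsub>R\<^esub>), ring.add = (\<lambda>f g. \<lambda>x\<in>B. f x \<oplus>\<^bsub>R\<^esub> g x),
     module.smult = (\<lambda>r f. \<lambda>x\<in>B. r \<otimes>\<^bsub>R\<^esub> f x)\<rparr>"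

definition power_module :: "('r, 'm, 'w) module_scheme \<Rightarrow> nat \<Rightarrow> ('r, nat \<Rightarrow> 'm) module" where
  "power_module M n = \<lparr>carrier = {..<n} \<rightarrow>\<^sub>E carrier M, monoid.mult = undefined, monoid.one = undefined,
     ring.zero = (\<lambda>i\<in>{..<n}. \<zero>\<^bsub>M\<^esub>), ring.add = (\<lambda>u v. \<lambda>i\<in>{..<n}. u i \<oplus>\<^bsub>M\<^esub> v i),
     module.smult = (\<lambda>r u. \<lambda>i\<in>{..<n}. r \<odot>\<^bsub>M\<^esub> u i)\<rparr>"

text \<open>
  Projective means: direct summand of a free module. Since \<open>P\<close> is a quotient of the free module on
  its own carrier, bases taken from the type of \<open>P\<close> suffice.
\<close>

definition projective :: "('r, 'z) ring_scheme \<Rightarrow> ('r, 'p, 'w) module_scheme \<Rightarrow> bool" where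
  "projective R P \<longleftrightarrow> left_module R P \<and> (\<exists>B :: 'p set. direct_summand R P (free_module R B))"

definition in_add ::
    "('r, 'z) ring_scheme \<Rightarrow> ('r, 'x, 'w) module_scheme \<Rightarrow> ('r, 'm, 'v) module_scheme \<Rightarrow> bool" where
  "in_add R B M \<longleftrightarrow> (\<exists>n. direct_summand R B (power_module M n))"

definition indecomposable :: "('r, 'z) ring_scheme \<Rightarrow> ('r, 'm, 'w) module_scheme \<Rightarrow> bool" where
  "indecomposable R M \<longleftrightarrow> carrier M \<noteq> {\<zero>\<^bsub>M\<^esub>} \<and>
     (\<forall>U V. submodule U R M \<and> submodule V R M \<and> U \<inter> V = {\<zero>\<^bsub>M\<^esub>} \<and> U <+>\<^bsub>M\<^esub> V = carrier M
        \<longrightarrow> U = {\<zero>\<^bsub>M\<^esub>} \<or> V = {\<zero>\<^bsub>M\<^esub>})"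

text \<open>A composition series with \<open>n\<close> factors exists.\<close>

definition has_length :: "('r, 'z) ring_scheme \<Rightarrow> ('r, 'm, 'w) module_scheme \<Rightarrow> nat \<Rightarrow> bool" where
  "has_length R M n \<longleftrightarrow> (\<exists>N :: nat \<Rightarrow> 'm set.
     N 0 = {\<zero>\<^bsub>M\<^esub>} \<and> N n = carrier M \<and> (\<forall>i\<le>n. submodule (N i) R M) \<and>
     (\<forall>i<n. N i \<subset> N (Suc i) \<and> (\<nexists>U. submodule U R M \<and> N i \<subset> U \<and> U \<subset> N (Suc i))))"


section \<open>Yoneda extensions\<close>

text \<open>
  A pair \<open>(C, f)\<close> stands for \<open>0 \<rightarrow> C 0 \<rightarrow> C 1 \<rightarrow> \<dots> \<rightarrow> C (n + 1) \<rightarrow> 0\<close> with maps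
  \<open>f i : C i \<rightarrow> C (i + 1)\<close>.
\<close>

type_synonym ('r, 'm) mod_seq = "(nat \<Rightarrow> ('r, 'm) module) \<times> (nat \<Rightarrow> 'm \<Rightarrow> 'm)"

definition long_exact :: "('r, 'z) ring_scheme \<Rightarrow> nat \<Rightarrow> ('r, 'm) mod_seq \<Rightarrow> bool" where
  "long_exact R n = (\<lambda>(C, f).
     (\<forall>i\<le>Suc n. left_module R (C i)) \<and>
     (\<forall>i\<le>n. f i \<in> lin_maps R (C i) (C (Suc i))) \<and>
     inj_on (f 0) (carrier (C 0)) \<and>
     f n ` carrier (C n) = carrier (C (Suc n)) \<and>
     (\<forall>i<n. f i ` carrier (C i) = {x \<in> carrier (C (Suc i)). f (Suc i) x = \<zero>\<^bsub>C (Suc (Suc i))\<^esub>}))"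

definition extensions ::
    "('r, 'z) ring_scheme \<Rightarrow> nat \<Rightarrow> ('r, 'm) module \<Rightarrow> ('r, 'm) module \<Rightarrow> ('r, 'm) mod_seq set" where
  "extensions R d M N = {(C, f). long_exact R d (C, f) \<and> C 0 = N \<and> C (Suc d) = M}"

definition seq_morphism ::
    "('r, 'z) ring_scheme \<Rightarrow> nat \<Rightarrow> ('r, 'm) mod_seq \<Rightarrow> ('r, 'm) mod_seq \<Rightarrow> (nat \<Rightarrow> 'm \<Rightarrow> 'm) \<Rightarrow> bool"
  where
  "seq_morphism R d = (\<lambda>(C, f) (Y, g) h.
     (\<forall>i\<le>Suc d. h i \<in> lin_maps R (C i) (Y i)) \<and>
     (\<forall>i\<le>d. \<forall>x\<in>carrier (C i). h (Suc i) (f i x) = g i (h i x)))"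

definition yoneda_step ::
    "('r, 'z) ring_scheme \<Rightarrow> nat \<Rightarrow> ('r, 'm) module \<Rightarrow> ('r, 'm) module \<Rightarrow> ('r, 'm) mod_seq rel" where
  "yoneda_step R d M N = {(E, E'). E \<in> extensions R d M N \<and> E' \<in> extensions R d M N \<and>
     (\<exists>h. seq_morphism R d E E' h \<and> (\<forall>x\<in>carrier N. h 0 x = x) \<and> (\<forall>x\<in>carrier M. h (Suc d) x = x))}"

definition yoneda_rel ::
    "('r, 'z) ring_scheme \<Rightarrow> nat \<Rightarrow> ('r, 'm) module \<Rightarrow> ('r, 'm) module \<Rightarrow> ('r, 'm) mod_seq rel" where
  "yoneda_rel R d M N =
     (yoneda_step R d M N \<union> (yoneda_step R d M N)\<inverse>)\<^sup>* \<inter> (extensions R d M N \<times> extensions R d M N)"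

text \<open>
  For \<open>d \<ge> 1\<close>, the elements of \<open>Ext\<^sup>d(M, N)\<close> are the Yoneda classes of exact sequences
  from \<open>N\<close> to \<open>M\<close>. All terms of the sequences have their carriers in one type, which has to be large
  enough to hold all finitely generated modules up to isomorphism.
\<close>

definition Ext ::
    "('r, 'z) ring_scheme \<Rightarrow> nat \<Rightarrow> ('r, 'm) module \<Rightarrow> ('r, 'm) module \<Rightarrow> ('r, 'm) mod_seq set set"
  where
  "Ext R d M N = extensions R d M N // yoneda_rel R d M N"

definition ext_class ::
    "('r, 'z) ring_scheme \<Rightarrow> nat \<Rightarrow> ('r, 'm) module \<Rightarrow> ('r, 'm) module \<Rightarrow> ('r, 'm) mod_seq
      \<Rightarrow> ('r, 'm) mod_seq set" where
  "ext_class R d M N E = yoneda_rel R d M N `` {E}"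

text \<open>
  The zero class is represented by split short exact sequences if \<open>d = 1\<close>, and by
  \<open>0 \<rightarrow> N = N \<rightarrow> 0 \<rightarrow> \<dots> \<rightarrow> 0 \<rightarrow> M = M \<rightarrow> 0\<close> if \<open>d \<ge> 2\<close>. Both are described up to isomorphism.
\<close>

definition zero_extensions ::
    "('r, 'z) ring_scheme \<Rightarrow> nat \<Rightarrow> ('r, 'm) module \<Rightarrow> ('r, 'm) module \<Rightarrow> ('r, 'm) mod_seq set" where
  "zero_extensions R d M N = {(C, f) \<in> extensions R d M N.
     if d = 1 then (\<exists>r \<in> lin_maps R (C 1) N. \<forall>x\<in>carrier N. r (f 0 x) = x)
     else bij_betw (f 0) (carrier N) (carrier (C 1)) \<and>
          (\<forall>i. 2 \<le> i \<and> i < d \<longrightarrow> carrier (C i) = {\<zero>\<^bsub>C i\<^esub>}) \<and>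
          bij_betw (f d) (carrier (C d)) (carrier M)}"

definition ext_zero ::
    "('r, 'z) ring_scheme \<Rightarrow> nat \<Rightarrow> ('r, 'm) module \<Rightarrow> ('r, 'm) module \<Rightarrow> ('r, 'm) mod_seq set" where
  "ext_zero R d M N = yoneda_rel R d M N `` zero_extensions R d M N"

text \<open>
  Multiplication of an extension class by a central scalar \<open>r\<close>: the product is the class of the
  pushout of \<open>E\<close> along \<open>r \<cdot> : N \<rightarrow> N\<close>, equivalently of any sequence that receives a morphism from
  \<open>E\<close> which is \<open>r \<cdot>\<close> on \<open>N\<close> and the identity on \<open>M\<close>.
\<close>

definition ext_smult ::
    "('r, 'z) ring_scheme \<Rightarrow> nat \<Rightarrow> ('r, 'm) module \<Rightarrow> ('r, 'm) module \<Rightarrow> 'r \<Rightarrow> ('r, 'm) mod_seq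
      \<Rightarrow> ('r, 'm) mod_seq set" where
  "ext_smult R d M N r E = yoneda_rel R d M N `` {E' \<in> extensions R d M N.
     \<exists>h. seq_morphism R d E E' h \<and> (\<forall>x\<in>carrier N. h 0 x = r \<odot>\<^bsub>N\<^esub> x) \<and>
         (\<forall>x\<in>carrier M. h (Suc d) x = x)}"


section \<open>Global dimension\<close>

definition proj_dim :: "('r, 'z) ring_scheme \<Rightarrow> ('r, 'm) module \<Rightarrow> enat" where
  "proj_dim R M = Inf {enat n | n. \<exists>P f. long_exact R n (P, f) \<and> P (Suc n) = M \<and>
     (\<forall>i\<le>n. projective R (P i))}"

text \<open>
  The carriers lie in \<open>(nat \<Rightarrow> 'e) set\<close>. This type contains all cyclic modules, which determine
  the global dimension, and with every module also a projective resolution of it.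
\<close>

definition gl_dim :: "('e, 'z) ring_scheme \<Rightarrow> enat" where
  "gl_dim R = Sup {proj_dim R M | M :: ('e, (nat \<Rightarrow> 'e) set) module. left_module R M}"


section \<open>Algebras and tensor products\<close>

text \<open>The locale \<^locale>\<open>Module.algebra\<close> of the library is restricted to commutative algebras.\<close>

locale assoc_algebra = Module.module K A + ring A
  for K :: "('k, 'z) ring_scheme" (structure) and A :: "('k, 'a, 'w) module_scheme" (structure) +
  assumes smult_mult_left:
      "\<lbrakk>c \<in> carrier K; x \<in> carrier A; y \<in> carrier A\<rbrakk> \<Longrightarrow>
        (c \<odot>\<^bsub>A\<^esub> x) \<otimes>\<^bsub>A\<^esub> y = c \<odot>\<^bsub>A\<^esub> (x \<otimes>\<^bsub>A\<^esub> y)"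
    and smult_mult_right:
      "\<lbrakk>c \<in> carrier K; x \<in> carrier A; y \<in> carrier A\<rbrakk> \<Longrightarrow>
        x \<otimes>\<^bsub>A\<^esub> (c \<odot>\<^bsub>A\<^esub> y) = c \<odot>\<^bsub>A\<^esub> (x \<otimes>\<^bsub>A\<^esub> y)"

text \<open>
  For modules \<open>M\<close>, \<open>N\<close> over a commutative ring \<open>R\<close>, the group \<open>M \<otimes>\<^sub>R N\<close> is the free abelian group
  on \<open>carrier M \<times> carrier N\<close> modulo the subgroup \<open>tensor_rels R M N\<close>.
\<close>

definition tensor_free ::
    "('r, 'm, 'w) module_scheme \<Rightarrow> ('r, 'n, 'v) module_scheme \<Rightarrow> (('m \<times> 'n) \<Rightarrow>\<^sub>0 int) monoid" where
  "tensor_free M N = free_Abelian_group (carrier M \<times> carrier N)"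

definition tensor_rels ::
    "('r, 'z) ring_scheme \<Rightarrow> ('r, 'm, 'w) module_scheme \<Rightarrow> ('r, 'n, 'v) module_scheme
      \<Rightarrow> (('m \<times> 'n) \<Rightarrow>\<^sub>0 int) set" where
  "tensor_rels R M N = generate (tensor_free M N)
     ({frag_of (x \<oplus>\<^bsub>M\<^esub> x', y) - frag_of (x, y) - frag_of (x', y) | x x' y.
         x \<in> carrier M \<and> x' \<in> carrier M \<and> y \<in> carrier N} \<union>
      {frag_of (x, y \<oplus>\<^bsub>N\<^esub> y') - frag_of (x, y) - frag_of (x, y') | x y y'.
         x \<in> carrier M \<and> y \<in> carrier N \<and> y' \<in> carrier N} \<union>
      {frag_of (r \<odot>\<^bsub>M\<^esub> x, y) - frag_of (x, r \<odot>\<^bsub>N\<^esub> y) | r x y.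
         r \<in> carrier R \<and> x \<in> carrier M \<and> y \<in> carrier N})"

definition tensor_group ::
    "('r, 'z) ring_scheme \<Rightarrow> ('r, 'm, 'w) module_scheme \<Rightarrow> ('r, 'n, 'v) module_scheme
      \<Rightarrow> (('m \<times> 'n) \<Rightarrow>\<^sub>0 int) set monoid" where
  "tensor_group R M N = tensor_free M N Mod tensor_rels R M N"

definition tensor_coset ::
    "('r, 'z) ring_scheme \<Rightarrow> ('r, 'm, 'w) module_scheme \<Rightarrow> ('r, 'n, 'v) module_scheme
      \<Rightarrow> (('m \<times> 'n) \<Rightarrow>\<^sub>0 int) \<Rightarrow> (('m \<times> 'n) \<Rightarrow>\<^sub>0 int) set" where
  "tensor_coset R M N u = tensor_rels R M N #>\<^bsub>tensor_free M N\<^esub> u"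

definition elem_tensor ::
    "('r, 'z) ring_scheme \<Rightarrow> ('r, 'm, 'w) module_scheme \<Rightarrow> ('r, 'n, 'v) module_scheme
      \<Rightarrow> 'm \<Rightarrow> 'n \<Rightarrow> (('m \<times> 'n) \<Rightarrow>\<^sub>0 int) set" where
  "elem_tensor R M N x y = tensor_coset R M N (frag_of (x, y))"

text \<open>
  \<open>tensor_map R M' N' \<phi> \<psi>\<close> is \<open>\<phi> \<otimes> \<psi>\<close> with values in \<open>M' \<otimes>\<^sub>R N'\<close>. As for \<^const>\<open>rcoset_mult\<close>, the
  union ranges over the representatives of a coset and all its members coincide.
\<close>

definition tensor_map ::
    "('r, 'z) ring_scheme \<Rightarrow> ('r, 'm', 'w) module_scheme \<Rightarrow> ('r, 'n', 'v) module_scheme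
      \<Rightarrow> ('m \<Rightarrow> 'm') \<Rightarrow> ('n \<Rightarrow> 'n') \<Rightarrow> (('m \<times> 'n) \<Rightarrow>\<^sub>0 int) set \<Rightarrow> (('m' \<times> 'n') \<Rightarrow>\<^sub>0 int) set"
  where
  "tensor_map R M' N' \<phi> \<psi> U =
     (\<Union>u\<in>U. tensor_coset R M' N' (frag_extend (\<lambda>(x, y). frag_of (\<phi> x, \<psi> y)) u))"

text \<open>The ring \<open>A \<otimes>\<^sub>K R\<close> for \<open>K\<close>-algebras \<open>A\<close> and \<open>R\<close>, with \<open>(a \<otimes> r)(b \<otimes> s) = ab \<otimes> rs\<close>.\<close>

definition tensor_ring ::
    "('k, 'z) ring_scheme \<Rightarrow> ('k, 'a, 'w) module_scheme \<Rightarrow> ('k, 'r, 'v) module_scheme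
      \<Rightarrow> (('a \<times> 'r) \<Rightarrow>\<^sub>0 int) set ring" where
  "tensor_ring K A R = \<lparr>carrier = carrier (tensor_group K A R),
     monoid.mult = (\<lambda>U V. \<Union>u\<in>U. \<Union>v\<in>V. tensor_coset K A R
       (frag_extend (\<lambda>(a, r). frag_extend (\<lambda>(b, s). frag_of (a \<otimes>\<^bsub>A\<^esub> b, r \<otimes>\<^bsub>R\<^esub> s)) v) u)),
     monoid.one = elem_tensor K A R \<one>\<^bsub>A\<^esub> \<one>\<^bsub>R\<^esub>,
     ring.zero = monoid.one (tensor_group K A R), ring.add = monoid.mult (tensor_group K A R)\<rparr>"


section \<open>Polynomial rings, maximal spectrum and localization\<close>

text \<open>
  The polynomial ring \<open>K[x\<^sub>0, \<dots>, x\<^bsub>d-1\<^esub>]\<close> as a \<open>K\<close>-algebra; a monomial is the multiset of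
  its variables.
\<close>

definition poly_algebra :: "('k, 'z) ring_scheme \<Rightarrow> nat \<Rightarrow> ('k, nat multiset \<Rightarrow> 'k) module" where
  "poly_algebra K d = \<lparr>carrier = ring.indexed_pset K {..<d} (carrier K),
     monoid.mult = (\<lambda>P Q m. \<Oplus>\<^bsub>K\<^esub>n \<in> {n. n \<subseteq># m}. P n \<otimes>\<^bsub>K\<^esub> Q (m - n)),
     monoid.one = ring.indexed_const K \<one>\<^bsub>K\<^esub>, ring.zero = ring.indexed_const K \<zero>\<^bsub>K\<^esub>,
     ring.add = ring.indexed_padd K, module.smult = (\<lambda>c P m. c \<otimes>\<^bsub>K\<^esub> P m)\<rparr>"

definition max_spec :: "('r, 'z) ring_scheme \<Rightarrow> 'r set set" where
  "max_spec R = {\<alpha>. maximalideal \<alpha> R}"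

definition zariski :: "('r, 'z) ring_scheme \<Rightarrow> 'r set topology" where
  "zariski R = topology (\<lambda>U. \<exists>S \<subseteq> carrier R. U = max_spec R - {\<alpha> \<in> max_spec R. S \<subseteq> \<alpha>})"

lemma istopology_zariski:
  assumes "cring R"
  shows "istopology (\<lambda>U. \<exists>S \<subseteq> carrier R. U = max_spec R - {\<alpha> \<in> max_spec R. S \<subseteq> \<alpha>})"
    (is "istopology ?L")
  unfolding istopology_def
proof (intro conjI allI impI)
  fix U V assume "?L U" "?L V"
  then obtain S T where S: "S \<subseteq> carrier R" "U = max_spec R - {\<alpha> \<in> max_spec R. S \<subseteq> \<alpha>}"
    and T: "T \<subseteq> carrier R" "V = max_spec R - {\<alpha> \<in> max_spec R. T \<subseteq> \<alpha>}" by auto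
  interpret cring R by fact
  define P where "P = (\<lambda>(s, t). s \<otimes>\<^bsub>R\<^esub> t) ` (S \<times> T)"
  have "P \<subseteq> carrier R" using S T by (auto simp: P_def)
  moreover have "P \<subseteq> \<alpha> \<longleftrightarrow> S \<subseteq> \<alpha> \<or> T \<subseteq> \<alpha>" if "\<alpha> \<in> max_spec R" for \<alpha>
  proof -
    interpret m: maximalideal \<alpha> R using that by (simp add: max_spec_def)
    interpret p: primeideal \<alpha> R
      by (rule maximalideal_prime) (rule m.is_maximalideal)
    have "s \<otimes>\<^bsub>R\<^esub> t \<in> \<alpha> \<longleftrightarrow> s \<in> \<alpha> \<or> t \<in> \<alpha>" if "s \<in> S" "t \<in> T" for s t
      using that S(1) T(1) p.I_prime m.I_l_closed m.I_r_closed by blast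
    then show ?thesis unfolding P_def by fastforce
  qed
  ultimately show "?L (U \<inter> V)" using S T by (intro exI[of _ P]) auto
next
  fix \<K> assume *: "\<forall>U\<in>\<K>. ?L U"
  define P where "P = \<Union>{S. S \<subseteq> carrier R \<and> max_spec R - {\<alpha> \<in> max_spec R. S \<subseteq> \<alpha>} \<in> \<K>}"
  have "P \<subseteq> carrier R" by (auto simp: P_def)
  moreover have "\<Union>\<K> = max_spec R - {\<alpha> \<in> max_spec R. P \<subseteq> \<alpha>}"
  proof (intro equalityI subsetI)
    fix \<alpha> assume "\<alpha> \<in> \<Union>\<K>"
    then obtain U where U: "U \<in> \<K>" "\<alpha> \<in> U" by blast
    with * obtain S where "S \<subseteq> carrier R" "U = max_spec R - {\<alpha> \<in> max_spec R. S \<subseteq> \<alpha>}" by blast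
    with U have "S \<subseteq> P" "\<alpha> \<in> max_spec R" "\<not> S \<subseteq> \<alpha>" by (auto simp: P_def)
    then show "\<alpha> \<in> max_spec R - {\<alpha> \<in> max_spec R. P \<subseteq> \<alpha>}" by blast
  next
    fix \<alpha> assume \<alpha>: "\<alpha> \<in> max_spec R - {\<alpha> \<in> max_spec R. P \<subseteq> \<alpha>}"
    then obtain S where "max_spec R - {\<alpha> \<in> max_spec R. S \<subseteq> \<alpha>} \<in> \<K>" "\<not> S \<subseteq> \<alpha>"
      unfolding P_def by blast
    with \<alpha> show "\<alpha> \<in> \<Union>\<K>" by blast
  qed
  ultimately show "?L (\<Union>\<K>)" by blast
qed

lemma openin_zariski:
  assumes "cring R"
  shows "openin (zariski R) U \<longleftrightarrow>
    (\<exists>S \<subseteq> carrier R. U = max_spec R - {\<alpha> \<in> max_spec R. S \<subseteq> \<alpha>})"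
  unfolding zariski_def by (simp add: istopology_zariski[OF assms] topology_inverse')

lemma topspace_zariski:
  assumes "cring R" shows "topspace (zariski R) = max_spec R"
proof
  interpret cring R by fact
  have "\<one>\<^bsub>R\<^esub> \<notin> \<alpha>" if "\<alpha> \<in> max_spec R" for \<alpha>
    using that ideal.one_imp_carrier[of \<alpha> R] maximalideal.I_notcarr[of \<alpha> R]
      maximalideal.axioms(1)[of \<alpha> R] by (auto simp: max_spec_def)
  then have "openin (zariski R) (max_spec R)"
    unfolding openin_zariski[OF assms] by (intro exI[of _ "{\<one>\<^bsub>R\<^esub>}"]) auto
  then show "max_spec R \<subseteq> topspace (zariski R)" by (rule openin_subset)
  show "topspace (zariski R) \<subseteq> max_spec R"
    unfolding topspace_def openin_zariski[OF assms] by auto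
qed

definition loc_rel :: "('r, 'z) ring_scheme \<Rightarrow> 'r set \<Rightarrow> ('r \<times> 'r) rel" where
  "loc_rel R S = {((a, s), (b, t)). a \<in> carrier R \<and> b \<in> carrier R \<and> s \<in> S \<and> t \<in> S \<and>
     (\<exists>u\<in>S. u \<otimes>\<^bsub>R\<^esub> (a \<otimes>\<^bsub>R\<^esub> t) = u \<otimes>\<^bsub>R\<^esub> (b \<otimes>\<^bsub>R\<^esub> s))}"

definition loc_frac :: "('r, 'z) ring_scheme \<Rightarrow> 'r set \<Rightarrow> 'r \<Rightarrow> 'r \<Rightarrow> ('r \<times> 'r) set" where
  "loc_frac R S a s = loc_rel R S `` {(a, s)}"

text \<open>\<open>R\<close> is commutative, \<open>S\<close> a multiplicative subset.\<close>

definition localization :: "('r, 'z) ring_scheme \<Rightarrow> 'r set \<Rightarrow> ('r \<times> 'r) set ring" where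
  "localization R S = \<lparr>carrier = (carrier R \<times> S) // loc_rel R S,
     monoid.mult = (\<lambda>U V. \<Union>(a, s)\<in>U. \<Union>(b, t)\<in>V. loc_frac R S (a \<otimes>\<^bsub>R\<^esub> b) (s \<otimes>\<^bsub>R\<^esub> t)),
     monoid.one = loc_frac R S \<one>\<^bsub>R\<^esub> \<one>\<^bsub>R\<^esub>, ring.zero = loc_frac R S \<zero>\<^bsub>R\<^esub> \<one>\<^bsub>R\<^esub>,
     ring.add = (\<lambda>U V. \<Union>(a, s)\<in>U. \<Union>(b, t)\<in>V.
       loc_frac R S (a \<otimes>\<^bsub>R\<^esub> t \<oplus>\<^bsub>R\<^esub> b \<otimes>\<^bsub>R\<^esub> s) (s \<otimes>\<^bsub>R\<^esub> t))\<rparr>"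

definition localization_at :: "('r, 'z) ring_scheme \<Rightarrow> 'r set \<Rightarrow> ('r \<times> 'r) set ring" where
  "localization_at R \<alpha> = localization R (carrier R - \<alpha>)"

definition loc_hom :: "('r, 'z) ring_scheme \<Rightarrow> 'r set \<Rightarrow> 'r \<Rightarrow> ('r \<times> 'r) set" where
  "loc_hom R \<alpha> r = loc_frac R (carrier R - \<alpha>) r \<one>\<^bsub>R\<^esub>"

text \<open>The simple module \<open>S\<^sub>\<alpha> = R/\<alpha>\<close>.\<close>

definition simple_at :: "('r, 'z) ring_scheme \<Rightarrow> 'r set \<Rightarrow> ('r, 'r set) module" where
  "simple_at R \<alpha> = restrict_scalars (\<lambda>r. \<alpha> +>\<^bsub>R\<^esub> r) (regular_module (R Quot \<alpha>))"


section \<open>Oppermann dimension\<close>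

text \<open>
  Carriers of lattices lie in \<open>nat \<Rightarrow> 'k\<close>: a finitely generated \<open>A \<otimes>\<^sub>K R\<close>-module has countable
  dimension over \<open>K\<close>, hence is isomorphic to one with such a carrier. The module operations on the
  carrier are arbitrary.
\<close>

type_synonym ('k, 'a) lattice =
  "((('a \<times> (nat multiset \<Rightarrow> 'k)) \<Rightarrow>\<^sub>0 int) set, nat \<Rightarrow> 'k) module"

definition lattice_left ::
    "('k, 'z) ring_scheme \<Rightarrow> ('k, 'a, 'w) module_scheme \<Rightarrow> nat \<Rightarrow> ('k, 'a) lattice
      \<Rightarrow> ('a, nat \<Rightarrow> 'k) module" where
  "lattice_left K A d L =
     restrict_scalars (\<lambda>a. elem_tensor K A (poly_algebra K d) a \<one>\<^bsub>poly_algebra K d\<^esub>) L"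

definition lattice_right ::
    "('k, 'z) ring_scheme \<Rightarrow> ('k, 'a, 'w) module_scheme \<Rightarrow> nat \<Rightarrow> ('k, 'a) lattice
      \<Rightarrow> (nat multiset \<Rightarrow> 'k, nat \<Rightarrow> 'k) module" where
  "lattice_right K A d L =
     restrict_scalars (\<lambda>r. elem_tensor K A (poly_algebra K d) \<one>\<^bsub>A\<^esub> r) L"

definition is_lattice ::
    "('k, 'z) ring_scheme \<Rightarrow> ('k, 'a, 'w) module_scheme \<Rightarrow> nat \<Rightarrow> ('k, 'a) lattice \<Rightarrow> bool" where
  "is_lattice K A d L \<longleftrightarrow>
     left_module (tensor_ring K A (poly_algebra K d)) L \<and>
     fin_gen (tensor_ring K A (poly_algebra K d)) L \<and>
     projective (poly_algebra K d) (lattice_right K A d L)"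

text \<open>The \<open>A\<close>-module \<open>L \<otimes>\<^sub>R M\<close>.\<close>

definition lattice_tensor ::
    "('k, 'z) ring_scheme \<Rightarrow> ('k, 'a, 'w) module_scheme \<Rightarrow> nat \<Rightarrow> ('k, 'a) lattice
      \<Rightarrow> (nat multiset \<Rightarrow> 'k, 'm) module \<Rightarrow> ('a, (((nat \<Rightarrow> 'k) \<times> 'm) \<Rightarrow>\<^sub>0 int) set) module" where
  "lattice_tensor K A d L M = (let R = poly_algebra K d; L\<^sub>R = lattice_right K A d L in
     \<lparr>carrier = carrier (tensor_group R L\<^sub>R M), monoid.mult = undefined, monoid.one = undefined,
      ring.zero = monoid.one (tensor_group R L\<^sub>R M), ring.add = monoid.mult (tensor_group R L\<^sub>R M),
      module.smult = (\<lambda>a. tensor_map R L\<^sub>R M (module.smult (lattice_left K A d L) a) (\<lambda>y. y))\<rparr>)"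

definition lattice_tensor_seq ::
    "('k, 'z) ring_scheme \<Rightarrow> ('k, 'a, 'w) module_scheme \<Rightarrow> nat \<Rightarrow> ('k, 'a) lattice
      \<Rightarrow> (nat multiset \<Rightarrow> 'k, 'm) mod_seq
      \<Rightarrow> ('a, (((nat \<Rightarrow> 'k) \<times> 'm) \<Rightarrow>\<^sub>0 int) set) mod_seq" where
  "lattice_tensor_seq K A d L = (\<lambda>(C, f).
     (\<lambda>i. lattice_tensor K A d L (C i),
      \<lambda>i. tensor_map (poly_algebra K d) (lattice_right K A d L) (C (Suc i)) (\<lambda>x. x) (f i)))"

text \<open>
  The sequences \<open>\<epsilon>\<^sub>\<alpha>\<close>: their middle terms come from indecomposable \<open>R\<^sub>\<alpha>\<close>-modules of length 2, and
  their class generates \<open>Ext\<^sup>d\<^sub>R(S\<^sub>\<alpha>, S\<^sub>\<alpha>)\<close> over \<open>K\<close>. The second condition does not follow from the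
  first: for \<open>d = 2\<close> both middle terms may be \<open>R/(x\<^sub>0\<^sup>2, x\<^sub>1)\<close>, and the class of such a
  sequence is zero.
\<close>

definition eps_sequences ::
    "('k, 'z) ring_scheme \<Rightarrow> nat \<Rightarrow> (nat multiset \<Rightarrow> 'k) set
      \<Rightarrow> (nat multiset \<Rightarrow> 'k, (nat multiset \<Rightarrow> 'k) set) mod_seq set" where
  "eps_sequences K d \<alpha> = (let R = poly_algebra K d; S = simple_at R \<alpha> in
     {(C, f) \<in> extensions R d S S.
        (\<forall>i\<in>{1..d}. \<exists>N :: (((nat multiset \<Rightarrow> 'k) \<times> (nat multiset \<Rightarrow> 'k)) set,
             (nat multiset \<Rightarrow> 'k) set) module.
           left_module (localization_at R \<alpha>) N \<and>
           indecomposable (localization_at R \<alpha>) N \<and> has_length (localization_at R \<alpha>) N 2 \<and>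
           C i = restrict_scalars (loc_hom R \<alpha>) N) \<and>
        Ext R d S S = {ext_smult R d S S (ring.indexed_const K c) (C, f) | c. c \<in> carrier K}})"

text \<open>
  \<open>Ext\<^sup>d\<^sub>R(S\<^sub>\<alpha>, S\<^sub>\<alpha>)\<close> being one-dimensional over \<open>K\<close>, the condition does not depend on the choice of
  \<open>\<epsilon>\<close>.
\<close>

definition oppermann_set ::
    "('k, 'z) ring_scheme \<Rightarrow> ('k, 'a, 'w) module_scheme \<Rightarrow> nat \<Rightarrow> ('k, 'a) lattice
      \<Rightarrow> (nat multiset \<Rightarrow> 'k) set set" where
  "oppermann_set K A d L = {\<alpha> \<in> max_spec (poly_algebra K d).
     \<exists>\<epsilon> \<in> eps_sequences K d \<alpha>.
       let T = lattice_tensor K A d L (simple_at (poly_algebra K d) \<alpha>) in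
       ext_class A d T T (lattice_tensor_seq K A d L \<epsilon>) \<noteq> ext_zero A d T T}"

definition oppermann_lattice ::
    "('k, 'z) ring_scheme \<Rightarrow> ('k, 'a, 'w) module_scheme \<Rightarrow> nat \<Rightarrow> ('k, 'a) lattice \<Rightarrow> bool" where
  "oppermann_lattice K A d L \<longleftrightarrow> is_lattice K A d L \<and>
     Abstract_Topology.closure_of (zariski (poly_algebra K d)) (oppermann_set K A d L)
       = max_spec (poly_algebra K d)"

text \<open>
  The dimension \<open>d\<close> of a lattice is a positive integer, and the supremum is taken in the extended
  reals, so that it is \<open>-\<infinity>\<close> if there are no Oppermann lattices. (With value \<open>0\<close> instead, the
  inequality \<open>rep.dim A \<ge> Odim A + 2\<close> would fail for semisimple \<open>A\<close>.)
\<close>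

definition Odim :: "('k, 'z) ring_scheme \<Rightarrow> ('k, 'a, 'w) module_scheme \<Rightarrow> ereal" where
  "Odim K A = Sup {ereal (real d) | d. 1 \<le> d \<and> (\<exists>L. oppermann_lattice K A d L)}"


section \<open>Representation dimension\<close>

definition End_ring ::
    "('r, 'z) ring_scheme \<Rightarrow> ('r, 'm, 'w) module_scheme \<Rightarrow> ('m \<Rightarrow> 'm) ring" where
  "End_ring R M = \<lparr>carrier = lin_maps R M M \<inter> extensional (carrier M),
     monoid.mult = compose (carrier M), monoid.one = (\<lambda>x\<in>carrier M. x),
     ring.zero = (\<lambda>x\<in>carrier M. \<zero>\<^bsub>M\<^esub>), ring.add = (\<lambda>f g. \<lambda>x\<in>carrier M. f x \<oplus>\<^bsub>M\<^esub> g x)\<rparr>"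

text \<open>The left module \<open>DA = Hom\<^sub>K(A, K)\<close>, with \<open>(a \<phi>)(x) = \<phi>(xa)\<close>.\<close>

definition dual_module ::
    "('k, 'z) ring_scheme \<Rightarrow> ('k, 'a, 'w) module_scheme \<Rightarrow> ('a, 'a \<Rightarrow> 'k) module" where
  "dual_module K A =
     \<lparr>carrier = lin_maps K A (regular_module K) \<inter> extensional (carrier A),
      monoid.mult = undefined, monoid.one = undefined,
      ring.zero = (\<lambda>x\<in>carrier A. \<zero>\<^bsub>K\<^esub>), ring.add = (\<lambda>\<phi> \<psi>. \<lambda>x\<in>carrier A. \<phi> x \<oplus>\<^bsub>K\<^esub> \<psi> x),
      module.smult = (\<lambda>a \<phi>. \<lambda>x\<in>carrier A. \<phi> (x \<otimes>\<^bsub>A\<^esub> a))\<rparr>"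

definition generator_cogenerator ::
    "('k, 'z) ring_scheme \<Rightarrow> ('k, 'a, 'w) module_scheme \<Rightarrow> ('a, 'm, 'v) module_scheme \<Rightarrow> bool" where
  "generator_cogenerator K A M \<longleftrightarrow> left_module A M \<and> fin_gen A M \<and>
     in_add A (regular_module A) M \<and> in_add A (dual_module K A) M"

text \<open>
  \<open>A\<close> is finite dimensional, so every finitely generated \<open>A\<close>-module is isomorphic to one with carrier
  in \<open>nat \<Rightarrow> 'k\<close>.
\<close>

definition rep_dim :: "('k, 'z) ring_scheme \<Rightarrow> ('k, 'a, 'w) module_scheme \<Rightarrow> enat" where
  "rep_dim K A = Inf {gl_dim (End_ring A M) | M :: ('a, nat \<Rightarrow> 'k) module.
     generator_cogenerator K A M}"


section \<open>Graded algebras and smash products\<close>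

text \<open>
  \<open>\<one>\<^bsub>A\<^esub> \<in> A\<^sub>e\<close> follows from the axioms.
\<close>

locale graded_algebra = assoc_algebra K A + G: group G
  for K :: "('k, 'z) ring_scheme" (structure) and G :: "('g, 'v) monoid_scheme" (structure)
    and A :: "('k, 'a, 'w) module_scheme" (structure) +
  fixes Agr :: "'g \<Rightarrow> 'a set"
  assumes finite_group: "finite (carrier G)"
    and homogeneous_submodule: "g \<in> carrier G \<Longrightarrow> submodule (Agr g) K A"
    and homogeneous_mult:
      "\<lbrakk>g \<in> carrier G; h \<in> carrier G; a \<in> Agr g; b \<in> Agr h\<rbrakk> \<Longrightarrow> a \<otimes>\<^bsub>A\<^esub> b \<in> Agr (g \<otimes>\<^bsub>G\<^esub> h)"
    and direct_sum:
      "a \<in> carrier A \<Longrightarrow> \<exists>!c. c \<in> Pi\<^sub>E (carrier G) Agr \<and> a = (\<Oplus>\<^bsub>A\<^esub>g\<in>carrier G. c g)"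

definition component ::
    "('g, 'v) monoid_scheme \<Rightarrow> ('a, 'w) ring_scheme \<Rightarrow> ('g \<Rightarrow> 'a set) \<Rightarrow> 'a \<Rightarrow> 'g \<Rightarrow> 'a" where
  "component G A Agr a = (THE c. c \<in> Pi\<^sub>E (carrier G) Agr \<and> a = (\<Oplus>\<^bsub>A\<^esub>g\<in>carrier G. c g))"

context graded_algebra begin

lemma component:
  assumes "a \<in> carrier A"
  shows "component G A Agr a \<in> Pi\<^sub>E (carrier G) Agr"
    and "a = (\<Oplus>\<^bsub>A\<^esub>g\<in>carrier G. component G A Agr a g)"
  using theI'[OF direct_sum[OF assms]] unfolding component_def by auto

lemma component_closed:
  assumes "a \<in> carrier A" "g \<in> carrier G"
  shows "component G A Agr a g \<in> carrier A"
proof -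
  have "component G A Agr a g \<in> Agr g" using component(1)[OF assms(1)] assms(2) by blast
  moreover have "Agr g \<subseteq> carrier A"
    using homogeneous_submodule[OF assms(2)] subgroup.subset unfolding submodule_def by fastforce
  ultimately show ?thesis by blast
qed

lemma component_zero:
  assumes "g \<in> carrier G" shows "component G A Agr \<zero>\<^bsub>A\<^esub> g = \<zero>\<^bsub>A\<^esub>"
proof -
  have z: "\<zero>\<^bsub>A\<^esub> \<in> Agr h" if "h \<in> carrier G" for h
    using homogeneous_submodule[OF that] subgroup.one_closed unfolding submodule_def by fastforce
  have "(\<Oplus>\<^bsub>A\<^esub>g\<in>carrier G. (\<lambda>g\<in>carrier G. \<zero>\<^bsub>A\<^esub>) g) = (\<Oplus>\<^bsub>A\<^esub>g\<in>carrier G. \<zero>\<^bsub>A\<^esub>)"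
    by (rule finsum_cong') auto
  then have "\<zero>\<^bsub>A\<^esub> = (\<Oplus>\<^bsub>A\<^esub>g\<in>carrier G. (\<lambda>g\<in>carrier G. \<zero>\<^bsub>A\<^esub>) g)" by simp
  then have "component G A Agr \<zero>\<^bsub>A\<^esub> = (\<lambda>g\<in>carrier G. \<zero>\<^bsub>A\<^esub>)"
    using direct_sum[OF zero_closed] component[OF zero_closed] z
    by (metis (no_types, lifting) restrict_PiE_iff)
  then show ?thesis using assms by simp
qed

end

text \<open>
  The function \<open>u\<close> represents \<open>\<Sum>\<^sub>g u(g) p\<^sub>g\<close>, and the product is the biadditive extension of
  \<open>a p\<^sub>g \<cdot> b p\<^sub>h = a b\<^bsub>gh\<inverse>\<^esub> p\<^sub>h\<close>.
\<close>

definition smash_product ::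
    "('g, 'v) monoid_scheme \<Rightarrow> ('k, 'a, 'w) module_scheme \<Rightarrow> ('g \<Rightarrow> 'a set)
      \<Rightarrow> ('k, 'g \<Rightarrow> 'a) module" where
  "smash_product G A Agr = \<lparr>carrier = carrier G \<rightarrow>\<^sub>E carrier A,
     monoid.mult = (\<lambda>u v. \<lambda>h\<in>carrier G. \<Oplus>\<^bsub>A\<^esub>g\<in>carrier G.
       u g \<otimes>\<^bsub>A\<^esub> component G A Agr (v h) (g \<otimes>\<^bsub>G\<^esub> inv\<^bsub>G\<^esub> h)),
     monoid.one = (\<lambda>g\<in>carrier G. \<one>\<^bsub>A\<^esub>), ring.zero = (\<lambda>g\<in>carrier G. \<zero>\<^bsub>A\<^esub>),
     ring.add = (\<lambda>u v. \<lambda>g\<in>carrier G. u g \<oplus>\<^bsub>A\<^esub> v g),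
     module.smult = (\<lambda>c u. \<lambda>g\<in>carrier G. c \<odot>\<^bsub>A\<^esub> u g)\<rparr>"

lemma (in graded_algebra) smash_product_mult_basis:
  fixes p defines "p \<equiv> \<lambda>a g. \<lambda>x\<in>carrier G. if x = g then a else \<zero>\<^bsub>A\<^esub>"
  assumes "a \<in> carrier A" "b \<in> carrier A" "g \<in> carrier G" "h \<in> carrier G"
  shows "p a g \<otimes>\<^bsub>smash_product G A Agr\<^esub> p b h =
    p (a \<otimes>\<^bsub>A\<^esub> component G A Agr b (g \<otimes>\<^bsub>G\<^esub> inv\<^bsub>G\<^esub> h)) h"
proof
  fix x
  show "(p a g \<otimes>\<^bsub>smash_product G A Agr\<^esub> p b h) x =
    p (a \<otimes>\<^bsub>A\<^esub> component G A Agr b (g \<otimes>\<^bsub>G\<^esub> inv\<^bsub>G\<^esub> h)) h x"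
  proof (cases "x \<in> carrier G")
    case True
    let ?c = "component G A Agr (p b h x)"
    have px: "p b h x \<in> carrier A" using assms True by auto
    have "(p a g \<otimes>\<^bsub>smash_product G A Agr\<^esub> p b h) x =
      (\<Oplus>\<^bsub>A\<^esub>y\<in>carrier G. p a g y \<otimes>\<^bsub>A\<^esub> ?c (y \<otimes>\<^bsub>G\<^esub> inv\<^bsub>G\<^esub> x))"
      using True by (simp add: smash_product_def)
    also have "\<dots> = (\<Oplus>\<^bsub>A\<^esub>y\<in>carrier G. if g = y then a \<otimes>\<^bsub>A\<^esub> ?c (y \<otimes>\<^bsub>G\<^esub> inv\<^bsub>G\<^esub> x) else \<zero>\<^bsub>A\<^esub>)"
      using px assms True by (intro finsum_cong') (auto simp: component_closed)
    also have "\<dots> = a \<otimes>\<^bsub>A\<^esub> ?c (g \<otimes>\<^bsub>G\<^esub> inv\<^bsub>G\<^esub> x)"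
      using px assms True finite_group by (intro add.finprod_singleton) (auto simp: component_closed)
    also have "\<dots> = p (a \<otimes>\<^bsub>A\<^esub> component G A Agr b (g \<otimes>\<^bsub>G\<^esub> inv\<^bsub>G\<^esub> h)) h x"
      using True assms by (auto simp: component_zero)
    finally show ?thesis .
  qed (simp add: smash_product_def p_def)
qed

definition separably_graded ::
    "('g, 'v) monoid_scheme \<Rightarrow> ('a, 'w) ring_scheme \<Rightarrow> ('g \<Rightarrow> 'a set) \<Rightarrow> bool" where
  "separably_graded G A Agr \<longleftrightarrow> (\<exists>x :: 'g \<Rightarrow> 'a.
     (\<forall>g\<in>carrier G. x g \<in> Agr \<one>\<^bsub>G\<^esub> \<and> (\<forall>y\<in>Agr \<one>\<^bsub>G\<^esub>. x g \<otimes>\<^bsub>A\<^esub> y = y \<otimes>\<^bsub>A\<^esub> x g)) \<and>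
     (\<Oplus>\<^bsub>A\<^esub>g\<in>carrier G. x g) = \<one>\<^bsub>A\<^esub> \<and>
     (\<forall>h\<in>carrier G. \<forall>g\<in>carrier G. \<forall>r\<in>Agr h. r \<otimes>\<^bsub>A\<^esub> x g = x (h \<otimes>\<^bsub>G\<^esub> g) \<otimes>\<^bsub>A\<^esub> r))"

end

(* Restricting scalars turns a lattice over the smash product B into one over A; since B is
separable over A, restriction loses no extension classes. For a separable grading, coinduction
from A to B has a retraction given by the x^g, so it loses none either.
For rep.dim: if End(M) has global dimension at most d + 1, coresolutions by add M split after d
steps. For generic alpha, linear maps extend along L (x) epsilon_alpha (linear systems over the
polynomial ring are solvable up to a denominator), which makes the class of L (x) epsilon_alpha zero. *)
theory Submission
  imports Defs "HOL-Library.Multiset_Order"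
begin

text \<open>A Yoneda class is a set of sequences in one fixed type, so its vanishing has to become a
  statement about single maps. Sequences run from \<open>C 0 = N\<close> to
  \<open>C (Suc d) = M\<close>; a resolution \<open>P\<close> of \<open>M\<close> then has a
  \<open>d\<close>-th syzygy \<open>P 0\<close> at its left end, and the class vanishes iff the
  comparison map from \<open>P 0\<close> to \<open>N\<close> factors through \<open>p 0\<close>
  (\<open>null_via\<close>). Both comparisons of Oppermann dimensions concern this factor:
  restriction keeps it, and a factor that is only linear over \<open>A\<close> is made linear over
  the smash product by averaging over the idempotents \<open>p_g\<close>. For the representation
  dimension, maps have to be extended at some point of the Oppermann set. Hence a nonzero polynomial
  \<open>De\<close> is constructed from the lattice and \<open>M\<close> alone, by Gaussian
  elimination for functionals on modules over the polynomial ring; density, together with the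
  vanishing of the Jacobson radical, yields a point where \<open>De\<close> is invertible. As
  carriers live in fixed types, modules are moved along injections throughout.\<close>

abbreviation (input) zero_at ("0[_]") where "0[M] == \<zero>\<^bsub>M\<^esub>"
abbreviation (input) one_at ("1[_]") where "1[M] == \<one>\<^bsub>M\<^esub>"
abbreviation (input) add_at ("(_ +[_] _)" [65, 0, 66] 65) where "x +[M] y == x \<oplus>\<^bsub>M\<^esub> y"
abbreviation (input) minus_at ("(_ -[_] _)" [65, 0, 66] 65) where "x -[M] y == x \<ominus>\<^bsub>M\<^esub> y"
abbreviation (input) uminus_at ("(-[_] _)" [0, 81] 80) where "-[M] y == \<ominus>\<^bsub>M\<^esub> y"
abbreviation (input) mult_at ("(_ *[_] _)" [70, 0, 71] 70) where "x *[M] y == x \<otimes>\<^bsub>M\<^esub> y"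
abbreviation (input) divide_at ("(_ '/[_] _)" [70, 0, 81] 70) where "x /[M] y == x \<otimes>\<^bsub>M\<^esub> inv\<^bsub>M\<^esub> y"
abbreviation (input) smult_at ("(_ .[_] _)" [70, 0, 71] 70) where "x .[M] y == x \<odot>\<^bsub>M\<^esub> y"
abbreviation (input) elements ("$_" [1000] 1000) where "$M == carrier M"
abbreviation (input) with_carrier ("_@[_]" [900, 0] 900) where "M@[N] == M\<lparr>carrier := N\<rparr>"
abbreviation (input) "Hom == lin_maps"
abbreviation (input) "lmod == left_module"
abbreviation (input) "smod == submodule"
abbreviation (input) "lexact == long_exact"
abbreviation (input) "smor == seq_morphism"
abbreviation (input) "rsc == restrict_scalars"
abbreviation (input) "regm == regular_module"
abbreviation (input) "powm == power_module"
abbreviation (input) "tmap == tensor_map"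
abbreviation (input) "etens == elem_tensor"
abbreviation (input) "polya == poly_algebra"
abbreviation (input) "lleft == lattice_left"
abbreviation (input) "lright == lattice_right"
notation (input) funcset (infixr "->" 60)
syntax
  "_finsum_at" :: "logic => pttrn => logic => logic => logic" ("(3SUM[_]_:_. _)" [0, 0, 51, 10] 10)
  "_lam" :: "pttrn => 'a set => ('a => 'b) => ('a => 'b)" ("(3%_:_./ _)" [0, 0, 3] 3)
translations "SUM[M]i:A. b" \<rightharpoonup> "CONST finsum M (%i. b) A"

section \<open>Modules and linear maps\<close>

lemma left_moduleI:
 assumes "ring R"
  and "0[M] : $M"
  and "!!x y. [|x : $M; y : $M|] ==> x +[M] y : $M"
  and "!!x y z. [|x : $M; y : $M; z : $M|] ==>
   x +[M] y +[M] z = x +[M] (y +[M] z)"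
  and "!!x y. [|x : $M; y : $M|] ==> x +[M] y = y +[M] x"
  and "!!x. x : $M ==> 0[M] +[M] x = x"
  and "!!x. x : $M ==> EX y:$M. y +[M] x = 0[M]"
  and "!!a x. [|a : $R; x : $M|] ==> a .[M] x : $M"
  and "!!a b x. [|a : $R; b : $R; x : $M|] ==>
   (a +[R] b) .[M] x = a .[M] x +[M] b .[M] x"
  and "!!a x y. [|a : $R; x : $M; y : $M|] ==>
   a .[M] (x +[M] y) = a .[M] x +[M] a .[M] y"
  and "!!a b x. [|a : $R; b : $R; x : $M|] ==>
   (a *[R] b) .[M] x = a .[M] (b .[M] x)"
  and "!!x. x : $M ==> 1[R] .[M] x = x"
 shows "lmod R M"
proof -
 have "abelian_group M"
  by (rule abelian_groupI) (use assms in auto)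
 then show ?thesis
  unfolding left_module_def left_module_axioms_def using assms by auto
qed

lemma (in abelian_group) ex_l_neg: "x : $G ==> EX y:$G. y \<oplus> x = \<zero>"
 using l_neg a_inv_closed by blast

context left_module begin

declare smult_closed[simp, intro]

lemma lself: "lmod R M" ..

lemma smult_l_null: "x : $M ==> 0[R] .[M] x = 0[M]"
proof -
 assume x: "x : $M"
 then have "0[R] .[M] x +[M] 0[R] .[M] x = 0[R] .[M] x +[M] 0[M]"
  by (subst smult_l_distr[symmetric]) auto
 then show ?thesis using x by (subst (asm) M.add.l_cancel) auto
qed

lemma smult_r_null: "a : $R ==> a .[M] 0[M] = 0[M]"
proof -
 assume a: "a : $R"
 then have "a .[M] 0[M] +[M] a .[M] 0[M] = a .[M] 0[M] +[M] 0[M]"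
  by (subst smult_r_distr[symmetric]) auto
 then show ?thesis using a by (subst (asm) M.add.l_cancel) auto
qed

lemma smult_r_minus: "a : $R ==> x : $M ==> a .[M] (-[M] x) = -[M] (a .[M] x)"
 by (rule M.minus_equality[symmetric])
  (simp_all add: smult_r_distr[symmetric] smult_r_null M.l_neg)

lemma smult_l_minus: "a : $R ==> x : $M ==> (-[R] a) .[M] x = -[M] (a .[M] x)"
 by (rule M.minus_equality[symmetric])
  (simp_all add: smult_l_distr[symmetric] smult_l_null R.l_neg)

lemma smult_finsum:
 assumes "a : $R" "g : I -> $M"
 shows "a .[M] (SUM[M]i:I. g i) = (SUM[M]i:I. a .[M] g i)"
 using assms(2)
proof (induction I rule: infinite_finite_induct)
 case (insert i I)
 then have "g : I -> $M" "g i : $M" by auto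
 with insert assms(1) show ?case
  by (subst M.finsum_insert, auto) (subst M.finsum_insert, auto simp: smult_r_distr)
qed (simp_all add: smult_r_null assms(1) M.finsum_infinite)

lemma finsum_smult:
 assumes "x : $M" "g : I -> $R"
 shows "(SUM[R]i:I. g i) .[M] x = (SUM[M]i:I. g i .[M] x)"
 using assms(2)
proof (induction I rule: infinite_finite_induct)
 case (insert i I)
 then have "g : I -> $R" "g i : $R" by auto
 with insert assms(1) show ?case
  by (subst R.finsum_insert, auto) (subst M.finsum_insert, auto simp: smult_l_distr)
qed (simp_all add: smult_l_null assms(1) M.finsum_infinite R.finsum_infinite)

text \<open>Negatives are multiples by \<open>-1\<close>, so closure under sums and scalars already
  gives a subgroup.\<close>

lemma submoduleI':
 assumes "N <= $M" "0[M] : N"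
  and "!!x y. x : N ==> y : N ==> x +[M] y : N"
  and "!!a x. a : $R ==> x : N ==> a .[M] x : N"
 shows "smod N R M"
proof (rule submodule.intro)
 have "-[M] x : N" if "x : N" for x
 proof -
  have "x : $M" using that assms(1) by auto
  then have "-[M] x = (-[R] 1[R]) .[M] x" by (simp add: smult_l_minus smult_one)
  then show ?thesis using assms(4)[OF _ that, of "-[R] 1[R]"] by simp
 qed
 then show "subgroup N (add_monoid M)"
  using assms by (intro subgroup.intro) (auto simp: a_inv_def)
qed (use assms in "auto simp: submodule_axioms_def")

lemma submoduleD:
 assumes "smod N R M"
 shows "N <= $M" "0[M] : N" "!!x y. x : N ==> y : N ==> x +[M] y : N"
  "!!a x. a : $R ==> x : N ==> a .[M] x : N" "!!x. x : N ==> -[M] x : N"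
 using assms subgroup.m_inv_closed[of N "add_monoid M"]
 by (auto simp: submodule_def submodule_axioms_def subgroup_def a_inv_def)

lemma submodule_finsum:
 assumes "smod N R M" "g : I -> N"
 shows "(SUM[M]i:I. g i) : N"
 using assms(2)
proof (induction I rule: infinite_finite_induct)
 case (insert i I)
 then have "g : I -> $M" "g i : $M" using submoduleD(1)[OF assms(1)] by auto
 with insert show ?case by (subst M.finsum_insert) (auto intro: submoduleD[OF assms(1)])
qed (simp_all add: submoduleD[OF assms(1)])

lemma submodule_left_module:
 assumes "smod N R M" shows "lmod R (M@[N])"
proof -
 have "EX y:N. y +[M] x = 0[M]" if "x : N" for x
  using that submoduleD[OF assms] by (intro bexI[of _ "-[M] x"]) (auto simp: M.l_neg)
 then show ?thesis
  using submoduleD[OF assms]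
  by (intro left_moduleI)
   (auto simp: M.a_ac smult_l_distr smult_r_distr smult_assoc1 smult_one R.ring_axioms subset_iff)
qed

lemma submodule_carrier: "smod $M R M" by (rule submoduleI') auto

lemma submodule_zero: "smod {0[M]} R M" by (rule submoduleI') (auto simp: smult_r_null)

lemma minus_zero_eq:
 assumes "x : $M" "y : $M" "x -[M] y = 0[M]" shows "x = y"
 using assms by (metis M.add.inv_closed M.minus_equality M.minus_minus a_minus_def)

lemma diff_add_cancel: "x : $M ==> y : $M ==> (x -[M] y) +[M] y = x"
 by (simp add: a_minus_def M.a_assoc M.l_neg)

end

lemma module_imp_left_module:
 assumes "module R M" shows "lmod R M"
proof -
 interpret module R M by fact
 show ?thesis
  by unfold_locales (auto simp: smult_l_distr smult_r_distr smult_assoc1)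
qed

lemma left_module_iff_module: "cring R ==> lmod R M \<longleftrightarrow> module R M"
 using module_imp_left_module[of R M]
 by (auto simp: left_module_def left_module_axioms_def module_def module_axioms_def)

section \<open>Linear maps, their kernels, images and inverses\<close>

lemma lin_mapsI:
 assumes "!!x. x : $M ==> f x : $N"
  and "!!x y. [|x : $M; y : $M|] ==> f (x +[M] y) = f x +[N] f y"
  and "!!r x. [|r : $R; x : $M|] ==> f (r .[M] x) = r .[N] f x"
 shows "f : Hom R M N"
 using assms by (auto simp: lin_maps_def)

lemma lin_closed: "f : Hom R M N ==> x : $M ==> f x : $N"
 and lin_add: "f : Hom R M N ==> x : $M ==> y : $M ==> f (x +[M] y) = f x +[N] f y"
 and lin_smult: "f : Hom R M N ==> r : $R ==> x : $M ==> f (r .[M] x) = r .[N] f x"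
 by (auto simp: lin_maps_def)

lemma lin_zero:
 assumes "lmod R M" "lmod R N" "f : Hom R M N"
 shows "f 0[M] = 0[N]"
proof -
 interpret M: left_module R M by fact
 interpret N: left_module R N by fact
 have "f (0[R] .[M] 0[M]) = 0[R] .[N] f 0[M]" using assms(3) by (intro lin_smult) auto
 then show ?thesis by (simp add: M.smult_l_null N.smult_l_null lin_closed[OF assms(3)])
qed

lemma lin_minus:
 assumes "lmod R M" "lmod R N" "f : Hom R M N" "x : $M"
 shows "f (-[M] x) = -[N] f x"
proof -
 interpret M: left_module R M by fact
 interpret N: left_module R N by fact
 have "f (-[M] x) +[N] f x = f (-[M] x +[M] x)"
  using assms by (subst lin_add[OF assms(3)]) auto
 also have "... = 0[N]" using assms by (simp add: M.l_neg lin_zero)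
 finally show ?thesis using assms by (metis N.minus_equality lin_closed M.M.a_inv_closed)
qed

lemma lin_diff:
 assumes "lmod R M" "lmod R N" "f : Hom R M N" "x : $M" "y : $M"
 shows "f (x -[M] y) = f x -[N] f y"
proof -
 interpret M: left_module R M by fact
 show ?thesis using assms by (simp add: a_minus_def lin_add lin_minus)
qed

lemma lin_finsum:
 assumes "lmod R M" "lmod R N" "f : Hom R M N" "g : I -> $M"
 shows "f (SUM[M]i:I. g i) = (SUM[N]i:I. f (g i))"
proof -
 interpret M: left_module R M by fact
 interpret N: left_module R N by fact
 show ?thesis
  using assms(4)
 proof (induction I rule: infinite_finite_induct)
  case (insert i I)
  then have "g : I -> $M" "g i : $M" by auto
  with insert show ?case
   by (subst M.finsum_insert, auto)
    (subst N.finsum_insert, auto simp: Pi_iff lin_add[OF assms(3)] lin_closed[OF assms(3)])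
 qed (simp_all add: lin_zero[OF assms(1-3)] M.finsum_infinite N.finsum_infinite)
qed

lemma lin_comp:
 "f : Hom R M N ==> g : Hom R N Q ==> (%x. g (f x)) : Hom R M Q"
 by (intro lin_mapsI) (auto simp: lin_closed lin_add lin_smult)

lemma lin_ident: "(%x. x) : Hom R M M" by (rule lin_mapsI) auto

lemma lin_cong:
 assumes "lmod R M" "f : Hom R M N" "!!x. x : $M ==> g x = f x"
 shows "g : Hom R M N"
proof -
 interpret left_module R M by fact
 show ?thesis using assms by (intro lin_mapsI) (auto simp: lin_closed lin_add lin_smult)
qed

lemma lin_plus:
 assumes "lmod R N" "f : Hom R M N" "g : Hom R M N"
 shows "(%x. f x +[N] g x) : Hom R M N"
proof -
 interpret N: left_module R N by fact
 show ?thesis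
  using assms by (intro lin_mapsI)
   (auto simp: lin_closed lin_add lin_smult N.a_ac N.smult_r_distr)
qed

lemma lin_minus_map:
 assumes "lmod R N" "f : Hom R M N" "g : Hom R M N"
 shows "(%x. f x -[N] g x) : Hom R M N"
proof -
 interpret N: left_module R N by fact
 show ?thesis
  using assms by (intro lin_mapsI)
   (auto simp: lin_closed lin_add lin_smult a_minus_def N.a_ac N.smult_r_distr N.minus_add N.smult_r_minus)
qed

lemma lin_zero_map: "lmod R N ==> (%x. 0[N]) : Hom R M N"
proof -
 assume "lmod R N"
 then interpret N: left_module R N .
 show ?thesis by (intro lin_mapsI) (auto simp: N.smult_r_null)
qed

lemma lin_finsum_map:
 assumes "lmod R N" "!!i. i : I ==> f i : Hom R M N"
 shows "(%x. SUM[N]i:I. f i x) : Hom R M N"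
proof -
 interpret N: left_module R N by fact
 have cl: "f i x : $N" if "i : I" "x : $M" for i x
  by (rule lin_closed[OF assms(2)[OF that(1)] that(2)])
 show ?thesis
 proof (rule lin_mapsI)
  fix x y assume *: "x : $M" "y : $M"
  then have "(SUM[N]i:I. f i (x +[M] y)) = (SUM[N]i:I. f i x +[N] f i y)"
   by (intro N.finsum_cong') (use * in "auto simp: lin_add[OF assms(2)] cl")
  also have "... = (SUM[N]i:I. f i x) +[N] (SUM[N]i:I. f i y)"
   using * by (intro N.finsum_addf) (auto simp: cl)
  finally show "(SUM[N]i:I. f i (x +[M] y)) = (SUM[N]i:I. f i x) +[N] (SUM[N]i:I. f i y)" .
 next
  fix r x assume *: "r : $R" "x : $M"
  then have "r .[N] (SUM[N]i:I. f i x) = (SUM[N]i:I. r .[N] f i x)"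
   using * by (intro N.smult_finsum) (auto simp: cl)
  also have "... = (SUM[N]i:I. f i (r .[M] x))"
   by (intro N.finsum_cong') (use * in "auto simp: lin_smult[OF assms(2)] cl")
  finally show "(SUM[N]i:I. f i (r .[M] x)) = r .[N] (SUM[N]i:I. f i x)" by simp
 qed (auto simp: cl intro!: N.finsum_closed)
qed

lemma lin_kernel:
 assumes "lmod R M" "lmod R N" "f : Hom R M N"
 shows "smod {x : $M. f x = 0[N]} R M"
proof -
 interpret M: left_module R M by fact
 interpret N: left_module R N by fact
 show ?thesis using assms
  by (intro M.submoduleI') (auto simp: lin_zero lin_add lin_smult N.smult_r_null)
qed

lemma lin_image:
 assumes "lmod R M" "lmod R N" "f : Hom R M N"
 shows "smod (f ` $M) R N"
proof -
 interpret M: left_module R M by fact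
 interpret N: left_module R N by fact
 show ?thesis
  by (intro N.submoduleI')
   (auto simp: lin_closed[OF assms(3)] lin_add[OF assms(3), symmetric] lin_smult[OF assms(3), symmetric]
    intro!: image_eqI[of "0[N]" f "0[M]"] lin_zero[OF assms, symmetric])
qed

lemma lin_inv_into:
 assumes "lmod R M" "f : Hom R M N" "inj_on f $M" "f ` $M = $N"
 shows "inv_into $M f : Hom R N M"
proof -
 interpret M: left_module R M by fact
 note [simp] = inv_into_f_f[OF assms(3)]
 show ?thesis
 proof (rule lin_mapsI; (subst (asm) assms(4)[symmetric])+; elim imageE; simp)
  fix x y assume "x : $M" "y : $M"
  then show "inv_into $M f (f x +[N] f y) = x +[M] y"
   by (simp add: lin_add[OF assms(2), symmetric])
 next
  fix r x assume "r : $R" "x : $M"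
  then show "inv_into $M f (r .[N] f x) = r .[M] x"
   by (simp add: lin_smult[OF assms(2), symmetric])
 qed
qed

text \<open>Sequences and global dimension are formulated for carriers in one given type. A
  construction that naturally lives in another type is brought there along an injection
  \<open>e\<close>.\<close>

definition transport :: "('m => 'n) => ('r, 'm, 'w) module_scheme => ('r, 'n) module" where
 "transport e M = (let e' = inv_into $M e in
  \<lparr>carrier = e ` $M, monoid.mult = undefined, monoid.one = undefined, ring.zero = e 0[M],
   ring.add = (%x y. e (e' x +[M] e' y)), module.smult = (%r x. e (r .[M] e' x))\<rparr>)"

lemma transport_simps:
 "$(transport e M) = e ` $M" "0[transport e M] = e 0[M]"
 by (simp_all add: transport_def Let_def)

lemma transport:
 assumes "lmod R M" "inj_on e $M"
 shows "lmod R (transport e M)" "e : Hom R M (transport e M)"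
  "inv_into $M e : Hom R (transport e M) M"
proof -
 interpret M: left_module R M by fact
 note [simp] = inv_into_f_f[OF assms(2)]
 show e: "e : Hom R M (transport e M)"
  by (rule lin_mapsI) (auto simp: transport_def Let_def)
 show "lmod R (transport e M)"
 proof (rule left_moduleI)
  fix x assume "x : $(transport e M)"
  then obtain z where z: "x = e z" "z : $M" by (auto simp: transport_simps)
  then show "EX y:$(transport e M). y +[transport e M] x = 0[transport e M]"
   by (intro bexI[of _ "e (-[M] z)"]) (auto simp: transport_def Let_def M.l_neg)
 qed (auto simp: transport_def Let_def M.a_ac M.smult_l_distr M.smult_r_distr
   M.smult_assoc1 M.smult_one M.R.ring_axioms)
 show "inv_into $M e : Hom R (transport e M) M"
  using e assms by (intro lin_inv_into) (auto simp: transport_simps)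
qed

lemma regular_module_simps[simp]:
 "$(regm R) = $R" "0[regm R] = 0[R]"
 "x +[regm R] y = x +[R] y" "x .[regm R] y = x *[R] y"
 by (simp_all add: regular_module_def)

lemma regular_left_module: "ring R ==> lmod R (regm R)"
proof -
 assume "ring R"
 then interpret ring R .
 show ?thesis
  by (rule left_moduleI) (auto simp: a_ac l_distr r_distr m_assoc ring_axioms intro: ex_l_neg)
qed

lemma finsum_regular[simp]: "finsum (regm R) = finsum R"
 by (intro ext) (simp add: finsum_def finprod_def regular_module_def)

lemma restrict_scalars_simps[simp]:
 "$(rsc ph M) = $M" "0[rsc ph M] = 0[M]"
 "x +[rsc ph M] y = x +[M] y" "r .[rsc ph M] y = ph r .[M] y"
 by (simp_all add: restrict_scalars_def)

lemma finsum_restrict_scalars[simp]: "finsum (rsc ph M) = finsum M"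
 by (intro ext) (simp add: finsum_def finprod_def restrict_scalars_def)

lemma restrict_scalars_left_module:
 assumes "ring R" "ph : ring_hom R S" "lmod S M"
 shows "lmod R (rsc ph M)"
proof -
 interpret R: ring R by fact
 interpret M: left_module S M by fact
 show ?thesis
  by (rule left_moduleI)
   (use assms(2) in "auto simp: M.a_ac M.smult_l_distr M.smult_r_distr M.smult_assoc1
    M.smult_one R.ring_axioms ring_hom_add ring_hom_mult ring_hom_one ring_hom_closed
    intro: M.ex_l_neg")
qed

lemma lin_restrict_scalars:
 assumes "ph : ring_hom R S" "f : Hom S M N"
 shows "f : Hom R (rsc ph M) (rsc ph N)"
 using assms by (intro lin_mapsI) (auto simp: lin_closed lin_add lin_smult ring_hom_closed)

section \<open>Projectivity and comparison of complexes\<close>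

text \<open>The test map \<open>q\<close> only has to cover the image of \<open>ph\<close>, so
  lifting into the kernel of a further map requires no module structure on that kernel. Test modules
  share the carrier type of \<open>P\<close>, as do all terms of the sequences considered.\<close>

definition liftable :: "('r, 'z) ring_scheme => ('r, 'm) module => bool" where
 "liftable R P \<longleftrightarrow> lmod R P & (ALL (U :: ('r, 'm) module) (Y :: ('r, 'm) module) q ph.
  lmod R U --> lmod R Y --> q : Hom R U Y --> ph : Hom R P Y -->
  ph ` $P <= q ` $U -->
  (EX vv:Hom R P U. ALL x:$P. q (vv x) = ph x))"

text \<open>The dual basis description of projectivity. The index type is free and supports are only
  pointwise finite, so infinitely generated modules are covered.\<close>

definition dual_basis ::
  "('r, 'z) ring_scheme => ('r, 'p, 'w) module_scheme => 'i set => ('i => 'p) => ('i => 'p => 'r) => bool"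
 where
 "dual_basis R P I b c \<longleftrightarrow>
  (ALL i:I. b i : $P & c i : Hom R P (regm R)) &
  (ALL x:$P. finite {i : I. c i x ~= 0[R]} &
    x = (SUM[P]i:{i : I. c i x ~= 0[R]}. c i x .[P] b i))"

lemma liftableD:
 fixes P U Y :: "('r, 'm) module"
 assumes "liftable R P" "lmod R U" "lmod R Y" "q : Hom R U Y"
  "ph : Hom R P Y" "ph ` $P <= q ` $U"
 shows "EX vv:Hom R P U. ALL x:$P. q (vv x) = ph x"
 using assms unfolding liftable_def by blast

lemma lin_enlarge:
 assumes "f : Hom R M (Y@[S])" "S <= $Y" shows "f : Hom R M Y"
 using assms lin_closed[OF assms(1)] lin_add[OF assms(1)] lin_smult[OF assms(1)]
 by (intro lin_mapsI) auto

lemma dual_basisD: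
 assumes "dual_basis R P I b c"
 shows "i : I ==> b i : $P" "i : I ==> c i : Hom R P (regm R)"
  "i : I ==> x : $P ==> c i x : $R"
  "x : $P ==> finite {i : I. c i x ~= 0[R]}"
  "x : $P ==> (SUM[P]i:{i : I. c i x ~= 0[R]}. c i x .[P] b i) = x"
 using assms lin_closed[of "c i" R P "regm R" x] unfolding dual_basis_def by auto

lemma (in left_module) finsum_support_eq:
 assumes "finite J" "S <= J" "!!i. i : J - S ==> a i = 0[R]"
  and "!!i. i : J ==> a i : $R" "!!i. i : J ==> u i : $M"
 shows "(SUM[M]i:S. a i .[M] u i) = (SUM[M]i:J. a i .[M] u i)"
 using assms by (intro M.add.finprod_mono_neutral_cong_left) (auto simp: smult_l_null)

text \<open>Values \<open>u i\<close> can be prescribed freely because the coordinates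
  \<open>c i\<close> are linear. The supports of \<open>x\<close>, \<open>y\<close> and their sum
  differ, hence the comparison over a common finite set \<open>J\<close>.\<close>

lemma dual_basis_combination:
 assumes P: "lmod R P" and b: "dual_basis R P I b c"
  and U: "lmod R U" and u: "!!i. i : I ==> u i : $U"
 shows "(%x. SUM[U]i:{i : I. c i x ~= 0[R]}. c i x .[U] u i) : Hom R P U"
proof -
 interpret P: left_module R P by fact
 interpret U: left_module R U by fact
 let ?S = "%x. {i : I. c i x ~= 0[R]}"
 note D = dual_basisD[OF b]
 have sub: "(SUM[U]i:?S x. c i x .[U] u i) = (SUM[U]i:J. c i x .[U] u i)"
  if "finite J" "?S x <= J" "J <= I" "x : $P" for J x
  using that u D by (intro U.finsum_support_eq) auto
 have cadd: "c i (x +[P] y) = c i x +[R] c i y" if "i : I" "x : $P" "y : $P" for i x y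
  using lin_add[OF D(2)] that by simp
 have csm: "c i (r .[P] y) = r *[R] c i y" if "i : I" "r : $R" "y : $P" for i r y
  using lin_smult[OF D(2)] that by simp
 show ?thesis
 proof (rule lin_mapsI)
  fix x assume "x : $P"
  then show "(SUM[U]i:?S x. c i x .[U] u i) : $U"
   using u D by (intro U.finsum_closed) auto
 next
  fix x y assume xy: "x : $P" "y : $P"
  define J where "J = ?S x \<union> ?S y"
  have J: "finite J" "J <= I" "?S x <= J" "?S y <= J" using xy D(4) by (auto simp: J_def)
  have Jxy: "?S (x +[P] y) <= J" using xy by (auto simp: J_def cadd)
  have "(SUM[U]i:J. c i (x +[P] y) .[U] u i) = (SUM[U]i:J. c i x .[U] u i +[U] c i y .[U] u i)"
   using J(2) xy u D(3) by (intro U.finsum_cong') (auto simp: cadd U.smult_l_distr subset_iff)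
  also have "... = (SUM[U]i:J. c i x .[U] u i) +[U] (SUM[U]i:J. c i y .[U] u i)"
   using J(2) xy u D(3) by (intro U.finsum_addf) auto
  finally show "(SUM[U]i:?S (x +[P] y). c i (x +[P] y) .[U] u i) =
    (SUM[U]i:?S x. c i x .[U] u i) +[U] (SUM[U]i:?S y. c i y .[U] u i)"
   using J Jxy xy by (simp add: sub)
 next
  fix r x assume x: "r : $R" "x : $P"
  have J: "finite (?S x)" "?S (r .[P] x) <= ?S x" using x D(4) by (auto simp: csm)
  have "(SUM[U]i:?S x. c i (r .[P] x) .[U] u i) = (SUM[U]i:?S x. r .[U] (c i x .[U] u i))"
   using x u D(3) by (intro U.finsum_cong') (auto simp: csm U.smult_assoc1)
  also have "... = r .[U] (SUM[U]i:?S x. c i x .[U] u i)"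
   using x u D(3) by (intro U.smult_finsum[symmetric]) auto
  finally show "(SUM[U]i:?S (r .[P] x). c i (r .[P] x) .[U] u i) = r .[U] (SUM[U]i:?S x. c i x .[U] u i)"
   using J x by (subst sub[of "?S x"]) auto
 qed
qed

lemma dual_basis_liftable:
 fixes P :: "('r, 'm) module"
 assumes P: "lmod R P" and b: "dual_basis R P I b c"
 shows "liftable R P"
 unfolding liftable_def
proof (intro conjI allI impI P)
 fix U Y :: "('r, 'm) module" and q ph
 assume U: "lmod R U" and Y: "lmod R Y" and q: "q : Hom R U Y"
  and ph: "ph : Hom R P Y" and sub: "ph ` $P <= q ` $U"
 interpret U: left_module R U by fact
 interpret Y: left_module R Y by fact
 interpret P: left_module R P by fact
 note D = dual_basisD[OF b]
 have "EX u. u : $U & q u = ph (b i)" if "i : I" for i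
  using sub D(1)[OF that] by (auto simp: image_subset_iff image_iff) metis
 then obtain u where u: "!!i. i : I ==> u i : $U" "!!i. i : I ==> q (u i) = ph (b i)" by metis
 let ?S = "%x. {i : I. c i x ~= 0[R]}"
 show "EX vv:Hom R P U. ALL x:$P. q (vv x) = ph x"
 proof (intro bexI ballI)
  show "(%x. SUM[U]i:?S x. c i x .[U] u i) : Hom R P U"
   by (rule dual_basis_combination[OF P b U u(1)])
  fix x assume x: "x : $P"
  have "q (SUM[U]i:?S x. c i x .[U] u i) = (SUM[Y]i:?S x. q (c i x .[U] u i))"
   using x u D(3) by (intro lin_finsum[OF U Y q]) auto
  also have "... = (SUM[Y]i:?S x. ph (c i x .[P] b i))"
   using x u D(1,3) by (intro Y.finsum_cong') (auto simp: lin_smult[OF q] lin_smult[OF ph] lin_closed[OF ph])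
  also have "... = ph (SUM[P]i:?S x. c i x .[P] b i)"
   using x u D(1,3) by (intro lin_finsum[OF P Y ph, symmetric]) auto
  finally show "q (SUM[U]i:?S x. c i x .[U] u i) = ph x" using D(5)[OF x] by simp
 qed
qed

lemma long_exactD:
 assumes "lexact R d (C, f)"
 shows "i <= Suc d ==> lmod R (C i)"
  "i <= d ==> f i : Hom R (C i) (C (Suc i))"
  "inj_on (f 0) ($(C 0))"
  "f d ` $(C d) = $(C (Suc d))"
  "i < d ==> f i ` $(C i) = {x : $(C (Suc i)). f (Suc i) x = 0[C (Suc (Suc i))]}"
  "i < d ==> x : $(C i) ==> f (Suc i) (f i x) = 0[C (Suc (Suc i))]"
proof -
 show ex: "f i ` $(C i) = {x : $(C (Suc i)). f (Suc i) x = 0[C (Suc (Suc i))]}" if "i < d" for i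
  using assms that unfolding long_exact_def by blast
 show "i < d ==> x : $(C i) ==> f (Suc i) (f i x) = 0[C (Suc (Suc i))]" using ex[of i] by blast
qed (use assms in "auto simp: long_exact_def")

lemma seq_morphismD:
 assumes "smor R d (C, f) (Y, g) h"
 shows "i <= Suc d ==> h i : Hom R (C i) (Y i)"
  "i <= d ==> x : $(C i) ==> h (Suc i) (f i x) = g i (h i x)"
 using assms by (auto simp: seq_morphism_def)

lemma seq_morphism_comp:
 assumes "smor R d (C, f) (Y, g) h" "smor R d (Y, g) (Z, k) l"
 shows "smor R d (C, f) (Z, k) (%i x. l i (h i x))"
 unfolding seq_morphism_def prod.case
proof (intro conjI allI impI ballI)
 fix i assume "i <= Suc d"
 then show "(%x. l i (h i x)) : Hom R (C i) (Z i)"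
  by (intro lin_comp[OF seq_morphismD(1)[OF assms(1)] seq_morphismD(1)[OF assms(2)]])
next
 fix i x assume i: "i <= d" "x : $(C i)"
 then have "h i x : $(Y i)" by (intro lin_closed[OF seq_morphismD(1)[OF assms(1)]]) auto
 then show "l (Suc i) (h (Suc i) (f i x)) = k i (l i (h i x))"
  using i seq_morphismD(2)[OF assms(1)] seq_morphismD(2)[OF assms(2)] by simp
qed

text \<open>The two ends are arbitrary modules: for a resolution, \<open>P (Suc d)\<close> is the
  resolved module and \<open>P 0\<close> a \<open>d\<close>-th syzygy. A source of chain maps only
  has to be a complex, whence zero composites in place of exactness.\<close>

definition proj_complex :: "('r, 'z) ring_scheme => nat => ('r, 'm) mod_seq => bool" where
 "proj_complex R d = (%(P, p).
  (ALL i<=Suc d. lmod R (P i)) & (ALL i<=d. p i : Hom R (P i) (P (Suc i))) &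
  (ALL i<d. ALL x:$(P i). p (Suc i) (p i x) = 0[P (Suc (Suc i))]) &
  (ALL i:{1..d}. liftable R (P i)))"

lemma proj_complexD:
 assumes "proj_complex R d (P, p)"
 shows "i <= Suc d ==> lmod R (P i)" "i <= d ==> p i : Hom R (P i) (P (Suc i))"
  "i < d ==> x : $(P i) ==> p (Suc i) (p i x) = 0[P (Suc (Suc i))]"
  "1 <= i ==> i <= d ==> liftable R (P i)"
 using assms by (auto simp: proj_complex_def)

lemma exact_proj_complex:
 "lexact R d (P, p) ==> (!!i. 1 <= i ==> i <= d ==> liftable R (P i)) ==> proj_complex R d (P, p)"
 unfolding proj_complex_def using long_exactD[of R d P p] by auto

text \<open>The comparison theorem, built from the right end towards the left. Projectivity produces
  the components from \<open>d\<close> down to \<open>1\<close>; the component at \<open>0\<close>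
  is forced, as \<open>f 0\<close> is injective.\<close>

lemma chain_lift:
 fixes P C :: "nat => ('r, 'm) module"
 assumes E: "lexact R d (C, f)" and P: "proj_complex R d (P, p)"
  and ph: "ph : Hom R (P (Suc d)) (C (Suc d))"
 shows "EX h. smor R d (P, p) (C, f) h & h (Suc d) = ph"
proof -
 note E = long_exactD[OF E] and P = proj_complexD[OF P]
 have "EX h. (ALL i. Suc d - k <= i & i <= Suc d --> h i : Hom R (P i) (C i)) &
   (ALL i x. Suc d - k <= i & i <= d & x : $(P i) --> h (Suc i) (p i x) = f i (h i x)) & h (Suc d) = ph"
  if "k <= Suc d" for k
  using that
 proof (induction k)
  case 0
  show ?case by (rule exI[of _ "%_. ph"]) (use ph in auto)
 next
  case (Suc k)
  define j where "j = d - k"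
  have j: "Suc d - k = Suc j" "Suc d - Suc k = j" "j <= d" using Suc.prems by (auto simp: j_def)
  obtain h where h: "!!i. Suc j <= i ==> i <= Suc d ==> h i : Hom R (P i) (C i)"
   "!!i x. Suc j <= i ==> i <= d ==> x : $(P i) ==> h (Suc i) (p i x) = f i (h i x)" "h (Suc d) = ph"
   using Suc j(1) by auto
  let ?g = "%x. h (Suc j) (p j x)"
  have g: "?g : Hom R (P j) (C (Suc j))" using j(3) by (intro lin_comp[OF P(2) h(1)]) auto
  \<comment> \<open>At \<open>j = d\<close> this is surjectivity of \<open>f d\<close>; further
    left, \<open>?g\<close> lands in the kernel of \<open>f (Suc j)\<close> because
    \<open>p (Suc j)\<close> after \<open>p j\<close> is zero.\<close>
  have im: "?g ` $(P j) <= f j ` $(C j)"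
  proof (cases "j = d")
   case True
   show ?thesis
   proof (rule image_subsetI)
    fix x assume "x : $(P j)"
    from lin_closed[OF g this] show "?g x : f j ` $(C j)" unfolding True E(4) .
   qed
  next
   case False
   then have j': "j < d" using j by simp
   show ?thesis
   proof (rule image_subsetI)
    fix x assume x: "x : $(P j)"
    have "f (Suc j) (?g x) = h (Suc (Suc j)) (p (Suc j) (p j x))"
     using h(2)[of "Suc j" "p j x"] lin_closed[OF P(2)[of j] x] j' by simp
    also have "... = 0[C (Suc (Suc j))]"
     using P(3)[OF j' x] j' lin_zero[OF P(1) E(1) h(1), of "Suc (Suc j)"] by simp
    finally show "?g x : f j ` $(C j)" using lin_closed[OF g x] E(5)[OF j'] by simp
   qed
  qed
  obtain vv where vv: "vv : Hom R (P j) (C j)" "!!x. x : $(P j) ==> f j (vv x) = ?g x"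
  proof (cases "j = 0")
   case True
   let ?i = "inv_into ($(C j)) (f j)"
   have inj: "inj_on (f j) ($(C j))" using E(3) True by simp
   have f: "f j : Hom R (C j) (C (Suc j))" using E(2) j by simp
   have m: "lmod R (C j)" "lmod R (C (Suc j))" using E(1) j by auto
   interpret Cj: left_module R "C j" by fact
   interpret Cs: left_module R "C (Suc j)" by fact
   have f': "f j : Hom R (C j) (C (Suc j) @[f j ` $(C j)])"
    using f by (auto simp: lin_maps_def)
   have "?i : Hom R (C (Suc j) @[f j ` $(C j)]) (C j)"
    by (rule lin_inv_into[OF m(1) f' inj]) simp
   moreover have "?g : Hom R (P j) (C (Suc j) @[f j ` $(C j)])"
    using g im by (auto simp: lin_maps_def)
   ultimately have "(%x. ?i (?g x)) : Hom R (P j) (C j)" by (rule lin_comp[rotated])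
   moreover have "f j (?i (?g x)) = ?g x" if "x : $(P j)" for x
    using im that by (intro f_inv_into_f) auto
   ultimately show ?thesis using that by blast
  next
   case False
   then have "liftable R (P j)" using P(4)[of j] j by simp
   then show ?thesis using liftableD[OF _ E(1)[of j] E(1)[of "Suc j"] E(2)[of j] g im] j(3) that
    by auto
  qed
  show ?case unfolding j
  proof (intro exI[of _ "h(j := vv)"] conjI allI impI)
   fix i assume "j <= i & i <= Suc d"
   then show "(h(j := vv)) i : Hom R (P i) (C i)" using h(1)[of i] vv by auto
  next
   fix i x assume "j <= i & i <= d & x : $(P i)"
   then show "(h(j := vv)) (Suc i) (p i x) = f i ((h(j := vv)) i x)" using h(2)[of i x] vv(2)[of x] by auto
  qed (use h(3) j in auto)
 qed
 from this[of "Suc d"] show ?thesis by (auto simp: seq_morphism_def)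
qed

text \<open>A chain homotopy is built from the right, but only its composites with \<open>f\<close>
  are controlled: \<open>h\<close> and \<open>s\<close> after \<open>p\<close> become equal when
  \<open>f\<close> is applied. At index \<open>0\<close> the injectivity of \<open>f 0\<close> turns
  this into an equality of maps.\<close>

lemma homotopy:
 fixes P C :: "nat => ('r, 'm) module"
 assumes E: "lexact R d (C, f)" and P: "proj_complex R d (P, p)"
  and h: "smor R d (P, p) (C, f) h" and 0: "!!x. x : $(P (Suc d)) ==> h (Suc d) x = 0[C (Suc d)]"
 shows "EX e:Hom R (P 1) (C 0). ALL x:$(P 0). h 0 x = e (p 0 x)"
proof -
 note E = long_exactD[OF E] and P = proj_complexD[OF P] and h = seq_morphismD[OF h]
 have "EX s:Hom R (P (Suc (d - k))) (C (d - k)).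
   ALL x:$(P (d - k)). f (d - k) (h (d - k) x) = f (d - k) (s (p (d - k) x))" if "k <= d" for k
  using that
 proof (induction k)
  \<comment> \<open>The start is \<open>s = 0\<close>: \<open>f d\<close> after \<open>h d\<close>
    equals \<open>h (Suc d)\<close> after \<open>p d\<close>, which vanishes.\<close>
  case 0
  have "f d (h d x) = f d 0[C d]" if "x : $(P d)" for x
   using that h(2)[of d x] assms(4) lin_closed[OF P(2)[of d]] lin_zero[OF E(1) E(1) E(2)[of d]] by simp
  then show ?case by (intro bexI[of _ "%_. 0[C d]"]) (auto intro!: lin_zero_map E)
 next
  case (Suc k)
  define j where "j = d - Suc k"
  have j: "d - k = Suc j" "Suc j <= d" using Suc.prems by (auto simp: j_def)
  obtain s where s: "s : Hom R (P (Suc (Suc j))) (C (Suc j))"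
   "!!x. x : $(P (Suc j)) ==> f (Suc j) (h (Suc j) x) = f (Suc j) (s (p (Suc j) x))"
   using Suc j by auto
  let ?g = "%x. h (Suc j) x -[C (Suc j)] s (p (Suc j) x)"
  interpret C1: left_module R "C (Suc j)" using E(1) j by simp
  interpret C2: left_module R "C (Suc (Suc j))" using E(1) j by simp
  have sp: "(%x. s (p (Suc j) x)) : Hom R (P (Suc j)) (C (Suc j))"
   using j by (intro lin_comp[OF P(2) s(1)]) auto
  have g: "?g : Hom R (P (Suc j)) (C (Suc j))"
   using j by (intro lin_minus_map sp h) (auto intro: C1.lself)
  have "f (Suc j) (?g x) = 0[C (Suc (Suc j))]" if "x : $(P (Suc j))" for x
  proof -
   have "f (Suc j) (?g x) = f (Suc j) (h (Suc j) x) -[C (Suc (Suc j))] f (Suc j) (s (p (Suc j) x))"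
    using j that lin_closed[OF sp] lin_closed[OF h(1)[of "Suc j"]]
    by (intro lin_diff[OF C1.lself C2.lself] E(2)) auto
   then show ?thesis using s(2)[OF that] lin_closed[OF E(2)[of "Suc j"]] lin_closed[OF sp that] j
    by (simp add: a_minus_def C2.r_neg)
  qed
  then have "?g ` $(P (Suc j)) <= f j ` $(C j)"
   using E(5)[of j] j lin_closed[OF g] by auto
  moreover have L: "liftable R (P (Suc j))" "lmod R (C j)" "f j : Hom R (C j) (C (Suc j))"
   using P(4) E(1,2) j by auto
  ultimately obtain t where t: "t : Hom R (P (Suc j)) (C j)"
   "!!x. x : $(P (Suc j)) ==> f j (t x) = ?g x"
   using liftableD[OF L(1,2) C1.lself L(3) g] by blast
  have "f j (h j x) = f j (t (p j x))" if x: "x : $(P j)" for x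
  proof -
   have px: "p j x : $(P (Suc j))" using lin_closed[OF P(2)[of j] x] j by simp
   have z: "s (p (Suc j) (p j x)) = 0[C (Suc j)]"
    using P(3)[of j x] x j lin_zero[OF P(1) C1.lself s(1)] by simp
   show ?thesis using t(2)[OF px] h(2)[of j x] x j z lin_closed[OF h(1) px]
    by (simp add: a_minus_def)
  qed
  then show ?case using t(1) unfolding j_def[symmetric] by blast
 qed
 from this[of d] obtain s where s: "s : Hom R (P 1) (C 0)"
  "!!x. x : $(P 0) ==> f 0 (h 0 x) = f 0 (s (p 0 x))" by auto
 then have "h 0 x = s (p 0 x)" if "x : $(P 0)" for x
  using that inj_onD[OF E(3) s(2)[OF that]] lin_closed[OF h(1)[of 0] that]
   lin_closed[OF s(1)] lin_closed[OF P(2)[of 0] that] by simp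
 then show ?thesis using s(1) by blast
qed

section \<open>Vanishing of Yoneda classes\<close>

definition resolution :: "('r, 'z) ring_scheme => nat => ('r, 'm) mod_seq => bool" where
 "resolution R d = (%(P, p). lexact R d (P, p) & (ALL i:{1..d}. liftable R (P i)))"

lemma resolutionD:
 assumes "resolution R d (P, p)"
 shows "lexact R d (P, p)" "proj_complex R d (P, p)"
 using assms exact_proj_complex[of R d P p] by (auto simp: resolution_def)

text \<open>
 The cocycle on \<open>P 0\<close> that represents the class of \<open>(C, f)\<close> is a coboundary.
\<close>

definition null_via ::
  "('r, 'z) ring_scheme => nat => ('r, 'm) mod_seq => ('r, 'm) mod_seq => bool" where
 "null_via R d = (%(P, p) (C, f). EX h. EX e:Hom R (P 1) (C 0). smor R d (P, p) (C, f) h &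
  (ALL x:$(P (Suc d)). h (Suc d) x = x) & (ALL x:$(P 0). h 0 x = e (p 0 x)))"

lemma null_viaI:
 assumes "smor R d (P, p) (C, f) h" "!!x. x : $(P (Suc d)) ==> h (Suc d) x = x"
  "e : Hom R (P 1) (C 0)" "!!x. x : $(P 0) ==> h 0 x = e (p 0 x)"
 shows "null_via R d (P, p) (C, f)"
 using assms unfolding null_via_def by blast

lemma seq_morphism_diff:
 assumes C: "lexact R d (C, f)"
  and h: "smor R d (P, p) (C, f) h" and g: "smor R d (P, p) (C, f) g"
 shows "smor R d (P, p) (C, f) (%i x. g i x -[C i] h i x)"
 unfolding seq_morphism_def prod.case
proof (intro conjI allI impI ballI)
 note C = long_exactD[OF C] and h = seq_morphismD[OF h] and g = seq_morphismD[OF g]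
 fix i assume "i <= Suc d"
 then show "(%x. g i x -[C i] h i x) : Hom R (P i) (C i)"
  by (intro lin_minus_map[OF C(1) g(1) h(1)]) auto
next
 note C = long_exactD[OF C] and h = seq_morphismD[OF h] and g = seq_morphismD[OF g]
 fix i x assume i: "i <= d" "x : $(P i)"
 have "f i (g i x -[C i] h i x) = f i (g i x) -[C (Suc i)] f i (h i x)"
  using i lin_closed[OF g(1) i(2)] lin_closed[OF h(1) i(2)]
  by (intro lin_diff[OF C(1) C(1) C(2)]) auto
 then show "g (Suc i) (p i x) -[C (Suc i)] h (Suc i) (p i x) = f i (g i x -[C i] h i x)"
  using i g(2) h(2) by simp
qed

text \<open>Two lifts of the identity differ by a morphism that is zero at the right end, and
  \<open>homotopy\<close> makes its left component a coboundary.\<close>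

lemma null_via_any:
 fixes P C :: "nat => ('r, 'm) module"
 assumes P: "proj_complex R d (P, p)" and C: "lexact R d (C, f)"
  and n: "null_via R d (P, p) (C, f)"
  and g: "smor R d (P, p) (C, f) g" "!!x. x : $(P (Suc d)) ==> g (Suc d) x = x"
 shows "EX e:Hom R (P 1) (C 0). ALL x:$(P 0). g 0 x = e (p 0 x)"
proof -
 obtain h e where e: "e : Hom R (P 1) (C 0)" and h: "smor R d (P, p) (C, f) h"
  "!!x. x : $(P (Suc d)) ==> h (Suc d) x = x" "!!x. x : $(P 0) ==> h 0 x = e (p 0 x)"
  using n unfolding null_via_def by blast
 interpret C0: left_module R "C 0" using long_exactD(1)[OF C] by simp
 interpret Cd: left_module R "C (Suc d)" using long_exactD(1)[OF C] by simp
 have "EX e':Hom R (P 1) (C 0). ALL x:$(P 0). g 0 x -[C 0] h 0 x = e' (p 0 x)"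
 proof (rule homotopy[OF C P seq_morphism_diff[OF C h(1) g(1)]])
  fix x assume "x : $(P (Suc d))"
  then show "g (Suc d) x -[C (Suc d)] h (Suc d) x = 0[C (Suc d)]"
   using lin_closed[OF seq_morphismD(1)[OF g(1), of "Suc d"], of x] g(2) h(2)
   by (simp add: a_minus_def Cd.r_neg)
 qed
 then obtain e' where e': "e' : Hom R (P 1) (C 0)"
  "!!x. x : $(P 0) ==> g 0 x -[C 0] h 0 x = e' (p 0 x)" by blast
 show ?thesis
 proof (intro bexI ballI)
  show "(%x. e' x +[C 0] e x) : Hom R (P 1) (C 0)"
   by (rule lin_plus[OF C0.lself e'(1) e])
  fix x assume x: "x : $(P 0)"
  have "g 0 x = (g 0 x -[C 0] h 0 x) +[C 0] h 0 x"
   using x lin_closed[OF seq_morphismD(1)[OF g(1)] x] lin_closed[OF seq_morphismD(1)[OF h(1)] x]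
   by (intro C0.diff_add_cancel[symmetric]) auto
  then show "g 0 x = e' (p 0 x) +[C 0] e (p 0 x)" using x e'(2) h(3) by simp
 qed
qed

lemma extensionsD:
 assumes "(C, f) : extensions R d M N"
 shows "lexact R d (C, f)" "C 0 = N" "C (Suc d) = M"
 using assms by (auto simp: extensions_def)

lemma extension_modules:
 assumes "(C, f) : extensions R d M N"
 shows "lmod R M" "lmod R N"
 using extensionsD[OF assms] long_exactD(1)[of R d C f] by fastforce+

lemma extension_rep:
 fixes P C :: "nat => ('r, 'm) module"
 assumes "proj_complex R d (P, p)" "P (Suc d) = M" "(C, f) : extensions R d M N"
 shows "EX h. smor R d (P, p) (C, f) h & (ALL x:$(P (Suc d)). h (Suc d) x = x)"
 using chain_lift[OF extensionsD(1)[OF assms(3)] assms(1), of "%x. x"] lin_ident extensionsD(3)[OF assms(3)] assms(2)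
 by metis

text \<open>A step is the identity on \<open>N\<close>, so composing with it does not change the
  cocycle on \<open>P 0\<close>. Backwards, the composite is some lift to \<open>E'\<close> rather
  than the given one; this is where independence of the lift enters.\<close>

lemma yoneda_step_null:
 fixes P :: "nat => ('r, 'm) module"
 assumes P: "proj_complex R d (P, p)" "P (Suc d) = M" and s: "(E, E') : yoneda_step R d M N"
 shows "null_via R d (P, p) E \<longleftrightarrow> null_via R d (P, p) E'"
proof -
 obtain C f Y g k where E: "E = (C, f)" "E' = (Y, g)" "(C, f) : extensions R d M N" "(Y, g) : extensions R d M N"
  and k: "smor R d (C, f) (Y, g) k" "!!x. x : $N ==> k 0 x = x" "!!x. x : $M ==> k (Suc d) x = x"
  using s unfolding yoneda_step_def by (cases E; cases E') auto
 note D = extensionsD[OF E(3)] extensionsD[OF E(4)]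
 show ?thesis unfolding E(1,2)
 proof
  assume "null_via R d (P, p) (C, f)"
  then obtain h e where e: "e : Hom R (P 1) (C 0)" and h: "smor R d (P, p) (C, f) h"
   "!!x. x : $(P (Suc d)) ==> h (Suc d) x = x" "!!x. x : $(P 0) ==> h 0 x = e (p 0 x)"
   unfolding null_via_def by blast
  have "k 0 (h 0 x) = e (p 0 x)" if "x : $(P 0)" for x
   using h(3)[OF that] k(2)[of "h 0 x"] lin_closed[OF seq_morphismD(1)[OF h(1), of 0] that] D(2) by simp
  moreover have "k (Suc d) (h (Suc d) x) = x" if "x : $(P (Suc d))" for x
   using that h(2) k(3) P(2) by simp
  ultimately show "null_via R d (P, p) (Y, g)"
   using e D(2,5) by (intro null_viaI[OF seq_morphism_comp[OF h(1) k(1)]]) auto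
 next
  assume n: "null_via R d (P, p) (Y, g)"
  obtain h where h: "smor R d (P, p) (C, f) h" "!!x. x : $(P (Suc d)) ==> h (Suc d) x = x"
   using extension_rep[OF P E(3)] by blast
  have "k (Suc d) (h (Suc d) x) = x" if "x : $(P (Suc d))" for x
   using that h(2) k(3) P(2) by simp
  then obtain e where e: "e : Hom R (P 1) (Y 0)" "!!x. x : $(P 0) ==> k 0 (h 0 x) = e (p 0 x)"
   using null_via_any[OF P(1) D(4) n seq_morphism_comp[OF h(1) k(1)]] by blast
  have "h 0 x = e (p 0 x)" if "x : $(P 0)" for x
   using e(2)[OF that] k(2)[of "h 0 x"] lin_closed[OF seq_morphismD(1)[OF h(1), of 0] that] D(2) by simp
  then show "null_via R d (P, p) (C, f)"
   using h e(1) D(2,5) by (intro null_viaI[OF h(1)]) auto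
 qed
qed

lemma yoneda_rel_null:
 fixes P :: "nat => ('r, 'm) module"
 assumes P: "proj_complex R d (P, p)" "P (Suc d) = M" and s: "(E, E') : yoneda_rel R d M N"
 shows "null_via R d (P, p) E \<longleftrightarrow> null_via R d (P, p) E'"
proof -
 have "(E, E') : (yoneda_step R d M N \<union> (yoneda_step R d M N)\<inverse>)\<^sup>*" using s by (simp add: yoneda_rel_def)
 then show ?thesis
  by induction (use yoneda_step_null[OF P] in blast)+
qed

lemma yoneda_rel_equiv: "equiv (extensions R d M N) (yoneda_rel R d M N)"
proof (rule equivI)
 let ?S = "yoneda_step R d M N \<union> (yoneda_step R d M N)\<inverse>"
 have "sym ?S" by (auto simp: sym_def)
 then have "sym (?S\<^sup>*)" by (rule sym_rtrancl)
 then show "sym (yoneda_rel R d M N)" by (auto simp: yoneda_rel_def sym_def)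
 show "trans (yoneda_rel R d M N)" by (auto simp: yoneda_rel_def trans_def intro: rtrancl_trans)
qed (auto simp: yoneda_rel_def refl_on_def)

lemma yoneda_step_rel: "(E, E') : yoneda_step R d M N ==> (E, E') : yoneda_rel R d M N"
 unfolding yoneda_rel_def by (auto simp: yoneda_step_def intro!: r_into_rtrancl)

text \<open>A common feature of both shapes of zero representatives: the splitting for
  \<open>d = 1\<close>, the inverse of the bijection \<open>f 0\<close> for larger
  \<open>d\<close>.\<close>

lemma zero_extension_retraction:
 assumes d: "1 <= d" and Z: "(C, f) : zero_extensions R d M N"
 shows "EX r:Hom R (C 1) N. ALL x:$N. r (f 0 x) = x"
proof (cases "d = 1")
 case False
 note D = extensionsD[of C f R d M N] long_exactD[of R d C f]
 have E: "(C, f) : extensions R d M N" and b: "bij_betw (f 0) $N ($(C 1))"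
  using Z False by (auto simp: zero_extensions_def)
 have "inv_into $N (f 0) : Hom R (C 1) N"
  using D(5)[OF D(1)[OF E], of 0] extension_modules[OF E] b D(2)[OF E]
  by (intro lin_inv_into) (auto simp: bij_betw_def)
 then show ?thesis using b by (intro bexI[of _ "inv_into $N (f 0)"]) (auto simp: bij_betw_def)
qed (use Z in "auto simp: zero_extensions_def")

text \<open>The retraction after \<open>h 1\<close> is the required factor, since \<open>h 1\<close>
  after \<open>p 0\<close> is \<open>f 0\<close> after \<open>h 0\<close>.\<close>

lemma retraction_null:
 fixes P :: "nat => ('r, 'm) module"
 assumes P: "proj_complex R d (P, p)" "P (Suc d) = M" and d: "1 <= d"
  and E: "(C, f) : extensions R d M N"
  and r: "r : Hom R (C 1) N" "!!x. x : $N ==> r (f 0 x) = x"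
 shows "null_via R d (P, p) (C, f)"
proof -
 obtain h where h: "smor R d (P, p) (C, f) h" "!!x. x : $(P (Suc d)) ==> h (Suc d) x = x"
  using extension_rep[OF P E] by blast
 note D = extensionsD[OF E]
 have "(%x. r (h 1 x)) : Hom R (P 1) (C 0)"
  using d r(1) D(2) by (intro lin_comp[OF seq_morphismD(1)[OF h(1)]]) auto
 moreover have "h 0 x = r (h 1 (p 0 x))" if "x : $(P 0)" for x
  using seq_morphismD(2)[OF h(1), of 0 x] that r(2) lin_closed[OF seq_morphismD(1)[OF h(1), of 0] that] D(2) by simp
 ultimately show ?thesis using null_viaI[OF h] by blast
qed

lemma zero_extension_null:
 fixes P :: "nat => ('r, 'm) module"
 assumes "proj_complex R d (P, p)" "P (Suc d) = M" "1 <= d" "(C, f) : zero_extensions R d M N"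
 shows "null_via R d (P, p) (C, f)"
 using zero_extension_retraction[OF assms(3,4)] retraction_null[OF assms(1-3)] assms(4)
 by (auto simp: zero_extensions_def)

definition prod_module ::
  "('r, 'm, 'w) module_scheme => ('r, 'n, 'v) module_scheme => ('r, 'm \<times> 'n) module" where
 "prod_module M N = \<lparr>carrier = $M \<times> $N, monoid.mult = undefined, monoid.one = undefined,
  ring.zero = (0[M], 0[N]), ring.add = (%u v. (fst u +[M] fst v, snd u +[N] snd v)),
  module.smult = (%r u. (r .[M] fst u, r .[N] snd u))\<rparr>"

lemma prod_left_module:
 assumes "lmod R M" "lmod R N" shows "lmod R (prod_module M N)"
proof -
 interpret M: left_module R M by fact
 interpret N: left_module R N by fact
 show ?thesis
 proof (rule left_moduleI)
  fix x assume "x : $(prod_module M N)"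
  then show "EX y:$(prod_module M N). y +[prod_module M N] x = 0[prod_module M N]"
   by (intro bexI[of _ "(-[M] fst x, -[N] snd x)"]) (auto simp: prod_module_def M.l_neg N.l_neg)
 qed (auto simp: prod_module_def M.a_ac N.a_ac M.smult_l_distr N.smult_l_distr M.smult_r_distr
   N.smult_r_distr M.smult_assoc1 N.smult_assoc1 M.smult_one N.smult_one M.R.ring_axioms)
qed

text \<open>The image of \<open>q\<close> plays the part of the quotient of \<open>M\<close> by the
  kernel of \<open>q\<close>, which keeps the factor in the type of \<open>Y\<close>. Its value is
  read off at a chosen preimage.\<close>

lemma lin_factor:
 assumes M: "lmod R M" and Y: "lmod R Y" and U: "lmod R U"
  and q: "q : Hom R M Y" and g: "g : Hom R M U"
  and ker: "!!x. x : $M ==> q x = 0[Y] ==> g x = 0[U]"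
 obtains k where "k : Hom R (Y@[q ` $M]) U" "!!x. x : $M ==> k (q x) = g x"
proof -
 interpret M: left_module R M by fact
 interpret Y: left_module R Y by fact
 interpret U: left_module R U by fact
 let ?s = "inv_into $M q"
 have *: "g (?s (q x)) = g x" if x: "x : $M" for x
 proof -
  have s: "?s (q x) : $M" "q (?s (q x)) = q x"
   using x by (auto intro: inv_into_into f_inv_into_f)
  have "q (?s (q x) -[M] x) = 0[Y]"
   using s x by (subst lin_diff[OF M Y q]) (auto simp: a_minus_def Y.r_neg lin_closed[OF q])
  then have "g (?s (q x) -[M] x) = 0[U]" using s x by (intro ker) auto
  from trans[OF sym[OF lin_diff[OF M U g s(1) x]] this] show ?thesis
   by (rule U.minus_zero_eq[OF lin_closed[OF g s(1)] lin_closed[OF g x]])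
 qed
 have "(%y. g (?s y)) : Hom R (Y@[q ` $M]) U"
  (is "_ : Hom R ?I U")
 proof (rule lin_mapsI)
  fix y assume "y : $?I"
  then show "g (?s y) : $U" by (auto simp: * lin_closed[OF g])
 next
  fix x y assume "x : $?I" "y : $?I"
  then obtain a b where "x = q a" "a : $M" "y = q b" "b : $M" by auto
  then show "g (?s (x +[?I] y)) = g (?s x) +[U] g (?s y)"
   by (simp add: lin_add[OF q, symmetric] * lin_add[OF g])
 next
  fix r x assume "r : $R" "x : $?I"
  then show "g (?s (r .[?I] x)) = r .[U] g (?s x)"
   by (auto simp: lin_smult[OF q, symmetric] * lin_smult[OF g])
 qed
 then show thesis using that * by blast
qed

text \<open>
 The pushout of a resolution along the zero map \<open>P 0 \<rightarrow> N\<close>, with the term \<open>N \<oplus> p 1 (P 1)\<close>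
 encoded by an injective pairing. It maps to every null extension.
\<close>

lemma null_pushout:
 fixes P :: "nat => ('r, 'm) module" and N :: "('r, 'm) module" and pr :: "'m \<times> 'm => 'm"
 assumes P: "resolution R d (P, p)" "P (Suc d) = M" and d: "1 <= d"
  and N: "lmod R N" and pr: "inj pr"
 obtains F q where "(F, q) : extensions R d M N" "EX r:Hom R (F 1) N. ALL x:$N. r (q 0 x) = x"
  "!!C f. (C, f) : extensions R d M N ==> null_via R d (P, p) (C, f) ==>
   ((F, q), (C, f)) : yoneda_step R d M N"
proof -
 note P' = long_exactD[OF resolutionD(1)[OF P(1)]]
 interpret N: left_module R N by fact
 interpret P1: left_module R "P 1" using P'(1)[of 1] by simp
 interpret P2: left_module R "P 2" using P'(1)[of 2] d by simp
 have p1: "p 1 : Hom R (P 1) (P 2)" using P'(2)[of 1] d by (simp add: numeral_2_eq_2)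
 define K where "K = P 2 @[p 1 ` $(P 1)]"
 have sK: "smod (p 1 ` $(P 1)) R (P 2)"
  by (rule lin_image[OF P1.lself P2.lself p1])
 interpret K: left_module R K unfolding K_def by (rule P2.submodule_left_module[OF sK])
 have K: "$K = p 1 ` $(P 1)" "0[K] = 0[P 2]" "x +[K] y = x +[P 2] y" "r .[K] y = r .[P 2] y" for x y r
  by (simp_all add: K_def)
 let ?Q = "prod_module N K"
 have Q: "$?Q = $N \<times> $K" "0[?Q] = (0[N], 0[K])" by (simp_all add: prod_module_def)
 interpret Q: left_module R ?Q by (rule prod_left_module) (rule N K.lself)+
 have inj: "inj_on pr ($?Q)" using pr by (rule inj_on_subset) auto
 define T where "T = transport pr ?Q"
 define u where "u = inv_into ($?Q) pr"
 have T: "lmod R T" "pr : Hom R ?Q T" "u : Hom R T ?Q"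
  unfolding T_def u_def by (rule transport[OF Q.lself inj])+
 have up: "u (pr (n, k)) = (n, k)" if "n : $N" "k : $K" for n k
  unfolding u_def by (rule inv_into_f_f[OF inj]) (use that Q in auto)
 have Tc: "$T = pr ` ($N \<times> $K)" by (simp add: T_def transport_simps Q)
 have unit: "(%n. (n, 0[K])) : Hom R N ?Q"
  by (rule lin_mapsI) (auto simp: prod_module_def K.smult_r_null)
 have fst: "fst : Hom R ?Q N" and snd: "snd : Hom R ?Q K"
  by (auto intro!: lin_mapsI simp: prod_module_def)
 \<comment> \<open>Only the terms \<open>0\<close> and \<open>1\<close> of the resolution change.
   The map out of \<open>T\<close> forgets \<open>N\<close> and includes \<open>p 1 (P 1)\<close> in
   \<open>P 2\<close>.\<close>
 define F where "F = (%i. if i = 0 then N else if i = 1 then T else P i)"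
 define q where "q = (%i. if i = 0 then (%n. pr (n, 0[K])) else if i = 1 then (%z. snd (u z)) else p i)"
 have F: "F 0 = N" "F 1 = T" "F (Suc 0) = T" "!!i. 2 <= i ==> F i = P i" "F (Suc d) = M" "F 2 = P 2" "F (Suc (Suc i)) = P (Suc (Suc i))" for i
  using d P(2) by (auto simp: F_def)
 have q: "q 0 = (%n. pr (n, 0[K]))" "q 1 = (%z. snd (u z))" "q (Suc 0) = (%z. snd (u z))" "!!i. 2 <= i ==> q i = p i"
  by (auto simp: q_def)
 have q0: "q 0 : Hom R N T" unfolding q by (rule lin_comp[OF unit T(2)])
 have q1K: "q 1 : Hom R T K" unfolding q by (rule lin_comp[OF T(3) snd])
 then have q1: "q 1 : Hom R T (P 2)"
  using P2.submoduleD(1)[OF sK] unfolding K_def by (rule lin_enlarge)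
 have q1im: "q 1 ` $T = p 1 ` $(P 1)"
  unfolding Tc q by (auto simp: up image_image K intro!: image_eqI[of _ _ "(0[N], _)"])
 have ext: "(F, q) : extensions R d M N"
  unfolding extensions_def long_exact_def
 proof (intro CollectI case_prodI conjI allI impI)
  fix i assume "i <= Suc d"
  then show "lmod R (F i)" using N T(1) P'(1) by (auto simp: F_def)
 next
  fix i assume i: "i <= d"
  consider "i = 0" | "i = 1" | "2 <= i" by linarith
  then show "q i : Hom R (F i) (F (Suc i))"
  proof cases
   case 3
   then show ?thesis using P'(2)[OF i] F(4)[of i] F(4)[of "Suc i"] q(4)[of i] by simp
  qed (use q0 q1 F in "auto simp: numeral_2_eq_2")
 next
  show "inj_on (q 0) ($(F 0))"
   unfolding F q by (rule inj_onI) (use pr in "auto dest: injD")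
 next
  have "q d ` $(F d) = p d ` $(P d)"
   using q1im F q d by (cases "d = 1") auto
  then show "q d ` $(F d) = $(F (Suc d))" using P'(4) F P(2) by simp
 next
  fix i assume i: "i < d"
  consider "i = 0" | "i = 1" | "2 <= i" by linarith
  then show "q i ` $(F i) = {x : $(F (Suc i)). q (Suc i) x = 0[F (Suc (Suc i))]}"
  proof cases
   case 1
   have "q 0 ` $N = {x : $T. snd (u x) = 0[P 2]}"
    unfolding Tc q using up K(2) K.zero_closed by auto
   then show ?thesis using 1 F q by (simp add: numeral_2_eq_2)
  next
   case 2
   then show ?thesis using P'(5)[OF i] q1im F q by (simp add: numeral_2_eq_2)
  next
   case 3
   then show ?thesis using P'(5)[OF i] F(4)[of i] F(4)[of "Suc i"] F(4)[of "Suc (Suc i)"] q(4)[of i] q(4)[of "Suc i"] by simp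
  qed
 qed (use F in auto)
 have ret: "EX r:Hom R (F 1) N. ALL x:$N. r (q 0 x) = x"
  unfolding F using lin_comp[OF T(3) fst] by (rule bexI[rotated]) (auto simp: q up)
 have step: "((F, q), (C, f)) : yoneda_step R d M N"
  if C: "(C, f) : extensions R d M N" and n: "null_via R d (P, p) (C, f)" for C f
 proof -
  note D = extensionsD[OF C] and L = long_exactD[OF extensionsD(1)[OF C]]
  obtain h e where e: "e : Hom R (P 1) N" and h: "smor R d (P, p) (C, f) h"
   "!!x. x : $(P (Suc d)) ==> h (Suc d) x = x" "!!x. x : $(P 0) ==> h 0 x = e (p 0 x)"
   using n unfolding null_via_def D(2)[symmetric] by auto
  note h' = seq_morphismD[OF h(1)]
  interpret C1: left_module R "C 1" using L(1)[of 1] by simp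
  interpret C2: left_module R "C 2" using L(1)[of 2] d by simp
  have f0: "f 0 : Hom R N (C 1)" using L(2)[of 0] D(2) by simp
  have f1: "f 1 : Hom R (C 1) (C 2)" using L(2)[of 1] d by (simp add: numeral_2_eq_2)
  have h1: "h 1 : Hom R (P 1) (C 1)" using h'(1)[of 1] by simp
  \<comment> \<open>On the image of \<open>p 0\<close> the maps \<open>h 1\<close> and
    \<open>f 0 e\<close> agree, because \<open>h 0\<close> is \<open>e\<close> after
    \<open>p 0\<close>. The corrected map therefore kills the kernel of \<open>p 1\<close> and
    descends to \<open>K\<close>.\<close>
  have g: "(%x. h 1 x -[C 1] f 0 (e x)) : Hom R (P 1) (C 1)"
   by (rule lin_minus_map[OF C1.lself h1 lin_comp[OF e f0]])
  have "h 1 x -[C 1] f 0 (e x) = 0[C 1]" if x: "x : $(P 1)" "p 1 x = 0[P 2]" for x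
  proof -
   obtain y where y: "y : $(P 0)" "x = p 0 y"
    using P'(5)[of 0] x d by (auto simp: numeral_2_eq_2)
   have "h 1 x = f 0 (e x)" using h'(2)[of 0 y] y h(3) d by simp
   then show ?thesis using lin_closed[OF h1 x(1)] by (simp add: a_minus_def C1.r_neg del: One_nat_def)
  qed
  then obtain k where k: "k : Hom R K (C 1)" "!!x. x : $(P 1) ==> k (p 1 x) = h 1 x -[C 1] f 0 (e x)"
   using lin_factor[OF P1.lself P2.lself C1.lself p1 g] unfolding K_def by blast
  have fu: "(%z. fst (u z)) : Hom R T N" and su: "(%z. snd (u z)) : Hom R T K"
   by (rule lin_comp[OF T(3) fst] lin_comp[OF T(3) snd])+
  define m where "m = (%i. if i = 0 then (%x. x) else if i = 1 then (%z. f 0 (fst (u z)) +[C 1] k (snd (u z))) else h i)"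
  have m: "m 0 = (%x. x)" "m 1 = (%z. f 0 (fst (u z)) +[C 1] k (snd (u z)))" "!!i. 2 <= i ==> m i = h i" by (auto simp: m_def)
  have m1: "m 1 : Hom R T (C 1)"
   unfolding m by (rule lin_plus[OF C1.lself lin_comp[OF fu f0] lin_comp[OF su k(1)]])
  have "smor R d (F, q) (C, f) m"
   unfolding seq_morphism_def prod.case
  proof (intro conjI allI impI ballI)
   fix i assume i: "i <= Suc d"
   consider "i = 0" | "i = 1" | "2 <= i" by linarith
   then show "m i : Hom R (F i) (C i)"
    by cases (use m m1 F lin_ident D(2) h'(1)[OF i] in auto)
  next
   fix i x assume i: "i <= d" and x: "x : $(F i)"
   consider "i = 0" | "i = 1" | "2 <= i" by linarith
   then show "m (Suc i) (q i x) = f i (m i x)"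
   proof cases
    case 1
    then have x': "x : $N" using x F by simp
    have "k 0[K] = 0[C 1]" by (rule lin_zero[OF K.lself C1.lself k(1)])
    then have "m 1 (q 0 x) = f 0 x" using x' lin_closed[OF f0 x'] by (simp add: m q up del: One_nat_def)
    then show ?thesis using 1 m by simp
   next
    case 2
    then obtain n y where y: "x = pr (n, p 1 y)" "n : $N" "y : $(P 1)" using x F Tc K by auto
    have K': "p 1 y : $K" using y K by auto
    have d': "f 1 (f 0 z) = 0[C 2]" if "z : $N" for z
     using L(6)[of 0 z] that d D(2) by (simp add: numeral_2_eq_2)
    have cl: "f 0 n : $(C 1)" "h 1 y : $(C 1)" "f 0 (e y) : $(C 1)" "k (p 1 y) : $(C 1)"
     using y lin_closed[OF f0] lin_closed[OF h1] lin_closed[OF e] lin_closed[OF k(1) K'] by auto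
    have "f 1 (m 1 x) = f 1 (f 0 n +[C 1] k (p 1 y))" using y K' by (simp add: m up del: One_nat_def)
    also have "... = f 1 (f 0 n) +[C 2] (f 1 (h 1 y) -[C 2] f 1 (f 0 (e y)))"
     using cl y by (simp add: lin_add[OF f1] k(2) lin_diff[OF C1.lself C2.lself f1] del: One_nat_def)
    also have "... = f 1 (h 1 y)"
     using cl y lin_closed[OF f1 cl(2)] lin_closed[OF e] by (simp add: d' a_minus_def del: One_nat_def)
    also have "... = h 2 (p 1 y)" using h'(2)[of 1 y] d y by (simp add: numeral_2_eq_2)
    also have "... = m 2 (q 1 x)" using y K' by (simp add: m q up del: One_nat_def)
    finally show ?thesis using 2 by (simp add: numeral_2_eq_2)
   next
    case 3
    then show ?thesis using h'(2)[OF i] x F(4)[of i] m(3) q(4) by simp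
   qed
  qed
  moreover have "ALL x:$M. m (Suc d) x = x" using h(2) P(2) m(3)[of "Suc d"] d by simp
  ultimately show ?thesis
   unfolding yoneda_step_def using ext C m(1) by (intro CollectI case_prodI conjI exI[of _ m]) auto
 qed
 show thesis by (rule that[OF ext ret step])
qed

text \<open>Without a representative, \<open>ext_zero\<close> would be empty rather than a class.
  For \<open>d = 2\<close> there is no term between the copies of \<open>N\<close> and
  \<open>M\<close>, and the middle map is zero.\<close>

lemma zero_extension_exists:
 fixes M N :: "('r, 'm) module"
 assumes M: "lmod R M" and N: "lmod R N" and d: "2 <= d"
 shows "zero_extensions R d M N ~= {}"
proof -
 interpret M: left_module R M by fact
 interpret N: left_module R N by fact
 define Z where "Z = N@[{0[N]}]"
 have Z: "lmod R Z" unfolding Z_def by (rule N.submodule_left_module[OF N.submodule_zero])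
 have Zc: "$Z = {0[Z]}" by (simp add: Z_def)
 define C where "C = (%i. if i <= 1 then N else if i < d then Z else M)"
 define f where "f = (%i (x::'m). if i = 0 | i = d then x else 0[C (Suc i)])"
 have mods: "lmod R (C i)" for i using M N Z by (simp add: C_def)
 have "(C, f) : extensions R d M N"
  unfolding extensions_def long_exact_def
 proof (intro CollectI case_prodI conjI allI impI mods)
  fix i assume "i <= d"
  show "f i : Hom R (C i) (C (Suc i))"
  proof (cases "i = 0 | i = d")
   case True
   then have "C (Suc i) = C i" "f i = (%x. x)" using d by (auto simp: C_def f_def)
   then show ?thesis using lin_ident by simp
  qed (use mods in "auto simp: f_def intro: lin_zero_map")
 next
  fix i assume i: "i < d"
  have 0: "0[C j] : $(C j)" for j
  proof -
   interpret left_module R "C j" by (rule mods)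
   show ?thesis by simp
  qed
  show "f i ` $(C i) = {x : $(C (Suc i)). f (Suc i) x = 0[C (Suc (Suc i))]}"
  proof (cases "i = 0")
   case True
   then show ?thesis using d by (auto simp: f_def C_def)
  next
   case False
   then have "f i ` $(C i) = {0[C (Suc i)]}" using i 0 by (auto simp: f_def)
   also have "... = {x : $(C (Suc i)). f (Suc i) x = 0[C (Suc (Suc i))]}"
    using False i Zc 0 by (cases "Suc i = d") (auto simp: f_def C_def)
   finally show ?thesis .
  qed
 qed (use d in "auto simp: f_def C_def")
 then have "(C, f) : zero_extensions R d M N"
  using d Zc by (auto simp: zero_extensions_def C_def f_def bij_betw_def)
 then show ?thesis by blast
qed

text \<open>The pushout \<open>(F, q)\<close> does not depend on the extension and maps by a step to
  every null extension, so all of these, the zero representatives included, form one Yoneda class.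
  The pairing \<open>pr\<close> makes room for the pushout in the carrier type.\<close>

theorem ext_class_eq_zero_iff:
 fixes P :: "nat => ('r, 'm) module" and N :: "('r, 'm) module" and pr :: "'m \<times> 'm => 'm"
 assumes P: "resolution R d (P, p)" "P (Suc d) = M" and d: "1 <= d"
  and pr: "inj pr" and E: "E : extensions R d M N"
 shows "ext_class R d M N E = ext_zero R d M N \<longleftrightarrow> null_via R d (P, p) E"
proof
 note P' = resolutionD(2)[OF P(1)]
 let ?r = "yoneda_rel R d M N"
 note eq = yoneda_rel_equiv[of R d M N]
 {
  assume "ext_class R d M N E = ext_zero R d M N"
  moreover have "(E, E) : ?r" using eq E by (simp add: equiv_def refl_on_def)
  ultimately obtain Z where "Z : zero_extensions R d M N" "(Z, E) : ?r"
   unfolding ext_class_def ext_zero_def by blast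
  then show "null_via R d (P, p) E"
   using zero_extension_null[OF P' P(2) d] yoneda_rel_null[OF P' P(2)] by (cases Z) blast
 }
 assume nE: "null_via R d (P, p) E"
 obtain C f where Cf: "E = (C, f)" by (cases E)
 have N: "lmod R N" and M: "lmod R M" using extension_modules E Cf by auto
 obtain F q where F: "(F, q) : extensions R d M N" "EX r:Hom R (F 1) N. ALL x:$N. r (q 0 x) = x"
  and step: "!!C f. (C, f) : extensions R d M N ==> null_via R d (P, p) (C, f) ==> ((F, q), (C, f)) : yoneda_step R d M N"
  using null_pushout[OF P d N pr] by blast
 have sym: "(a, b) : ?r ==> (b, a) : ?r" and tr: "(a, b) : ?r ==> (b, c) : ?r ==> (a, c) : ?r" for a b c
  using eq by (auto simp: equiv_def dest: symD transD)
 have FE: "((F, q), E) : ?r" using step E nE Cf yoneda_step_rel by blast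
 have FZ: "((F, q), Z) : ?r" if "Z : zero_extensions R d M N" for Z
 proof -
  obtain C f where Z: "Z = (C, f)" by (cases Z)
  have "(C, f) : extensions R d M N" using that Z by (auto simp: zero_extensions_def)
  then show ?thesis
   using zero_extension_null[OF P' P(2) d] that step yoneda_step_rel unfolding Z by blast
 qed
 \<comment> \<open>For \<open>d = 1\<close> the pushout itself is split and serves as a
   representative.\<close>
 have "zero_extensions R d M N ~= {}"
 proof (cases "d = 1")
  case True
  then have "(F, q) : zero_extensions R d M N" using F by (auto simp: zero_extensions_def)
  then show ?thesis by blast
 qed (use zero_extension_exists[OF M N] d in auto)
 then obtain Z where Z: "Z : zero_extensions R d M N" by blast
 show "ext_class R d M N E = ext_zero R d M N"
  unfolding ext_class_def ext_zero_def
 proof (intro equalityI subsetI)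
  fix G assume "G : ?r `` {E}"
  then have "(Z, G) : ?r" using tr[OF sym[OF FZ[OF Z]] tr[OF FE]] by blast
  then show "G : ?r `` zero_extensions R d M N" using Z by blast
 next
  fix G assume "G : ?r `` zero_extensions R d M N"
  then obtain Z where "Z : zero_extensions R d M N" "(Z, G) : ?r" by blast
  then have "(E, G) : ?r" using tr[OF sym[OF FE] tr[OF FZ]] by blast
  then show "G : ?r `` {E}" by blast
 qed
qed

section \<open>Free resolutions\<close>

lemma infinite_pairing:
 assumes "infinite (UNIV :: 'm set)"
 obtains pr :: "'m \<times> 'm => 'm" where "inj pr"
proof -
 have "|UNIV :: ('m \<times> 'm) set| =o |UNIV :: 'm set|"
  using card_of_Times_same_infinite[OF assms] by (simp add: UNIV_Times_UNIV[symmetric] del: UNIV_Times_UNIV)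
 then obtain pr :: "'m \<times> 'm => 'm" where "bij pr" by (auto simp: card_of_ordIso[symmetric])
 then show thesis using that by (auto simp: bij_def)
qed

text \<open>Iterated pairing is injective on lists of equal length, so the length is recorded as
  well.\<close>

lemma infinite_list_encoding:
 assumes "infinite (UNIV :: 'm set)"
 obtains e :: "'m list => 'm" where "inj e"
proof -
 obtain pr :: "'m \<times> 'm => 'm" where pr: "inj pr" using infinite_pairing[OF assms] .
 obtain nu :: "nat => 'm" where nu: "inj nu" using assms infinite_countable_subset by blast
 define enc where "enc = rec_list undefined (%x xs r. pr (x, r))"
 have enc: "enc (x # xs) = pr (x, enc xs)" for x xs by (simp add: enc_def)
 have "length xs = length ys ==> enc xs = enc ys ==> xs = ys" for xs ys
  by (induction xs ys rule: list_induct2) (use pr in "auto simp: enc dest: injD")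
 then have "inj (%xs. pr (nu (length xs), enc xs))"
  using pr nu by (intro injI) (simp add: inj_eq)
 then show thesis by (rule that)
qed

lemma free_module_left_module:
 assumes "ring R" shows "lmod R (free_module R B)"
proof -
 interpret ring R by fact
 let ?F = "free_module R B"
 have c: "f : $?F \<longleftrightarrow> f : B \<rightarrow>\<^sub>E $R & finite {x : B. f x ~= 0[R]}" for f
  by (simp add: free_module_def)
 show ?thesis
 proof (rule left_moduleI)
  fix f g assume "f : $?F" "g : $?F"
  then have *: "finite ({x : B. f x ~= 0[R]} \<union> {x : B. g x ~= 0[R]})"
   "f : B \<rightarrow>\<^sub>E $R" "g : B \<rightarrow>\<^sub>E $R" by (auto simp: c)
  have "finite {x : B. f x +[R] g x ~= 0[R]}"
   by (rule finite_subset[OF _ *(1)]) auto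
  with *(2,3) show "f +[?F] g : $?F" unfolding c
   by (auto simp: free_module_def PiE_iff cong: conj_cong)
 next
  fix r f assume "r : $R" "f : $?F"
  then have *: "finite {x : B. f x ~= 0[R]}" "f : B \<rightarrow>\<^sub>E $R" "r : $R" by (auto simp: c)
  have "finite {x : B. r *[R] f x ~= 0[R]}"
   by (rule finite_subset[OF _ *(1)]) (use * in auto)
  with *(2,3) show "r .[?F] f : $?F" unfolding c
   by (auto simp: free_module_def PiE_iff cong: conj_cong)
 next
  fix f assume "f : $?F"
  then have f: "finite {x : B. f x ~= 0[R]}" "f : B \<rightarrow>\<^sub>E $R" by (auto simp: c)
  have "{x : B. -[R] f x ~= 0[R]} <= {x : B. f x ~= 0[R]}" by auto
  then have "(%x:B. -[R] f x) : $?F" unfolding c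
   using f finite_subset[OF _ f(1)] by (auto simp: PiE_iff cong: conj_cong)
  moreover have "(%x:B. -[R] f x) +[?F] f = 0[?F]"
   using f(2) by (auto simp: free_module_def l_neg PiE_iff intro!: restrict_ext)
  ultimately show "EX y:$?F. y +[?F] f = 0[?F]" by blast
 next
  show "0[?F] : $?F" unfolding c by (auto simp: free_module_def PiE_iff)
 qed (auto simp: free_module_def a_ac l_distr r_distr m_assoc ring_axioms PiE_iff
   intro!: restrict_ext extensionalityI[of _ B])
qed

lemma free_module_dual_basis:
 assumes "ring R"
 shows "dual_basis R (free_module R B) B (%x. %y:B. if y = x then 1[R] else 0[R]) (%x f. f x)"
  (is "dual_basis R ?F B ?b _")
proof -
 interpret ring R by fact
 interpret F: left_module R ?F by (rule free_module_left_module) fact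
 have c: "f : $?F \<longleftrightarrow> f : B \<rightarrow>\<^sub>E $R & finite {x : B. f x ~= 0[R]}" for f
  by (simp add: free_module_def)
 have b: "?b x : $?F" if "x : B" for x
  unfolding c by (auto intro!: finite_subset[of _ "{x}"] split: if_splits)
 have ev: "(%f. f x) : Hom R ?F (regm R)" if "x : B" for x
  using that by (intro lin_mapsI) (auto simp: free_module_def)
 have ext: "g : $?F ==> g : extensional B" for g by (auto simp: c PiE_iff)
 show ?thesis unfolding dual_basis_def
 proof (intro conjI ballI b ev)
  fix f assume f: "f : $?F"
  then show fin: "finite {i : B. f i ~= 0[R]}" by (simp add: c)
  have fc: "f i : $R" if "i : B" for i using f that by (auto simp: c)
  have s: "(SUM[?F]i:{i : B. f i ~= 0[R]}. f i .[?F] ?b i) : $?F"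
   using b fc by (intro F.finsum_closed) auto
  show "f = (SUM[?F]i:{i : B. f i ~= 0[R]}. f i .[?F] ?b i)"
  proof (rule extensionalityI[OF ext[OF f] ext[OF s]])
   fix y assume y: "y : B"
   have "(SUM[?F]i:{i : B. f i ~= 0[R]}. f i .[?F] ?b i) y = (SUM[R]i:{i : B. f i ~= 0[R]}. (f i .[?F] ?b i) y)"
    using b fc by (subst lin_finsum[OF F.lself regular_left_module[OF assms] ev[OF y]]) auto
   also have "... = (SUM[R]i:{i : B. f i ~= 0[R]}. if y = i then f i else 0[R])"
    using y fc by (intro finsum_cong') (auto simp: free_module_def)
   also have "... = f y"
   proof (cases "f y = 0[R]")
    case True
    then have "(SUM[R]i:{i : B. f i ~= 0[R]}. if y = i then f i else 0[R]) = (SUM[R]i:{i : B. f i ~= 0[R]}. 0[R])"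
     by (intro finsum_cong') auto
    then show ?thesis using True by simp
   next
    case False
    then show ?thesis using y fin fc by (intro add.finprod_singleton) auto
   qed
   finally show "f y = (SUM[?F]i:{i : B. f i ~= 0[R]}. f i .[?F] ?b i) y" by simp
  qed
 qed
qed

text \<open>Only \<open>e\<close> after \<open>e'\<close> has to be the identity, so
  \<open>Q\<close> may be a proper retract of \<open>P\<close>. This serves transports as well as
  direct summands.\<close>

lemma dual_basis_iso:
 assumes P: "lmod R P" and b: "dual_basis R P I b c"
  and e: "e : Hom R P Q" "e' : Hom R Q P" "!!y. y : $Q ==> e (e' y) = y"
  and Q: "lmod R Q"
 shows "dual_basis R Q I (%i. e (b i)) (%i y. c i (e' y))"
 unfolding dual_basis_def
proof (intro conjI ballI)
 interpret Q: left_module R Q by fact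
 note D = dual_basisD[OF b]
 fix y assume y: "y : $Q"
 then have y': "e' y : $P" by (rule lin_closed[OF e(2)])
 show "finite {i : I. c i (e' y) ~= 0[R]}" by (rule D(4)[OF y'])
 have "e (SUM[P]i:{i : I. c i (e' y) ~= 0[R]}. c i (e' y) .[P] b i) =
   (SUM[Q]i:{i : I. c i (e' y) ~= 0[R]}. e (c i (e' y) .[P] b i))"
  using D(1,3) y' left_module.smult_closed[OF P] by (intro lin_finsum[OF P Q e(1)]) auto
 also have "... = (SUM[Q]i:{i : I. c i (e' y) ~= 0[R]}. c i (e' y) .[Q] e (b i))"
  using D(1,3) y' by (intro Q.finsum_cong') (auto simp: lin_smult[OF e(1)] lin_closed[OF e(1)])
 finally show "y = (SUM[Q]i:{i : I. c i (e' y) ~= 0[R]}. c i (e' y) .[Q] e (b i))"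
  using D(5)[OF y'] e(3)[OF y] by simp
next
 fix i assume "i : I"
 then show "e (b i) : $Q" "(%y. c i (e' y)) : Hom R Q (regm R)"
  using dual_basisD(1)[OF b] lin_closed[OF e(1)] lin_comp[OF e(2) dual_basisD(2)[OF b]] by auto
qed

text \<open>The free module on the elements of \<open>M\<close> lives in a function type. A finitely
  supported function is determined by its finite graph, and a finite set of pairs is coded by a list
  and then by one element of the infinite type.\<close>

lemma free_cover:
 fixes M :: "('r, 'm) module" and io :: "'r => 'm"
 assumes M: "lmod R M" and inf: "infinite (UNIV :: 'm set)" and io: "inj_on io $R"
 obtains F :: "('r, 'm) module" and q b c where "lmod R F" "q : Hom R F M"
  "q ` $F = $M" "dual_basis R F $M b c"
proof -
 interpret M: left_module R M by fact
 let ?B = "$M" and ?F = "free_module R $M"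
 note R = M.R.ring_axioms
 note F = free_module_left_module[OF R, of ?B] and db = free_module_dual_basis[OF R, of ?B]
 obtain pr :: "'m \<times> 'm => 'm" where pr: "inj pr" using infinite_pairing[OF inf] .
 obtain le :: "'m list => 'm" where le: "inj le" using infinite_list_encoding[OF inf] .
 define g where "g = (%f :: 'm => 'r. pr ` (%x. (x, io (f x))) ` {x : ?B. f x ~= 0[R]})"
 define e where "e = (%f. le (SOME xs. set xs = g f))"
 have fin: "finite (g f)" if "f : $?F" for f using that by (auto simp: g_def free_module_def)
 have "inj_on e ($?F)"
 proof (rule inj_onI)
  fix f h assume fh: "f : $?F" "h : $?F" "e f = e h"
  have "set (SOME xs. set xs = g k) = g k" if "k : $?F" for k
   using someI_ex[OF finite_list[OF fin[OF that]]] .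
  then have "g f = g h" using fh le unfolding e_def by (metis injD)
  then have eq: "(%x. (x, io (f x))) ` {x : ?B. f x ~= 0[R]} = (%x. (x, io (h x))) ` {x : ?B. h x ~= 0[R]}"
   unfolding g_def by (simp add: inj_image_eq_iff[OF pr])
  have fh': "f : ?B \<rightarrow>\<^sub>E $R" "h : ?B \<rightarrow>\<^sub>E $R" using fh by (auto simp: free_module_def)
  show "f = h"
  proof (rule PiE_ext[OF fh'])
   fix x assume x: "x : ?B"
   then have fx: "f x : $R" "h x : $R" using fh' by auto
   show "f x = h x"
   proof (cases "f x = 0[R] & h x = 0[R]")
    case False
    then have "io (f x) = io (h x)" using eq x by (auto simp: set_eq_iff image_iff)
    then show ?thesis using io fx by (auto dest: inj_onD)
   qed auto
  qed
 qed
 note T = transport[OF F this]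
 let ?T = "transport e ?F" and ?i = "inv_into ($?F) e"
 have ei: "e (?i y) = y" if "y : $?T" for y
  using that unfolding transport_simps by (rule f_inv_into_f)
 let ?q = "%f. SUM[M]x:{x : ?B. f x ~= 0[R]}. f x .[M] x"
 have q: "?q : Hom R ?F M" by (rule dual_basis_combination[OF F db M]) simp
 have "$M <= (%z. ?q (?i z)) ` $?T"
 proof
  fix x assume x: "x : $M"
  let ?d = "%y:?B. if y = x then 1[R] else 0[R]"
  have d: "?d : $?F" using dual_basisD(1)[OF db x] .
  \<comment> \<open>Over the zero ring the function \<open>?d\<close> has empty support; then
    \<open>x\<close> is zero and so is the empty sum.\<close>
  have triv: "x = 0[M]" if "1[R] = 0[R]" using M.smult_one[OF x] M.smult_l_null[OF x] that by simp
  have "?q ?d = (SUM[M]y:{x}. ?d y .[M] y)"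
   using x triv by (intro M.add.finprod_mono_neutral_cong_left) (auto simp: M.smult_l_null M.smult_one split: if_splits)
  also have "... = x" using x by (simp add: M.smult_one)
  finally have "?q ?d = x" .
  moreover have "?i (e ?d) = ?d" using `inj_on e _` d by (rule inv_into_f_f)
  ultimately have "x = ?q (?i (e ?d))" by simp
  then show "x : (%z. ?q (?i z)) ` $?T" using d by (auto simp: transport_simps)
 qed
 then have "(%z. ?q (?i z)) ` $?T = $M" using lin_closed[OF lin_comp[OF T(3) q]] by blast
 moreover have "dual_basis R ?T ?B (%x. e (%y:?B. if y = x then 1[R] else 0[R])) (%x y. ?i y x)"
  by (rule dual_basis_iso[OF F db T(2,3) _ T(1)]) (rule ei)
 ultimately show thesis using that[OF T(1) lin_comp[OF T(3) q]] by blast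
qed

text \<open>Each round covers \<open>M\<close> freely and resolves the kernel, whose resolution is
  spliced in on the left. The leftmost term remains the last kernel.\<close>

lemma free_resolution:
 fixes M :: "('r, 'm) module" and io :: "'r => 'm"
 assumes M: "lmod R M" and inf: "infinite (UNIV :: 'm set)" and io: "inj_on io $R"
 shows "EX P p. lexact R d (P, p) & P (Suc d) = M &
  (ALL i:{1..d}. EX (I :: 'm set) b c. dual_basis R (P i) I b c)"
 using M
proof (induction d arbitrary: M)
 case 0
 show ?case
  by (rule exI[of _ "%_. M"], rule exI[of _ "%_ x. x"]) (auto simp: long_exact_def 0 lin_ident)
next
 case (Suc d)
 obtain F :: "('r, 'm) module" and q b c where F: "lmod R F" "q : Hom R F M"
  "q ` $F = $M" "dual_basis R F $M b c"
  by (rule free_cover[OF Suc.prems inf io])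
 interpret F: left_module R F by fact
 let ?K = "F@[{x : $F. q x = 0[M]}]"
 have K: "lmod R ?K" by (rule F.submodule_left_module[OF lin_kernel[OF F(1) Suc.prems F(2)]])
 from Suc.IH[OF K] obtain P p where P: "lexact R d (P, p)" "P (Suc d) = ?K"
  "ALL i:{1..d}. EX (I :: 'm set) b c. dual_basis R (P i) I b c" by blast
 note P' = long_exactD[OF P(1)]
 define P2 where "P2 = (%i. if i <= d then P i else if i = Suc d then F else M)"
 define p2 where "p2 = (%i. if i <= d then p i else q)"
 have "lexact R (Suc d) (P2, p2)"
  unfolding long_exact_def
 proof (intro case_prodI conjI allI impI)
  fix i assume "i <= Suc (Suc d)"
  then show "lmod R (P2 i)" using P'(1)[of i] F(1) Suc.prems by (auto simp: P2_def)
 next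
  fix i assume "i <= Suc d"
  then consider "i < d" | "i = d" | "i = Suc d" by linarith
  then show "p2 i : Hom R (P2 i) (P2 (Suc i))"
  proof cases
   case 2
   have "p d : Hom R (P d) F"
    using P'(2)[of d] P(2) by (intro lin_enlarge[of _ R _ "{x : $F. q x = 0[M]}" F]) auto
   then show ?thesis using 2 by (simp add: P2_def p2_def)
  qed (use P'(2)[of i] F(2) in "auto simp: P2_def p2_def")
 next
  show "inj_on (p2 0) ($(P2 0))" using P'(3) by (simp add: P2_def p2_def)
  show "p2 (Suc d) ` $(P2 (Suc d)) = $(P2 (Suc (Suc d)))"
   using F(3) by (simp add: P2_def p2_def)
 next
  fix i assume "i < Suc d"
  then consider "Suc i < d" | "Suc i = d" | "i = d" by linarith
  then show "p2 i ` $(P2 i) = {x : $(P2 (Suc i)). p2 (Suc i) x = 0[P2 (Suc (Suc i))]}"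
  proof cases
   case 2
   then show ?thesis using P'(5)[of i] P(2) by (simp add: P2_def p2_def)
  next
   case 3
   then show ?thesis using P'(4) P(2) by (simp add: P2_def p2_def)
  qed (use P'(5)[of i] in "auto simp: P2_def p2_def")
 qed
 moreover have "EX (I :: 'm set) b c. dual_basis R (P2 i) I b c" if "i : {1..Suc d}" for i
  using that P(3) F(4) by (cases "i = Suc d") (auto simp: P2_def)
 moreover have "P2 (Suc (Suc d)) = M" by (simp add: P2_def)
 ultimately show ?case by blast
qed

lemma projective_resolution_exists:
 fixes M :: "('r, 'm) module" and io :: "'r => 'm"
 assumes "lmod R M" "infinite (UNIV :: 'm set)" "inj_on io $R"
 obtains P p where "resolution R d (P, p)" "P (Suc d) = M"
  "!!i. 1 <= i ==> i <= d ==> EX (I :: 'm set) b c. dual_basis R (P i) I b c"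
proof -
 obtain P p where P: "lexact R d (P, p)" "P (Suc d) = M"
  "ALL i:{1..d}. EX (I :: 'm set) b c. dual_basis R (P i) I b c"
  using free_resolution[OF assms] by metis
 have "liftable R (P i)" if i: "i : {1..d}" for i
 proof -
  obtain I :: "'m set" and b c where "dual_basis R (P i) I b c" using P(3) i by blast
  then show ?thesis using i by (intro dual_basis_liftable[OF long_exactD(1)[OF P(1)]]) auto
 qed
 then show thesis using that[of P p] P by (auto simp: resolution_def)
qed

section \<open>Tensor products\<close>

definition balanced ::
  "('r, 'z) ring_scheme => ('r, 'm, 'w) module_scheme => ('r, 'n, 'v) module_scheme
   => ('h, 'u) ring_scheme => ('m => 'n => 'h) => bool" where
 "balanced R M N H b \<longleftrightarrow>
  (ALL x:$M. ALL y:$N. b x y : $H) &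
  (ALL x:$M. ALL x':$M. ALL y:$N. b (x +[M] x') y = b x y +[H] b x' y) &
  (ALL x:$M. ALL y:$N. ALL y':$N. b x (y +[N] y') = b x y +[H] b x y') &
  (ALL r:$R. ALL x:$M. ALL y:$N. b (r .[M] x) y = b x (r .[N] y))"

text \<open>The record \<open>T\<close> is arbitrary apart from carrier, zero and addition, so that
  the tensor ring of two algebras and the tensor products of modules share these lemmas.\<close>

locale tensor_product = M: left_module R M + N: left_module R N
 for R :: "('r, 'z) ring_scheme" and M :: "('r, 'm, 'w) module_scheme" and N :: "('r, 'n, 'v) module_scheme" +
 fixes T :: "(('m \<times> 'n \<Rightarrow>\<^sub>0 int) set, 't) ring_scheme"
 assumes carrier_T_group: "$T = $(tensor_group R M N)"
  and zero_T_group: "0[T] = 1[tensor_group R M N]"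
  and add_T_group: "ring.add T = monoid.mult (tensor_group R M N)"
begin

abbreviation "FF \<equiv> tensor_free M N"
abbreviation "KK \<equiv> tensor_rels R M N"
abbreviation tcoset where "tcoset \<equiv> tensor_coset R M N"
abbreviation tensor (infixl "><" 70) where "x >< y \<equiv> etens R M N x y"

lemma FF: "$FF = {u. Poly_Mapping.keys u <= $M \<times> $N}" "x *[FF] y = x + y" "1[FF] = 0"
 by (auto simp: tensor_free_def)

lemma FF_closed: "u : $FF ==> v : $FF ==> u + v : $FF"
 "u : $FF ==> v : $FF ==> u - v : $FF" "0 : $FF"
 "x : $M ==> y : $N ==> frag_of (x, y) : $FF"
 using Poly_Mapping.keys_add[of u v] keys_diff[of u v] by (auto simp: FF)

sublocale FF: comm_group FF
 unfolding tensor_free_def by (rule abelian_free_Abelian_group)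

lemma KK_subgroup: "subgroup KK FF"
 unfolding tensor_rels_def by (rule FF.generate_is_subgroup) (auto intro!: FF_closed)

lemma KK_normal: "KK \<lhd> FF"
 by (rule FF.subgroup_imp_normal[OF KK_subgroup])

lemma carrier_T: "$T = tcoset ` $FF"
 unfolding carrier_T_group by (auto simp: tensor_group_def FactGroup_def RCOSETS_def tensor_coset_def)

lemma tcoset_closed: "u : $FF ==> tcoset u : $T"
 by (simp add: carrier_T)

lemma tcoset_iff: "u : tcoset v \<longleftrightarrow> (EX k:KK. u = k + v)"
 by (auto simp: tensor_coset_def r_coset_def FF)

lemma zero_T: "0[T] = tcoset 0"
proof -
 have "0[T] = KK" by (simp add: zero_T_group tensor_group_def FactGroup_def)
 also have "... = tcoset 0" by (auto simp: tcoset_iff)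
 finally show ?thesis .
qed

lemma tcoset_add:
 assumes "u : $FF" "v : $FF"
 shows "tcoset (u + v) = tcoset u +[T] tcoset v"
proof -
 have "tcoset u +[T] tcoset v = tcoset u <#>\<^bsub>FF\<^esub> tcoset v"
  by (simp add: add_T_group tensor_group_def FactGroup_def)
 also have "... = tcoset (u + v)"
  using normal.rcos_sum[OF KK_normal assms] by (simp add: tensor_coset_def FF)
 finally show ?thesis by simp
qed

lemma abelian_group_T: "abelian_group T"
proof -
 interpret Q: comm_group "tensor_group R M N"
  unfolding tensor_group_def by (rule FF.abelian_FactGroup[OF KK_subgroup])
 show ?thesis
  by (rule abelian_groupI) (auto simp: carrier_T_group zero_T_group add_T_group Q.m_ac intro: Q.l_inv_ex)
qed

sublocale T: abelian_group T by (rule abelian_group_T)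

lemma tensor_closed[simp, intro]: "x : $M ==> y : $N ==> x >< y : $T"
 unfolding elem_tensor_def by (intro tcoset_closed FF_closed)

lemma tcoset_eq:
 assumes "k : KK" "v : $FF" "u = k + v" shows "tcoset u = tcoset v"
proof -
 have k: "k : $FF" using KK_subgroup assms(1) subgroup.subset by blast
 have "tcoset k = tcoset 0"
  using FF.coset_join2[OF k KK_subgroup assms(1)]
   FF.coset_join2[OF FF_closed(3) KK_subgroup] subgroup.one_closed[OF KK_subgroup]
  by (simp add: tensor_coset_def FF)
 then show ?thesis
  unfolding assms(3) using k assms(2) tcoset_closed by (simp add: tcoset_add zero_T[symmetric])
qed

lemma KK_gen:
 "x : $M ==> x' : $M ==> y : $N ==>
  frag_of (x +[M] x', y) - frag_of (x, y) - frag_of (x', y) : KK"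
 "x : $M ==> y : $N ==> y' : $N ==>
  frag_of (x, y +[N] y') - frag_of (x, y) - frag_of (x, y') : KK"
 "r : $R ==> x : $M ==> y : $N ==>
  frag_of (r .[M] x, y) - frag_of (x, r .[N] y) : KK"
 unfolding tensor_rels_def by (rule generate.incl, blast)+

lemma tensor_add_left: 
 assumes "x : $M" "x' : $M" "y : $N"
 shows "(x +[M] x') >< y = x >< y +[T] x' >< y"
 using assms tcoset_eq[OF KK_gen(1)[OF assms], of "frag_of (x, y) + frag_of (x', y)"]
 by (simp add: elem_tensor_def FF_closed tcoset_add)

lemma tensor_add_right:
 assumes "x : $M" "y : $N" "y' : $N"
 shows "x >< (y +[N] y') = x >< y +[T] x >< y'"
 using assms tcoset_eq[OF KK_gen(2)[OF assms], of "frag_of (x, y) + frag_of (x, y')"]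
 by (simp add: elem_tensor_def FF_closed tcoset_add)

lemma tensor_smult:
 assumes "r : $R" "x : $M" "y : $N"
 shows "(r .[M] x) >< y = x >< (r .[N] y)"
 using assms tcoset_eq[OF KK_gen(3)[OF assms], of "frag_of (x, r .[N] y)"]
 by (simp add: elem_tensor_def FF_closed)

lemma tensor_zero_left: "y : $N ==> 0[M] >< y = 0[T]"
 using tensor_add_left[of "0[M]" "0[M]" y] T.add.l_cancel_one[of "0[M] >< y" "0[M] >< y"]
 by (simp add: eq_commute)

lemma tensor_zero_right: "x : $M ==> x >< 0[N] = 0[T]"
 using tensor_add_right[of x "0[N]" "0[N]"] T.add.l_cancel_one[of "x >< 0[N]" "x >< 0[N]"]
 by (simp add: eq_commute)

lemma tensor_minus_left: "x : $M ==> y : $N ==> (-[M] x) >< y = -[T] (x >< y)"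
 using tensor_add_left[of "-[M] x" x y]
 by (intro T.minus_equality[symmetric]) (simp_all add: M.M.l_neg tensor_zero_left)

text \<open>Negation costs nothing, as the negative of \<open>x >< y\<close> is
  \<open>(-x) >< y\<close>. Elements of the free group are reached by differences, so the claim is
  carried along for an element together with its negative.\<close>

lemma tensor_induct [consumes 1, case_names tensor add]:
 assumes z: "z : $T"
  and t: "!!x y. x : $M ==> y : $N ==> Q (x >< y)"
  and a: "!!z w. z : $T ==> w : $T ==> Q z ==> Q w ==> Q (z +[T] w)"
 shows "Q z"
proof -
 obtain u where u: "u : $FF" "z = tcoset u" using z by (auto simp: carrier_T)
 have "Poly_Mapping.keys u <= $M \<times> $N" using u by (simp add: FF)
 then have "u : $FF & Q (tcoset u) & Q (-[T] (tcoset u))"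
 proof (induction u rule: frag_induction)
  case zero
  have "Q 0[T]" using t[of "0[M]" "0[N]"] by (simp add: tensor_zero_left)
  moreover have "0[T] = -[T] 0[T]" by (rule T.minus_equality[symmetric]) auto
  ultimately have "Q 0[T] & Q (-[T] 0[T])" by metis
  then show ?case unfolding zero_T[symmetric] by (blast intro: FF_closed)
 next
  case (one a)
  then obtain x y where a: "a = (x, y)" "x : $M" "y : $N" by auto
  then show ?case using t[of x y] t[of "-[M] x" y] tensor_minus_left[of x y]
   by (simp add: elem_tensor_def[symmetric] FF_closed)
 next
  case (diff v w)
  have "tcoset (v - w) +[T] tcoset w = tcoset v"
   using diff tcoset_add[of "v - w" w] by (simp add: FF_closed)
  then have *: "tcoset (v - w) = tcoset v +[T] -[T] (tcoset w)"
   using diff tcoset_closed FF_closed(2)[of v w] by (metis T.add.inv_solve_right)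
  then have "-[T] (tcoset (v - w)) = -[T] (tcoset v) +[T] tcoset w"
   using diff tcoset_closed by (simp add: T.minus_add)
  with * show ?case using diff a tcoset_closed FF_closed(2)[of v w] by simp
 qed
 then show ?thesis using u by simp
qed

text \<open>An additive function on the free group that is balanced on generators kills the tensor
  relations. This is what makes unions over representatives collapse to one value.\<close>

lemma coset_const:
 assumes H: "abelian_group H" and h: "!!u. u : $FF ==> h u : $H"
  and add: "!!u v. u : $FF ==> v : $FF ==> h (u + v) = h u +[H] h v"
  and b: "balanced R M N H (%x y. h (frag_of (x, y)))"
  and v: "v : $FF" and u: "u : tcoset v"
 shows "h u = h v"
proof -
 interpret H: abelian_group H by fact
 have zero: "h 0 = 0[H]"
  using add[of 0 0] h[of 0] H.add.l_cancel_one[of "h 0" "h 0"] by (simp add: FF_closed eq_commute)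
 have diff: "h (u - v) = h u -[H] h v" if "u : $FF" "v : $FF" for u v
 proof -
  have "h u = h (u - v) +[H] h v" using add[of "u - v" v] that by (simp add: FF_closed)
  then show ?thesis using that h FF_closed(2)[OF that] by (simp add: a_minus_def H.a_assoc H.r_neg)
 qed
 have sum0: "a +[H] b -[H] a -[H] b = 0[H]" if "a : $H" "b : $H" for a b
  using that H.r_neg[of "a +[H] b"] by (simp add: a_minus_def H.minus_add H.a_assoc)
 note B = b[unfolded balanced_def]
 have "k : $FF & h k = 0[H]" if "k : KK" for k
  using that unfolding tensor_rels_def
 proof (induction rule: generate.induct)
  case one
  then show ?case using zero by (simp add: FF FF_closed(3)[simplified FF])
 next
  case (incl k)
  then show ?case using B h
   by (elim UnE CollectE exE conjE)
    (simp_all add: diff FF_closed sum0, simp_all add: a_minus_def H.r_neg FF_closed)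
 next
  case (inv k)
  then have k: "k : $FF" "h k = 0[H]" using B h
   by (auto simp add: diff FF_closed sum0) (simp_all add: a_minus_def H.r_neg FF_closed)
  have "inv\<^bsub>FF\<^esub> k = 0 - k" using k(1) by (simp add: tensor_free_def)
  then show ?case using k zero by (simp add: FF_closed diff del: diff_0) (simp add: a_minus_def)
 next
  case (eng k l)
  then show ?case using add by (simp add: FF(2) FF_closed)
 qed
 moreover obtain k where "k : KK" "u = k + v" using u by (auto simp: tcoset_iff)
 ultimately show ?thesis using add[of k v] v h by simp
qed

text \<open>The extension to the free group is constant on cosets by \<open>coset_const\<close>, so
  it may be evaluated at a chosen representative.\<close>

lemma universal:
 assumes H: "abelian_group H" and b: "balanced R M N H b"
 obtains ph where "ph : $T -> $H"
  "!!z w. z : $T ==> w : $T ==> ph (z +[T] w) = ph z +[H] ph w"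
  "!!x y. x : $M ==> y : $N ==> ph (x >< y) = b x y"
proof -
 interpret H: abelian_group H by fact
 have im: "(%(x, y). b x y) ` ($M \<times> $N) <= $(add_monoid H)"
  using b by (auto simp: balanced_def)
 obtain h where h': "!!u. u : $FF ==> h u : $H"
  "!!u v. u : $FF ==> v : $FF ==> h (u + v) = h u +[H] h v"
  and h: "!!x y. x : $M ==> y : $N ==> h (frag_of (x, y)) = b x y"
 proof (rule comm_group.free_Abelian_group_universal[OF H.a_comm_group im])
  fix h assume "h : hom (free_Abelian_group ($M \<times> $N)) (add_monoid H)"
   "!!p. p : $M \<times> $N ==> h (frag_of p) = (%(x, y). b x y) p"
  then show thesis by (intro that[of h]) (auto simp: hom_def tensor_free_def)
 qed
 have bal: "balanced R M N H (%x y. h (frag_of (x, y)))"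
  using b h by (simp add: balanced_def)
 define ph where "ph = (%z. h (SOME u. u : z))"
 have ph: "ph (tcoset u) = h u" if u: "u : $FF" for u
 proof -
  have "u : tcoset u" unfolding tcoset_iff
   using subgroup.one_closed[OF KK_subgroup] by (intro bexI[of _ 0]) (auto simp: FF)
  then have "(SOME v. v : tcoset u) : tcoset u" by (rule someI)
  then show ?thesis unfolding ph_def by (intro coset_const[OF H _ _ bal u] h')
 qed
 show thesis
 proof (rule that[of ph])
  show "ph : $T -> $H" by (auto simp: carrier_T ph h')
  show "ph (z +[T] w) = ph z +[H] ph w" if "z : $T" "w : $T" for z w
   using that by (auto simp: carrier_T tcoset_add[symmetric] ph h' FF_closed)
  show "ph (x >< y) = b x y" if "x : $M" "y : $N" for x y
   using that by (simp add: elem_tensor_def ph FF_closed h)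
 qed
qed

text \<open>The operation \<open>pl\<close> is left open, so that the rule applies before the target
  is known to be a group.\<close>

lemma additive_eqI:
 assumes "z : $T"
  and "!!z w. z : $T ==> w : $T ==> ph (z +[T] w) = pl (ph z) (ph w)"
  and "!!z w. z : $T ==> w : $T ==> vv (z +[T] w) = pl (vv z) (vv w)"
  and "!!x y. x : $M ==> y : $N ==> ph (x >< y) = vv (x >< y)"
 shows "ph z = vv z"
 using assms(1) by (induction rule: tensor_induct) (simp_all add: assms(2-4))

end

text \<open>All representatives of a coset give the same value by \<open>coset_const\<close>, so the
  union in the definition is the value at any of them; the three rules are then inherited from
  \<open>frag_extend\<close>.\<close>

lemma tensor_map:
 assumes "tensor_product R M N T" "tensor_product R M' N' T'"
  and ph: "ph : Hom R M M'" and vv: "vv : Hom R N N'"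
 shows "z : $T ==> tmap R M' N' ph vv z : $T'"
  and "z : $T ==> w : $T ==>
   tmap R M' N' ph vv (z +[T] w) = tmap R M' N' ph vv z +[T'] tmap R M' N' ph vv w"
  and "x : $M ==> y : $N ==>
   tmap R M' N' ph vv (etens R M N x y) = etens R M' N' (ph x) (vv y)"
proof -
 interpret S: tensor_product R M N T by fact
 interpret S': tensor_product R M' N' T' by fact
 let ?e = "frag_extend (%(x, y). frag_of (ph x, vv y))"
 let ?h = "%u. tensor_coset R M' N' (?e u)"
 have e: "?e u : $S'.FF" if "u : $S.FF" for u
 proof -
  have u: "Poly_Mapping.keys u <= $M \<times> $N" using that by (simp add: S.FF)
  have "Poly_Mapping.keys (?e u) <= (UN p:Poly_Mapping.keys u. {(ph (fst p), vv (snd p))})"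
   using keys_frag_extend[of "%(x, y). frag_of (ph x, vv y)" u] by (simp add: split_beta)
  also have "... <= $M' \<times> $N'"
   using u lin_closed[OF ph] lin_closed[OF vv] by (auto simp: subset_iff)
  finally show ?thesis by (simp add: S'.FF)
 qed
 have add: "?h (u + v) = ?h u +[T'] ?h v" if "u : $S.FF" "v : $S.FF" for u v
  using that e by (simp add: frag_extend_add S'.tcoset_add)
 have bal: "balanced R M N T' (%x y. ?h (frag_of (x, y)))"
  using lin_closed[OF ph] lin_closed[OF vv]
  by (simp add: balanced_def elem_tensor_def[symmetric] S'.tensor_add_left S'.tensor_add_right S'.tensor_smult
   lin_add[OF ph] lin_add[OF vv] lin_smult[OF ph] lin_smult[OF vv])
 have tm: "tmap R M' N' ph vv (tensor_coset R M N u) = ?h u" if u: "u : $S.FF" for u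
 proof -
  have "u : S.tcoset u" unfolding S.tcoset_iff
   using subgroup.one_closed[OF S.KK_subgroup] by (intro bexI[of _ 0]) (auto simp: S.FF)
  moreover have *: "?h v = ?h u" if "v : S.tcoset u" for v
   by (rule S.coset_const[OF S'.abelian_group_T _ _ bal u that]) (simp_all add: add S'.tcoset_closed e)
  ultimately show ?thesis unfolding tensor_map_def SUP_cong[OF refl *] by blast
 qed
 show "z : $T ==> tmap R M' N' ph vv z : $T'"
  by (auto simp: S.carrier_T tm S'.tcoset_closed e)
 show "z : $T ==> w : $T ==>
   tmap R M' N' ph vv (z +[T] w) = tmap R M' N' ph vv z +[T'] tmap R M' N' ph vv w"
  by (auto simp: S.carrier_T tm S.tcoset_add[symmetric] add S.FF_closed)
 show "x : $M ==> y : $N ==>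
   tmap R M' N' ph vv (etens R M N x y) = etens R M' N' (ph x) (vv y)"
  by (simp add: elem_tensor_def tm S.FF_closed)
qed

section \<open>Tensoring with a bimodule\<close>

lemma tensor_map_comp:
 assumes "tensor_product R M N T" "tensor_product R M' N' T'" "tensor_product R M'' N'' T''"
  and "ph : Hom R M M'" "vv : Hom R N N'" "ph' : Hom R M' M''" "vv' : Hom R N' N''"
  and z: "z : $T"
 shows "tmap R M'' N'' ph' vv' (tmap R M' N' ph vv z) =
  tmap R M'' N'' (%x. ph' (ph x)) (%y. vv' (vv y)) z"
proof -
 interpret S: tensor_product R M N T by fact
 note tm = tensor_map[OF assms(1,2,4,5)] and tm' = tensor_map[OF assms(2,3,6,7)]
  and tm'' = tensor_map[OF assms(1,3) lin_comp[OF assms(4,6)] lin_comp[OF assms(5,7)]]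
 show ?thesis
  using z by (rule S.additive_eqI[where pl = "ring.add T''"])
   (simp_all add: tm tm' tm'' lin_closed[OF assms(4)] lin_closed[OF assms(5)])
qed

lemma tensor_map_id:
 assumes T: "tensor_product R M N T"
  and "!!x. x : $M ==> ph x = x" "!!y. y : $N ==> vv y = y" and z: "z : $T"
 shows "tmap R M N ph vv z = z"
proof -
 interpret S: tensor_product R M N T by fact
 have "ph : Hom R M M" "vv : Hom R N N"
  by (auto intro!: lin_cong[OF _ lin_ident] S.M.lself S.N.lself assms)
 note tm = tensor_map[OF T T this]
 show ?thesis
  using z by (rule S.additive_eqI[where pl = "ring.add T"]) (simp_all add: tm assms)
qed

lemma (in tensor_product) tensor_finsum_left:
 assumes "y : $N" "g : I -> $M"
 shows "(SUM[M]i:I. g i) >< y = (SUM[T]i:I. g i >< y)"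
 using assms(2)
proof (induction I rule: infinite_finite_induct)
 case (insert i I)
 then have "g : I -> $M" "g i : $M" by auto
 with insert assms(1) show ?case
  by (subst M.finsum_insert, auto) (subst T.finsum_insert, auto simp: tensor_add_left Pi_iff)
qed (simp_all add: tensor_zero_left assms(1) M.finsum_infinite T.finsum_infinite)

text \<open>With finitely many indices, sums run over the fixed set \<open>I\<close> in place of
  supports that vary with \<open>x\<close>.\<close>

definition fin_dual_basis ::
  "('r, 'z) ring_scheme => ('r, 'p, 'w) module_scheme => 'i set => ('i => 'p) => ('i => 'p => 'r) => bool"
 where
 "fin_dual_basis R P I b c \<longleftrightarrow> finite I &
  (ALL i:I. b i : $P & c i : Hom R P (regm R)) &
  (ALL x:$P. (SUM[P]i:I. c i x .[P] b i) = x)"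

lemma fin_dual_basisD:
 assumes "fin_dual_basis R P I b c"
 shows "finite I" "i : I ==> b i : $P" "i : I ==> c i : Hom R P (regm R)"
  "i : I ==> x : $P ==> c i x : $R"
  "x : $P ==> (SUM[P]i:I. c i x .[P] b i) = x"
 using assms lin_closed[of "c i" R P "regm R" x] unfolding fin_dual_basis_def by auto

text \<open>A module record has one ring of scalars, so the two actions are two records on the same
  additive group.\<close>

locale bimodule = LA: left_module A LA + LR: left_module R LR
 for A :: "('a, 'y) ring_scheme" and LA :: "('a, 'l, 'w) module_scheme"
  and R :: "('r, 'z) ring_scheme" and LR :: "('r, 'l, 'v) module_scheme" +
 assumes carrier_eq: "$LA = $LR" and zero_eq: "0[LA] = 0[LR]"
  and add_eq: "ring.add LA = ring.add LR"
  and actions_commute: "[|a : $A; r : $R; x : $LR|] ==>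
   a .[LA] (r .[LR] x) = r .[LR] (a .[LA] x)"

text \<open>The module \<open>lattice_tensor\<close> with the two actions as parameters. Lattices
  over \<open>A\<close> and over the smash product can thus be compared before they are packed into
  modules over a tensor ring.\<close>

definition bt :: "('r, 'z) ring_scheme => ('a, 'l, 'w) module_scheme => ('r, 'l, 'v) module_scheme
  => ('r, 'm) module => ('a, ('l \<times> 'm \<Rightarrow>\<^sub>0 int) set) module" where
 "bt R LA LR N = \<lparr>carrier = $(tensor_group R LR N), monoid.mult = undefined, monoid.one = undefined,
   ring.zero = monoid.one (tensor_group R LR N), ring.add = monoid.mult (tensor_group R LR N),
   module.smult = (%a. tmap R LR N (module.smult LA a) (%y. y))\<rparr>"

definition bt_seq where
 "bt_seq R LA LR = (%(C, f). (%i. bt R LA LR (C i), %i. tmap R LR (C (Suc i)) (%x. x) (f i)))"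

lemma lattice_tensor_bt:
 "lattice_tensor K A d L M =
  bt (polya K d) (lleft K A d L) (lright K A d L) M"
 "lattice_tensor_seq K A d L E =
  bt_seq (polya K d) (lleft K A d L) (lright K A d L) E"
 by (simp_all add: lattice_tensor_def lattice_tensor_seq_def bt_def bt_seq_def Let_def split: prod.split)

lemma tensor_product_bt:
 "lmod R LR ==> lmod R N ==> tensor_product R LR N (bt R LA LR N)"
 by (simp add: tensor_product_def tensor_product_axioms_def bt_def)

context bimodule begin

abbreviation "BT \<equiv> bt R LA LR"

lemma carrier_LA[simp]: "$LA = $LR" and zero_LA[simp]: "0[LA] = 0[LR]"
 and add_LA[simp]: "x +[LA] y = x +[LR] y"
 by (simp_all add: carrier_eq zero_eq add_eq)

lemma act_closed[simp, intro]: "a : $A ==> x : $LR ==> a .[LA] x : $LR"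
 using LA.smult_closed[of a x] by simp

lemma act_lin: "a : $A ==> module.smult LA a : Hom R LR LR"
 using LA.smult_r_distr[of a] by (intro lin_mapsI) (auto simp: actions_commute)

lemma tp: "lmod R N ==> tensor_product R LR N (BT N)"
 by (rule tensor_product_bt[OF LR.lself])

lemma bt_smult:
 assumes "lmod R N" "a : $A" "x : $LR" "y : $N"
 shows "a .[BT N] etens R LR N x y = etens R LR N (a .[LA] x) y"
 using tensor_map(3)[OF tp[OF assms(1)] tp[OF assms(1)] act_lin[OF assms(2)] lin_ident assms(3,4)]
 by (simp add: bt_def)

lemma bt_left_module:
 assumes N: "lmod R N" shows "lmod A (BT N)" (is "lmod A ?T")
proof -
 interpret S: tensor_product R LR N ?T by (rule tp[OF N])
 have sm: "a .[?T] z = tmap R LR N (module.smult LA a) (%y. y) z" for a z by (simp add: bt_def)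
 note tm = tensor_map[OF tp[OF N] tp[OF N] act_lin lin_ident]
 have cl: "a : $A ==> z : $?T ==> a .[?T] z : $?T" for a z
  by (simp add: sm tm)
 have add: "a : $A ==> z : $?T ==> w : $?T ==> a .[?T] (z +[?T] w) = a .[?T] z +[?T] a .[?T] w" for a z w
  by (simp add: sm tm)
 note el = bt_smult[OF N]
 show ?thesis
  unfolding left_module_def left_module_axioms_def
 proof (intro conjI allI impI LA.R.ring_axioms S.abelian_group_T cl add)
  fix a b z assume *: "a : $A" "b : $A" "z : $?T"
  show "(a +[A] b) .[?T] z = a .[?T] z +[?T] b .[?T] z"
   using *(3) *(1,2) LA.smult_l_distr[of a b]
   by (induction rule: S.tensor_induct) (auto simp: el add cl S.tensor_add_left S.T.a_ac)
  show "(a *[A] b) .[?T] z = a .[?T] (b .[?T] z)"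
   using *(3) *(1,2) LA.smult_assoc1[of a b]
   by (induction rule: S.tensor_induct) (auto simp: el add cl)
 next
  fix z assume "z : $?T"
  then show "1[A] .[?T] z = z" using LA.smult_one
   by (induction rule: S.tensor_induct) (auto simp: el add)
 qed
qed

end

lemma bt_map:
 assumes B: "bimodule A LA R LR" "bimodule A LA' R LR'"
  and N: "lmod R N" "lmod R N'"
  and ph: "ph : Hom R LR LR'" "ph : Hom A LA LA'" and f: "f : Hom R N N'"
 shows "tmap R LR' N' ph f : Hom A (bt R LA LR N) (bt R LA' LR' N')"
proof -
 interpret B: bimodule A LA R LR by fact
 interpret B': bimodule A LA' R LR' by fact
 interpret S: tensor_product R LR N "bt R LA LR N" by (rule B.tp[OF N(1)])
 interpret S': tensor_product R LR' N' "bt R LA' LR' N'" by (rule B'.tp[OF N(2)])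
 interpret T: left_module A "bt R LA LR N" by (rule B.bt_left_module[OF N(1)])
 interpret T': left_module A "bt R LA' LR' N'" by (rule B'.bt_left_module[OF N(2)])
 note tm = tensor_map[OF B.tp[OF N(1)] B'.tp[OF N(2)] ph(1) f]
 show ?thesis
 proof (rule lin_mapsI)
  fix a z assume *: "a : $A" "z : $(bt R LA LR N)"
  show "tmap R LR' N' ph f (a .[bt R LA LR N] z) = a .[bt R LA' LR' N'] tmap R LR' N' ph f z"
   using *(2,1) lin_smult[OF ph(2)] lin_closed[OF ph(1)] lin_closed[OF f]
   by (induction rule: S.tensor_induct)
    (auto simp: tm T.smult_r_distr T'.smult_r_distr B.bt_smult[OF N(1)] B'.bt_smult[OF N(2)])
 qed (use tm in auto)
qed

context bimodule begin

lemma bt_map_right: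
 assumes "lmod R N" "lmod R N'" "f : Hom R N N'"
 shows "tmap R LR N' (%x. x) f : Hom A (BT N) (BT N')"
 by (rule bt_map[OF bimodule_axioms bimodule_axioms assms(1,2) lin_ident lin_ident assms(3)])

lemma bt_map_comp:
 fixes N' :: "('r, 'm') module" and N'' :: "('r, 'm'') module"
 assumes "lmod R N" "lmod R N'" "lmod R N''" "f : Hom R N N'" "g : Hom R N' N''"
  "z : $(BT N)"
 shows "tmap R LR N'' (%x. x) g (tmap R LR N' (%x. x) f z) = tmap R LR N'' (%x. x) (%y. g (f y)) z"
 by (rule tensor_map_comp[OF tp[OF assms(1)] tp[OF assms(2)] tp[OF assms(3)] lin_ident assms(4) lin_ident assms(5,6)])

lemma bt_map_cong:
 fixes N' :: "('r, 'm') module"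
 assumes N: "lmod R N" "lmod R N'" "f : Hom R N N'"
  and "!!y. y : $N ==> g y = f y" and z: "z : $(BT N)"
 shows "tmap R LR N' (%x. x) g z = tmap R LR N' (%x. x) f z"
proof -
 interpret S: tensor_product R LR N "BT N" by (rule tp[OF N(1)])
 have g: "g : Hom R N N'" by (rule lin_cong[OF N(1,3) assms(4)])
 note tm = tensor_map[OF tp[OF N(1)] tp[OF N(2)] lin_ident]
 show ?thesis
  using z by (rule S.additive_eqI[where pl = "ring.add (BT N')"]) (simp_all add: tm g N assms(4))
qed

lemma bt_seq_morphism:
 assumes C: "!!i. i <= Suc d ==> lmod R (C i)" "!!i. i <= d ==> f i : Hom R (C i) (C (Suc i))"
  and Y: "!!i. i <= Suc d ==> lmod R (Y i)" "!!i. i <= d ==> g i : Hom R (Y i) (Y (Suc i))"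
  and h: "smor R d (C, f) (Y, g) h"
 shows "smor A d (bt_seq R LA LR (C, f)) (bt_seq R LA LR (Y, g)) (%i. tmap R LR (Y i) (%x. x) (h i))"
 unfolding seq_morphism_def bt_seq_def prod.case
proof (intro conjI allI impI ballI)
 note h = seq_morphismD[OF h]
 fix i assume "i <= Suc d"
 then show "tmap R LR (Y i) (%x. x) (h i) : Hom A (BT (C i)) (BT (Y i))"
  using C Y h by (intro bt_map_right) auto
next
 note h = seq_morphismD[OF h]
 fix i z assume i: "i <= d" and z: "z : $(BT (C i))"
 have m: "lmod R (C i)" "lmod R (C (Suc i))" "lmod R (Y i)" "lmod R (Y (Suc i))"
  "f i : Hom R (C i) (C (Suc i))" "h (Suc i) : Hom R (C (Suc i)) (Y (Suc i))"
  "h i : Hom R (C i) (Y i)" "g i : Hom R (Y i) (Y (Suc i))" using i C Y h by auto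
 show "tmap R LR (Y (Suc i)) (%x. x) (h (Suc i)) (tmap R LR (C (Suc i)) (%x. x) (f i) z) =
   tmap R LR (Y (Suc i)) (%x. x) (g i) (tmap R LR (Y i) (%x. x) (h i) z)"
  unfolding bt_map_comp[OF m(1,2,4,5,6) z] bt_map_comp[OF m(1,3,4,7,8) z]
  using i h(2) by (intro bt_map_cong[OF m(1,4) lin_comp[OF m(7,8)] _ z]) auto
qed

end

text \<open>The right-hand module is finitely generated projective, presented by a finite dual
  basis. Exactness of tensoring is read off coordinatewise from that basis.\<close>

locale flat_bimodule = bimodule A LA R LR
 for A :: "('a, 'y) ring_scheme" and LA :: "('a, 'l, 'w) module_scheme"
  and R :: "('r, 'z) ring_scheme" and LR :: "('r, 'l, 'v) module_scheme" +
 fixes I :: "'i set" and b c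
 assumes cring_R: "cring R" and db: "fin_dual_basis R LR I b c"
begin

sublocale RC: cring R by (rule cring_R)

lemmas dbD = fin_dual_basisD[OF db]

text \<open>This is \<open>c i\<close> tensored with the identity, followed by the identification of
  \<open>R\<close> tensor \<open>N\<close> with \<open>N\<close>; the choice picks a map supplied by
  the universal property.\<close>

definition coord :: "('r, 'm) module => 'i => ('l \<times> 'm \<Rightarrow>\<^sub>0 int) set => 'm" where
 "coord N i = (SOME k. k : $(BT N) -> $N &
  (ALL z:$(BT N). ALL w:$(BT N). k (z +[BT N] w) = k z +[N] k w) &
  (ALL x:$LR. ALL y:$N. k (etens R LR N x y) = c i x .[N] y))"

lemma coord:
 assumes N: "lmod R N" and i: "i : I"
 shows "z : $(BT N) ==> coord N i z : $N"
  "z : $(BT N) ==> w : $(BT N) ==>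
   coord N i (z +[BT N] w) = coord N i z +[N] coord N i w"
  "x : $LR ==> y : $N ==> coord N i (etens R LR N x y) = c i x .[N] y"
proof -
 interpret N: left_module R N by fact
 interpret S: tensor_product R LR N "BT N" by (rule tp[OF N])
 have "balanced R LR N N (%x y. c i x .[N] y)"
  using dbD(4)[OF i] lin_add[OF dbD(3)[OF i]] lin_smult[OF dbD(3)[OF i]]
  by (auto simp: balanced_def N.smult_l_distr N.smult_r_distr N.smult_assoc1[symmetric] RC.m_comm)
 then have "EX k. k : $(BT N) -> $N &
  (ALL z:$(BT N). ALL w:$(BT N). k (z +[BT N] w) = k z +[N] k w) &
  (ALL x:$LR. ALL y:$N. k (etens R LR N x y) = c i x .[N] y)"
  by (rule S.universal[OF N.M.abelian_group_axioms]) blast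
 from someI_ex[OF this, folded coord_def] show
  "z : $(BT N) ==> coord N i z : $N"
  "z : $(BT N) ==> w : $(BT N) ==>
   coord N i (z +[BT N] w) = coord N i z +[N] coord N i w"
  "x : $LR ==> y : $N ==> coord N i (etens R LR N x y) = c i x .[N] y" by blast+
qed

text \<open>Scalars move across the tensor sign, so the dual basis of \<open>LR\<close> also expands
  elements of the tensor product. Injectivity and images of tensored maps thereby reduce to
  coordinates in \<open>N\<close>.\<close>

lemma coord_expand:
 assumes N: "lmod R N" and z: "z : $(BT N)"
 shows "(SUM[BT N]i:I. etens R LR N (b i) (coord N i z)) = z"
proof -
 interpret N: left_module R N by fact
 interpret S: tensor_product R LR N "BT N" by (rule tp[OF N])
 note k = coord[OF N]
 show ?thesis
  using z
 proof (induction rule: S.tensor_induct)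
  case (tensor x y)
  have "(SUM[BT N]i:I. etens R LR N (b i) (coord N i (etens R LR N x y))) =
    (SUM[BT N]i:I. etens R LR N (c i x .[LR] b i) y)"
   using tensor dbD by (intro S.T.finsum_cong') (auto simp: k S.tensor_smult)
  also have "... = etens R LR N (SUM[LR]i:I. c i x .[LR] b i) y"
   using tensor dbD by (intro S.tensor_finsum_left[symmetric]) auto
  finally show ?case using dbD(5) tensor by simp
 next
  case (add z w)
  have "(SUM[BT N]i:I. etens R LR N (b i) (coord N i (z +[BT N] w))) =
    (SUM[BT N]i:I. etens R LR N (b i) (coord N i z) +[BT N] etens R LR N (b i) (coord N i w))"
   using add dbD k by (intro S.T.finsum_cong') (auto simp: S.tensor_add_right)
  also have "... = (SUM[BT N]i:I. etens R LR N (b i) (coord N i z)) +[BT N]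
    (SUM[BT N]i:I. etens R LR N (b i) (coord N i w))"
   using add dbD k by (intro S.T.finsum_addf) auto
  finally show ?case using add by simp
 qed
qed

lemma coord_natural:
 assumes N: "lmod R N" "lmod R N'" and f: "f : Hom R N N'" and i: "i : I"
  and z: "z : $(BT N)"
 shows "coord N' i (tmap R LR N' (%x. x) f z) = f (coord N i z)"
proof -
 interpret S: tensor_product R LR N "BT N" by (rule tp[OF N(1)])
 note tm = tensor_map[OF tp[OF N(1)] tp[OF N(2)] lin_ident f]
 show ?thesis
  using z by (rule S.additive_eqI[where pl = "ring.add N'"])
   (simp_all add: tm coord[OF N(1) i] coord[OF N(2) i] lin_add[OF f] lin_smult[OF f] lin_closed[OF f] dbD(4)[OF i])
qed

lemma bt_inj:
 fixes N' :: "('r, 'm') module"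
 assumes N: "lmod R N" "lmod R N'" and f: "f : Hom R N N'" "inj_on f $N"
 shows "inj_on (tmap R LR N' (%x. x) f) ($(BT N))"
proof (rule inj_onI)
 fix z w assume *: "z : $(BT N)" "w : $(BT N)"
  "tmap R LR N' (%x. x) f z = tmap R LR N' (%x. x) f w"
 have "coord N i z = coord N i w" if "i : I" for i
  using * coord_natural[OF N f(1) that] coord(1)[OF N(1) that] f(2) by (metis inj_onD)
 interpret S: tensor_product R LR N "BT N" by (rule tp[OF N(1)])
 have "(SUM[BT N]i:I. etens R LR N (b i) (coord N i z)) =
   (SUM[BT N]i:I. etens R LR N (b i) (coord N i w))"
  using `!!i. i : I ==> coord N i z = coord N i w` *(2) coord(1)[OF N(1)] dbD(2)
  by (intro S.T.finsum_cong') auto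
 then show "z = w" using coord_expand[OF N(1)] * by simp
qed

lemma bt_image:
 assumes N: "lmod R N" "lmod R N'" and f: "f : Hom R N N'"
  and z: "z : $(BT N')" "!!i. i : I ==> coord N' i z : f ` $N"
 shows "z : tmap R LR N' (%x. x) f ` $(BT N)"
proof -
 interpret S: tensor_product R LR N "BT N" by (rule tp[OF N(1)])
 interpret S': tensor_product R LR N' "BT N'" by (rule tp[OF N(2)])
 note tm = tensor_map[OF tp[OF N(1)] tp[OF N(2)] lin_ident f]
 have "ALL i:I. EX w. w : $N & coord N' i z = f w" using z(2) by auto
 from bchoice[OF this] obtain w where w: "!!i. i : I ==> w i : $N" "!!i. i : I ==> coord N' i z = f (w i)" by blast
 let ?u = "SUM[BT N]i:I. etens R LR N (b i) (w i)"
 have "tmap R LR N' (%x. x) f ?u = (SUM[BT N']i:I. tmap R LR N' (%x. x) f (etens R LR N (b i) (w i)))"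
  using dbD(2) w(1) by (intro lin_finsum[OF bt_left_module[OF N(1)] bt_left_module[OF N(2)] bt_map_right[OF N f]]) auto
 also have "... = (SUM[BT N']i:I. etens R LR N' (b i) (coord N' i z))"
  using dbD(2) w coord(1)[OF N(2) _ z(1)] by (intro S'.T.finsum_cong') (auto simp: tm)
 also have "... = z" by (rule coord_expand[OF N(2) z(1)])
 finally have "z = tmap R LR N' (%x. x) f ?u" by simp
 moreover have "?u : $(BT N)" using dbD(2) w(1) by (intro S.T.finsum_closed) auto
 ultimately show ?thesis by blast
qed

text \<open>By naturality, an element of the kernel has coordinates in the kernel, hence in the
  image of \<open>f i\<close>, and these coordinates are lifted one by one.\<close>

lemma bt_long_exact:
 assumes "lexact R d (C, f)" shows "lexact A d (bt_seq R LA LR (C, f))"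
 unfolding long_exact_def bt_seq_def prod.case
proof (intro conjI allI impI)
 note E = long_exactD[OF assms]
 show "!!i. i <= Suc d ==> lmod A (BT (C i))" by (intro bt_left_module E)
 show "!!i. i <= d ==> tmap R LR (C (Suc i)) (%x. x) (f i) : Hom A (BT (C i)) (BT (C (Suc i)))"
  by (intro bt_map_right E) auto
 show "inj_on (tmap R LR (C (Suc 0)) (%x. x) (f 0)) ($(BT (C 0)))"
  by (intro bt_inj E) auto
 have m: "lmod R (C d)" "lmod R (C (Suc d))" "f d : Hom R (C d) (C (Suc d))" using E by auto
 show "tmap R LR (C (Suc d)) (%x. x) (f d) ` $(BT (C d)) = $(BT (C (Suc d)))"
  using lin_closed[OF bt_map_right[OF m]] bt_image[OF m] coord(1)[OF m(2)] E(4) by blast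
 fix i assume i: "i < d"
 have m: "lmod R (C i)" "lmod R (C (Suc i))" "lmod R (C (Suc (Suc i)))"
  "f i : Hom R (C i) (C (Suc i))" "f (Suc i) : Hom R (C (Suc i)) (C (Suc (Suc i)))" using E i by auto
 interpret C2: left_module R "C (Suc (Suc i))" by fact
 interpret S: tensor_product R LR "C i" "BT (C i)" by (rule tp[OF m(1)])
 interpret S2: tensor_product R LR "C (Suc (Suc i))" "BT (C (Suc (Suc i)))" by (rule tp[OF m(3)])
 let ?t = "%i. tmap R LR (C (Suc i)) (%x. x) (f i)"
 show "?t i ` $(BT (C i)) = {z : $(BT (C (Suc i))). ?t (Suc i) z = 0[BT (C (Suc (Suc i)))]}"
 proof (intro equalityI subsetI)
  fix z assume "z : ?t i ` $(BT (C i))"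
  then obtain w where w: "z = ?t i w" "w : $(BT (C i))" by blast
  note tm = tensor_map[OF tp[OF m(1)] tp[OF m(3)] lin_ident lin_comp[OF m(4,5)]]
  have "tmap R LR (C (Suc (Suc i))) (%x. x) (%y. f (Suc i) (f i y)) w = 0[BT (C (Suc (Suc i)))]"
   using w(2) by (induction rule: S.tensor_induct) (simp_all add: tm E(6)[OF i] S2.tensor_zero_right)
  then show "z : {z : $(BT (C (Suc i))). ?t (Suc i) z = 0[BT (C (Suc (Suc i)))]}"
   using w lin_closed[OF bt_map_right[OF m(1,2,4)] w(2)] bt_map_comp[OF m(1,2,3,4,5) w(2)] by simp
 next
  fix z assume "z : {z : $(BT (C (Suc i))). ?t (Suc i) z = 0[BT (C (Suc (Suc i)))]}"
  then have z: "z : $(BT (C (Suc i)))" "?t (Suc i) z = 0[BT (C (Suc (Suc i)))]" by auto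
  have "coord (C (Suc (Suc i))) j 0[BT (C (Suc (Suc i)))] = 0[C (Suc (Suc i))]" if "j : I" for j
   using coord(3)[OF m(3) that, of "0[LR]" "0[C (Suc (Suc i))]"] dbD(4)[OF that]
   by (simp add: S2.tensor_zero_left C2.smult_r_null)
  then have "coord (C (Suc i)) j z : f i ` $(C i)" if "j : I" for j
   using coord_natural[OF m(2,3,5) that z(1)] coord(1)[OF m(2) that z(1)] z(2) that E(5)[OF i] by simp
  then show "z : ?t i ` $(BT (C i))" by (rule bt_image[OF m(1,2,4) z(1)])
 qed
qed

lemma bt_extension:
 assumes "(C, f) : extensions R d M N"
 shows "bt_seq R LA LR (C, f) : extensions A d (BT M) (BT N)"
 using bt_long_exact[OF extensionsD(1)[OF assms]] extensionsD(2,3)[OF assms]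
 by (simp add: extensions_def bt_seq_def)

lemma bt_yoneda_step:
 assumes "(E, E') : yoneda_step R d M N"
 shows "(bt_seq R LA LR E, bt_seq R LA LR E') : yoneda_step A d (BT M) (BT N)"
proof -
 obtain C f Y g k where E: "E = (C, f)" "E' = (Y, g)" "(C, f) : extensions R d M N" "(Y, g) : extensions R d M N"
  and k: "smor R d (C, f) (Y, g) k" "!!x. x : $N ==> k 0 x = x" "!!x. x : $M ==> k (Suc d) x = x"
  using assms unfolding yoneda_step_def by (cases E; cases E') auto
 note D = extensionsD[OF E(3)] extensionsD[OF E(4)]
 have NM: "lmod R N" "lmod R M" using extension_modules[OF E(3)] by auto
 have "smor A d (bt_seq R LA LR (C, f)) (bt_seq R LA LR (Y, g)) (%i. tmap R LR (Y i) (%x. x) (k i))"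
  by (rule bt_seq_morphism[OF _ _ _ _ k(1)]) (intro long_exactD[OF D(1)] long_exactD[OF D(4)]; assumption)+
 moreover have "tmap R LR (Y 0) (%x. x) (k 0) z = z" if "z : $(BT N)" for z
  unfolding D(5) by (rule tensor_map_id[OF tp[OF NM(1)] refl k(2) that])
 moreover have "tmap R LR (Y (Suc d)) (%x. x) (k (Suc d)) z = z" if "z : $(BT M)" for z
  unfolding D(6) by (rule tensor_map_id[OF tp[OF NM(2)] refl k(3) that])
 ultimately show ?thesis
  unfolding yoneda_step_def E(1,2) using bt_extension[OF E(3)] bt_extension[OF E(4)]
  by (intro CollectI case_prodI conjI exI[of _ "%i. tmap R LR (Y i) (%x. x) (k i)"]) auto
qed

end

section \<open>Polynomial algebras\<close>

lemma finite_submultisets: "finite {n. n <=# (m :: 'c multiset)}"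
proof (induction m)
 case (add x m)
 have "n : {n. n <=# m} \<union> add_mset x ` {n. n <=# m}" if "n <=# add_mset x m" for n
 proof (cases "x :# n")
  case True
  then obtain k where k: "n = add_mset x k" by (metis insert_DiffM)
  then show ?thesis using that by auto
 next
  case False
  have "count n a <= count m a" for a
   using mset_subset_eq_count[OF that, of a] False by (cases "a = x") (auto simp: not_in_iff)
  then show ?thesis by (simp add: mset_subset_eqI)
 qed
 then show ?case by (intro finite_subset[OF _ finite_UnI[OF add finite_imageI[OF add, of "add_mset x"]]]) auto
qed simp

lemma submultiset_double_diff: "n <=# m ==> m - (m - n) = (n :: 'c multiset)"
 by (auto simp: mset_subset_eq_exists_conv)

context cring begin

lemma pset_closed: "P : indexed_pset I $R ==> P m : $R"
 using indexed_pset_in_carrier[of "$R" P I] carrier_coeffE by auto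

lemma pset_finite_support: "P : indexed_pset I $R ==> finite {m. P m ~= \<zero>}"
proof (induction rule: indexed_pset.induct)
 case (indexed_padd P Q)
 show ?case
  by (rule finite_subset[OF _ finite_UnI[OF indexed_padd.IH]]) (auto simp: indexed_padd_def)
next
 case (indexed_pmult P i)
 have "{m. indexed_pmult P i m ~= \<zero>} <= add_mset i ` {m. P m ~= \<zero>}"
  by (auto simp: indexed_pmult_def image_iff split: if_splits) (metis insert_DiffM)
 then show ?case using indexed_pmult.IH by (meson finite_imageI finite_subset)
qed (auto simp: indexed_const_def intro: finite_subset[of _ "{{#}}"])

text \<open>The product of power series: the sum is finite without any condition on supports, so
  most identities hold for arbitrary coefficient functions.\<close>

definition conv :: "('c multiset => 'a) => ('c multiset => 'a) => 'c multiset => 'a" where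
 "conv P Q m = (\<Oplus>n\<in>{n. n <=# m}. P n \<otimes> Q (m - n))"

abbreviation coeffs :: "('c multiset => 'a) set" where "coeffs \<equiv> {P. ALL m. P m : $R}"

lemma conv_closed: "P : coeffs ==> Q : coeffs ==> conv P Q : coeffs"
 by (auto simp: conv_def intro!: finsum_closed)

text \<open>Substitution of \<open>m - n\<close> for \<open>n\<close>, an involution on the
  submultisets of \<open>m\<close>.\<close>

lemma conv_comm:
 fixes P Q :: "'c multiset => 'a"
 assumes PQ: "P : coeffs" "Q : coeffs" shows "conv P Q = conv Q P"
proof
 fix m :: "'c multiset"
 have inj: "inj_on (%n. m - n) {n. n <=# m}"
  by (rule inj_on_inverseI[where g = "%n. m - n"]) (simp add: submultiset_double_diff)
 have im: "(%n. m - n) ` {n. n <=# m} = {n. n <=# m}"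
  by (auto simp: submultiset_double_diff intro!: image_eqI[of x "%n. m - n" "m - x" for x])
 have "conv P Q m = (\<Oplus>n\<in>(%n. m - n) ` {n. n <=# m}. P n \<otimes> Q (m - n))" by (simp add: conv_def im)
 also have "... = (\<Oplus>n\<in>{n. n <=# m}. P (m - n) \<otimes> Q (m - (m - n)))"
  using PQ by (intro finsum_reindex inj) auto
 also have "... = conv Q P m"
  unfolding conv_def using PQ by (intro finsum_cong') (auto simp: m_comm submultiset_double_diff)
 finally show "conv P Q m = conv Q P m" .
qed

lemma conv_padd:
 assumes "P : coeffs" "Q : coeffs" "S : coeffs"
 shows "conv (indexed_padd P Q) S = indexed_padd (conv P S) (conv Q S)"
proof
 fix m
 have "conv (indexed_padd P Q) S m = (\<Oplus>n\<in>{n. n <=# m}. P n \<otimes> S (m - n) \<oplus> Q n \<otimes> S (m - n))"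
  unfolding conv_def using assms by (intro finsum_cong') (auto simp: indexed_padd_def l_distr)
 also have "... = indexed_padd (conv P S) (conv Q S) m"
  unfolding conv_def indexed_padd_def using assms by (intro finsum_addf) auto
 finally show "conv (indexed_padd P Q) S m = indexed_padd (conv P S) (conv Q S) m" .
qed

lemma conv_const:
 assumes "k : $R" "Q : coeffs" shows "conv (indexed_const k) Q = (%m. k \<otimes> Q m)"
proof
 fix m
 have "conv (indexed_const k) Q m = (\<Oplus>n\<in>{n. n <=# m}. if {#} = n then k \<otimes> Q (m - n) else \<zero>)"
  unfolding conv_def using assms by (intro finsum_cong') (auto simp: indexed_const_def)
 also have "... = k \<otimes> Q (m - {#})"
  using assms by (intro add.finprod_singleton finite_submultisets) auto
 finally show "conv (indexed_const k) Q m = k \<otimes> Q m" by simp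
qed

text \<open>Only submultisets containing \<open>i\<close> contribute, and removing one
  \<open>i\<close> identifies them with the submultisets of the rest of \<open>m\<close>.\<close>

lemma conv_pmult:
 assumes "P : coeffs" "Q : coeffs" shows "conv (indexed_pmult P i) Q = indexed_pmult (conv P Q) i"
proof
 fix m
 show "conv (indexed_pmult P i) Q m = indexed_pmult (conv P Q) i m"
 proof (cases "i :# m")
  case True
  then obtain k where m: "m = add_mset i k" by (metis insert_DiffM)
  have "(\<Oplus>n\<in>add_mset i ` {n. n <=# k}. indexed_pmult P i n \<otimes> Q (m - n)) =
    (\<Oplus>n\<in>{n. n <=# m}. indexed_pmult P i n \<otimes> Q (m - n))"
  proof (intro add.finprod_mono_neutral_cong_left finite_submultisets ballI)
   fix n assume n: "n : {n. n <=# m} - add_mset i ` {n. n <=# k}"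
   have "i ~:# n"
   proof
    assume "i :# n"
    then obtain l where "n = add_mset i l" by (metis insert_DiffM)
    then show False using n by (auto simp: m)
   qed
   then show "indexed_pmult P i n \<otimes> Q (m - n) = \<zero>" using assms by (auto simp: indexed_pmult_def)
  qed (use assms in "auto simp: m indexed_pmult_def")
  also have "(\<Oplus>n\<in>add_mset i ` {n. n <=# k}. indexed_pmult P i n \<otimes> Q (m - n)) =
    (\<Oplus>n\<in>{n. n <=# k}. indexed_pmult P i (add_mset i n) \<otimes> Q (m - add_mset i n))"
   using assms by (intro finsum_reindex) (auto simp: indexed_pmult_def inj_on_def)
  also have "... = conv P Q k"
   unfolding conv_def using assms by (intro finsum_cong') (auto simp: indexed_pmult_def m)
  finally show ?thesis by (simp add: conv_def indexed_pmult_def[of "conv P Q"] m)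
 next
  case False
  then have "conv (indexed_pmult P i) Q m = (\<Oplus>n\<in>{n. n <=# m}. \<zero>)"
   unfolding conv_def using assms by (intro finsum_cong') (auto simp: indexed_pmult_def dest: mset_subset_eqD)
  then show ?thesis using False by (simp add: indexed_pmult_def)
 qed
qed

lemma coeffs_ops:
 "k : $R ==> indexed_const k : coeffs" "P : coeffs ==> indexed_pmult P i : coeffs"
 "P : coeffs ==> Q : coeffs ==> indexed_padd P Q : coeffs"
 "P : coeffs ==> k : $R ==> (%m. k \<otimes> P m) : coeffs"
 "P : indexed_pset I $R ==> P : coeffs"
 by (auto simp: indexed_const_def indexed_pmult_def indexed_padd_def pset_closed)

text \<open>Induction on the construction of the first factor from constants, sums and
  multiplication by variables; each of these operations can be pulled out of a convolution.\<close>

lemma conv_assoc: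
 assumes "P : indexed_pset I $R" "Q : coeffs" "S : coeffs"
 shows "conv (conv P Q) S = conv P (conv Q S)"
 using assms(1)
proof (induction rule: indexed_pset.induct)
 case (indexed_const k)
 have "conv (%m. k \<otimes> Q m) S = (%m. k \<otimes> conv Q S m)"
 proof
  fix m
  have "conv (%m. k \<otimes> Q m) S m = (\<Oplus>n\<in>{n. n <=# m}. k \<otimes> (Q n \<otimes> S (m - n)))"
   unfolding conv_def using indexed_const assms by (intro finsum_cong') (auto simp: m_assoc)
  also have "... = k \<otimes> conv Q S m"
   unfolding conv_def using indexed_const assms by (intro finsum_rdistr[symmetric] finite_submultisets) auto
  finally show "conv (%m. k \<otimes> Q m) S m = k \<otimes> conv Q S m" .
 qed
 then show ?case using indexed_const assms conv_closed[OF assms(2,3)] by (simp add: conv_const)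
next
 case (indexed_padd P P')
 note c = coeffs_ops(5)[OF indexed_padd(1)] coeffs_ops(5)[OF indexed_padd(2)]
 show ?case
  using conv_padd[OF c assms(2)] conv_padd[OF conv_closed[OF c(1) assms(2)] conv_closed[OF c(2) assms(2)] assms(3)]
   conv_padd[OF c conv_closed[OF assms(2,3)]] indexed_padd.IH by simp
next
 case (indexed_pmult P i)
 note c = coeffs_ops(5)[OF indexed_pmult(1)]
 show ?case
  using conv_pmult[OF c assms(2)] conv_pmult[OF conv_closed[OF c assms(2)] assms(3)]
   conv_pmult[OF c conv_closed[OF assms(2,3)]] indexed_pmult.IH by simp
qed

lemma pset_smult:
 fixes P :: "'c multiset => 'a"
 assumes "k : $R" "P : indexed_pset I $R"
 shows "(%m. k \<otimes> P m) : indexed_pset I $R"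
 using assms(2)
proof (induction rule: indexed_pset.induct)
 case (indexed_const c)
 have "(%m :: 'c multiset. k \<otimes> indexed_const c m) = indexed_const (k \<otimes> c)" using assms(1) by (auto simp: indexed_const_def)
 then show ?case using indexed_const assms(1) by (simp add: indexed_pset.indexed_const)
next
 case (indexed_padd P Q)
 have "(%m. k \<otimes> indexed_padd P Q m) = indexed_padd (%m. k \<otimes> P m) (%m. k \<otimes> Q m)"
  using assms(1) indexed_padd by (auto simp: indexed_padd_def r_distr pset_closed)
 then show ?case using indexed_padd by (simp add: indexed_pset.indexed_padd)
next
 case (indexed_pmult P i)
 have "(%m. k \<otimes> indexed_pmult P i m) = indexed_pmult (%m. k \<otimes> P m) i"
  using assms(1) by (auto simp: indexed_pmult_def)
 then show ?case using indexed_pmult by (simp add: indexed_pset.indexed_pmult)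
qed

lemma conv_pset:
 assumes "P : indexed_pset I $R" "Q : indexed_pset I $R"
 shows "conv P Q : indexed_pset I $R"
 using assms(1)
proof (induction rule: indexed_pset.induct)
 case (indexed_const k)
 then show ?case using pset_smult[OF _ assms(2)] coeffs_ops(5)[OF assms(2)] by (simp add: conv_const)
next
 case (indexed_padd P P')
 then show ?case
  using conv_padd[OF coeffs_ops(5) coeffs_ops(5) coeffs_ops(5)[OF assms(2)]] by (simp add: indexed_pset.indexed_padd)
next
 case (indexed_pmult P i)
 then show ?case
  using conv_pmult[OF coeffs_ops(5) coeffs_ops(5)[OF assms(2)]] by (simp add: indexed_pset.indexed_pmult)
qed

lemma pset_zero: "(%m. \<zero>) : indexed_pset I $R"
 using indexed_pset.indexed_const[of \<zero> "$R" I] by (simp add: indexed_const_def)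

lemma pset_add:
 "P : indexed_pset I $R ==> Q : indexed_pset I $R ==>
  (%m. P m \<oplus> Q m) : indexed_pset I $R"
 using indexed_pset.indexed_padd[of P I "$R" Q] by (simp add: indexed_padd_def)

lemma poly_algebra_simps:
 "$(polya R d) = indexed_pset {..<d} $R" "P *[polya R d] Q = conv P Q"
 "1[polya R d] = indexed_const \<one>" "0[polya R d] = indexed_const \<zero>"
 "P +[polya R d] Q = indexed_padd P Q" "k .[polya R d] P = (%m. k \<otimes> P m)"
 by (simp_all add: poly_algebra_def conv_def fun_eq_iff)

lemma poly_cring: "cring (polya R d)"
proof (rule cringI)
 note [simp] = poly_algebra_simps
 have neg: "(%m. \<ominus> \<one> \<otimes> P m) : indexed_pset {..<d} $R"
  "indexed_padd (%m. \<ominus> \<one> \<otimes> P m) P = indexed_const \<zero>" if "P : indexed_pset {..<d} $R" for P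
 proof -
  have "\<ominus> \<one> \<otimes> x \<oplus> x = \<zero>" if "x : $R" for x using that by (simp add: l_minus l_neg)
  then show "indexed_padd (%m. \<ominus> \<one> \<otimes> P m) P = indexed_const \<zero>"
   unfolding indexed_padd_def indexed_const_def using pset_closed[OF that] by auto
 qed (use pset_smult[OF _ that, of "\<ominus> \<one>"] in simp)
 show "abelian_group (polya R d)"
 proof (rule abelian_groupI)
  fix P assume "P : $(polya R d)"
  then show "EX Q:$(polya R d). Q +[polya R d] P = 0[polya R d]"
   using neg by auto
 qed (auto simp: indexed_padd_def indexed_const_def a_ac pset_closed intro: pset_zero pset_add)
 show "comm_monoid (polya R d)"
  by (rule comm_monoidI) (auto simp: conv_pset conv_assoc coeffs_ops(5) pset_closed conv_const
    intro: conv_comm indexed_pset.intros)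
qed (simp add: poly_algebra_simps conv_padd pset_closed)

lemma poly_assoc_algebra: "assoc_algebra R (polya R d)"
proof -
 interpret P: cring "polya R d" by (rule poly_cring)
 note [simp] = poly_algebra_simps
 have "module R (polya R d)"
  by (rule moduleI) (auto simp: is_cring P.abelian_group_axioms pset_smult pset_add indexed_padd_def
    l_distr r_distr pset_closed m_assoc)
 moreover have "conv (%m. k \<otimes> P m) Q = (%m. k \<otimes> conv P Q m)"
  if "k : $R" "P : indexed_pset {..<d} $R" "Q : indexed_pset {..<d} $R" for k P Q
  using conv_assoc[OF indexed_pset.indexed_const, of k P Q] that
  by (simp add: conv_const coeffs_ops(5) pset_closed conv_closed[simplified])
 moreover have "conv P (%m. k \<otimes> Q m) = (%m. k \<otimes> conv P Q m)"
  if "k : $R" "P : indexed_pset {..<d} $R" "Q : indexed_pset {..<d} $R" for k P Q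
  using calculation(2)[of k Q P] that conv_comm[of P Q] conv_comm[of P "%m. k \<otimes> Q m"]
  by (simp add: pset_closed)
 ultimately show ?thesis
  by (auto simp: assoc_algebra_def assoc_algebra_axioms_def intro: P.ring_axioms)
qed

lemma maximalideal_exists:
 assumes "ideal J R" "\<one> ~: J" shows "EX M. maximalideal M R & J <= M"
proof -
 let ?S = "{I. ideal I R & J <= I & \<one> ~: I}"
 have "\<Union>C : ?S" if C: "C ~= {}" "subset.chain ?S C" for C
 proof -
  have "subset.chain {I. ideal I R} C" using C(2) by (auto simp: subset.chain_def)
  from chain_Union_is_ideal[OF this] C show ?thesis by (auto simp: subset.chain_def)
 qed
 moreover have "?S ~= {}" using assms by blast
 ultimately have "EX M:?S. ALL V:?S. M <= V --> V = M" by (intro subset_Zorn_nonempty)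
 then obtain M where M: "M : ?S" "!!V. V : ?S ==> M <= V ==> V = M" by (elim bexE) (rule, assumption, blast)
 have "maximalideal M R"
 proof (rule maximalidealI)
  show "$R ~= M" using M(1) by auto
  fix V assume V: "ideal V R" "M <= V" "V <= $R"
  show "V = M | V = $R"
   using M(2)[of V] M(1) V ideal.one_imp_carrier[OF V(1)] by blast
 qed (use M in auto)
 then show ?thesis using M(1) by blast
qed

end

section \<open>Leading monomials and the Jacobson radical of polynomial rings\<close>

context "domain" begin

lemma lead_monomial:
 assumes "P : indexed_pset I $R" "P ~= (%m. \<zero>)"
 obtains m :: "('c :: linorder) multiset" where "P m ~= \<zero>" "!!n. P n ~= \<zero> ==> n <= m"
proof (rule that)
 let ?S = "{m. P m ~= \<zero>}"
 have *: "finite ?S" "?S ~= {}" using assms pset_finite_support by auto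
 show "P (Max ?S) ~= \<zero>" using Max_in[OF *] by simp
 show "n <= Max ?S" if "P n ~= \<zero>" for n using Max_ge[OF *(1)] that by simp
qed

text \<open>The multiset order is linear and compatible with sums: if \<open>n\<close> is at most
  \<open>a\<close> and \<open>a + b - n\<close> at most \<open>b\<close>, then \<open>n = a\<close>,
  so a single summand survives.\<close>

lemma conv_lead:
 fixes a b :: "('c :: linorder) multiset"
 assumes "P : coeffs" "Q : coeffs" "!!n. P n ~= \<zero> ==> n <= a" "!!n. Q n ~= \<zero> ==> n <= b"
 shows "conv P Q (a + b) = P a \<otimes> Q b"
proof -
 have "conv P Q (a + b) = (\<Oplus>n\<in>{n. n <=# a + b}. if a = n then P n \<otimes> Q (a + b - n) else \<zero>)"
  unfolding conv_def
 proof (intro finsum_cong' refl)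
  fix n assume n: "n : {n. n <=# a + b}"
  show "P n \<otimes> Q (a + b - n) = (if a = n then P n \<otimes> Q (a + b - n) else \<zero>)"
  proof (cases "P n = \<zero> | Q (a + b - n) = \<zero>")
   case False
   then have "n <= a" "a + b - n <= b" using assms by auto
   moreover have "n + (a + b - n) = a + b" using n by simp
   ultimately have "a = n" by (metis add_less_le_mono less_irrefl order_le_less)
   then show ?thesis by simp
  qed (use assms in auto)
 qed (use assms in auto)
 also have "... = P a \<otimes> Q (a + b - a)"
  using assms by (intro add.finprod_singleton finite_submultisets) auto
 finally show ?thesis by simp
qed

lemma poly_domain: "domain (polya R d)"
proof -
 interpret P: cring "polya R d" by (rule poly_cring)
 note [simp] = poly_algebra_simps
 have z: "indexed_const \<zero> = (%m. \<zero>)" by (auto simp: indexed_const_def)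
 show ?thesis
 proof
  have "indexed_const \<one> {#} ~= indexed_const \<zero> ({#} :: nat multiset)" by (simp add: indexed_const_def)
  then show "1[polya R d] ~= 0[polya R d]" by (metis poly_algebra_simps(3,4))
  fix P Q assume PQ: "P : $(polya R d)" "Q : $(polya R d)"
   "P *[polya R d] Q = 0[polya R d]"
  show "P = 0[polya R d] | Q = 0[polya R d]"
  proof (rule ccontr)
   assume "~ ?thesis"
   then have "P ~= (%m. \<zero>)" "Q ~= (%m. \<zero>)" by (auto simp: z)
   then obtain a b where ab: "P a ~= \<zero>" "!!n. P n ~= \<zero> ==> n <= a" "Q b ~= \<zero>" "!!n. Q n ~= \<zero> ==> n <= b"
    using PQ lead_monomial by (metis poly_algebra_simps(1))
   have "conv P Q (a + b) = P a \<otimes> Q b"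
    using PQ ab by (intro conv_lead) (auto simp: pset_closed)
   moreover have "conv P Q (a + b) = \<zero>" using PQ(3) by (simp add: z)
   ultimately show False using ab integral[of "P a" "Q b"] PQ by (auto simp: pset_closed)
  qed
 qed
qed

text \<open>
 If \<open>D\<close> lies in all maximal ideals, then \<open>1 + x\<^sub>0 D\<close> is a unit, but its leading monomial is not \<open>1\<close>.
\<close>

lemma poly_jacobson:
 assumes d: "1 <= d" and D: "D : $(polya R d)" "D ~= 0[polya R d]"
 shows "EX aa. maximalideal aa (polya R d) & D ~: aa"
proof (rule ccontr)
 assume "~ ?thesis"
 then have all: "D : aa" if "maximalideal aa (polya R d)" for aa using that by blast
 let ?P = "polya R d"
 interpret P: "domain" ?P by (rule poly_domain)
 have z: "indexed_const \<zero> = (%m. \<zero>)" by (auto simp: indexed_const_def)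
 define xD where "xD = indexed_pmult D 0"
 have x: "indexed_pmult (indexed_const \<one>) 0 : $?P"
  using d by (auto simp: poly_algebra_simps intro!: indexed_pset.intros)
 have xD: "xD = indexed_pmult (indexed_const \<one>) 0 *[?P] D"
  using D(1) conv_pmult[of "indexed_const \<one>" D 0] conv_const[of \<one> D]
  by (simp add: xD_def poly_algebra_simps coeffs_ops(1)[simplified] pset_closed)
 have xDc: "xD : $?P" unfolding xD using x D(1) by simp
 define u where "u = 1[?P] +[?P] xD"
 have u: "u : $?P" using xDc by (simp add: u_def)
 \<comment> \<open>A non-unit \<open>u\<close> would lie in a maximal ideal; this ideal contains
   \<open>D\<close>, hence \<open>xD\<close>, hence \<open>1\<close>.\<close>
 have "EX v:$?P. u *[?P] v = 1[?P]"
 proof (rule ccontr)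
  assume *: "~ ?thesis"
  have "1[?P] ~: PIdl\<^bsub>?P\<^esub> u"
   using * u by (auto simp: cgenideal_def P.m_comm)
  then obtain M where M: "maximalideal M ?P" "PIdl\<^bsub>?P\<^esub> u <= M"
   using P.maximalideal_exists[OF P.cgenideal_ideal[OF u]] by blast
  interpret M: maximalideal M ?P by fact
  have uM: "u : M" using M(2) P.cgenideal_self[OF u] by blast
  have "xD : M" unfolding xD using all[OF M(1)] x by (rule M.I_l_closed)
  then have "u +[?P] -[?P] xD : M" using uM M.a_closed M.a_inv_closed by blast
  moreover have "u +[?P] -[?P] xD = 1[?P]" using xDc by (simp add: u_def P.a_assoc P.r_neg)
  ultimately show False using M.one_imp_carrier M.I_notcarr by simp
 qed
 then obtain v where v: "v : $?P" "conv u v = indexed_const \<one>" by (auto simp: poly_algebra_simps)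
 have "D ~= (%m. \<zero>)" using D(2) by (simp add: poly_algebra_simps z)
 then obtain m where m: "D m ~= \<zero>" by auto
 \<comment> \<open>The constant \<open>1\<close> does not contribute at \<open>add_mset 0 m\<close>,
   so the coefficient of \<open>u\<close> there is that of \<open>D\<close> at
   \<open>m\<close>.\<close>
 have um: "u (add_mset 0 m) ~= \<zero>"
  using m D(1) by (simp add: u_def xD_def poly_algebra_simps indexed_padd_def indexed_const_def indexed_pmult_def pset_closed)
 then have "u ~= (%m. \<zero>)" by auto
 moreover have "v ~= (%m. \<zero>)"
 proof
  assume "v = (%m. \<zero>)"
  then have "conv u v {#} = \<zero>" using u by (simp add: conv_def poly_algebra_simps pset_closed)
  then show False using v(2) by (simp add: indexed_const_def)
 qed
 ultimately obtain a b where ab: "u a ~= \<zero>" "!!n. u n ~= \<zero> ==> n <= a" "v b ~= \<zero>" "!!n. v n ~= \<zero> ==> n <= b"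
  using u v(1) lead_monomial by (metis poly_algebra_simps(1))
 have "conv u v (a + b) = u a \<otimes> v b"
  using u v(1) ab by (intro conv_lead) (auto simp: pset_closed poly_algebra_simps)
 moreover have "... ~= \<zero>" using ab integral[of "u a" "v b"] u v(1) by (auto simp: pset_closed poly_algebra_simps)
 \<comment> \<open>The product is \<open>1\<close> and has a nonzero coefficient at
   \<open>a + b\<close>, so this multiset is empty.\<close>
 ultimately have "a = {#}" using v(2) by (auto simp: indexed_const_def split: if_splits)
 then have "add_mset 0 m <= {#}" using ab(2)[OF um] by simp
 then show False by simp
qed

end

section \<open>Tensor products of algebras\<close>

lemma (in tensor_product) free_eqI:
 assumes u: "u : $FF" and H: "abelian_group H"
  and "!!u. u : $FF ==> h u : $H" "!!u. u : $FF ==> k u : $H"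
  and "!!u v. u : $FF ==> v : $FF ==> h (u + v) = h u +[H] h v"
  and "!!u v. u : $FF ==> v : $FF ==> k (u + v) = k u +[H] k v"
  and "!!x y. x : $M ==> y : $N ==> h (frag_of (x, y)) = k (frag_of (x, y))"
 shows "h u = k u"
proof -
 interpret H: abelian_group H by fact
 have "Poly_Mapping.keys u <= $M \<times> $N" using u by (simp add: FF)
 then have "u : $FF & h u = k u"
 proof (induction u rule: frag_induction)
  case zero
  have "h 0 = 0[H]" "k 0 = 0[H]"
   using assms(3-6)[of 0] assms(5,6)[of 0 0] H.add.l_cancel_one[of "h 0" "h 0"] H.add.l_cancel_one[of "k 0" "k 0"]
   by (simp_all add: FF_closed eq_commute)
  then show ?case by (simp add: FF_closed)
 next
  case (one a)
  then show ?case using assms(7) by (cases a) (auto simp: FF_closed)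
 next
  case (diff v w)
  then have "h (v - w) +[H] h w = k (v - w) +[H] h w"
   using assms(5)[of "v - w" w] assms(6)[of "v - w" w] by (simp add: FF_closed)
  then show ?case using diff assms(3,4) by (simp add: FF_closed)
 qed
 then show ?thesis by simp
qed

lemma (in tensor_product) tcoset_extend:
 assumes "!!x y. x : $M' ==> y : $N' ==> F (x, y) : $FF"
 shows "Poly_Mapping.keys u <= $M' \<times> $N' ==> frag_extend F u : $FF"
  and "Poly_Mapping.keys u <= $M' \<times> $N' ==> Poly_Mapping.keys v <= $M' \<times> $N' ==>
   tcoset (frag_extend F (u + v)) = tcoset (frag_extend F u) +[T] tcoset (frag_extend F v)"
proof -
 have *: "frag_extend F u : $FF" if "Poly_Mapping.keys u <= $M' \<times> $N'" for u
  using that keys_frag_extend[of F u] assms by (fastforce simp: FF)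
 then show "Poly_Mapping.keys u <= $M' \<times> $N' ==> frag_extend F u : $FF" .
 show "Poly_Mapping.keys u <= $M' \<times> $N' ==> Poly_Mapping.keys v <= $M' \<times> $N' ==>
   tcoset (frag_extend F (u + v)) = tcoset (frag_extend F u) +[T] tcoset (frag_extend F v)"
  using * by (simp add: frag_extend_add tcoset_add)
qed

locale tensor_algebra = KA: assoc_algebra K A + KR: assoc_algebra K R
 for K :: "('k, 'z) ring_scheme" and A :: "('k, 'a, 'w) module_scheme" and R :: "('k, 'r, 'v) module_scheme"
begin

abbreviation "T \<equiv> tensor_ring K A R"

sublocale TP: tensor_product K A R T
 by (auto simp: tensor_product_def tensor_product_axioms_def tensor_ring_def
   intro!: module_imp_left_module KA.module_axioms KR.module_axioms)

abbreviation tens (infixl "><" 70) where "x >< y \<equiv> etens K A R x y"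

text \<open>With a representative \<open>v\<close> of the right factor fixed, the product is
  balanced in the left factor. This is one half of the independence of representatives.\<close>

lemma mult_elem_balanced:
 assumes "v : $TP.FF"
 defines "l \<equiv> %a r. TP.tcoset (frag_extend (%(b, s). frag_of (a *[A] b, r *[R] s)) v)"
 shows "balanced K A R T l"
proof -
 have c: "TP.tcoset (frag_extend (%(b, s). frag_of (a *[A] b, r *[R] s)) u) : $T"
  "TP.tcoset (frag_extend (%(b, s). frag_of (a *[A] b, r *[R] s)) (u + v)) =
   TP.tcoset (frag_extend (%(b, s). frag_of (a *[A] b, r *[R] s)) u) +[T]
   TP.tcoset (frag_extend (%(b, s). frag_of (a *[A] b, r *[R] s)) v)"
  if "a : $A" "r : $R" "u : $TP.FF" "v : $TP.FF" for a r u v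
  using that TP.tcoset_extend[of A R "%(b, s). frag_of (a *[A] b, r *[R] s)"]
  by (auto simp: TP.FF(1) TP.FF_closed[simplified TP.FF] intro!: TP.tcoset_closed)
 show ?thesis
  unfolding balanced_def l_def
 proof (intro conjI ballI)
  fix a a' r assume *: "a : $A" "a' : $A" "r : $R"
  show "TP.tcoset (frag_extend (%(b, s). frag_of ((a +[A] a') *[A] b, r *[R] s)) v) =
   TP.tcoset (frag_extend (%(b, s). frag_of (a *[A] b, r *[R] s)) v) +[T]
   TP.tcoset (frag_extend (%(b, s). frag_of (a' *[A] b, r *[R] s)) v)"
   by (rule TP.free_eqI[OF assms(1) TP.abelian_group_T])
    (use * c in "simp_all add: TP.T.a_ac elem_tensor_def[symmetric] KA.l_distr TP.tensor_add_left")
 next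
  fix a r r' assume *: "a : $A" "r : $R" "r' : $R"
  show "TP.tcoset (frag_extend (%(b, s). frag_of (a *[A] b, (r +[R] r') *[R] s)) v) =
   TP.tcoset (frag_extend (%(b, s). frag_of (a *[A] b, r *[R] s)) v) +[T]
   TP.tcoset (frag_extend (%(b, s). frag_of (a *[A] b, r' *[R] s)) v)"
   by (rule TP.free_eqI[OF assms(1) TP.abelian_group_T])
    (use * c in "simp_all add: TP.T.a_ac elem_tensor_def[symmetric] KR.l_distr TP.tensor_add_right")
 next
  fix k a r assume *: "k : $K" "a : $A" "r : $R"
  show "TP.tcoset (frag_extend (%(b, s). frag_of ((k .[A] a) *[A] b, r *[R] s)) v) =
   TP.tcoset (frag_extend (%(b, s). frag_of (a *[A] b, (k .[R] r) *[R] s)) v)"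
   by (rule TP.free_eqI[OF assms(1) TP.abelian_group_T])
    (use * c in "simp_all add: elem_tensor_def[symmetric] KA.smult_mult_left KR.smult_mult_left TP.tensor_smult")
 qed (use c assms(1) in simp)
qed

lemma mult_props:
 shows mult_closed: "U : $T ==> V : $T ==> U *[T] V : $T"
  and mult_add_left: "U : $T ==> U' : $T ==> V : $T ==>
   (U +[T] U') *[T] V = U *[T] V +[T] U' *[T] V"
  and mult_add_right: "U : $T ==> V : $T ==> V' : $T ==>
   U *[T] (V +[T] V') = U *[T] V +[T] U *[T] V'"
  and mult_tensor: "a : $A ==> r : $R ==> b : $A ==> s : $R ==>
   (a >< r) *[T] (b >< s) = (a *[A] b) >< (r *[R] s)"
proof -
 let ?l = "%a r. frag_extend (%(b, s). frag_of (a *[A] b, r *[R] s))"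
 \<comment> \<open>The product of representatives; \<open>c2\<close> and \<open>c1\<close> below
   remove the dependence on the right and on the left representative.\<close>
 define g where "g = (%u v. TP.tcoset (frag_extend (%(a, r). ?l a r v) u))"
 have l: "?l a r v : $TP.FF"
  "TP.tcoset (?l a r (v + v')) = TP.tcoset (?l a r v) +[T] TP.tcoset (?l a r v')"
  if "a : $A" "r : $R" "v : $TP.FF" "v' : $TP.FF" for a r v v'
  using that TP.tcoset_extend[of A R "%(b, s). frag_of (a *[A] b, r *[R] s)"]
  by (auto simp: TP.FF(1) TP.FF_closed[simplified TP.FF])
 have g: "g u v : $T" "g (u + u') v = g u v +[T] g u' v"
  if "u : $TP.FF" "v : $TP.FF" "u' : $TP.FF" for u u' v
  unfolding g_def using that l TP.tcoset_extend[of A R "%(a, r). ?l a r v"]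
  by (auto simp: TP.FF(1) intro!: TP.tcoset_closed)
 have gen: "g (frag_of (a, r)) v = TP.tcoset (?l a r v)" for a r v by (simp add: g_def)
 have gv: "g u (v + v') = g u v +[T] g u v'"
  if "u : $TP.FF" "v : $TP.FF" "v' : $TP.FF" for u v v'
  by (rule TP.free_eqI[OF that(1) TP.abelian_group_T])
   (use that g l in "simp_all add: gen TP.FF_closed TP.T.a_ac")
 have lbal: "balanced K A R T (%b s. TP.tcoset (?l a r (frag_of (b, s))))"
  if "a : $A" "r : $R" for a r
  using that by (simp add: balanced_def elem_tensor_def[symmetric] KA.r_distr KR.r_distr TP.tensor_add_left
   TP.tensor_add_right KA.smult_mult_right KR.smult_mult_right TP.tensor_smult)
 have c2: "g u v' = g u v" if "u : $TP.FF" "v : $TP.FF" "v' : TP.tcoset v" for u v v'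
 proof -
  have v': "v' : $TP.FF" using that(2,3) subgroup.subset[OF TP.KK_subgroup]
   by (auto simp: TP.tcoset_iff intro!: TP.FF_closed)
  have eq: "TP.tcoset (?l a r v') = TP.tcoset (?l a r v)" if "a : $A" "r : $R" for a r
   by (rule TP.coset_const[OF TP.abelian_group_T _ _ lbal[OF that] `v : carrier TP.FF` `v' : TP.tcoset v`])
    (use that l in "auto intro: TP.tcoset_closed")
  show ?thesis
   by (rule TP.free_eqI[OF that(1) TP.abelian_group_T]) (simp_all add: gen g v' that(2) eq)
 qed
 have c1: "g u' v = g u v" if "u : $TP.FF" "v : $TP.FF" "u' : TP.tcoset u" for u u' v
  by (rule TP.coset_const[OF TP.abelian_group_T _ _ _ that(1,3)])
   (use that g mult_elem_balanced in "auto simp: gen")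
 have self: "u : TP.tcoset u" for u unfolding TP.tcoset_iff
  using subgroup.one_closed[OF TP.KK_subgroup] by (intro bexI[of _ 0]) (auto simp: TP.FF)
 have mult: "TP.tcoset u *[T] TP.tcoset v = g u v" if "u : $TP.FF" "v : $TP.FF" for u v
 proof -
  have "TP.tcoset u *[T] TP.tcoset v = (UN u':TP.tcoset u. UN v':TP.tcoset v. g u' v')"
   by (simp add: tensor_ring_def g_def)
  also have "... = (UN u':TP.tcoset u. UN v':TP.tcoset v. g u v)"
  proof (intro SUP_cong refl)
   fix u' v' assume *: "u' : TP.tcoset u" "v' : TP.tcoset v"
   then have "u' : $TP.FF" using that(1) subgroup.subset[OF TP.KK_subgroup]
    by (auto simp: TP.tcoset_iff intro!: TP.FF_closed)
   then show "g u' v' = g u v" using c2 c1 that * by simp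
  qed
  also have "... = g u v" using self by blast
  finally show ?thesis .
 qed
 show "U : $T ==> V : $T ==> U *[T] V : $T"
  by (auto simp: TP.carrier_T mult g(1)[simplified TP.carrier_T])
 show "U : $T ==> U' : $T ==> V : $T ==>
   (U +[T] U') *[T] V = U *[T] V +[T] U' *[T] V"
  by (auto simp: TP.carrier_T mult g TP.tcoset_add[symmetric] TP.FF_closed)
 show "U : $T ==> V : $T ==> V' : $T ==>
   U *[T] (V +[T] V') = U *[T] V +[T] U *[T] V'"
  by (auto simp: TP.carrier_T mult gv TP.tcoset_add[symmetric] TP.FF_closed)
 show "a : $A ==> r : $R ==> b : $A ==> s : $R ==>
   (a >< r) *[T] (b >< s) = (a *[A] b) >< (r *[R] s)"
  by (simp add: elem_tensor_def mult TP.FF_closed gen)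
qed

lemma one_T: "1[T] = 1[A] >< 1[R]"
 by (simp add: tensor_ring_def)

lemma tensor_ring: "ring T"
proof (rule ringI[OF TP.abelian_group_T])
 show "monoid T"
 proof (rule monoidI)
  fix U V W assume UVW: "U : $T" "V : $T" "W : $T"
  show "U *[T] V *[T] W = U *[T] (V *[T] W)"
   using UVW(1)
  proof (induction rule: TP.tensor_induct)
   case U: (tensor a r)
   show ?case using UVW(2)
   proof (induction rule: TP.tensor_induct)
    case V: (tensor b s)
    show ?case using UVW(3)
     by (induction rule: TP.tensor_induct)
      (use U V in "simp_all add: mult_tensor mult_add_right mult_closed KA.m_assoc KR.m_assoc")
   qed (use UVW U in "simp add: mult_add_left mult_add_right mult_closed")
  qed (use UVW in "simp add: mult_add_left mult_closed")
 next
  show "1[T] *[T] U = U" if "U : $T" for U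
   using that by (induction rule: TP.tensor_induct) (simp_all add: one_T mult_tensor mult_add_right)
  show "U *[T] 1[T] = U" if "U : $T" for U
   using that by (induction rule: TP.tensor_induct) (simp_all add: one_T mult_tensor mult_add_left)
 qed (auto simp: mult_closed one_T)
qed (auto simp: mult_add_left mult_add_right)

lemma left_hom: "(%a. a >< 1[R]) : ring_hom A T" and right_hom: "(%r. 1[A] >< r) : ring_hom R T"
 by (auto intro!: ring_hom_memI simp: mult_tensor TP.tensor_add_left TP.tensor_add_right one_T)

text \<open>
 The module over \<open>A \<otimes> R\<close> given by commuting actions of \<open>A\<close> and \<open>R\<close>.
\<close>

definition tensor_act ::
  "('a, 'l, 'u) module_scheme => ('r, 'l, 't) module_scheme => (('a \<times> 'r \<Rightarrow>\<^sub>0 int) set, 'l) module" where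
 "tensor_act LA LR = \<lparr>carrier = $LR, monoid.mult = undefined, monoid.one = undefined,
  ring.zero = 0[LR], ring.add = ring.add LR,
  module.smult = (%z x. (SOME h. h : $T -> $LR &
   (ALL z:$T. ALL w:$T. h (z +[T] w) = h z +[LR] h w) &
   (ALL a:$A. ALL r:$R. h (a >< r) = a .[LA] (r .[LR] x))) z)\<rparr>"

lemma tensor_act_simps:
 "$(tensor_act LA LR) = $LR" "0[tensor_act LA LR] = 0[LR]"
 "x +[tensor_act LA LR] y = x +[LR] y"
 by (simp_all add: tensor_act_def)

text \<open>The condition \<open>compat\<close> says that \<open>K\<close> acts in the same way
  through \<open>A\<close> and through \<open>R\<close>. It makes \<open>a .[LA] (r .[LR] x)\<close>
  balanced over \<open>K\<close> in \<open>a\<close> and \<open>r\<close>; multiplicativity then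
  uses that the two actions commute.\<close>

lemma tensor_act:
 assumes B: "bimodule A LA R LR"
  and compat: "!!k x. k : $K ==> x : $LR ==> (k .[A] 1[A]) .[LA] x = (k .[R] 1[R]) .[LR] x"
 shows "lmod T (tensor_act LA LR)"
  and "a : $A ==> r : $R ==> x : $LR ==>
   (a >< r) .[tensor_act LA LR] x = a .[LA] (r .[LR] x)"
proof -
 interpret B: bimodule A LA R LR by fact
 interpret T: ring T by (rule tensor_ring)
 let ?L = "tensor_act LA LR"
 have act: "z : $T ==> z .[?L] x : $LR"
  "z : $T ==> w : $T ==> (z +[T] w) .[?L] x = z .[?L] x +[LR] w .[?L] x"
  "a : $A ==> r : $R ==> (a >< r) .[?L] x = a .[LA] (r .[LR] x)"
  if x: "x : $LR" for x z w a r
 proof -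
  have bal: "balanced K A R LR (%a r. a .[LA] (r .[LR] x))"
   unfolding balanced_def
  proof (intro conjI ballI)
   fix k a r assume *: "k : $K" "a : $A" "r : $R"
   have "k .[A] a = a *[A] (k .[A] 1[A])" "k .[R] r = (k .[R] 1[R]) *[R] r"
    using * by (simp_all add: KA.smult_mult_right KR.smult_mult_left)
   then show "(k .[A] a) .[LA] (r .[LR] x) = a .[LA] ((k .[R] r) .[LR] x)"
    using * x compat[OF *(1), of "r .[LR] x"] B.LA.smult_assoc1[of a "k .[A] 1[A]" "r .[LR] x"]
    by (simp add: B.LR.smult_assoc1)
  qed (use x B.LA.smult_l_distr B.LA.smult_r_distr B.LR.smult_l_distr in auto)
  have "EX h. h : $T -> $LR &
   (ALL z:$T. ALL w:$T. h (z +[T] w) = h z +[LR] h w) &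
   (ALL a:$A. ALL r:$R. h (a >< r) = a .[LA] (r .[LR] x))"
   by (rule TP.universal[OF B.LR.M.abelian_group_axioms bal]) blast
  from someI_ex[OF this] show
   "z : $T ==> z .[?L] x : $LR"
   "z : $T ==> w : $T ==> (z +[T] w) .[?L] x = z .[?L] x +[LR] w .[?L] x"
   "a : $A ==> r : $R ==> (a >< r) .[?L] x = a .[LA] (r .[LR] x)"
   by (auto simp: tensor_act_def)
 qed
 show "a : $A ==> r : $R ==> x : $LR ==> (a >< r) .[?L] x = a .[LA] (r .[LR] x)"
  by (rule act(3))
 have add: "z .[?L] (x +[LR] y) = z .[?L] x +[LR] z .[?L] y"
  if "z : $T" "x : $LR" "y : $LR" for z x y
  using that(1)
  by (induction rule: TP.tensor_induct)
   (use that B.LA.smult_r_distr in "auto simp: act B.LR.smult_r_distr B.LR.M.a_ac")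
 show "lmod T ?L"
 proof (rule left_moduleI)
  fix z w x assume *: "z : $T" "w : $T" "x : $?L"
  show "(z *[T] w) .[?L] x = z .[?L] (w .[?L] x)"
   using *(1)
  proof (induction rule: TP.tensor_induct)
   case z: (tensor a r)
   show ?case using *(2)
   proof (induction rule: TP.tensor_induct)
    case (tensor b s)
    then show ?case using z * B.LA.smult_assoc1[of a b] B.actions_commute[of b r]
     by (simp add: tensor_act_simps act mult_tensor B.LR.smult_assoc1)
   qed (use z * in "simp add: tensor_act_simps act mult_add_right mult_closed add")
  qed (use * in "simp add: tensor_act_simps act mult_add_left mult_closed")
 qed (use B.LA.smult_one in "auto simp: tensor_act_simps act add T.ring_axioms one_T B.LR.M.a_ac B.LR.smult_one
   intro: B.LR.M.ex_l_neg")
qed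

lemma module_bimodule:
 assumes L: "lmod T L"
 shows "bimodule A (rsc (%a. a >< 1[R]) L) R (rsc (%r. 1[A] >< r) L)"
  and "k : $K ==> x : $L ==> ((k .[A] 1[A]) >< 1[R]) .[L] x = (1[A] >< (k .[R] 1[R])) .[L] x"
proof -
 interpret L: left_module T L by fact
 interpret LA: left_module A "rsc (%a. a >< 1[R]) L"
  by (rule restrict_scalars_left_module[OF KA.ring_axioms left_hom L])
 interpret LR: left_module R "rsc (%r. 1[A] >< r) L"
  by (rule restrict_scalars_left_module[OF KR.ring_axioms right_hom L])
 show "bimodule A (rsc (%a. a >< 1[R]) L) R (rsc (%r. 1[A] >< r) L)"
  by unfold_locales (auto simp: L.smult_assoc1[symmetric] mult_tensor restrict_scalars_def)
 show "k : $K ==> x : $L ==> ((k .[A] 1[A]) >< 1[R]) .[L] x = (1[A] >< (k .[R] 1[R])) .[L] x"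
  by (simp add: TP.tensor_smult)
qed

text \<open>Every element of the tensor ring is a sum of products of some \<open>a >< 1\<close> with
  some \<open>1 >< r\<close>.\<close>

lemma submodule_iff:
 assumes L: "lmod T L"
 shows "smod N T L \<longleftrightarrow> smod N A (rsc (%a. a >< 1[R]) L) &
  smod N R (rsc (%r. 1[A] >< r) L)"
proof -
 interpret L: left_module T L by fact
 interpret LA: left_module A "rsc (%a. a >< 1[R]) L"
  by (rule restrict_scalars_left_module[OF KA.ring_axioms left_hom L])
 interpret LR: left_module R "rsc (%r. 1[A] >< r) L"
  by (rule restrict_scalars_left_module[OF KR.ring_axioms right_hom L])
 show ?thesis
 proof
  assume N: "smod N T L"
  note D = L.submoduleD[OF N]
  show "smod N A (rsc (%a. a >< 1[R]) L) & smod N R (rsc (%r. 1[A] >< r) L)"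
   using D(1-4) by (intro conjI LA.submoduleI' LR.submoduleI') auto
 next
  assume N: "smod N A (rsc (%a. a >< 1[R]) L) & smod N R (rsc (%r. 1[A] >< r) L)"
  note DA = LA.submoduleD[OF conjunct1[OF N]] and DR = LR.submoduleD[OF conjunct2[OF N]]
  show "smod N T L"
  proof (rule L.submoduleI')
   fix z x assume z: "z : $T" and x: "x : N"
   have xL: "x : $L" using x DA(1) by auto
   show "z .[L] x : N" using z
   proof (induction rule: TP.tensor_induct)
    case (tensor a r)
    have "a >< r = (a >< 1[R]) *[T] (1[A] >< r)" using tensor by (simp add: mult_tensor)
    then show ?case using tensor DA(4)[of a] DR(4)[of r x] x xL by (simp add: L.smult_assoc1)
   qed (use DA(3) xL in "simp add: L.smult_l_distr")
  qed (use DA in auto)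
 qed
qed

end

section \<open>Finite generation and finite dual bases\<close>

context left_module begin

lemma span_submodule: "S <= $M ==> smod (module_span R M S) R M"
proof (rule submoduleI')
 assume S: "S <= $M"
 show "module_span R M S <= $M"
  using submodule_carrier S by (auto simp: module_span_def)
qed (auto simp: module_span_def dest: submoduleD)

lemma span_least: "smod N R M ==> S <= N ==> module_span R M S <= N"
 by (auto simp: module_span_def)

lemma span_superset: "S <= module_span R M S"
 by (auto simp: module_span_def)

text \<open>In this form, a property is checked on generators once the elements that have it are
  seen to form a submodule.\<close>

lemma fin_gen_iff:
 "fin_gen R M \<longleftrightarrow> (EX S. finite S & S <= $M & (ALL N. smod N R M --> S <= N --> N = $M))"
proof
 assume "fin_gen R M"
 then obtain S where S: "finite S" "S <= $M" "module_span R M S = $M"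
  by (auto simp: fin_gen_def)
 then have "N = $M" if "smod N R M" "S <= N" for N
  using span_least[OF that] submoduleD(1)[OF that(1)] by auto
 with S show "EX S. finite S & S <= $M & (ALL N. smod N R M --> S <= N --> N = $M)" by blast
next
 assume "EX S. finite S & S <= $M & (ALL N. smod N R M --> S <= N --> N = $M)"
 then obtain S where S: "finite S" "S <= $M" "ALL N. smod N R M --> S <= N --> N = $M" by blast
 then have "module_span R M S = $M" using span_submodule[OF S(2)] span_superset[of S] by simp
 then show "fin_gen R M" unfolding fin_gen_def using S(1,2) by (intro exI[of _ S]) simp
qed

lemma combinations_submodule:
 assumes "finite S" "u : S -> $M"
 shows "smod {SUM[M]s:S. c s .[M] u s | c. c : S -> $R} R M" (is "smod ?N R M")
proof (rule submoduleI')
 show "?N <= $M" using assms(2) by (auto intro!: M.finsum_closed)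
 have "(SUM[M]s:S. 0[R] .[M] u s) = (SUM[M]s:S. 0[M])"
  using assms(2) by (intro M.finsum_cong') (auto simp: smult_l_null Pi_iff)
 then show "0[M] : ?N" by (intro CollectI exI[of _ "%s. 0[R]"]) auto
next
 fix x y assume "x : ?N" "y : ?N"
 then obtain c e where c: "c : S -> $R" "x = (SUM[M]s:S. c s .[M] u s)"
  and e: "e : S -> $R" "y = (SUM[M]s:S. e s .[M] u s)" by blast
 have "x +[M] y = (SUM[M]s:S. c s .[M] u s +[M] e s .[M] u s)"
  unfolding c e using c(1) e(1) assms(2) by (intro M.finsum_addf[symmetric]) auto
 also have "... = (SUM[M]s:S. (c s +[R] e s) .[M] u s)"
  using c(1) e(1) assms(2) by (intro M.finsum_cong') (auto simp: smult_l_distr Pi_iff)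
 finally show "x +[M] y : ?N" using c(1) e(1) by (intro CollectI exI[of _ "%s. c s +[R] e s"]) auto
next
 fix a x assume a: "a : $R" and "x : ?N"
 then obtain c where c: "c : S -> $R" "x = (SUM[M]s:S. c s .[M] u s)" by blast
 have "a .[M] x = (SUM[M]s:S. a .[M] (c s .[M] u s))"
  unfolding c using c(1) a assms(2) by (intro smult_finsum) auto
 also have "... = (SUM[M]s:S. (a *[R] c s) .[M] u s)"
  using c(1) a assms(2) by (intro M.finsum_cong') (auto simp: smult_assoc1 Pi_iff)
 finally show "a .[M] x : ?N" using c(1) a by (intro CollectI exI[of _ "%s. a *[R] c s"]) auto
qed

lemma combination_single:
 assumes "finite S" "s : S" "u : S -> $M"
 shows "(SUM[M]t:S. (if t = s then 1[R] else 0[R]) .[M] u t) = u s"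
proof -
 have "(SUM[M]t:S. (if t = s then 1[R] else 0[R]) .[M] u t) = (SUM[M]t:S. if s = t then u t else 0[M])"
  using assms by (intro M.finsum_cong') (auto simp: smult_l_null smult_one Pi_iff)
 also have "... = u s" using assms by (intro M.add.finprod_singleton) auto
 finally show ?thesis .
qed

lemma fin_gen_combination:
 assumes "fin_gen R M"
 obtains S where "finite S" "S <= $M"
  "!!x. x : $M ==> EX c. c : S -> $R & x = (SUM[M]s:S. c s .[M] s)"
proof -
 obtain S where S: "finite S" "S <= $M" "ALL N. smod N R M --> S <= N --> N = $M"
  using assms unfolding fin_gen_iff by blast
 let ?N = "{SUM[M]s:S. c s .[M] s | c. c : S -> $R}"
 have id: "(%s. s) : S -> $M" using S(2) by auto
 have "S <= ?N"
 proof
  fix s assume "s : S"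
  then have "s = (SUM[M]t:S. (if t = s then 1[R] else 0[R]) .[M] t)"
   using combination_single[OF S(1) _ id] by simp
  then show "s : ?N" by (intro CollectI exI[of _ "%t. if t = s then 1[R] else 0[R]"]) auto
 qed
 moreover have "smod ?N R M" using combinations_submodule[of S "%s. s"] S by auto
 ultimately have "?N = $M" using S(3) by blast
 then show thesis using that[OF S(1,2)] by blast
qed

lemma fin_gen_image:
 assumes "fin_gen R M" "lmod R N" "f : Hom R M N" "f ` $M = $N"
 shows "fin_gen R N"
proof -
 interpret N: left_module R N by fact
 obtain S where S: "finite S" "S <= $M" "!!N. smod N R M ==> S <= N ==> N = $M"
  using assms(1) unfolding fin_gen_iff by blast
 have "Q = $N" if Q: "smod Q R N" "f ` S <= Q" for Q
 proof -
  note D = N.submoduleD[OF Q(1)]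
  have "smod {x : $M. f x : Q} R M"
   using D by (intro submoduleI')
    (auto simp: lin_add[OF assms(3)] lin_smult[OF assms(3)] lin_zero[OF lself assms(2,3)])
  then have "{x : $M. f x : Q} = $M" using S(2) Q(2) by (intro S(3)) auto
  then have "$N <= Q" unfolding assms(4)[symmetric] by auto
  then show ?thesis using D(1) by simp
 qed
 then show ?thesis unfolding N.fin_gen_iff
  using S(1,2) lin_closed[OF assms(3)] by (intro exI[of _ "f ` S"]) auto
qed

end

text \<open>Coefficient vectors with respect to a finite generating set, numbered by naturals. The
  embedding provides room for free \<open>A\<close>-modules in the carrier types of the tensor
  products.\<close>

lemma fin_gen_embeds:
 fixes A :: "('k, 'a, 'w) module_scheme"
 assumes A: "lmod K A" and fg: "fin_gen K A"
 shows "EX io :: 'a => nat => 'k. inj_on io $A"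
proof -
 interpret left_module K A by fact
 obtain S where S: "finite S" "S <= $A"
  "!!x. x : $A ==> EX c. c : S -> $K & x = (SUM[A]s:S. c s .[A] s)"
  by (rule fin_gen_combination[OF fg]) blast
 have "ALL x:$A. EX c. c : S -> $K & x = (SUM[A]s:S. c s .[A] s)" using S(3) by blast
 from bchoice[OF this] obtain c where c: "!!x. x : $A ==> c x : S -> $K"
  "!!x. x : $A ==> x = (SUM[A]s:S. c x s .[A] s)" by blast
 obtain e :: "'a => nat" where e: "inj_on e S"
  using S(1) finite_imp_inj_to_nat_seg by metis
 have "x = y" if xy: "x : $A" "y : $A"
  "(%n. c x (inv_into S e n)) = (%n. c y (inv_into S e n))" for x y
 proof -
  have "c x s = c y s" if "s : S" for s using fun_cong[OF xy(3), of "e s"] that e by simp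
  then have "(SUM[A]s:S. c x s .[A] s) = (SUM[A]s:S. c y s .[A] s)"
   using c(1)[OF xy(2)] S(2) by (intro M.finsum_cong') auto
  then show ?thesis using c(2)[OF xy(1)] c(2)[OF xy(2)] by simp
 qed
 then have "inj_on (%x n. c x (inv_into S e n)) $A" by (intro inj_onI)
 then show ?thesis by blast
qed

lemma fin_dual_basis_fin_gen:
 assumes P: "lmod R P" and db: "fin_dual_basis R P I b c" shows "fin_gen R P"
proof -
 interpret left_module R P by fact
 note D = fin_dual_basisD[OF db]
 have "N = $P" if N: "smod N R P" "b ` I <= N" for N
 proof (intro equalityI subsetI)
  fix x assume x: "x : $P"
  have "(SUM[P]i:I. c i x .[P] b i) : N"
   using D x N(2) submoduleD(4)[OF N(1)] by (intro submodule_finsum[OF N(1)]) auto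
  then show "x : N" using D(5)[OF x] by simp
 qed (use submoduleD(1)[OF N(1)] in auto)
 then show ?thesis unfolding fin_gen_iff using D(1,2) by (intro exI[of _ "b ` I"]) auto
qed

lemma projective_dual_basis:
 fixes P :: "('r, 'p, 'w) module_scheme"
 assumes "projective R P" shows "EX (I :: 'p set) b c. dual_basis R P I b c"
proof -
 obtain B :: "'p set" and i p where P: "lmod R P" and i: "i : Hom R P (free_module R B)"
  and p: "p : Hom R (free_module R B) P" "!!x. x : $P ==> p (i x) = x"
  using assms by (auto simp: projective_def direct_summand_def)
 have R: "ring R" using P by (simp add: left_module_def)
 have "dual_basis R P B (%be. p (%y:B. if y = be then 1[R] else 0[R])) (%be x. i x be)"
  by (rule dual_basis_iso[OF free_module_left_module[OF R] free_module_dual_basis[OF R] p(1) i _ P]) (rule p(2))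
 then show ?thesis by blast
qed

text \<open>The finitely many generators have only finitely many nonzero coordinates altogether; the
  elements whose other coordinates vanish form a submodule containing the generators.\<close>

lemma projective_fin_dual_basis:
 fixes P :: "('r, 'p, 'w) module_scheme"
 assumes "projective R P" "fin_gen R P" shows "EX (I :: 'p set) b c. fin_dual_basis R P I b c"
proof -
 obtain B :: "'p set" and b c where db: "dual_basis R P B b c" using projective_dual_basis[OF assms(1)] by blast
 interpret left_module R P using assms(1) by (simp add: projective_def)
 obtain S where S: "finite S" "S <= $P" "ALL N. smod N R P --> S <= N --> N = $P"
  using assms(2) unfolding fin_gen_iff by blast
 note D = dual_basisD[OF db]
 define I where "I = (UN s:S. {i : B. c i s ~= 0[R]})"
 have I: "finite I" "I <= B" using S D(4) by (auto simp: I_def)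
 have add: "c i (x +[P] y) = c i x +[R] c i y" if "i : B" "x : $P" "y : $P" for i x y
  using lin_add[OF D(2)] that by simp
 have sm: "c i (r .[P] y) = r *[R] c i y" if "i : B" "r : $R" "y : $P" for i r y
  using lin_smult[OF D(2)] that by simp
 have z: "c i 0[P] = 0[R]" if "i : B" for i
  using lin_zero[OF lself regular_left_module[OF R.ring_axioms] D(2)[OF that]] by simp
 let ?N = "{x : $P. ALL i:B - I. c i x = 0[R]}"
 have "smod ?N R P" by (rule submoduleI') (auto simp: add sm z)
 moreover have "S <= ?N" using S(2) by (auto simp: I_def)
 ultimately have N: "?N = $P" using S(3) by blast
 have "(SUM[P]i:I. c i x .[P] b i) = x" if x: "x : $P" for x
 proof -
  have "x : ?N" using x N by simp
  then have sub: "{i : B. c i x ~= 0[R]} <= I" by auto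
  have "(SUM[P]i:{i : B. c i x ~= 0[R]}. c i x .[P] b i) = (SUM[P]i:I. c i x .[P] b i)"
   using I(2) D(1,3) x by (intro finsum_support_eq[OF I(1) sub]) auto
  then show ?thesis using D(5)[OF x] by simp
 qed
 then have "fin_dual_basis R P I b c" using I D(1,2) by (auto simp: fin_dual_basis_def)
 then show ?thesis by blast
qed

lemma fin_dual_basis_iso:
 assumes P: "lmod R P" and b: "fin_dual_basis R P I b c"
  and e: "e : Hom R P Q" "e' : Hom R Q P" "!!y. y : $Q ==> e (e' y) = y"
  and Q: "lmod R Q"
 shows "fin_dual_basis R Q I (%i. e (b i)) (%i y. c i (e' y))"
 unfolding fin_dual_basis_def
proof (intro conjI ballI)
 interpret Q: left_module R Q by fact
 note D = fin_dual_basisD[OF b]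
 fix y assume y: "y : $Q"
 then have y': "e' y : $P" by (rule lin_closed[OF e(2)])
 have "e (SUM[P]i:I. c i (e' y) .[P] b i) = (SUM[Q]i:I. e (c i (e' y) .[P] b i))"
  using D(2,4) y' left_module.smult_closed[OF P] by (intro lin_finsum[OF P Q e(1)]) auto
 also have "... = (SUM[Q]i:I. c i (e' y) .[Q] e (b i))"
  using D(2,4) y' by (intro Q.finsum_cong') (auto simp: lin_smult[OF e(1)] lin_closed[OF e(1)])
 finally show "(SUM[Q]i:I. c i (e' y) .[Q] e (b i)) = y"
  using D(5)[OF y'] e(3)[OF y] by simp
next
 fix i assume "i : I"
 then show "e (b i) : $Q" "(%y. c i (e' y)) : Hom R Q (regm R)"
  using fin_dual_basisD(2)[OF b] lin_closed[OF e(1)] lin_comp[OF e(2) fin_dual_basisD(3)[OF b]] by auto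
qed (use fin_dual_basisD(1)[OF b] in simp)

text \<open>
 Equal basis vectors are merged, since the free module in \<^const>\<open>projective\<close> has its basis in the
 type of \<open>P\<close>.
\<close>

lemma fin_dual_basis_projective:
 fixes P :: "('r, 'p, 'w) module_scheme"
 assumes P: "lmod R P" and db: "fin_dual_basis R P I b c"
 shows "projective R P"
proof -
 interpret left_module R P by fact
 note D = fin_dual_basisD[OF db]
 let ?B = "b ` I" and ?f = "%x. %be:b ` I. SUM[R]i:{i : I. b i = be}. c i x"
 let ?F = "free_module R ?B" and ?p = "%f. SUM[P]be:b ` I. f be .[P] be"
 have fin: "finite ?B" using D(1) by simp
 have cf: "f : $?F \<longleftrightarrow> f : ?B \<rightarrow>\<^sub>E $R" for f using fin by (auto simp: free_module_def)
 have fop: "be : ?B ==> (f +[?F] g) be = f be +[R] g be" "be : ?B ==> (r .[?F] f) be = r *[R] f be" for f g r be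
  by (simp_all add: free_module_def)
 have i: "?f : Hom R P ?F"
 proof (rule lin_mapsI)
  fix x assume x: "x : $P"
  then show "?f x : $?F" unfolding cf using D by (auto intro!: R.finsum_closed)
 next
  fix x y assume xy: "x : $P" "y : $P"
  have "(SUM[R]i:{i : I. b i = be}. c i (x +[P] y)) =
   (SUM[R]i:{i : I. b i = be}. c i x) +[R] (SUM[R]i:{i : I. b i = be}. c i y)" for be
  proof -
   have "(SUM[R]i:{i : I. b i = be}. c i (x +[P] y)) = (SUM[R]i:{i : I. b i = be}. c i x +[R] c i y)"
    using xy D(4) lin_add[OF D(3)] by (intro R.finsum_cong') auto
   also have "... = (SUM[R]i:{i : I. b i = be}. c i x) +[R] (SUM[R]i:{i : I. b i = be}. c i y)"
    using xy D(4) by (intro R.finsum_addf) auto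
   finally show ?thesis .
  qed
  then show "?f (x +[P] y) = ?f x +[?F] ?f y" by (auto simp: free_module_def intro!: restrict_ext)
 next
  fix r x assume x: "r : $R" "x : $P"
  have "(SUM[R]i:{i : I. b i = be}. c i (r .[P] x)) = r *[R] (SUM[R]i:{i : I. b i = be}. c i x)" for be
  proof -
   have "(SUM[R]i:{i : I. b i = be}. c i (r .[P] x)) = (SUM[R]i:{i : I. b i = be}. r *[R] c i x)"
    using x D(4) lin_smult[OF D(3)] by (intro R.finsum_cong') auto
   also have "... = r *[R] (SUM[R]i:{i : I. b i = be}. c i x)"
    using x D by (intro R.finsum_rdistr[symmetric]) auto
   finally show ?thesis .
  qed
  then show "?f (r .[P] x) = r .[?F] ?f x" by (auto simp: free_module_def intro!: restrict_ext)
 qed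
 have ev: "(%f. f be .[P] be) : Hom R ?F P" if "be : ?B" for be
  using that D(2) by (intro lin_mapsI) (auto simp: cf fop smult_l_distr smult_assoc1 PiE_iff)
 have p: "?p : Hom R ?F P" by (rule lin_finsum_map[OF P ev])
 have pf: "?p (?f x) = x" if x: "x : $P" for x
 proof -
  have "?p (?f x) = (SUM[P]be:?B. SUM[P]i:{i : I. b i = be}. c i x .[P] b i)"
  proof (intro M.finsum_cong')
   fix be assume be: "be : ?B"
   have "?f x be .[P] be = (SUM[P]i:{i : I. b i = be}. c i x .[P] be)"
    using be x D by (auto intro!: finsum_smult)
   also have "... = (SUM[P]i:{i : I. b i = be}. c i x .[P] b i)"
    using x D by (intro M.finsum_cong') auto
   finally show "?f x be .[P] be = (SUM[P]i:{i : I. b i = be}. c i x .[P] b i)" .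
  qed (use x D in "auto intro!: M.finsum_closed")
  also have "... = (SUM[P]i:(UN be:?B. {i : I. b i = be}). c i x .[P] b i)"
   by (rule M.add.finprod_UN_disjoint[of ?B "%be. {i : I. b i = be}" "%i. c i x .[P] b i", symmetric])
    (use x D(1,2,4) in "auto simp: pairwise_def disjnt_def")
  also have "(UN be:?B. {i : I. b i = be}) = I" by auto
  finally show ?thesis using D(5)[OF x] by simp
 qed
 have "direct_summand R P ?F"
  unfolding direct_summand_def by (rule bexI[OF _ i], rule bexI[OF _ p]) (rule ballI, rule pf)
 then show ?thesis unfolding projective_def using P by (intro conjI exI)
qed

section \<open>Lattices as bimodules\<close>

context tensor_algebra begin

text \<open>Products of generators of \<open>A\<close> over \<open>K\<close> with generators of
  \<open>L\<close> generate over \<open>R\<close>. Let an \<open>R\<close>-submodule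
  \<open>N\<close> contain them. For a generator \<open>s\<close>, the \<open>a\<close> with
  \<open>a s\<close> in \<open>N\<close> form a \<open>K\<close>-subspace, so all of
  \<open>A s\<close> lies in \<open>N\<close>; and the \<open>x\<close> with \<open>A x\<close>
  inside \<open>N\<close> form a submodule over the tensor ring.\<close>

lemma fin_gen_right:
 assumes L: "lmod T L" and fg: "fin_gen T L" and A: "fin_gen K A"
 shows "fin_gen R (rsc (%r. 1[A] >< r) L)" (is "fin_gen R ?LR")
proof -
 let ?LA = "rsc (%a. a >< 1[R]) L"
 interpret B: bimodule A ?LA R ?LR by (rule module_bimodule(1)[OF L])
 interpret L: left_module T L by fact
 obtain S where S: "finite S" "S <= $L" "ALL N. smod N T L --> S <= N --> N = $L"
  using fg unfolding L.fin_gen_iff by blast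
 obtain F where F: "finite F" "F <= $A" "ALL N. smod N K A --> F <= N --> N = $A"
  using A unfolding TP.M.fin_gen_iff by blast
 let ?S = "(%(a, s). a .[?LA] s) ` (F \<times> S)"
 have "N = $?LR" if N: "smod N R ?LR" "?S <= N" for N
 proof -
  note D = B.LR.submoduleD[OF N(1)]
  have FA: "a .[?LA] s : N" if s: "s : S" and a: "a : $A" for s a
  proof -
   have sL: "s : $?LR" using s S by auto
   let ?Q = "{a : $A. a .[?LA] s : N}"
   have "smod ?Q K A"
   proof (rule TP.M.submoduleI')
    show "0[A] : ?Q" using B.LA.smult_l_null[of s] sL D(2) by simp
    show "a +[A] b : ?Q" if "a : ?Q" "b : ?Q" for a b
     using that B.LA.smult_l_distr[of a b s] sL D(3) by simp
    show "k .[A] a : ?Q" if k: "k : $K" and a: "a : ?Q" for k a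
    proof -
     have ka: "k .[A] a = (k .[A] 1[A]) *[A] a" using k a by (simp add: KA.smult_mult_left)
     have "(k .[A] a) .[?LA] s = (k .[A] 1[A]) .[?LA] (a .[?LA] s)"
      unfolding ka using k a sL by (intro B.LA.smult_assoc1) auto
     also have "... = (k .[R] 1[R]) .[?LR] (a .[?LA] s)"
      using module_bimodule(2)[OF L k, of "a .[?LA] s"] B.act_closed[of a s] a sL by simp
     also have "... : N" using a k by (intro D(4)) auto
     finally show ?thesis using k a by simp
    qed
   qed auto
   moreover have "F <= ?Q" using F(2) N(2) s by auto
   ultimately show ?thesis using F(3) a by blast
  qed
  let ?N = "{x : $L. ALL a:$A. a .[?LA] x : N}"
  have "smod ?N T L" unfolding submodule_iff[OF L]
  proof (intro conjI B.LA.submoduleI' B.LR.submoduleI')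
   show "a .[?LA] x : ?N" if "a : $A" "x : ?N" for a x
    using that B.LA.smult_assoc1[of _ a x, symmetric] B.act_closed[of a x] by simp
   show "r .[?LR] x : ?N" if "r : $R" "x : ?N" for r x
    using that B.actions_commute[of _ r x] D(4)[of r] B.LR.smult_closed[of r x] by simp
  qed (use D B.LA.smult_r_null B.LA.smult_r_distr in auto)
  moreover have "S <= ?N" using FA S(2) by auto
  ultimately have N': "?N = $L" using S(3) by blast
  have "x : N" if x: "x : $L" for x
  proof -
   have "x : ?N" using x unfolding N' .
   then have "1[A] .[?LA] x : N" by auto
   then show ?thesis using B.LA.smult_one[of x] x by simp
  qed
  then show ?thesis using D(1) by auto
 qed
 moreover have "?S <= $?LR" using F(2) S(2) B.act_closed by (auto simp: subset_iff)
 ultimately show ?thesis unfolding B.LR.fin_gen_iff using F(1) S(1) by (intro exI[of _ ?S]) auto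
qed

lemma tensor_act_restrict:
 assumes B: "bimodule A LA R LR"
  and compat: "!!k x. k : $K ==> x : $LR ==> (k .[A] 1[A]) .[LA] x = (k .[R] 1[R]) .[LR] x"
 shows "a : $A ==> x : $LR ==> (a >< 1[R]) .[tensor_act LA LR] x = a .[LA] x"
  and "r : $R ==> x : $LR ==> (1[A] >< r) .[tensor_act LA LR] x = r .[LR] x"
proof -
 interpret B: bimodule A LA R LR by fact
 show "a : $A ==> x : $LR ==> (a >< 1[R]) .[tensor_act LA LR] x = a .[LA] x"
  using tensor_act(2)[OF B compat] by (simp add: B.LR.smult_one)
 show "r : $R ==> x : $LR ==> (1[A] >< r) .[tensor_act LA LR] x = r .[LR] x"
  using tensor_act(2)[OF B compat] B.LA.smult_one by simp
qed

lemma tensor_act_lattice: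
 assumes B: "bimodule A LA R LR"
  and compat: "!!k x. k : $K ==> x : $LR ==> (k .[A] 1[A]) .[LA] x = (k .[R] 1[R]) .[LR] x"
  and db: "fin_dual_basis R LR I b c"
 defines "L \<equiv> tensor_act LA LR"
 shows "lmod T L" "fin_gen T L" "projective R (rsc (%r. 1[A] >< r) L)"
proof -
 interpret B: bimodule A LA R LR by fact
 show L: "lmod T L" unfolding L_def by (rule tensor_act(1)[OF B compat])
 let ?LR = "rsc (%r. 1[A] >< r) L"
 interpret B': bimodule A "rsc (%a. a >< 1[R]) L" R ?LR by (rule module_bimodule(1)[OF L])
 have id: "(%x. x) : Hom R LR ?LR" "(%x. x) : Hom R ?LR LR"
  using tensor_act_restrict(2)[OF B compat] by (auto intro!: lin_mapsI simp: L_def tensor_act_simps)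
 have db': "fin_dual_basis R ?LR I (%i. b i) (%i y. c i y)"
  by (rule fin_dual_basis_iso[OF B.LR.lself db id _ B'.LR.lself]) simp
 show "projective R ?LR" by (rule fin_dual_basis_projective[OF B'.LR.lself db'])
 interpret L: left_module T L by fact
 from fin_dual_basis_fin_gen[OF B'.LR.lself db'] obtain S where
  S: "finite S" "S <= $L" "ALL N. smod N R ?LR --> S <= N --> N = $L"
  unfolding B'.LR.fin_gen_iff by auto
 then show "fin_gen T L" unfolding L.fin_gen_iff submodule_iff[OF L] by blast
qed

end

section \<open>Retracts of null extensions and restriction of scalars\<close>

text \<open>Nullity passes from \<open>C'\<close> to \<open>C\<close> along a morphism
  \<open>i\<close> that is split at the left end only. The composite of \<open>i\<close> and
  \<open>h\<close> is compared with \<open>h'\<close> after a lift of \<open>P\<close> to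
  \<open>P'\<close>; the two agree at the right end, so they differ by a coboundary, and
  \<open>pp\<close> brings the factor back. The sequence \<open>P'\<close> only receives maps, so it
  may be a restricted resolution.\<close>

lemma retract_null:
 fixes P P' C C' :: "nat => ('r, 'm) module"
 assumes P: "proj_complex R d (P, p)" and E: "lexact R d (C, f)"
  and E': "lexact R d (C', f')" and P': "lexact R d (P', p')" "P' (Suc d) = C' (Suc d)"
  and h: "smor R d (P, p) (C, f) h" and h': "smor R d (P', p') (C', f') h'"
  and h'id: "!!x. x : $(P' (Suc d)) ==> h' (Suc d) x = x"
  and e: "e : Hom R (P' 1) (C' 0)" "!!x. x : $(P' 0) ==> h' 0 x = e (p' 0 x)"
  and i: "smor R d (C, f) (C', f') i"
  and pp: "pp : Hom R (C' 0) (C 0)" "!!x. x : $(C 0) ==> pp (i 0 x) = x"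
 shows "EX e:Hom R (P 1) (C 0). ALL x:$(P 0). h 0 x = e (p 0 x)"
proof -
 note ih = seq_morphism_comp[OF h i]
 have "(%x. i (Suc d) (h (Suc d) x)) : Hom R (P (Suc d)) (P' (Suc d))"
  unfolding P'(2) by (rule seq_morphismD(1)[OF ih]) simp
 from chain_lift[OF P'(1) P this] obtain g where
  g: "smor R d (P, p) (P', p') g" "g (Suc d) = (%x. i (Suc d) (h (Suc d) x))" by blast
 note hg = seq_morphism_comp[OF g(1) h']
 interpret C0: left_module R "C' 0" using long_exactD(1)[OF E'] by simp
 interpret Cd: left_module R "C' (Suc d)" using long_exactD(1)[OF E'] by simp
 have "EX s:Hom R (P 1) (C' 0). ALL x:$(P 0). i 0 (h 0 x) -[C' 0] h' 0 (g 0 x) = s (p 0 x)"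
 proof (rule homotopy[OF E' P seq_morphism_diff[OF E' hg ih]])
  fix x assume x: "x : $(P (Suc d))"
  have "g (Suc d) x : $(P' (Suc d))" by (rule lin_closed[OF seq_morphismD(1)[OF g(1)] x]) simp
  then show "i (Suc d) (h (Suc d) x) -[C' (Suc d)] h' (Suc d) (g (Suc d) x) = 0[C' (Suc d)]"
   using h'id g(2) P'(2) by (simp add: a_minus_def Cd.r_neg)
 qed
 then obtain s where s: "s : Hom R (P 1) (C' 0)"
  "!!x. x : $(P 0) ==> i 0 (h 0 x) -[C' 0] h' 0 (g 0 x) = s (p 0 x)" by blast
 have g1: "g 1 : Hom R (P 1) (P' 1)" by (rule seq_morphismD(1)[OF g(1)]) simp
 show ?thesis
 proof (intro bexI ballI)
  show "(%x. pp (s x +[C' 0] e (g 1 x))) : Hom R (P 1) (C 0)"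
   by (rule lin_comp[OF lin_plus[OF C0.lself s(1) lin_comp[OF g1 e(1)]] pp(1)])
  fix x assume x: "x : $(P 0)"
  have c: "i 0 (h 0 x) : $(C' 0)" "h' 0 (g 0 x) : $(C' 0)" "h 0 x : $(C 0)" "g 0 x : $(P' 0)"
   using lin_closed[OF seq_morphismD(1)[OF ih, of 0] x] lin_closed[OF seq_morphismD(1)[OF hg, of 0] x]
    lin_closed[OF seq_morphismD(1)[OF h, of 0] x] lin_closed[OF seq_morphismD(1)[OF g(1), of 0] x] by auto
  have "h' 0 (g 0 x) = e (g 1 (p 0 x))"
   using e(2)[OF c(4)] seq_morphismD(2)[OF g(1), of 0 x] x by simp
  then have "i 0 (h 0 x) = s (p 0 x) +[C' 0] e (g 1 (p 0 x))"
   using C0.diff_add_cancel[OF c(1,2)] s(2)[OF x] by simp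
  then show "h 0 x = pp (s (p 0 x) +[C' 0] e (g 1 (p 0 x)))" using pp(2)[OF c(3)] by simp
 qed
qed

lemma restrict_long_exact:
 assumes "ring R" "ph : ring_hom R S" "lexact S d (C, f)"
 shows "lexact R d (%i. rsc ph (C i), f)"
 using long_exactD[OF assms(3)] unfolding long_exact_def
 by (auto intro!: restrict_scalars_left_module[OF assms(1,2)] lin_restrict_scalars[OF assms(2)])

lemma restrict_seq_morphism:
 assumes "ph : ring_hom R S" "smor S d (C, f) (Y, g) h"
 shows "smor R d (%i. rsc ph (C i), f) (%i. rsc ph (Y i), g) h"
 using seq_morphismD[OF assms(2)] unfolding seq_morphism_def
 by (auto intro!: lin_restrict_scalars[OF assms(1)])

section \<open>Oppermann sets and null extensions\<close>

lemma infinite_frag_set: "infinite (UNIV :: (('b \<Rightarrow>\<^sub>0 int) set) set)"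
proof -
 have "inj (%n :: nat. {frag_cmul (int n) (frag_of undefined) :: 'b \<Rightarrow>\<^sub>0 int})"
 proof (rule injI)
  fix m n :: nat
  assume "{frag_cmul (int m) (frag_of undefined) :: 'b \<Rightarrow>\<^sub>0 int} = {frag_cmul (int n) (frag_of undefined)}"
  then have "frag_cmul (int m - int n) (frag_of undefined :: 'b \<Rightarrow>\<^sub>0 int) = 0"
   by (simp add: frag_cmul_diff_distrib)
  then show "m = n" by simp
 qed
 then show ?thesis using infinite_iff_countable_subset by blast
qed

locale fin_dim_algebra = K: field K + A: assoc_algebra K A
 for K :: "('k, 'z) ring_scheme" and A :: "('k, 'a, 'w) module_scheme" +
 assumes fin_gen_A: "fin_gen K A"
begin

abbreviation "poly d \<equiv> polya K d"

lemma poly_tensor_algebra: "tensor_algebra K A (poly d)"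
 by (intro tensor_algebra.intro A.assoc_algebra_axioms K.poly_assoc_algebra)

text \<open>The carrier type of the tensor products is infinite and receives an injection from
  \<open>A\<close>, which is the room that free covers require.\<close>

lemma resolution_exists:
 fixes M :: "('a, ((nat => 'k) \<times> 'm \<Rightarrow>\<^sub>0 int) set) module"
 assumes "lmod A M"
 obtains P p where "resolution A d (P, p)" "P (Suc d) = M"
  "!!i. 1 <= i ==> i <= d ==> EX (I :: ((nat => 'k) \<times> 'm \<Rightarrow>\<^sub>0 int) set set) b c. dual_basis A (P i) I b c"
proof -
 obtain io :: "'a => nat => 'k" where "inj_on io $A"
  using fin_gen_embeds[OF module_imp_left_module[OF A.module_axioms] fin_gen_A] by blast
 then have "inj_on (%a. {frag_of (io a, undefined :: 'm)}) $A"
  by (auto simp: inj_on_def frag_of_eq)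
 then show thesis by (rule projective_resolution_exists[OF assms infinite_frag_set]) (rule that)
qed

text \<open>Finite dimension of \<open>A\<close> makes a lattice finitely generated over the
  polynomial ring, and projectivity then yields a finite dual basis.\<close>

lemma flat_lattice:
 assumes "is_lattice K A d L"
 obtains I :: "(nat => 'k) set" and b c where
  "flat_bimodule A (lleft K A d L) (poly d) (lright K A d L) I b c"
proof -
 interpret TA: tensor_algebra K A "poly d" by (rule poly_tensor_algebra)
 have L: "lmod TA.T L" "fin_gen TA.T L" "projective (poly d) (lright K A d L)"
  using assms by (auto simp: is_lattice_def)
 have "fin_gen (poly d) (lright K A d L)"
  using TA.fin_gen_right[OF L(1,2) fin_gen_A] by (simp add: lattice_right_def)
 with L(3) obtain I :: "(nat => 'k) set" and b c where "fin_dual_basis (poly d) (lright K A d L) I b c"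
  using projective_fin_dual_basis by blast
 then show thesis using TA.module_bimodule(1)[OF L(1)] K.poly_cring
  by (intro that) (simp add: flat_bimodule_def flat_bimodule_axioms_def lattice_left_def lattice_right_def)
qed

lemma class_zero_iff:
 fixes P :: "nat => ('a, ((nat => 'k) \<times> 'm \<Rightarrow>\<^sub>0 int) set) module"
 assumes "resolution A d (P, p)" "1 <= d" "E : extensions A d (P (Suc d)) N"
 shows "ext_class A d (P (Suc d)) N E = ext_zero A d (P (Suc d)) N \<longleftrightarrow> null_via A d (P, p) E"
proof -
 obtain pr :: "((nat => 'k) \<times> 'm \<Rightarrow>\<^sub>0 int) set \<times> ((nat => 'k) \<times> 'm \<Rightarrow>\<^sub>0 int) set => ((nat => 'k) \<times> 'm \<Rightarrow>\<^sub>0 int) set"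
  where "inj pr" using infinite_pairing[OF infinite_frag_set] .
 then show ?thesis using ext_class_eq_zero_iff[OF assms(1) refl assms(2) _ assms(3)] by blast
qed

lemma eps_extension:
 "E : eps_sequences K d aa ==> E : extensions (poly d) d (simple_at (poly d) aa) (simple_at (poly d) aa)"
 by (auto simp: eps_sequences_def Let_def)

text \<open>From here on Yoneda classes over \<open>A\<close> are gone: membership is decided by a
  comparison map out of one resolution.\<close>

lemma oppermann_set_iff:
 fixes L :: "('k, 'a) lattice"
 assumes L: "is_lattice K A d L" and d: "1 <= d"
  and P: "resolution A d (P, p)"
   "P (Suc d) = bt (poly d) (lleft K A d L) (lright K A d L) (simple_at (poly d) aa)"
 shows "aa : oppermann_set K A d L \<longleftrightarrow> aa : max_spec (poly d) & (EX E:eps_sequences K d aa.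
  ~ null_via A d (P, p) (bt_seq (poly d) (lleft K A d L) (lright K A d L) E))"
proof -
 obtain I :: "(nat => 'k) set" and b c where
  "flat_bimodule A (lleft K A d L) (poly d) (lright K A d L) I b c"
  using flat_lattice[OF L] .
 then interpret flat_bimodule A "lleft K A d L" "poly d" "lright K A d L" I b c .
 have "bt_seq (poly d) (lleft K A d L) (lright K A d L) E : extensions A d (P (Suc d)) (P (Suc d))"
  if "E : eps_sequences K d aa" for E
  unfolding P(2) using bt_extension[of "fst E" "snd E"] eps_extension[OF that] by simp
 note eq = class_zero_iff[OF P(1) d this]
 show ?thesis
  unfolding oppermann_set_def Let_def lattice_tensor_bt by (simp add: eq[unfolded P(2)] cong: bex_cong)
qed

end

section \<open>Smash products\<close>

text \<open>A power of \<open>M\<close> with arbitrary index set. Free modules of finite rank, the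
  additive group of the smash product and coinduced lattices are all of this kind, so their
  expansions are proved once.\<close>

definition Fun :: "'x set => ('r, 'm, 'w) module_scheme => ('r, 'x => 'm) module" where
 "Fun U M = \<lparr>carrier = U \<rightarrow>\<^sub>E $M, monoid.mult = undefined, monoid.one = undefined,
  ring.zero = (%i:U. 0[M]), ring.add = (%u v. %i:U. u i +[M] v i),
  module.smult = (%r u. %i:U. r .[M] u i)\<rparr>"

lemma power_module_fun: "powm M n = Fun {..<n} M"
 by (simp add: power_module_def Fun_def)

lemma Fun_simps:
 "$(Fun U M) = U \<rightarrow>\<^sub>E $M" "0[Fun U M] = (%i:U. 0[M])"
 "u +[Fun U M] v = (%i:U. u i +[M] v i)" "r .[Fun U M] u = (%i:U. r .[M] u i)"
 by (simp_all add: Fun_def)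

lemma fun_left_module:
 assumes "lmod R M" shows "lmod R (Fun U M)"
proof -
 interpret left_module R M by fact
 show ?thesis
 proof (rule left_moduleI)
  fix u assume "u : $(Fun U M)"
  then show "EX y:$(Fun U M). y +[Fun U M] u = 0[Fun U M]"
   by (intro bexI[of _ "%i:U. -[M] u i"]) (auto simp: Fun_simps M.l_neg PiE_iff intro!: restrict_ext)
 qed (auto simp: Fun_simps M.a_ac smult_l_distr smult_r_distr smult_assoc1 smult_one R.ring_axioms PiE_iff
   intro!: restrict_ext extensionalityI[of _ U])
qed

lemma fun_eval_lin: "i : U ==> (%u. u i) : Hom R (Fun U M) M"
 by (rule lin_mapsI) (auto simp: Fun_simps)

lemma fun_pointwise_lin:
 assumes "!!i. i : U ==> f i : Hom R N M"
 shows "(%x. %i:U. f i x) : Hom R N (Fun U M)"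
 by (rule lin_mapsI) (auto simp: Fun_simps lin_closed[OF assms] lin_add[OF assms] lin_smult[OF assms]
  intro!: restrict_ext)

definition fun_unit :: "'x set => ('r, 'm, 'w) module_scheme => 'x => 'm => 'x => 'm" where
 "fun_unit U M j x = (%i:U. if i = j then x else 0[M])"

context left_module begin

lemma fun_unit_lin: "fun_unit U M j : Hom R M (Fun U M)"
 by (rule lin_mapsI) (auto simp: fun_unit_def Fun_simps smult_r_null intro!: restrict_ext)

lemma fun_expand:
 assumes "finite U" "u : $(Fun U M)"
 shows "(SUM[Fun U M]j:U. fun_unit U M j (u j)) = u"
proof -
 interpret F: left_module R "Fun U M" by (rule fun_left_module[OF lself])
 have u: "u j : $M" if "j : U" for j using assms(2) that by (auto simp: Fun_simps)
 have c: "fun_unit U M j (u j) : $(Fun U M)" if "j : U" for j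
  using lin_closed[OF fun_unit_lin u[OF that]] .
 have s: "(SUM[Fun U M]j:U. fun_unit U M j (u j)) : $(Fun U M)"
  using c by (intro F.M.finsum_closed) auto
 show ?thesis
 proof (rule extensionalityI[of _ U])
  fix i assume i: "i : U"
  have "(SUM[Fun U M]j:U. fun_unit U M j (u j)) i = (SUM[M]j:U. fun_unit U M j (u j) i)"
   using c by (intro lin_finsum[OF F.lself lself fun_eval_lin[OF i]]) auto
  also have "... = (SUM[M]j:U. if i = j then u j else 0[M])"
   using i u by (intro M.finsum_cong') (auto simp: fun_unit_def)
  also have "... = u i" using i u assms(1) by (intro M.add.finprod_singleton) auto
  finally show "(SUM[Fun U M]j:U. fun_unit U M j (u j)) i = u i" .
 qed (use s assms(2) in "auto simp: Fun_simps PiE_iff")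
qed

lemma fin_gen_fun:
 assumes U: "finite U" and fg: "fin_gen R M" shows "fin_gen R (Fun U M)"
proof -
 interpret F: left_module R "Fun U M" by (rule fun_left_module[OF lself])
 obtain S where S: "finite S" "S <= $M" "ALL N. smod N R M --> S <= N --> N = $M"
  using fg unfolding fin_gen_iff by blast
 let ?S = "(%(j, s). fun_unit U M j s) ` (U \<times> S)"
 have "N = $(Fun U M)" if N: "smod N R (Fun U M)" "?S <= N" for N
 proof -
  note D = F.submoduleD[OF N(1)]
  have un: "fun_unit U M j x : N" if j: "j : U" and x: "x : $M" for j x
  proof -
   have "smod {x : $M. fun_unit U M j x : N} R M"
    using D by (intro submoduleI') (auto simp: lin_add[OF fun_unit_lin] lin_smult[OF fun_unit_lin]
     lin_zero[OF lself F.lself fun_unit_lin])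
   moreover have "S <= {x : $M. fun_unit U M j x : N}" using N(2) j S(2) by auto
   ultimately show ?thesis using S(3) x by blast
  qed
  have "u : N" if u: "u : $(Fun U M)" for u
   using F.submodule_finsum[OF N(1), of "%j. fun_unit U M j (u j)" U] un u fun_expand[OF U u]
   by (auto simp: Fun_simps)
  then show ?thesis using D(1) by auto
 qed
 moreover have "?S <= $(Fun U M)" using S(2) by (auto intro!: lin_closed[OF fun_unit_lin])
 ultimately show ?thesis unfolding F.fin_gen_iff using U S(1) by (intro exI[of _ ?S]) auto
qed

lemma finsum_double:
 assumes "finite U" "!!i. i : U ==> finite (V i)" "!!i j. i : U ==> j : V i ==> g i j : $M"
 shows "(SUM[M]i:U. SUM[M]j:V i. g i j) = (SUM[M]p:Sigma U V. g (fst p) (snd p))"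
proof -
 have "(SUM[M]p:(UN i:U. Pair i ` V i). g (fst p) (snd p)) = (SUM[M]i:U. SUM[M]p:Pair i ` V i. g (fst p) (snd p))"
  using assms by (intro M.add.finprod_UN_disjoint) (auto simp: pairwise_def disjnt_def)
 also have "... = (SUM[M]i:U. SUM[M]j:V i. g i j)"
 proof (intro M.finsum_cong' refl)
  fix i assume i: "i : U"
  show "(SUM[M]p:Pair i ` V i. g (fst p) (snd p)) = (SUM[M]j:V i. g i j)"
   using assms(3)[OF i] by (subst M.finsum_reindex) (auto simp: inj_on_def)
 qed (use assms in "auto intro!: M.finsum_closed")
 also have "(UN i:U. Pair i ` V i) = Sigma U V" by auto
 finally show ?thesis by simp
qed

lemma finsum_swap:
 assumes "finite U" "finite V" "!!i j. i : U ==> j : V ==> g i j : $M"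
 shows "(SUM[M]i:U. SUM[M]j:V. g i j) = (SUM[M]j:V. SUM[M]i:U. g i j)"
proof -
 have "(SUM[M]p:V \<times> U. g (snd p) (fst p)) = (SUM[M]p:prod.swap ` (U \<times> V). g (snd p) (fst p))"
  by (simp add: product_swap)
 also have "... = (SUM[M]p:U \<times> V. g (fst p) (snd p))"
  using assms(3) by (subst M.finsum_reindex) (auto intro: inj_onI)
 finally show ?thesis using finsum_double[of U "%_. V" g] finsum_double[of V "%_. U" "%j i. g i j"] assms by simp
qed

end

section \<open>Homogeneous components and the ring structure of the smash product\<close>

context graded_algebra begin

abbreviation "cpt \<equiv> component G A Agr"
abbreviation "B \<equiv> smash_product G A Agr"
abbreviation "GG \<equiv> $G"

lemma group_simps:
 assumes "x : GG" "y : GG" "z : GG"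
 shows "x *[G] y /[G] y = x" "x /[G] y *[G] y = x"
  "x /[G] z /[G] (y /[G] z) = x /[G] y"
  "inv\<^bsub>G\<^esub> x *[G] (x *[G] y) = y" "x *[G] (inv\<^bsub>G\<^esub> x *[G] y) = y"
proof -
 show "x /[G] z /[G] (y /[G] z) = x /[G] y"
  using assms by (simp add: G.inv_mult_group G.m_assoc) (simp add: G.m_assoc[symmetric])
 show "inv\<^bsub>G\<^esub> x *[G] (x *[G] y) = y" "x *[G] (inv\<^bsub>G\<^esub> x *[G] y) = y"
  using assms by (simp_all add: G.m_assoc[symmetric])
qed (use assms in "simp_all add: G.m_assoc")

sublocale AK: left_module K A by (rule module_imp_left_module) (rule module_axioms)

lemma abelian_A: "abelian_group A"
 using AK.lself by (simp add: left_module_def)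

lemma shift_sum:
 assumes "abelian_group M" "f : GG -> $M" "h : GG"
 shows "(SUM[M]g:GG. f (g /[G] h)) = (SUM[M]g:GG. f g)" "(SUM[M]g:GG. f (h *[G] g)) = (SUM[M]g:GG. f g)"
proof -
 interpret AM: abelian_group M by fact
 have inj: "inj_on (%g. g /[G] h) GG" "inj_on ((\<otimes>\<^bsub>G\<^esub>) h) GG"
  using assms(3) by (auto intro!: inj_onI)
 have im: "(%g. g /[G] h) ` GG = GG" "((\<otimes>\<^bsub>G\<^esub>) h) ` GG = GG"
  using assms(3) group_simps(1,5)
  by (auto intro!: image_eqI[of x "%g. g /[G] h" "x *[G] h" for x] image_eqI[of x "(\<otimes>\<^bsub>G\<^esub>) h" "inv\<^bsub>G\<^esub> h *[G] x" for x])
 show "(SUM[M]g:GG. f (g /[G] h)) = (SUM[M]g:GG. f g)" "(SUM[M]g:GG. f (h *[G] g)) = (SUM[M]g:GG. f g)"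
  using AM.finsum_reindex[of f "%g. g /[G] h" GG] AM.finsum_reindex[of f "(\<otimes>\<^bsub>G\<^esub>) h" GG] inj im assms(2) by auto
qed

lemma homogeneousD:
 assumes "g : GG"
 shows "a : Agr g ==> a : $A" "0[A] : Agr g" "a : Agr g ==> b : Agr g ==> a +[A] b : Agr g"
  "k : $K ==> a : Agr g ==> k .[A] a : Agr g"
 using AK.submoduleD[OF homogeneous_submodule[OF assms]] by auto

lemma comp_mem: "a : $A ==> g : GG ==> cpt a g : Agr g"
 using component(1) by blast

lemma comp_unique:
 assumes "!!g. g : GG ==> c g : Agr g" "a = (SUM[A]g:GG. c g)" "h : GG"
 shows "cpt a h = c h"
proof -
 have a: "a : $A" unfolding assms(2) using assms(1) homogeneousD(1) by (intro finsum_closed) auto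
 have "a = (SUM[A]g:GG. (%g:GG. c g) g)"
  unfolding assms(2) using assms(1) homogeneousD(1) by (intro finsum_cong') auto
 moreover have "(%g:GG. c g) : Pi\<^sub>E GG Agr" using assms(1) by auto
 ultimately have "cpt a = (%g:GG. c g)" using direct_sum[OF a] component[OF a] by blast
 then show ?thesis using assms(3) by simp
qed

lemma comp_add:
 assumes "a : $A" "b : $A" "h : GG" shows "cpt (a +[A] b) h = cpt a h +[A] cpt b h"
proof (rule comp_unique[OF _ _ assms(3)])
 show "a +[A] b = (SUM[A]g:GG. cpt a g +[A] cpt b g)"
  using component(2)[OF assms(1)] component(2)[OF assms(2)] assms
  by (subst finsum_addf) (auto simp: component_closed)
qed (auto intro: homogeneousD comp_mem assms)

lemma comp_smult:
 assumes "k : $K" "a : $A" "h : GG" shows "cpt (k .[A] a) h = k .[A] cpt a h"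
proof (rule comp_unique[OF _ _ assms(3)])
 show "k .[A] a = (SUM[A]g:GG. k .[A] cpt a g)"
  using component(2)[OF assms(2)] assms AK.smult_finsum[OF assms(1), of "cpt a" GG]
  by (auto simp: component_closed)
qed (auto intro: homogeneousD comp_mem assms)

lemma comp_finsum:
 assumes "h : GG" "f : I -> $A" shows "cpt (SUM[A]i:I. f i) h = (SUM[A]i:I. cpt (f i) h)"
 using assms(2)
proof (induction I rule: infinite_finite_induct)
 case (insert i I)
 then have "f : I -> $A" "f i : $A" by auto
 with insert assms(1) show ?case
  by (subst finsum_insert, auto) (subst finsum_insert, auto simp: comp_add component_closed Pi_iff)
qed (simp_all add: component_zero assms(1))

lemma comp_homogeneous:
 assumes "a : Agr g" "g : GG" "h : GG" shows "cpt a h = (if g = h then a else 0[A])"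
proof -
 have "(SUM[A]h:GG. if g = h then a else 0[A]) = a"
  using assms homogeneousD(1) finite_group by (intro add.finprod_singleton) auto
 then show ?thesis using assms homogeneousD(2)
  by (intro comp_unique[of "%h. if g = h then a else 0[A]"]) auto
qed

lemma comp_mult_right:
 assumes "a : $A" "c : Agr y" "y : GG" "x : GG"
 shows "cpt (a *[A] c) x = cpt a (x /[G] y) *[A] c"
proof (rule comp_unique[OF _ _ assms(4)])
 have c: "c : $A" using homogeneousD(1) assms by blast
 fix g assume g: "g : GG"
 have "cpt a (g /[G] y) *[A] c : Agr (g /[G] y *[G] y)"
  using assms g by (intro homogeneous_mult comp_mem) auto
 then show "cpt a (g /[G] y) *[A] c : Agr g" using g assms(3) by (simp add: group_simps)
next
 have c: "c : $A" using homogeneousD(1) assms by blast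
 have "a *[A] c = (SUM[A]g:GG. cpt a g) *[A] c" using component(2)[OF assms(1)] by simp
 also have "... = (SUM[A]g:GG. cpt a g *[A] c)"
  using assms c finite_group by (intro finsum_ldistr) (auto simp: component_closed)
 also have "... = (SUM[A]g:GG. cpt a (g /[G] y) *[A] c)"
  using assms c shift_sum(1)[OF abelian_A, of "%g. cpt a g *[A] c" y] by (auto simp: component_closed)
 finally show "a *[A] c = (SUM[A]g:GG. cpt a (g /[G] y) *[A] c)" .
qed

lemma comp_mult_left:
 assumes "a : Agr y" "b : $A" "y : GG" "x : GG"
 shows "cpt (a *[A] b) (y *[G] x) = a *[A] cpt b x"
proof -
 have a: "a : $A" using homogeneousD(1) assms by blast
 have "cpt (a *[A] b) (y *[G] x) = a *[A] cpt b (inv\<^bsub>G\<^esub> y *[G] (y *[G] x))"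
 proof (rule comp_unique)
  fix g assume g: "g : GG"
  have "a *[A] cpt b (inv\<^bsub>G\<^esub> y *[G] g) : Agr (y *[G] (inv\<^bsub>G\<^esub> y *[G] g))"
   using assms g by (intro homogeneous_mult comp_mem) auto
  then show "a *[A] cpt b (inv\<^bsub>G\<^esub> y *[G] g) : Agr g" using g assms(3) by (simp add: group_simps)
 next
  have "a *[A] b = a *[A] (SUM[A]g:GG. cpt b g)" using component(2)[OF assms(2)] by simp
  also have "... = (SUM[A]g:GG. a *[A] cpt b g)"
   using assms a finite_group by (intro finsum_rdistr) (auto simp: component_closed)
  also have "... = (SUM[A]g:GG. a *[A] cpt b (inv\<^bsub>G\<^esub> y *[G] g))"
   using assms a shift_sum(2)[OF abelian_A, of "%g. a *[A] cpt b g" "inv\<^bsub>G\<^esub> y"] by (auto simp: component_closed)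
  finally show "a *[A] b = (SUM[A]g:GG. a *[A] cpt b (inv\<^bsub>G\<^esub> y *[G] g))" .
 qed (use assms in auto)
 then show ?thesis using assms by (simp add: group_simps)
qed

text \<open>Comparing degrees in \<open>x 1 = x\<close> for the homogeneous components
  \<open>x\<close> of \<open>1\<close> shows that the neutral component is a right unit for each of
  them. Summation gives that \<open>1\<close> times the neutral component is
  \<open>1\<close>.\<close>

lemma one_homogeneous: "1[A] : Agr 1[G]"
proof -
 have h: "cpt 1[A] g *[A] cpt 1[A] 1[G] = cpt 1[A] g" if g: "g : GG" for g
  using comp_mult_left[OF comp_mem[OF one_closed g] one_closed g G.one_closed]
   comp_homogeneous[OF comp_mem[OF one_closed g] g g] g component_closed by simp
 have c: "cpt 1[A] g : $A" if "g : GG" for g using component_closed that by simp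
 have "cpt 1[A] 1[G] = (SUM[A]g:GG. cpt 1[A] g) *[A] cpt 1[A] 1[G]"
  using component(2)[OF one_closed] c by simp
 also have "... = (SUM[A]g:GG. cpt 1[A] g *[A] cpt 1[A] 1[G])"
  using c finite_group by (intro finsum_ldistr) auto
 also have "... = (SUM[A]g:GG. cpt 1[A] g)" using h c by (intro finsum_cong') auto
 also have "... = 1[A]" using component(2)[OF one_closed] by simp
 finally show ?thesis using comp_mem[OF one_closed G.one_closed] by simp
qed

lemma comp_one: "h : GG ==> cpt 1[A] h = (if 1[G] = h then 1[A] else 0[A])"
 using comp_homogeneous[OF one_homogeneous] by simp

lemma smash_simps:
 "$B = GG \<rightarrow>\<^sub>E $A" "0[B] = (%g:GG. 0[A])" "1[B] = (%g:GG. 1[A])"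
 "u +[B] v = (%g:GG. u g +[A] v g)" "k .[B] u = (%g:GG. k .[A] u g)"
 "h : GG ==> (u *[B] v) h = (SUM[A]g:GG. u g *[A] cpt (v h) (g /[G] h))"
 "u *[B] v : extensional GG"
 by (simp_all add: smash_product_def)

lemma smash_mem: "u : $B ==> g : GG ==> u g : $A"
 by (auto simp: smash_simps)

lemma smash_eqI: "u : extensional GG ==> v : extensional GG ==> (!!h. h : GG ==> u h = v h) ==> u = v"
 by (rule extensionalityI)

lemma smash_closed:
 assumes "u : $B" "v : $B" shows "u *[B] v : $B"
proof -
 have "(u *[B] v) h : $A" if "h : GG" for h
  using that assms by (auto simp: smash_simps(6) smash_mem component_closed intro!: finsum_closed)
 then show ?thesis using smash_simps(7)[of u v] by (auto simp: smash_simps(1) PiE_iff)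
qed

text \<open>The degrees telescope: in degree \<open>k/h\<close>, a product whose right factor has
  degree \<open>g/h\<close> involves the component of degree \<open>k/g\<close> of the left
  factor.\<close>

lemma smash_assoc:
 assumes u: "u : $B" and v: "v : $B" and w: "w : $B"
 shows "u *[B] v *[B] w = u *[B] (v *[B] w)"
proof (rule smash_eqI)
 fix h assume h: "h : GG"
 note m = smash_mem[OF u] smash_mem[OF v] smash_mem[OF w]
 let ?w = "%g. cpt (w h) (g /[G] h)"
 have wc: "?w g : $A" "?w g : Agr (g /[G] h)" if "g : GG" for g
  using that h m(3) by (auto intro!: component_closed comp_mem)
 have vc: "cpt (v g) (k /[G] g) : $A" if "g : GG" "k : GG" for g k
  using that m(2) by (auto intro!: component_closed)
 have "(u *[B] v *[B] w) h = (SUM[A]g:GG. SUM[A]k:GG. u k *[A] cpt (v g) (k /[G] g) *[A] ?w g)"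
  unfolding smash_simps(6)[OF h]
  by (intro finsum_cong' refl)
   (use m wc vc in "auto simp: smash_simps(6) finsum_ldistr finite_group intro!: finsum_closed")
 also have "... = (SUM[A]k:GG. SUM[A]g:GG. u k *[A] cpt (v g) (k /[G] g) *[A] ?w g)"
  using m wc vc by (intro AK.finsum_swap finite_group) auto
 also have "... = (SUM[A]k:GG. u k *[A] cpt ((v *[B] w) h) (k /[G] h))"
 proof (intro finsum_cong' refl)
  fix k assume k: "k : GG"
  have "cpt ((v *[B] w) h) (k /[G] h) = (SUM[A]g:GG. cpt (v g *[A] ?w g) (k /[G] h))"
   unfolding smash_simps(6)[OF h] using k h m wc by (intro comp_finsum) auto
  also have "... = (SUM[A]g:GG. cpt (v g) (k /[G] g) *[A] ?w g)"
  proof (intro finsum_cong' refl)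
   fix g assume g: "g : GG"
   show "cpt (v g *[A] ?w g) (k /[G] h) = cpt (v g) (k /[G] g) *[A] ?w g"
    using comp_mult_right[OF m(2)[OF g] wc(2)[OF g], of "k /[G] h"] g h k by (simp add: group_simps)
  qed (use vc wc k in auto)
  finally have "u k *[A] cpt ((v *[B] w) h) (k /[G] h) =
    u k *[A] (SUM[A]g:GG. cpt (v g) (k /[G] g) *[A] ?w g)" by simp
  also have "... = (SUM[A]g:GG. u k *[A] (cpt (v g) (k /[G] g) *[A] ?w g))"
   using k m(1) vc wc finite_group by (intro finsum_rdistr) auto
  also have "... = (SUM[A]g:GG. u k *[A] cpt (v g) (k /[G] g) *[A] ?w g)"
   using k m(1) vc wc by (intro finsum_cong') (auto simp: m_assoc)
  finally show "(SUM[A]g:GG. u k *[A] cpt (v g) (k /[G] g) *[A] ?w g) =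
    u k *[A] cpt ((v *[B] w) h) (k /[G] h)" by simp
 qed (use m h smash_mem[OF smash_closed[OF v w]] in "auto intro!: component_closed")
 finally show "(u *[B] v *[B] w) h = (u *[B] (v *[B] w)) h" using h by (simp add: smash_simps(6))
qed (simp_all add: smash_simps)

lemma smash_one_right: "u : $B ==> u *[B] 1[B] = u"
proof (rule smash_eqI)
 fix h assume u: "u : $B" and h: "h : GG"
 have "(u *[B] 1[B]) h = (SUM[A]g:GG. if h = g then u g else 0[A])"
  unfolding smash_simps(6)[OF h]
 proof (intro finsum_cong' refl)
  fix g assume g: "g : GG"
  have "1[G] = g /[G] h \<longleftrightarrow> h = g" using g h by (metis G.inv_equality G.inv_inv G.r_inv G.inv_closed)
  then show "u g *[A] cpt (1[B] h) (g /[G] h) = (if h = g then u g else 0[A])"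
   using g h smash_mem[OF u] by (simp add: smash_simps comp_one)
 qed (use smash_mem[OF u] in auto)
 also have "... = u h" using h smash_mem[OF u] finite_group by (intro add.finprod_singleton) auto
 finally show "(u *[B] 1[B]) h = u h" .
qed (auto simp: smash_simps PiE_iff)

lemma smash_one_left: "u : $B ==> 1[B] *[B] u = u"
proof (rule smash_eqI)
 fix h assume u: "u : $B" and h: "h : GG"
 have "(1[B] *[B] u) h = (SUM[A]g:GG. cpt (u h) (g /[G] h))"
  unfolding smash_simps(6)[OF h] using h smash_mem[OF u]
  by (intro finsum_cong' refl) (auto simp: smash_simps component_closed)
 also have "... = u h" using shift_sum(1)[OF abelian_A, of "cpt (u h)" h]
   component(2)[OF smash_mem[OF u h]] h smash_mem[OF u h] by (simp add: component_closed Pi_iff)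
 finally show "(1[B] *[B] u) h = u h" .
qed (auto simp: smash_simps PiE_iff)

lemma smash_distrib:
 assumes u: "u : $B" and v: "v : $B" and w: "w : $B"
 shows "(u +[B] v) *[B] w = u *[B] w +[B] v *[B] w" "w *[B] (u +[B] v) = w *[B] u +[B] w *[B] v"
proof -
 note m = smash_mem[OF u] smash_mem[OF v] smash_mem[OF w]
 have c: "cpt (x h) (g /[G] h) : $A" if "x : $B" "h : GG" "g : GG" for x h g
  using that smash_mem by (intro component_closed) auto
 show "(u +[B] v) *[B] w = u *[B] w +[B] v *[B] w"
 proof (rule smash_eqI)
  fix h assume h: "h : GG"
  have "((u +[B] v) *[B] w) h = (SUM[A]g:GG. u g *[A] cpt (w h) (g /[G] h) +[A] v g *[A] cpt (w h) (g /[G] h))"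
   unfolding smash_simps(6)[OF h] using m c h u v w by (intro finsum_cong') (auto simp: smash_simps(4) l_distr)
  also have "... = (u *[B] w) h +[A] (v *[B] w) h"
   unfolding smash_simps(6)[OF h] using m c h u v w by (intro finsum_addf) auto
  finally show "((u +[B] v) *[B] w) h = (u *[B] w +[B] v *[B] w) h" using h by (simp add: smash_simps(4))
 qed (auto simp: smash_simps)
 show "w *[B] (u +[B] v) = w *[B] u +[B] w *[B] v"
 proof (rule smash_eqI)
  fix h assume h: "h : GG"
  have "(w *[B] (u +[B] v)) h = (SUM[A]g:GG. w g *[A] cpt (u h) (g /[G] h) +[A] w g *[A] cpt (v h) (g /[G] h))"
   unfolding smash_simps(6)[OF h] using m c h u v w
   by (intro finsum_cong') (auto simp: smash_simps(4) r_distr comp_add)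
  also have "... = (w *[B] u) h +[A] (w *[B] v) h"
   unfolding smash_simps(6)[OF h] using m c h u v w by (intro finsum_addf) auto
  finally show "(w *[B] (u +[B] v)) h = (w *[B] u +[B] w *[B] v) h" using h by (simp add: smash_simps(4))
 qed (auto simp: smash_simps)
qed

lemma smash_smult:
 assumes k: "k : $K" and u: "u : $B" and v: "v : $B"
 shows "(k .[B] u) *[B] v = k .[B] (u *[B] v)" "u *[B] (k .[B] v) = k .[B] (u *[B] v)"
proof -
 note m = smash_mem[OF u] smash_mem[OF v]
 have c: "cpt (v h) (g /[G] h) : $A" if "h : GG" "g : GG" for h g
  using that m by (intro component_closed) auto
 have *: "k .[A] (u *[B] v) h = (SUM[A]g:GG. k .[A] (u g *[A] cpt (v h) (g /[G] h)))" if h: "h : GG" for h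
  unfolding smash_simps(6)[OF h] using k m c h by (intro AK.smult_finsum) auto
 show "(k .[B] u) *[B] v = k .[B] (u *[B] v)"
 proof (rule smash_eqI)
  fix h assume h: "h : GG"
  have "((k .[B] u) *[B] v) h = (SUM[A]g:GG. k .[A] (u g *[A] cpt (v h) (g /[G] h)))"
   unfolding smash_simps(6)[OF h] using k m c h
   by (intro finsum_cong') (auto simp: smash_simps(5) smult_mult_left)
  then show "((k .[B] u) *[B] v) h = (k .[B] (u *[B] v)) h" using h * by (simp add: smash_simps(5))
 qed (auto simp: smash_simps)
 show "u *[B] (k .[B] v) = k .[B] (u *[B] v)"
 proof (rule smash_eqI)
  fix h assume h: "h : GG"
  have "(u *[B] (k .[B] v)) h = (SUM[A]g:GG. k .[A] (u g *[A] cpt (v h) (g /[G] h)))"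
   unfolding smash_simps(6)[OF h] using k m c h
   by (intro finsum_cong') (auto simp: smash_simps(5) smult_mult_right comp_smult)
  then show "(u *[B] (k .[B] v)) h = (k .[B] (u *[B] v)) h" using h * by (simp add: smash_simps(5))
 qed (auto simp: smash_simps)
qed

lemma smash_module: "lmod K B"
proof -
 interpret F: left_module K "Fun GG A" by (rule fun_left_module[OF AK.lself])
 have eq: "$B = $(Fun GG A)" "0[B] = 0[Fun GG A]"
  "u +[B] v = u +[Fun GG A] v" "k .[B] u = k .[Fun GG A] u" for u v k
  by (simp_all add: smash_simps Fun_simps)
 show ?thesis
  by (rule left_moduleI) (auto simp only: eq F.M.a_ac F.smult_l_distr F.smult_r_distr F.smult_assoc1 F.smult_one
   intro: F.M.ex_l_neg left_module.axioms(1)[OF AK.lself] F.M.zero_closed F.M.a_closed F.smult_closed F.M.l_zero)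
qed

lemma smash_assoc_algebra: "assoc_algebra K B"
proof -
 interpret BK: left_module K B by (rule smash_module)
 have one: "1[B] : $B" by (simp add: smash_simps(1,3))
 have "monoid B"
  by (rule monoidI) (simp_all add: smash_closed smash_assoc smash_one_left smash_one_right one)
 then have "ring B"
  using BK.lself by (intro ringI) (simp_all add: smash_distrib left_module_def)
 moreover have "module K B" using smash_module left_module_iff_module is_cring by blast
 ultimately show ?thesis
  by (simp add: assoc_algebra_def assoc_algebra_axioms_def smash_smult)
qed

lemma smash_fin_gen:
 assumes "fin_gen K A" shows "fin_gen K B"
proof -
 interpret F: left_module K "Fun GG A" by (rule fun_left_module[OF AK.lself])
 have "(%u. u) : Hom K (Fun GG A) B"
  by (rule lin_mapsI) (simp_all add: smash_simps Fun_simps)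
 then show ?thesis
  using F.fin_gen_image[OF AK.fin_gen_fun[OF finite_group assms] smash_module]
  by (simp add: smash_simps Fun_simps)
qed

end

section \<open>Modules over the smash product\<close>

lemma bt_seq_left_morphism:
 assumes B: "bimodule A LA R LR" "bimodule A LA' R LR'"
  and ph: "ph : Hom R LR LR'" "ph : Hom A LA LA'" and E: "lexact R d (C, f)"
 shows "smor A d (bt_seq R LA LR (C, f)) (bt_seq R LA' LR' (C, f)) (%i. tmap R LR' (C i) ph (%y. y))"
 unfolding seq_morphism_def bt_seq_def prod.case
proof (intro conjI allI impI ballI)
 note E = long_exactD[OF E]
 fix i assume "i <= Suc d"
 then show "tmap R LR' (C i) ph (%y. y) : Hom A (bt R LA LR (C i)) (bt R LA' LR' (C i))"
  by (intro bt_map[OF B E(1) E(1) ph lin_ident])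
next
 note E = long_exactD[OF E]
 interpret B: bimodule A LA R LR by fact
 interpret B': bimodule A LA' R LR' by fact
 fix i z assume i: "i <= d" and z: "z : $(bt R LA LR (C i))"
 have m: "lmod R (C i)" "lmod R (C (Suc i))" "f i : Hom R (C i) (C (Suc i))" using E i by auto
 note tp = B.tp[OF m(1)] B.tp[OF m(2)] B'.tp[OF m(1)] B'.tp[OF m(2)]
 show "tmap R LR' (C (Suc i)) ph (%y. y) (tmap R LR (C (Suc i)) (%x. x) (f i) z) =
   tmap R LR' (C (Suc i)) (%x. x) (f i) (tmap R LR' (C i) ph (%y. y) z)"
  unfolding tensor_map_comp[OF tp(1,2,4) lin_ident m(3) ph(1) lin_ident z]
   tensor_map_comp[OF tp(1,3,4) ph(1) lin_ident lin_ident m(3) z] ..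
qed

lemma restrict_bt: "rsc ph (bt R LA LR N) = bt R (rsc ph LA) LR N"
 by (simp add: restrict_scalars_def bt_def)

lemma restrict_bimodule:
 assumes "ring A" "ph : ring_hom A S" "bimodule S LA R LR"
 shows "bimodule A (rsc ph LA) R LR"
proof -
 interpret bimodule S LA R LR by fact
 interpret L': left_module A "rsc ph LA"
  by (rule restrict_scalars_left_module[OF assms(1,2) LA.lself])
 show ?thesis
  by unfold_locales
   (use assms(2) in "auto simp: ring_hom_closed actions_commute add_eq restrict_scalars_def")
qed

section \<open>Separability of the smash product over \<open>A\<close>\<close>

context graded_algebra begin

text \<open>\<open>emb a\<close> is \<open>a\<close> times the sum of all \<open>p_g\<close>, so
  \<open>emb\<close> is a unital ring map from \<open>A\<close> to the smash product;
  \<open>pj h\<close> is the idempotent \<open>p_h\<close>.\<close>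

definition emb :: "'a => 'g => 'a" where "emb a = (%g:GG. a)"
definition pj :: "'g => 'g => 'a" where "pj h = (%g:GG. if g = h then 1[A] else 0[A])"

lemma emb_closed: "a : $A ==> emb a : $B" and pj_closed: "pj h : $B"
 by (auto simp: emb_def pj_def smash_simps(1))

lemma emb_mult: "a : $A ==> v : $B ==> emb a *[B] v = (%x:GG. a *[A] v x)"
proof (rule smash_eqI)
 fix h assume *: "a : $A" "v : $B" "h : GG"
 note vh = smash_mem[OF *(2,3)]
 have "(emb a *[B] v) h = (SUM[A]g:GG. a *[A] cpt (v h) (g /[G] h))"
  unfolding smash_simps(6)[OF *(3)] using * vh by (intro finsum_cong') (auto simp: emb_def component_closed)
 also have "... = a *[A] (SUM[A]g:GG. cpt (v h) (g /[G] h))"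
  using * vh finite_group by (intro finsum_rdistr[symmetric]) (auto simp: component_closed)
 also have "(SUM[A]g:GG. cpt (v h) (g /[G] h)) = v h"
  using shift_sum(1)[OF abelian_A, of "cpt (v h)" h] component(2)[OF vh] * vh by (simp add: component_closed Pi_iff)
 finally show "(emb a *[B] v) h = (%x:GG. a *[A] v x) h" using * by simp
qed (simp_all add: smash_simps)

lemma emb_hom: "emb : ring_hom A B"
 by (rule ring_hom_memI) (auto simp: emb_closed emb_mult, auto simp: emb_def smash_simps)

lemma emb_pj: "a : $A ==> emb a *[B] pj h = fun_unit GG A h a"
 by (simp only: emb_mult pj_closed) (auto simp: pj_def fun_unit_def intro!: restrict_ext)

lemma pj_mult:
 assumes "v : $B" "k : GG" "x : GG" shows "(pj k *[B] v) x = cpt (v x) (k /[G] x)"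
proof -
 note vx = smash_mem[OF assms(1,3)]
 have "(pj k *[B] v) x = (SUM[A]g:GG. if k = g then cpt (v x) (g /[G] x) else 0[A])"
  unfolding smash_simps(6)[OF assms(3)] using assms vx by (intro finsum_cong') (auto simp: pj_def component_closed)
 also have "... = cpt (v x) (k /[G] x)"
  using assms vx finite_group by (intro add.finprod_singleton) (auto simp: component_closed)
 finally show ?thesis .
qed

lemma quotient_eq_iff:
 assumes "k : GG" "x : GG" "y : GG" shows "y = k /[G] x \<longleftrightarrow> x = inv\<^bsub>G\<^esub> y *[G] k"
proof
 assume "y = k /[G] x"
 then have "k = y *[G] x" using assms by (simp add: group_simps)
 then show "x = inv\<^bsub>G\<^esub> y *[G] k" using assms by (simp add: group_simps)
next
 assume "x = inv\<^bsub>G\<^esub> y *[G] k"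
 then have "k = y *[G] x" using assms by (simp add: group_simps)
 then show "y = k /[G] x" using assms by (simp add: group_simps)
qed

text \<open>Moving an idempotent past a homogeneous element of degree \<open>y\<close> translates
  its index, because \<open>p_k a\<close> only has an entry where \<open>y = k/x\<close>, that is at
  \<open>x = y^-1 k\<close>.\<close>

lemma pj_emb:
 assumes "a : Agr y" "y : GG" "k : GG"
 shows "pj k *[B] emb a = emb a *[B] pj (inv\<^bsub>G\<^esub> y *[G] k)"
proof (rule smash_eqI)
 have a: "a : $A" using assms homogeneousD(1) by blast
 fix x assume x: "x : GG"
 then have "(pj k *[B] emb a) x = (if y = k /[G] x then a else 0[A])"
  using assms a by (simp add: pj_mult emb_closed, simp add: emb_def comp_homogeneous)
 then show "(pj k *[B] emb a) x = (emb a *[B] pj (inv\<^bsub>G\<^esub> y *[G] k)) x"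
  using x a assms by (simp add: emb_pj fun_unit_def quotient_eq_iff)
qed (simp_all add: smash_simps)

lemma pj_pj:
 assumes "k : GG" "h : GG" shows "pj k *[B] pj h = (if k = h then pj h else 0[B])"
proof (rule smash_eqI)
 fix x assume x: "x : GG"
 then have "(pj k *[B] pj h) x = (if x = h then cpt 1[A] (k /[G] x) else 0[A])"
  using assms by (simp add: pj_mult pj_closed, simp add: pj_def component_zero)
 then show "(pj k *[B] pj h) x = (if k = h then pj h else 0[B]) x"
  using x assms quotient_eq_iff[of k x "1[G]"] by (auto simp: comp_one pj_def smash_simps(2))
qed (auto simp: smash_simps pj_def)

lemma finsum_smash: "finsum B = finsum (Fun GG A)"
 by (intro ext) (simp add: finsum_def finprod_def smash_product_def Fun_def)

lemma smash_expand:
 assumes "u : $B" shows "(SUM[B]h:GG. emb (u h) *[B] pj h) = u"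
proof -
 interpret FM: left_module K "Fun GG A" by (rule fun_left_module[OF AK.lself])
 have "(SUM[Fun GG A]h:GG. emb (u h) *[B] pj h) = (SUM[Fun GG A]h:GG. fun_unit GG A h (u h))"
  using smash_mem[OF assms]
  by (intro FM.M.finsum_cong') (auto simp: emb_pj intro!: lin_closed[OF AK.fun_unit_lin])
 also have "... = u" using assms by (intro AK.fun_expand[OF finite_group]) (simp add: smash_simps Fun_simps)
 finally show ?thesis by (simp add: finsum_smash)
qed

lemma pj_sum: "(SUM[B]h:GG. pj h) = 1[B]"
proof -
 interpret FB: assoc_algebra K B by (rule smash_assoc_algebra)
 have "(SUM[B]h:GG. pj h) = (SUM[B]h:GG. emb (1[B] h) *[B] pj h)"
  using pj_closed emb_closed by (intro FB.finsum_cong')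
   (auto simp: smash_simps(3), auto simp: emb_mult pj_closed pj_def intro!: restrict_ext)
 then show ?thesis using smash_expand[of "1[B]"] FB.one_closed by simp
qed

text \<open>The sum of the \<open>p_k\<close> tensor \<open>p_k\<close> is a separability idempotent
  of the smash product over \<open>A\<close>. The averaged map commutes with each \<open>p_h\<close>
  by orthogonality, and with a homogeneous element of degree \<open>y\<close> by the substitution of
  \<open>y^-1 k\<close> for \<open>k\<close>; sums of products of such elements exhaust the smash
  product.\<close>

lemma average:
 assumes V: "lmod B V" and N: "lmod B N"
  and e: "e : Hom A (rsc emb V) (rsc emb N)"
 shows "(%x. SUM[N]k:GG. pj k .[N] e (pj k .[V] x)) : Hom B V N" (is "?av : _")
proof -
 interpret V: left_module B V by fact
 interpret N: left_module B N by fact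
 have rV: "lmod A (rsc emb V)" and rN: "lmod A (rsc emb N)"
  using restrict_scalars_left_module[OF _ emb_hom] V N by (auto intro: ring_axioms)
 have ec: "e x : $N" if "x : $V" for x using lin_closed[OF e, of x] that by simp
 have ea: "e (x +[V] y) = e x +[N] e y" if "x : $V" "y : $V" for x y
  using lin_add[OF e, of x y] that by simp
 have es: "e (emb a .[V] x) = emb a .[N] e x" if "a : $A" "x : $V" for a x
  using lin_smult[OF e that(1)] that by simp
 have e0: "e 0[V] = 0[N]" using lin_zero[OF rV rN e] by simp
 note pc = pj_closed
 have add: "?av (x +[V] y) = ?av x +[N] ?av y" if "x : $V" "y : $V" for x y
 proof -
  have "?av (x +[V] y) = (SUM[N]k:GG. pj k .[N] e (pj k .[V] x) +[N] pj k .[N] e (pj k .[V] y))"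
   using that pc ec by (intro N.finsum_cong') (auto simp: V.smult_r_distr N.smult_r_distr ea)
  also have "... = ?av x +[N] ?av y" using that pc ec by (intro N.finsum_addf) auto
  finally show ?thesis .
 qed
 have cl: "?av x : $N" if "x : $V" for x
  using that pc ec by (intro N.finsum_closed) auto
 have P: "?av (pj h .[V] x) = pj h .[N] ?av x" if x: "x : $V" and h: "h : GG" for x h
 proof -
  have "?av (pj h .[V] x) = (SUM[N]k:GG. if h = k then pj k .[N] e (pj k .[V] x) else 0[N])"
   using x h pc ec by (intro N.finsum_cong')
    (auto simp: V.smult_assoc1[symmetric] pj_pj V.smult_l_null e0 N.smult_r_null)
  also have "... = (SUM[N]k:GG. pj h .[N] (pj k .[N] e (pj k .[V] x)))"
   using x h pc ec by (intro N.finsum_cong')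
    (auto simp: N.smult_assoc1[symmetric] pj_pj N.smult_l_null)
  also have "... = pj h .[N] ?av x" using x pc ec by (intro N.smult_finsum[symmetric]) auto
  finally show ?thesis .
 qed
 have H: "?av (emb a .[V] x) = emb a .[N] ?av x" if x: "x : $V" and a: "a : Agr y" and y: "y : GG" for x a y
 proof -
  have aA: "a : $A" using a y homogeneousD(1) by blast
  note ac = emb_closed[OF aA]
  let ?t = "%k. emb a .[N] (pj k .[N] e (pj k .[V] x))"
  have "?av (emb a .[V] x) = (SUM[N]k:GG. ?t (inv\<^bsub>G\<^esub> y *[G] k))"
  proof (intro N.finsum_cong' refl)
   fix k assume k: "k : GG"
   have "e (pj k .[V] (emb a .[V] x)) = emb a .[N] e (pj (inv\<^bsub>G\<^esub> y *[G] k) .[V] x)"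
    using x ac pc k y a aA es by (simp add: V.smult_assoc1[symmetric] pj_emb) (simp add: V.smult_assoc1 es)
   then show "pj k .[N] e (pj k .[V] (emb a .[V] x)) = ?t (inv\<^bsub>G\<^esub> y *[G] k)"
    using x ac pc k y a ec by (simp add: N.smult_assoc1[symmetric] pj_emb)
  qed (use x ac pc ec y in auto)
  also have "... = (SUM[N]k:GG. ?t k)"
   using x ac pc ec y by (intro shift_sum(2)[OF N.M.abelian_group_axioms, of ?t "inv\<^bsub>G\<^esub> y"]) auto
  also have "... = emb a .[N] ?av x" using x ac pc ec by (intro N.smult_finsum[symmetric]) auto
  finally show ?thesis .
 qed
 have sum: "?av (SUM[V]i:I. f i) = (SUM[N]i:I. ?av (f i))" if "finite I" "f : I -> $V" for f and I :: "'g set"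
  using that
 proof (induction I rule: finite_induct)
  case empty
  have "?av 0[V] = (SUM[N]k:GG. 0[N])" using pc by (intro N.finsum_cong') (auto simp: V.smult_r_null e0 N.smult_r_null)
  then show ?case by simp
 next
  case (insert i I)
  then have f: "f : I -> $V" "f i : $V" by auto
  have fN: "(%i. ?av (f i)) : I -> $N" using f by (intro Pi_I cl) auto
  show ?case
   unfolding V.finsum_insert[OF insert(1,2) f] N.finsum_insert[OF insert(1,2) fN cl[OF f(2)]]
    add[OF f(2) V.M.finsum_closed[OF f(1)]] insert.IH[OF f(1)] ..
 qed
 have E: "?av (emb a .[V] x) = emb a .[N] ?av x" if x: "x : $V" and a: "a : $A" for x a
 proof -
  have ca: "cpt a y : $A" "emb (cpt a y) : $B" if "y : GG" for y
   using component_closed[OF a that] emb_closed by auto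
  have "emb a = (SUM[B]y:GG. emb (cpt a y))"
  proof -
   have eA: "emb : Hom A (regm A) (rsc emb (regm B))"
    using emb_hom by (intro lin_mapsI) (auto simp: ring_hom_closed ring_hom_add ring_hom_mult)
   have "emb (SUM[regm A]y:GG. cpt a y) = (SUM[rsc emb (regm B)]y:GG. emb (cpt a y))"
    using ca by (intro lin_finsum[OF regular_left_module[OF ring_axioms]
     restrict_scalars_left_module[OF ring_axioms emb_hom regular_left_module[OF V.R.ring_axioms]] eA]) auto
   then show ?thesis using component(2)[OF a] by simp
  qed
  then have s: "emb a .[M] z = (SUM[M]y:GG. emb (cpt a y) .[M] z)"
   if M: "lmod B M" "z : $M" for M z
   using left_module.finsum_smult[OF M, of "%y. emb (cpt a y)" GG] ca by auto
  have "?av (emb a .[V] x) = (SUM[N]y:GG. ?av (emb (cpt a y) .[V] x))"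
   unfolding s[OF V x] using ca x by (intro sum finite_group) auto
  also have "... = (SUM[N]y:GG. emb (cpt a y) .[N] ?av x)"
   using H[OF x comp_mem[OF a]] ca cl[OF x] by (intro N.finsum_cong') auto
  also have "... = emb a .[N] ?av x" using s[OF N cl[OF x]] by simp
  finally show ?thesis .
 qed
 show ?thesis
 proof (rule lin_mapsI)
  fix u x assume u: "u : $B" and x: "x : $V"
  have c: "emb (u h) : $B" if "h : GG" for h using smash_mem[OF u that] emb_closed by simp
  have s: "u .[M] z = (SUM[M]h:GG. emb (u h) .[M] (pj h .[M] z))" if M: "lmod B M" "z : $M" for M z
  proof -
   interpret LM: left_module B M by fact
   have "u .[M] z = (SUM[M]h:GG. (emb (u h) *[B] pj h) .[M] z)"
    using LM.finsum_smult[OF M(2), of "%h. emb (u h) *[B] pj h" GG] smash_expand[OF u] c pc by auto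
   also have "... = (SUM[M]h:GG. emb (u h) .[M] (pj h .[M] z))"
    using M(2) c pc by (intro LM.M.finsum_cong') (auto simp: LM.smult_assoc1)
   finally show ?thesis .
  qed
  have "?av (u .[V] x) = (SUM[N]h:GG. ?av (emb (u h) .[V] (pj h .[V] x)))"
   unfolding s[OF V x] using c pc x by (intro sum finite_group) auto
  also have "... = (SUM[N]h:GG. emb (u h) .[N] (pj h .[N] ?av x))"
   using E P x c pc smash_mem[OF u] cl[OF x] by (intro N.finsum_cong') auto
  also have "... = u .[N] ?av x" using s[OF N cl[OF x]] by simp
  finally show "?av (u .[V] x) = u .[N] ?av x" .
 qed (rule cl add; assumption)+
qed

text \<open>The smash product is free over \<open>A\<close> with basis the \<open>p_g\<close>, since
  \<open>u\<close> is the sum of the \<open>u g\<close> times \<open>p_g\<close>. So projective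
  modules restrict to projective modules.\<close>

lemma restrict_dual_basis:
 assumes V: "lmod B V" and db: "dual_basis B V I b c"
 shows "dual_basis A (rsc emb V) (I \<times> GG) (%(i, g). pj g .[V] b i) (%(i, g) x. c i x g)"
 unfolding dual_basis_def
proof (intro conjI ballI)
 interpret V: left_module B V by fact
 note D = dual_basisD[OF db]
 have cB: "c i x g : $A" if "i : I" "x : $V" "g : GG" for i x g
  using smash_mem[OF D(3)[OF that(1,2)] that(3)] .
 {
  fix p assume p: "p : I \<times> GG"
  then show "(%(i, g). pj g .[V] b i) p : $(rsc emb V)" using D(1) pj_closed by auto
  obtain i g where ig: "p = (i, g)" "i : I" "g : GG" using p by auto
  have "(%x. c i x g) : Hom A (rsc emb V) (regm A)"
  proof (rule lin_mapsI)
   fix a x assume "a : $A" "x : $(rsc emb V)"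
   then show "c i (a .[rsc emb V] x) g = a .[regm A] c i x g"
    using lin_smult[OF D(2)[OF ig(2)], of "emb a" x] D(3) ig by (simp add: emb_closed emb_mult)
  qed (use lin_add[OF D(2)[OF ig(2)]] ig cB in "auto simp: smash_simps(4)")
  then show "(%(i, g) x. c i x g) p : Hom A (rsc emb V) (regm A)" by (simp add: ig)
 }
 fix x assume x': "x : $(rsc emb V)"
 then have x: "x : $V" by simp
 let ?S = "{i : I. c i x ~= 0[B]}" and ?S2 = "{p : I \<times> GG. (%(i, g) x. c i x g) p x ~= 0[A]}"
 have sub: "?S2 <= ?S \<times> GG" by (auto simp: smash_simps(2))
 have fin: "finite (?S \<times> GG)" using D(4)[OF x] finite_group by simp
 show "finite ?S2" using sub fin by (rule finite_subset)
 have "x = (SUM[V]i:?S. c i x .[V] b i)" using D(5)[OF x] by simp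
 also have "... = (SUM[V]i:?S. SUM[V]g:GG. emb (c i x g) .[V] (pj g .[V] b i))"
 proof (intro V.finsum_cong' refl)
  fix i assume i: "i : ?S"
  have ci: "emb (c i x g) : $B" if "g : GG" for g using cB x i that emb_closed by auto
  have "c i x .[V] b i = (SUM[V]g:GG. (emb (c i x g) *[B] pj g) .[V] b i)"
   using V.finsum_smult[of "b i" "%g. emb (c i x g) *[B] pj g" GG] smash_expand[of "c i x"] ci pj_closed D(1,3) i x by auto
  also have "... = (SUM[V]g:GG. emb (c i x g) .[V] (pj g .[V] b i))"
   using ci pj_closed D(1) i by (intro V.finsum_cong') (auto simp: V.smult_assoc1)
  finally show "c i x .[V] b i = (SUM[V]g:GG. emb (c i x g) .[V] (pj g .[V] b i))" .
 qed (use cB x emb_closed pj_closed D(1) in "auto intro!: V.finsum_closed")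
 also have "... = (SUM[V]p:?S \<times> GG. emb (c (fst p) x (snd p)) .[V] (pj (snd p) .[V] b (fst p)))"
  using cB x emb_closed pj_closed D(1,4) finite_group by (intro V.finsum_double) auto
 also have "... = (SUM[V]p:?S2. emb (c (fst p) x (snd p)) .[V] (pj (snd p) .[V] b (fst p)))"
 proof (intro V.add.finprod_mono_neutral_cong_right fin sub ballI)
  fix p assume "p : ?S \<times> GG - ?S2"
  then show "emb (c (fst p) x (snd p)) .[V] (pj (snd p) .[V] b (fst p)) = 0[V]"
   using D(1) pj_closed V.smult_l_null by (auto simp: emb_def smash_simps(2)[symmetric])
 qed (use cB x emb_closed pj_closed D(1) in auto)
 finally show "x = (SUM[rsc emb V]p:?S2. (%(i, g) x. c i x g) p x .[rsc emb V] (%(i, g). pj g .[V] b i) p)"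
  by (simp add: split_beta)
qed

end

section \<open>Oppermann dimension of the smash product\<close>

type_synonym 'k polyn = "nat multiset => 'k"
type_synonym 'k tens = "((nat => 'k) \<times> 'k polyn set \<Rightarrow>\<^sub>0 int) set"

lemma null_viaE:
 assumes "null_via R d (P, p) (C, f)"
 obtains h e where "smor R d (P, p) (C, f) h" "!!x. x : $(P (Suc d)) ==> h (Suc d) x = x"
  "e : Hom R (P 1) (C 0)" "!!x. x : $(P 0) ==> h 0 x = e (p 0 x)"
 using assms unfolding null_via_def by blast

text \<open>Restricting the constructed module gives back the two actions on the carrier, but not
  the same records. Identity maps in both directions carry the comparison.\<close>

lemma (in fin_dim_algebra) lattice_construction:
 fixes LA :: "('a, nat => 'k) module" and LR :: "('k polyn, nat => 'k) module"
 assumes B: "bimodule A LA (poly d) LR"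
  and compat: "!!k x. k : $K ==> x : $LR ==> (k .[A] 1[A]) .[LA] x = (k .[poly d] 1[poly d]) .[LR] x"
  and db: "fin_dual_basis (poly d) LR I b c"
 obtains L where "is_lattice K A d L" "bimodule A (lleft K A d L) (poly d) (lright K A d L)"
  "(%x. x) : Hom A LA (lleft K A d L)" "(%x. x) : Hom A (lleft K A d L) LA"
  "(%x. x) : Hom (poly d) LR (lright K A d L)" "(%x. x) : Hom (poly d) (lright K A d L) LR"
proof -
 interpret TA: tensor_algebra K A "poly d" by (rule poly_tensor_algebra)
 interpret B: bimodule A LA "poly d" LR by fact
 note tl = TA.tensor_act_lattice[OF B compat db] and tr = TA.tensor_act_restrict[OF B compat]
 show thesis
  by (rule that[of "TA.tensor_act LA LR"])
   (use tl TA.module_bimodule(1)[OF tl(1)] tr in "auto simp: is_lattice_def lattice_left_def lattice_right_def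
    TA.tensor_act_simps intro!: lin_mapsI")
qed

text \<open>The contrapositive form: nullity for the second lattice has to imply nullity for the
  first. The dual bases of the terms of \<open>P\<close> are handed over so that restriction of
  scalars can preserve their projectivity.\<close>

lemma (in fin_dim_algebra) oppermann_set_subset:
 fixes L :: "('k, 'a) lattice" and L' :: "('k, 'b) lattice" and A' :: "('k, 'b, 'u) module_scheme"
 assumes L: "is_lattice K A d L" and L': "is_lattice K A' d L'" and A': "fin_dim_algebra K A'" and d: "1 <= d"
  and tr: "!!aa C f P p P' p'. (C, f) : extensions (poly d) d (simple_at (poly d) aa) (simple_at (poly d) aa) ==>
   resolution A d (P, p) ==> P (Suc d) = bt (poly d) (lleft K A d L) (lright K A d L) (simple_at (poly d) aa) ==>
   (!!i. 1 <= i ==> i <= d ==> EX (I :: 'k tens set) b c. dual_basis A (P i) I b c) ==>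
   resolution A' d (P', p') ==> P' (Suc d) = bt (poly d) (lleft K A' d L') (lright K A' d L') (simple_at (poly d) aa) ==>
   null_via A' d (P', p') (bt_seq (poly d) (lleft K A' d L') (lright K A' d L') (C, f)) ==>
   null_via A d (P, p) (bt_seq (poly d) (lleft K A d L) (lright K A d L) (C, f))"
 shows "oppermann_set K A d L <= oppermann_set K A' d L'"
proof
 interpret A': fin_dim_algebra K A' by fact
 fix aa assume aa: "aa : oppermann_set K A d L"
 let ?S = "simple_at (poly d) aa"
 let ?b = "bt (poly d) (lleft K A d L) (lright K A d L)"
 let ?b' = "bt (poly d) (lleft K A' d L') (lright K A' d L')"
 obtain E where "E : eps_sequences K d aa" using aa by (auto simp: oppermann_set_def)
 then have "(fst E, snd E) : extensions (poly d) d ?S ?S" using eps_extension by simp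
 from extension_modules(1)[OF this] have S: "lmod (poly d) ?S" .
 have "lmod A (?b ?S)" "lmod A' (?b' ?S)"
  using flat_lattice[OF L] A'.flat_lattice[OF L'] bimodule.bt_left_module[OF _ S]
  by (metis flat_bimodule.axioms(1))+
 then obtain P p P' p' where P: "resolution A d (P, p)" "P (Suc d) = ?b ?S"
   "!!i. 1 <= i ==> i <= d ==> EX (I :: 'k tens set) b c. dual_basis A (P i) I b c"
  and P': "resolution A' d (P', p')" "P' (Suc d) = ?b' ?S"
  using resolution_exists[of "?b ?S" d] A'.resolution_exists[of "?b' ?S" d] by metis
 obtain C f where Cf: "(C, f) : eps_sequences K d aa" "aa : max_spec (poly d)"
  and n: "~ null_via A d (P, p) (bt_seq (poly d) (lleft K A d L) (lright K A d L) (C, f))"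
  using aa unfolding oppermann_set_iff[OF L d P(1,2)] by auto
 show "aa : oppermann_set K A' d L'"
  unfolding A'.oppermann_set_iff[OF L' d P'] using Cf n tr[OF eps_extension[OF Cf(1)] P P'] by blast
qed

text \<open>A subset of the maximal spectrum that contains a dense one is dense, so lattices of the
  same dimension suffice.\<close>

lemma (in fin_dim_algebra) Odim_mono:
 assumes A': "fin_dim_algebra K A'"
  and ex: "!!d L. 1 <= d ==> is_lattice K A d L ==>
   EX L'. is_lattice K A' d L' & oppermann_set K A d L <= oppermann_set K A' d L'"
 shows "Odim K A <= Odim K A'"
proof -
 have "EX L'. oppermann_lattice K A' d L'" if d: "1 <= d" and L: "oppermann_lattice K A d L" for d L
 proof -
  obtain L' where L': "is_lattice K A' d L'" "oppermann_set K A d L <= oppermann_set K A' d L'"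
   using ex[OF d, of L] L unfolding oppermann_lattice_def by blast
  have "max_spec (poly d) <= zariski (poly d) closure_of oppermann_set K A' d L'"
   using closure_of_mono[OF L'(2), of "zariski (poly d)"] L by (simp add: oppermann_lattice_def)
  then show ?thesis
   using L'(1) closure_of_subset_topspace[of "zariski (poly d)"] topspace_zariski[OF K.poly_cring[of d]]
   unfolding oppermann_lattice_def by (intro exI[of _ L'] conjI equalityI) auto
 qed
 then show ?thesis unfolding Odim_def by (intro Sup_subset_mono) blast
qed

context graded_algebra begin

lemma fin_dim_algebras:
 assumes "field K" "fin_gen K A" shows "fin_dim_algebra K A" "fin_dim_algebra K B"
 using assms smash_assoc_algebra smash_fin_gen assoc_algebra_axioms
 by (simp_all add: fin_dim_algebra_def fin_dim_algebra_axioms_def)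

text \<open>The lattice is restricted along \<open>emb\<close>. Nullity over \<open>A\<close> yields
  an \<open>A\<close>-linear factor of the cocycle, and averaging makes the factor linear over the
  smash product without changing the cocycle, which is linear over the smash product
  already.\<close>

lemma oppermann_set_smash:
 assumes K: "field K" and fg: "fin_gen K A" and L: "is_lattice K B d L" and d: "1 <= d"
 shows "EX L'. is_lattice K A d L' & oppermann_set K B d L <= oppermann_set K A d L'"
proof -
 let ?R = "polya K d"
 note fA = fin_dim_algebras(1)[OF K fg] and fB = fin_dim_algebras(2)[OF K fg]
 note TA = fin_dim_algebra.poly_tensor_algebra[OF fA, of d] and TB = fin_dim_algebra.poly_tensor_algebra[OF fB, of d]
 define LB where "LB = lleft K B d L"
 define LR where "LR = lright K B d L"
 define LA where "LA = rsc emb LB"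
 obtain I :: "(nat => 'k) set" and b c where fl: "flat_bimodule B LB ?R LR I b c"
  using fin_dim_algebra.flat_lattice[OF fB L] unfolding LB_def LR_def by blast
 note bB = flat_bimodule.axioms(1)[OF fl]
 have bA: "bimodule A LA ?R LR" unfolding LA_def by (rule restrict_bimodule[OF ring_axioms emb_hom bB])
 have flA: "flat_bimodule A LA ?R LR I b c" using fl bA by (simp add: flat_bimodule_def)
 have hL: "lmod (tensor_ring K B ?R) L" using L by (simp add: is_lattice_def)
 have compat: "(k .[A] 1[A]) .[LA] x = (k .[?R] 1[?R]) .[LR] x" if "k : $K" "x : $LR" for k x
 proof -
  have "emb (k .[A] 1[A]) = k .[B] 1[B]" by (auto simp: emb_def smash_simps)
  then show ?thesis using tensor_algebra.module_bimodule(2)[OF TB hL that(1), of x] that(2)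
   by (simp add: LA_def LB_def LR_def lattice_left_def lattice_right_def)
 qed
 obtain L' where L': "is_lattice K A d L'" and b': "bimodule A (lleft K A d L') ?R (lright K A d L')"
  and id: "(%x. x) : Hom A LA (lleft K A d L')" "(%x. x) : Hom A (lleft K A d L') LA"
   "(%x. x) : Hom ?R LR (lright K A d L')" "(%x. x) : Hom ?R (lright K A d L') LR"
  by (rule fin_dim_algebra.lattice_construction[OF fA bA compat flat_bimodule.db[OF fl]])
 have "oppermann_set K B d L <= oppermann_set K A d L'"
 proof (rule fin_dim_algebra.oppermann_set_subset[OF fB L L' fA d])
  fix aa and C :: "nat => ('k polyn, 'k polyn set) module" and f :: "nat => 'k polyn set => 'k polyn set"
   and P :: "nat => ('g => 'a, 'k tens) module" and p :: "nat => 'k tens => 'k tens"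
   and P' :: "nat => ('a, 'k tens) module" and p' :: "nat => 'k tens => 'k tens"
  let ?S = "simple_at ?R aa" and ?b = "bt ?R LB LR" and ?A = "bt ?R LA LR"
  let ?b' = "bt ?R (lleft K A d L') (lright K A d L')"
  let ?f = "%i. tmap ?R LR (C (Suc i)) (%x. x) (f i)"
  assume E: "(C, f) : Defs.extensions ?R d ?S ?S"
   and P: "resolution B d (P, p)" "P (Suc d) = bt ?R (lleft K B d L) (lright K B d L) ?S"
    "!!i. 1 <= i ==> i <= d ==> EX (I :: 'k tens set) b c. dual_basis B (P i) I b c"
   and P': "resolution A d (P', p')" "P' (Suc d) = ?b' ?S"
   and n: "null_via A d (P', p') (bt_seq ?R (lleft K A d L') (lright K A d L') (C, f))"
  note D = extensionsD[OF E]
  have S: "lmod ?R ?S" using extension_modules[OF E] by simp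
  note EB = flat_bimodule.bt_extension[OF fl E, unfolded bt_seq_def prod.case]
  have PB: "P (Suc d) = ?b ?S" using P(2) by (simp add: LB_def LR_def)
  obtain h where h: "smor B d (P, p) (%i. ?b (C i), ?f) h" "!!x. x : $(P (Suc d)) ==> h (Suc d) x = x"
   using extension_rep[OF resolutionD(2)[OF P(1)] PB EB] by blast
  have PAex: "lexact A d (%i. rsc emb (P i), p)"
   by (rule restrict_long_exact[OF ring_axioms emb_hom resolutionD(1)[OF P(1)]])
  \<comment> \<open>The restricted resolution is the source of the comparison over \<open>A\<close>,
    so its terms have to remain projective there.\<close>
  have PA: "proj_complex A d (%i. rsc emb (P i), p)"
  proof (rule exact_proj_complex[OF PAex])
   fix i assume i: "1 <= i" "i <= d"
   obtain I :: "'k tens set" and b c where db: "dual_basis B (P i) I b c"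
    using P(3)[OF i] by blast
   have "lmod B (P i)" using long_exactD(1)[OF resolutionD(1)[OF P(1)]] i by simp
   from restrict_dual_basis[OF this db] show "liftable A (rsc emb (P i))"
    using long_exactD(1)[OF PAex] i by (intro dual_basis_liftable) auto
  qed
  have hA: "smor A d (%i. rsc emb (P i), p) (%i. ?A (C i), ?f) h"
   using restrict_seq_morphism[OF emb_hom h(1)] by (simp add: restrict_bt LA_def)
  note EA = flat_bimodule.bt_long_exact[OF flA D(1), unfolded bt_seq_def prod.case]
  obtain I' :: "(nat => 'k) set" and b'' c' where fl': "flat_bimodule A (lleft K A d L') ?R (lright K A d L') I' b'' c'"
   using fin_dim_algebra.flat_lattice[OF fA L'] by blast
  note EA' = flat_bimodule.bt_long_exact[OF fl' D(1), unfolded bt_seq_def prod.case]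
  obtain h' e' where
   h': "smor A d (P', p') (%i. ?b' (C i), %i. tmap ?R (lright K A d L') (C (Suc i)) (%x. x) (f i)) h'"
    "!!x. x : $(P' (Suc d)) ==> h' (Suc d) x = x"
   and e': "e' : Hom A (P' 1) (?b' (C 0))" "!!x. x : $(P' 0) ==> h' 0 x = e' (p' 0 x)"
   by (rule null_viaE[OF n[unfolded bt_seq_def prod.case]]) (rule that)
  \<comment> \<open>\<open>L'\<close> has the same underlying modules as the restriction, so this
    morphism and its retraction \<open>pp\<close> both come from the identity map.\<close>
  note i = bt_seq_left_morphism[OF bA b' id(3,1) D(1), unfolded bt_seq_def prod.case]
  have C0: "lmod ?R (C 0)" using D(2) S by simp
  have pp: "tmap ?R LR (C 0) (%x. x) (%y. y) : Hom A (?b' (C 0)) (?A (C 0))"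
   by (rule bt_map[OF b' bA C0 C0 id(4,2) lin_ident])
  note tp = bimodule.tp[OF bA C0] bimodule.tp[OF b' C0]
  have ppi: "tmap ?R LR (C 0) (%x. x) (%y. y) (tmap ?R (lright K A d L') (C 0) (%x. x) (%y. y) z) = z"
   if "z : $(?A (C 0))" for z
   unfolding tensor_map_comp[OF tp(1,2,1) id(3) lin_ident id(4) lin_ident that]
   by (rule tensor_map_id[OF tp(1) refl refl that])
  have P'd: "P' (Suc d) = ?b' (C (Suc d))" using P'(2) D(3) by simp
  from retract_null[OF PA EA EA' resolutionD(1)[OF P'(1)] P'd hA h' e' i pp ppi]
  obtain e where e: "e : Hom A (rsc emb (P 1)) (rsc emb (?b (C 0)))"
   "!!x. x : $(P 0) ==> h 0 x = e (p 0 x)" by (auto simp: restrict_bt LA_def)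
  have mods: "lmod B (P 1)" "lmod B (?b (C 0))" "lmod B (P 0)"
   using long_exactD(1)[OF resolutionD(1)[OF P(1)]] bimodule.bt_left_module[OF bB C0] by auto
  interpret PM1: left_module B "P 0" by fact
  interpret PM2: left_module B "?b (C 0)" by fact
  note p0 = long_exactD(2)[OF resolutionD(1)[OF P(1)], of 0, simplified]
  note h0 = seq_morphismD(1)[OF h(1), of 0, simplified]
  show "null_via B d (P, p) (bt_seq ?R (lleft K B d L) (lright K B d L) (C, f))"
   unfolding LB_def[symmetric] LR_def[symmetric] bt_seq_def prod.case
  proof (rule null_viaI[OF h average[OF mods(1,2) e(1)]])
   fix x assume x: "x : $(P 0)"
   have px: "pj k .[P 0] x : $(P 0)" for k using x pj_closed by simp
   have hx: "h 0 x : $(?b (C 0))" by (rule lin_closed[OF h0 x])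
   \<comment> \<open>As \<open>h 0\<close> and \<open>p 0\<close> commute with \<open>p_k\<close>,
     the averaged factor at \<open>p 0 x\<close> is the sum of the \<open>p_k (h 0 x)\<close>; the
     idempotents add up to \<open>1\<close>.\<close>
   have "(SUM[?b (C 0)]k:GG. pj k .[?b (C 0)] e (pj k .[P 1] p 0 x)) = (SUM[?b (C 0)]k:GG. pj k .[?b (C 0)] h 0 x)"
   proof (intro PM2.M.finsum_cong' refl)
    fix k assume k: "k : GG"
    have "e (pj k .[P 1] p 0 x) = pj k .[?b (C 0)] h 0 x"
     using e(2)[OF px[of k]] lin_smult[OF p0 pj_closed x, of k] lin_smult[OF h0 pj_closed x, of k] by simp
    then show "pj k .[?b (C 0)] e (pj k .[P 1] p 0 x) = pj k .[?b (C 0)] h 0 x"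
     using hx k pj_closed by (simp add: PM2.smult_assoc1[symmetric] pj_pj)
   qed (use hx pj_closed in auto)
   also have "... = h 0 x"
    using PM2.finsum_smult[OF hx, of pj GG] hx pj_closed by (simp add: pj_sum PM2.smult_one)
   finally show "h 0 x = (SUM[?b (C 0)]k:GG. pj k .[?b (C 0)] e (pj k .[P 1] p 0 x))" by simp
  qed
 qed
 then show ?thesis using L' by blast
qed

lemma Odim_smash_le:
 assumes "field K" "fin_gen K A" shows "Odim K B <= Odim K A"
 using fin_dim_algebra.Odim_mono[OF fin_dim_algebras(2)[OF assms] fin_dim_algebras(1)[OF assms]]
  oppermann_set_smash[OF assms] by blast

end

section \<open>Separably graded algebras\<close>

lemma transport_bimodule:
 assumes "bimodule A LA R LR" "inj_on e $LR"
 shows "bimodule A (transport e LA) R (transport e LR)"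
proof -
 interpret bimodule A LA R LR by fact
 have inj: "inj_on e $LA" using assms(2) by simp
 interpret TA: left_module A "transport e LA" by (rule transport(1)[OF LA.lself inj])
 interpret TR: left_module R "transport e LR" by (rule transport(1)[OF LR.lself assms(2)])
 show ?thesis
  by unfold_locales (use assms(2) in "auto simp: transport_def Let_def add_eq actions_commute")
qed

lemma fun_dual_basis:
 assumes M: "lmod R M" and db: "fin_dual_basis R M I b c" and U: "finite U"
 shows "fin_dual_basis R (Fun U M) (U \<times> I) (%(j, i). fun_unit U M j (b i)) (%(j, i) u. c i (u j))"
 unfolding fin_dual_basis_def
proof (intro conjI ballI)
 interpret left_module R M by fact
 interpret F: left_module R "Fun U M" by (rule fun_left_module[OF M])
 note D = fin_dual_basisD[OF db]
 show "finite (U \<times> I)" using U D(1) by simp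
 {
  fix p assume "p : U \<times> I"
  then obtain j i where p: "p = (j, i)" "j : U" "i : I" by auto
  show "(%(j, i). fun_unit U M j (b i)) p : $(Fun U M)"
   using p D(2) by (auto intro!: lin_closed[OF fun_unit_lin])
  show "(%(j, i) u. c i (u j)) p : Hom R (Fun U M) (regm R)"
   using p lin_comp[OF fun_eval_lin[OF p(2)] D(3)[OF p(3)]] by simp
 }
 fix u assume u: "u : $(Fun U M)"
 then have uj: "u j : $M" if "j : U" for j using that by (auto simp: Fun_simps)
 have bc: "fun_unit U M j (b i) : $(Fun U M)" if "i : I" for j i
  using D(2)[OF that] by (rule lin_closed[OF fun_unit_lin])
 have "u = (SUM[Fun U M]j:U. fun_unit U M j (u j))" using fun_expand[OF U u] by simp
 also have "... = (SUM[Fun U M]j:U. SUM[Fun U M]i:I. c i (u j) .[Fun U M] fun_unit U M j (b i))"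
 proof (intro F.M.finsum_cong' refl)
  fix j assume j: "j : U"
  have "fun_unit U M j (SUM[M]i:I. c i (u j) .[M] b i) = (SUM[Fun U M]i:I. fun_unit U M j (c i (u j) .[M] b i))"
   using D(2,4) uj[OF j] by (intro lin_finsum[OF M F.lself fun_unit_lin]) auto
  also have "... = (SUM[Fun U M]i:I. c i (u j) .[Fun U M] fun_unit U M j (b i))"
   using D(2,4) uj[OF j] bc by (intro F.M.finsum_cong') (auto simp: lin_smult[OF fun_unit_lin])
  finally show "fun_unit U M j (u j) = (SUM[Fun U M]i:I. c i (u j) .[Fun U M] fun_unit U M j (b i))"
   using D(5)[OF uj[OF j]] by simp
 qed (use D(4) uj bc in "auto intro!: F.M.finsum_closed")
 also have "... = (SUM[Fun U M]p:U \<times> I. c (snd p) (u (fst p)) .[Fun U M] fun_unit U M (fst p) (b (snd p)))"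
  using D(1,4) U uj bc by (intro F.finsum_double) auto
 finally show "(SUM[Fun U M]p:U \<times> I. (%(j, i) u. c i (u j)) p u .[Fun U M] (%(j, i). fun_unit U M j (b i)) p) = u"
  by (simp add: split_beta)
qed

text \<open>Lattice carriers lie in \<open>nat => 'k\<close>; finitely many such functions are
  interleaved by means of the bijection between \<open>nat\<close> and pairs.\<close>

lemma fun_encoding:
 assumes "finite U" obtains e :: "('x => nat => 'k) => nat => 'k" where "inj_on e (extensional U)"
proof -
 obtain nu :: "'x => nat" where nu: "inj_on nu U" using finite_imp_inj_to_nat_seg[OF assms] by metis
 have "inj_on (%(f :: 'x => nat => 'k) n. f (inv_into U nu (fst (prod_decode n))) (snd (prod_decode n))) (extensional U)"
 proof (rule inj_onI)
  fix f g :: "'x => nat => 'k"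
  assume fg: "f : extensional U" "g : extensional U"
   "(%n. f (inv_into U nu (fst (prod_decode n))) (snd (prod_decode n))) =
   (%n. g (inv_into U nu (fst (prod_decode n))) (snd (prod_decode n)))"
  show "f = g"
  proof (rule extensionalityI[OF fg(1,2)])
   fix x assume x: "x : U"
   show "f x = g x"
   proof (rule ext)
    fix j show "f x j = g x j" using fun_cong[OF fg(3), of "prod_encode (nu x, j)"] nu x by simp
   qed
  qed
 qed
 then show thesis by (rule that)
qed

context graded_algebra begin

text \<open>
 Modules over the smash product are graded modules; this one is \<open>LA\<close> with the free \<open>G\<close>-grading,
 that is, the module of all functions from \<open>G\<close> to \<open>LA\<close>.
\<close>

definition coind :: "('a, 'l, 'u) module_scheme => ('g => 'a, 'g => 'l) module" where
 "coind LA = \<lparr>carrier = GG \<rightarrow>\<^sub>E $LA, monoid.mult = undefined, monoid.one = undefined,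
  ring.zero = (%g:GG. 0[LA]), ring.add = (%u v. %g:GG. u g +[LA] v g),
  module.smult = (%u l. %g:GG. SUM[LA]h:GG. cpt (u h) (g /[G] h) .[LA] l h)\<rparr>"

lemma coind_simps:
 "$(coind LA) = GG \<rightarrow>\<^sub>E $LA" "0[coind LA] = (%g:GG. 0[LA])"
 "l +[coind LA] m = (%g:GG. l g +[LA] m g)"
 "u .[coind LA] l = (%g:GG. SUM[LA]h:GG. cpt (u h) (g /[G] h) .[LA] l h)"
 by (simp_all add: coind_def)

text \<open>The element \<open>a p_h\<close> takes the entry at \<open>h\<close>, multiplies it by
  the components of \<open>a\<close> and puts the product with the component of degree
  \<open>g/h\<close> at \<open>g\<close>. Associativity is again the telescoping of degrees.\<close>

lemma coind_left_module:
 assumes LA: "lmod A LA" shows "lmod B (coind LA)"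
proof -
 interpret LA: left_module A LA by fact
 interpret SB: assoc_algebra K B by (rule smash_assoc_algebra)
 have c: "cpt (u h) (g /[G] h) : $A" if "u : $B" "h : GG" "g : GG" for u h g
  using that smash_mem by (intro component_closed) auto
 have l: "l g : $LA" if "l : $(coind LA)" "g : GG" for l g
  using that by (auto simp: coind_simps)
 have ext: "l : extensional GG" if "l : $(coind LA)" for l using that by (auto simp: coind_simps PiE_iff)
 show ?thesis
 proof (rule left_moduleI)
  fix x assume "x : $(coind LA)"
  then show "EX y:$(coind LA). y +[coind LA] x = 0[coind LA]"
   by (intro bexI[of _ "%g:GG. -[LA] x g"]) (auto simp: coind_simps LA.M.l_neg PiE_iff intro!: restrict_ext)
 next
  fix u x assume "u : $B" "x : $(coind LA)"
  then show "u .[coind LA] x : $(coind LA)"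
   using c l by (auto simp: coind_simps(1,4) intro!: LA.M.finsum_closed)
 next
  fix u v x assume *: "u : $B" "v : $B" "x : $(coind LA)"
  show "(u +[B] v) .[coind LA] x = u .[coind LA] x +[coind LA] v .[coind LA] x"
   unfolding coind_simps(3,4)
  proof (rule restrict_ext)
   fix g assume g: "g : GG"
   have "(SUM[LA]h:GG. cpt ((u +[B] v) h) (g /[G] h) .[LA] x h) =
     (SUM[LA]h:GG. cpt (u h) (g /[G] h) .[LA] x h +[LA] cpt (v h) (g /[G] h) .[LA] x h)"
    using * g c l smash_mem by (intro LA.M.finsum_cong') (auto simp: smash_simps(4) comp_add LA.smult_l_distr)
   also have "... = (SUM[LA]h:GG. cpt (u h) (g /[G] h) .[LA] x h) +[LA] (SUM[LA]h:GG. cpt (v h) (g /[G] h) .[LA] x h)"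
    using * g c l by (intro LA.M.finsum_addf) auto
   finally show "(SUM[LA]h:GG. cpt ((u +[B] v) h) (g /[G] h) .[LA] x h) =
    (%g:GG. SUM[LA]h:GG. cpt (u h) (g /[G] h) .[LA] x h) g +[LA] (%g:GG. SUM[LA]h:GG. cpt (v h) (g /[G] h) .[LA] x h) g"
    using g by simp
  qed
  show "(u *[B] v) .[coind LA] x = u .[coind LA] (v .[coind LA] x)"
   unfolding coind_simps(4)
  proof (rule restrict_ext)
   fix g assume g: "g : GG"
   let ?t = "%h k. cpt (u k) (g /[G] k) .[LA] (cpt (v h) (k /[G] h) .[LA] x h)"
   have "(SUM[LA]h:GG. cpt ((u *[B] v) h) (g /[G] h) .[LA] x h) = (SUM[LA]h:GG. SUM[LA]k:GG. ?t h k)"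
   proof (intro LA.M.finsum_cong' refl)
    fix h assume h: "h : GG"
    have "cpt ((u *[B] v) h) (g /[G] h) = (SUM[A]k:GG. cpt (u k) (g /[G] k) *[A] cpt (v h) (k /[G] h))"
     unfolding smash_simps(6)[OF h]
    proof (subst comp_finsum)
     show "(SUM[A]k:GG. cpt (u k *[A] cpt (v h) (k /[G] h)) (g /[G] h)) =
       (SUM[A]k:GG. cpt (u k) (g /[G] k) *[A] cpt (v h) (k /[G] h))"
     proof (intro finsum_cong' refl)
      fix k assume k: "k : GG"
      show "cpt (u k *[A] cpt (v h) (k /[G] h)) (g /[G] h) =
        cpt (u k) (g /[G] k) *[A] cpt (v h) (k /[G] h)"
       using comp_mult_right[OF smash_mem[OF *(1) k] comp_mem[OF smash_mem[OF *(2) h]], of "k /[G] h" "g /[G] h"] g h k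
       by (simp add: group_simps)
     qed (use * g h c in auto)
    qed (use * g h c smash_mem[OF *(1)] in auto)
    then have "cpt ((u *[B] v) h) (g /[G] h) .[LA] x h =
      (SUM[LA]k:GG. (cpt (u k) (g /[G] k) *[A] cpt (v h) (k /[G] h)) .[LA] x h)"
     using * g h c l by (simp add: LA.finsum_smult)
    also have "... = (SUM[LA]k:GG. ?t h k)"
     using * g h c l by (intro LA.M.finsum_cong') (auto simp: LA.smult_assoc1)
    finally show "cpt ((u *[B] v) h) (g /[G] h) .[LA] x h = (SUM[LA]k:GG. ?t h k)" .
   qed (use * g c l in "auto intro!: LA.M.finsum_closed")
   also have "... = (SUM[LA]k:GG. SUM[LA]h:GG. ?t h k)"
    using * g c l by (intro LA.finsum_swap finite_group) auto
   also have "... = (SUM[LA]k:GG. cpt (u k) (g /[G] k) .[LA] (%g:GG. SUM[LA]h:GG. cpt (v h) (g /[G] h) .[LA] x h) k)"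
    using * g c l by (intro LA.M.finsum_cong') (auto simp: LA.smult_finsum)
   finally show "(SUM[LA]h:GG. cpt ((u *[B] v) h) (g /[G] h) .[LA] x h) =
    (SUM[LA]k:GG. cpt (u k) (g /[G] k) .[LA] (%g:GG. SUM[LA]h:GG. cpt (v h) (g /[G] h) .[LA] x h) k)" .
  qed
 next
  fix u x y assume *: "u : $B" "x : $(coind LA)" "y : $(coind LA)"
  show "u .[coind LA] (x +[coind LA] y) = u .[coind LA] x +[coind LA] u .[coind LA] y"
   unfolding coind_simps(3,4)
  proof (rule restrict_ext)
   fix g assume g: "g : GG"
   have "(SUM[LA]h:GG. cpt (u h) (g /[G] h) .[LA] (%g:GG. x g +[LA] y g) h) =
     (SUM[LA]h:GG. cpt (u h) (g /[G] h) .[LA] x h +[LA] cpt (u h) (g /[G] h) .[LA] y h)"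
    using * g c l by (intro LA.M.finsum_cong') (auto simp: LA.smult_r_distr)
   also have "... = (SUM[LA]h:GG. cpt (u h) (g /[G] h) .[LA] x h) +[LA] (SUM[LA]h:GG. cpt (u h) (g /[G] h) .[LA] y h)"
    using * g c l by (intro LA.M.finsum_addf) auto
   finally show "(SUM[LA]h:GG. cpt (u h) (g /[G] h) .[LA] (%g:GG. x g +[LA] y g) h) =
    (%g:GG. SUM[LA]h:GG. cpt (u h) (g /[G] h) .[LA] x h) g +[LA] (%g:GG. SUM[LA]h:GG. cpt (u h) (g /[G] h) .[LA] y h) g"
    using g by simp
  qed
 next
  fix x assume x: "x : $(coind LA)"
  show "1[B] .[coind LA] x = x"
  proof (rule extensionalityI)
   fix g assume g: "g : GG"
   have "(1[B] .[coind LA] x) g = (SUM[LA]h:GG. if g = h then x h else 0[LA])"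
    unfolding coind_simps(4) restrict_apply'[OF g]
   proof (intro LA.M.finsum_cong' refl)
    fix h assume h: "h : GG"
    have "1[G] = g /[G] h \<longleftrightarrow> g = h" using quotient_eq_iff[OF g h G.one_closed] g h by auto
    then show "cpt (1[B] h) (g /[G] h) .[LA] x h = (if g = h then x h else 0[LA])"
     using g h l[OF x] by (simp add: smash_simps(3) comp_one LA.smult_one LA.smult_l_null)
   qed (use l[OF x] in auto)
   also have "... = x g" using g l[OF x] finite_group by (intro LA.M.add.finprod_singleton) auto
   finally show "(1[B] .[coind LA] x) g = x g" .
  qed (use ext[OF x] in "auto simp: coind_simps")
 qed (use SB.ring_axioms in "auto simp: coind_simps LA.M.a_ac PiE_iff intro!: restrict_ext extensionalityI[of _ GG]")
qed

lemma coind_bimodule: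
 assumes "bimodule A LA R LR" shows "bimodule B (coind LA) R (Fun GG LR)"
proof -
 interpret bimodule A LA R LR by fact
 interpret F: left_module R "Fun GG LR" by (rule fun_left_module[OF LR.lself])
 interpret C: left_module B "coind LA" by (rule coind_left_module[OF LA.lself])
 have fs: "finsum LA = finsum LR"
  by (intro ext) (simp add: finsum_def finprod_def carrier_eq zero_eq add_eq)
 show ?thesis
 proof unfold_locales
  fix u r l assume *: "u : $B" "r : $R" "l : $(Fun GG LR)"
  have c: "cpt (u h) (g /[G] h) : $A" if "h : GG" "g : GG" for h g
   using that smash_mem[OF *(1)] by (intro component_closed) auto
  have l: "l g : $LR" if "g : GG" for g using * that by (auto simp: Fun_simps)
  show "u .[coind LA] (r .[Fun GG LR] l) = r .[Fun GG LR] (u .[coind LA] l)"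
   unfolding coind_simps Fun_simps fs
  proof (rule restrict_ext)
   fix g assume g: "g : GG"
   have "(SUM[LR]h:GG. cpt (u h) (g /[G] h) .[LA] (%g:GG. r .[LR] l g) h) =
     (SUM[LR]h:GG. r .[LR] (cpt (u h) (g /[G] h) .[LA] l h))"
    using *(2) g c l by (intro LR.M.finsum_cong') (auto simp: actions_commute)
   also have "... = r .[LR] (SUM[LR]h:GG. cpt (u h) (g /[G] h) .[LA] l h)"
    using *(2) g c l by (intro LR.smult_finsum[symmetric]) auto
   finally show "(SUM[LR]h:GG. cpt (u h) (g /[G] h) .[LA] (%g:GG. r .[LR] l g) h) =
    r .[LR] (%g:GG. SUM[LR]h:GG. cpt (u h) (g /[G] h) .[LA] l h) g" using g by simp
  qed
 qed (auto simp: coind_def Fun_def add_eq)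
qed

end

lemma (in left_module) finsum_single_eq:
 assumes "finite U" "j : U" "!!i. i : U ==> g i = (if j = i then y else 0[M])" "y : $M"
 shows "(SUM[M]i:U. g i) = y"
proof -
 have "(SUM[M]i:U. g i) = (SUM[M]i:U. if j = i then y else 0[M])" using assms by (intro M.finsum_cong') auto
 also have "... = y" using assms by (intro M.add.finprod_singleton) auto
 finally show ?thesis .
qed

context graded_algebra begin

lemma coind_scalar:
 assumes LA: "lmod A LA" and k: "k : $K" and l: "l : $(coind LA)"
 shows "(k .[B] 1[B]) .[coind LA] l = (%g:GG. (k .[A] 1[A]) .[LA] l g)"
 unfolding coind_simps(4)
proof (rule restrict_ext)
 interpret LA: left_module A LA by fact
 have lc: "l g : $LA" if "g : GG" for g using l that by (auto simp: coind_simps)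
 fix g assume g: "g : GG"
 show "(SUM[LA]h:GG. cpt ((k .[B] 1[B]) h) (g /[G] h) .[LA] l h) = (k .[A] 1[A]) .[LA] l g"
 proof (rule LA.finsum_single_eq[OF finite_group g])
  fix h assume h: "h : GG"
  have "1[G] = g /[G] h \<longleftrightarrow> g = h" using quotient_eq_iff[OF g h G.one_closed] g h by auto
  then show "cpt ((k .[B] 1[B]) h) (g /[G] h) .[LA] l h =
    (if g = h then (k .[A] 1[A]) .[LA] l g else 0[LA])"
   using g h k lc by (simp add: smash_simps(3,5) comp_smult comp_one AK.smult_r_null LA.smult_l_null)
 qed (use k lc g in simp)
qed

text \<open>
 For a separable grading, \<open>l \<mapsto> (x\<^sup>g l)\<^sub>g\<close> embeds \<open>LA\<close> into the coinduced module, and summation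
 over \<open>G\<close> is a retraction.
\<close>

lemma separable_retract:
 assumes LA: "lmod A LA" and x: "!!g. g : GG ==> x g : Agr 1[G]" "(SUM[A]g:GG. x g) = 1[A]"
  and comm: "!!h g r. h : GG ==> g : GG ==> r : Agr h ==> r *[A] x g = x (h *[G] g) *[A] r"
 shows "(%l. %g:GG. x g .[LA] l) : Hom A LA (rsc emb (coind LA))"
  "(%l. SUM[LA]g:GG. l g) : Hom A (rsc emb (coind LA)) LA"
  "l : $LA ==> (SUM[LA]g:GG. (%g:GG. x g .[LA] l) g) = l"
proof -
 interpret LA: left_module A LA by fact
 have xA: "x g : $A" if "g : GG" for g using homogeneousD(1)[OF G.one_closed x(1)[OF that]] .
 have embc: "emb a .[coind LA] l = (%g:GG. SUM[LA]h:GG. cpt a (g /[G] h) .[LA] l h)"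
  if "a : $A" "l : $(coind LA)" for a l
  using that component_closed unfolding coind_simps(1,4)
  by (intro restrict_ext LA.M.finsum_cong') (auto simp: emb_def)
 show "(%l. %g:GG. x g .[LA] l) : Hom A LA (rsc emb (coind LA))"
 proof (rule lin_mapsI)
  fix a l assume a: "a : $A" and l: "l : $LA"
  have xl: "(%g:GG. x g .[LA] l) : $(coind LA)" using xA l by (auto simp: coind_simps)
  have *: "(SUM[LA]h:GG. cpt a (g /[G] h) .[LA] (x h .[LA] l)) = x g .[LA] (a .[LA] l)" if g: "g : GG" for g
  proof -
   have "(SUM[LA]h:GG. cpt a (g /[G] h) .[LA] (x h .[LA] l)) = (SUM[LA]h:GG. (x g *[A] cpt a (g /[G] h)) .[LA] l)"
   proof (intro LA.M.finsum_cong' refl)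
    fix h assume h: "h : GG"
    \<comment> \<open>The commutation rule of the separable grading in degree \<open>g/h\<close>
      turns \<open>x h\<close> into \<open>x g\<close>, which leaves the sum over \<open>h\<close>;
      the components of \<open>a\<close> then add up to \<open>a\<close>.\<close>
    have "cpt a (g /[G] h) *[A] x h = x g *[A] cpt a (g /[G] h)"
     using comm[OF _ h comp_mem[OF a], of "g /[G] h"] g h by (simp add: group_simps)
    then show "cpt a (g /[G] h) .[LA] (x h .[LA] l) = (x g *[A] cpt a (g /[G] h)) .[LA] l"
     using a g h l xA by (simp add: LA.smult_assoc1[symmetric] component_closed)
   qed (use a g l xA component_closed in auto)
   also have "... = (SUM[A]h:GG. x g *[A] cpt a (g /[G] h)) .[LA] l"
    using a g l xA component_closed by (intro LA.finsum_smult[symmetric]) auto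
   also have "(SUM[A]h:GG. x g *[A] cpt a (g /[G] h)) = x g *[A] (SUM[A]h:GG. cpt a (g /[G] h))"
    using a g xA component_closed finite_group by (intro finsum_rdistr[symmetric]) auto
   also have "(SUM[A]h:GG. cpt a (g /[G] h)) = (SUM[A]h:GG. cpt a (g *[G] h))"
   proof -
    have "(SUM[A]h:GG. cpt a (g /[G] h)) = (SUM[A]h:m_inv G ` GG. cpt a (g *[G] h))"
     using a g component_closed by (subst finsum_reindex) (auto intro: inj_onI)
    also have "m_inv G ` GG = GG" by (auto intro!: image_eqI[of y "m_inv G" "inv\<^bsub>G\<^esub> y" for y])
    finally show ?thesis .
   qed
   also have "... = a" using shift_sum(2)[OF abelian_A, of "cpt a" g] component(2)[OF a] a g
    by (simp add: component_closed Pi_iff)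
   finally show ?thesis using a g l xA by (simp add: LA.smult_assoc1)
  qed
  show "(%g:GG. x g .[LA] (a .[LA] l)) = a .[rsc emb (coind LA)] (%g:GG. x g .[LA] l)"
   unfolding restrict_scalars_simps embc[OF a xl]
  proof (rule restrict_ext)
   fix g assume g: "g : GG"
   have "(SUM[LA]h:GG. cpt a (g /[G] h) .[LA] (%g:GG. x g .[LA] l) h) =
     (SUM[LA]h:GG. cpt a (g /[G] h) .[LA] (x h .[LA] l))"
    using a l xA g by (intro LA.M.finsum_cong') (auto simp: component_closed)
   from sym[OF trans[OF this *[OF g]]] show "x g .[LA] (a .[LA] l) =
     (SUM[LA]h:GG. cpt a (g /[G] h) .[LA] (%g:GG. x g .[LA] l) h)" .
  qed
 qed (auto simp: coind_simps xA LA.smult_r_distr intro!: restrict_ext)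
 show "(%l. SUM[LA]g:GG. l g) : Hom A (rsc emb (coind LA)) LA"
 proof (rule lin_mapsI)
  fix a l assume a: "a : $A" and l': "l : $(rsc emb (coind LA))"
  then have l: "l g : $LA" if "g : GG" for g using that by (auto simp: coind_simps)
  have "(SUM[LA]g:GG. (emb a .[coind LA] l) g) = (SUM[LA]g:GG. SUM[LA]h:GG. cpt a (g /[G] h) .[LA] l h)"
   using a l l' component_closed by (intro LA.M.finsum_cong') (auto simp: embc intro!: LA.M.finsum_closed)
  also have "... = (SUM[LA]h:GG. SUM[LA]g:GG. cpt a (g /[G] h) .[LA] l h)"
   using a l component_closed by (intro LA.finsum_swap finite_group) auto
  also have "... = (SUM[LA]h:GG. a .[LA] l h)"
  proof (intro LA.M.finsum_cong' refl)
   fix h assume h: "h : GG"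
   have "(SUM[LA]g:GG. cpt a (g /[G] h) .[LA] l h) = (SUM[A]g:GG. cpt a (g /[G] h)) .[LA] l h"
    using a l h component_closed by (intro LA.finsum_smult[symmetric]) auto
   then show "(SUM[LA]g:GG. cpt a (g /[G] h) .[LA] l h) = a .[LA] l h"
    using shift_sum(1)[OF abelian_A, of "cpt a" h] component(2)[OF a] a h by (simp add: component_closed Pi_iff)
  qed (use a l in auto)
  also have "... = a .[LA] (SUM[LA]g:GG. l g)" using a l by (intro LA.smult_finsum[symmetric]) auto
  finally show "(SUM[LA]g:GG. (a .[rsc emb (coind LA)] l) g) = a .[LA] (SUM[LA]g:GG. l g)" by simp
 next
  fix l m assume "l : $(rsc emb (coind LA))" "m : $(rsc emb (coind LA))"
  then have lm: "l g : $LA" "m g : $LA" if "g : GG" for g using that by (auto simp: coind_simps)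
  have "(SUM[LA]g:GG. (%g:GG. l g +[LA] m g) g) = (SUM[LA]g:GG. l g +[LA] m g)"
   using lm by (intro LA.M.finsum_cong') auto
  also have "... = (SUM[LA]g:GG. l g) +[LA] (SUM[LA]g:GG. m g)" using lm by (intro LA.M.finsum_addf) auto
  finally show "(SUM[LA]g:GG. (l +[rsc emb (coind LA)] m) g) = (SUM[LA]g:GG. l g) +[LA] (SUM[LA]g:GG. m g)"
   by (simp add: coind_simps)
 qed (auto simp: coind_simps intro!: LA.M.finsum_closed)
 show "(SUM[LA]g:GG. (%g:GG. x g .[LA] l) g) = l" if l: "l : $LA"
 proof -
  have "(SUM[LA]g:GG. (%g:GG. x g .[LA] l) g) = (SUM[LA]g:GG. x g .[LA] l)"
   using xA l by (intro LA.M.finsum_cong') auto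
  then show ?thesis using LA.finsum_smult[OF l, of x GG] xA l x(2) by (simp add: LA.smult_one Pi_iff)
 qed
qed

text \<open>The new lattice is coinduced. Nullity over the smash product restricts to
  \<open>A\<close>, and the old lattice is a retract of the restricted coinduced one, compatibly
  with the actions of \<open>A\<close> and of the polynomial ring; so \<open>retract_null\<close>
  applies directly.\<close>

lemma oppermann_set_coind:
 assumes K: "field K" and fg: "fin_gen K A" and sep: "separably_graded G A Agr"
  and L: "is_lattice K A d L" and d: "1 <= d"
 shows "EX L'. is_lattice K B d L' & oppermann_set K A d L <= oppermann_set K B d L'"
proof -
 let ?R = "polya K d"
 note fA = fin_dim_algebras(1)[OF K fg] and fB = fin_dim_algebras(2)[OF K fg]
 note TA = fin_dim_algebra.poly_tensor_algebra[OF fA, of d]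
 obtain x where x: "!!g. g : GG ==> x g : Agr 1[G]" "(SUM[A]g:GG. x g) = 1[A]"
  "!!h g r. h : GG ==> g : GG ==> r : Agr h ==> r *[A] x g = x (h *[G] g) *[A] r"
  using sep unfolding separably_graded_def by blast
 define LA where "LA = lleft K A d L"
 define LR where "LR = lright K A d L"
 obtain I :: "(nat => 'k) set" and b c where fl: "flat_bimodule A LA ?R LR I b c"
  using fin_dim_algebra.flat_lattice[OF fA L] unfolding LA_def LR_def by blast
 note bA = flat_bimodule.axioms(1)[OF fl]
 interpret bA: bimodule A LA ?R LR by (rule bA)
 let ?F = "Fun GG LR"
 note bC = coind_bimodule[OF bA]
 interpret bC: bimodule B "coind LA" ?R ?F by (rule bC)
 obtain e :: "('g => nat => 'k) => nat => 'k" where e: "inj_on e (extensional GG)"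
  by (rule fun_encoding[OF finite_group])
 have inj: "inj_on e ($?F)" "inj_on e ($(coind LA))"
  using e by (auto simp: Fun_simps coind_simps PiE_def intro: inj_on_subset)
 \<comment> \<open>Elements of the coinduced module are functions on \<open>G\<close>; the recoding
   \<open>e\<close> moves them into the carrier type of lattices.\<close>
 let ?HB = "transport e (coind LA)" and ?HR = "transport e ?F"
 have bH: "bimodule B ?HB ?R ?HR" by (rule transport_bimodule[OF bC inj(1)])
 note tR = transport[OF bC.LR.lself inj(1)] and tB = transport[OF bC.LA.lself inj(2)]
 let ?e' = "inv_into ($?F) e"
 have e': "inv_into ($(coind LA)) e = ?e'" by simp
 have "e (?e' y) = y" if "y : $?HR" for y using that unfolding transport_simps by (rule f_inv_into_f)
 then have db: "fin_dual_basis ?R ?HR (GG \<times> I) (%p. e (case p of (j, i) => fun_unit GG LR j (b i)))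
   (%p y. (case p of (j, i) => (%u. c i (u j))) (?e' y))"
  by (intro fin_dual_basis_iso[OF bC.LR.lself fun_dual_basis[OF bA.LR.lself flat_bimodule.db[OF fl] finite_group]
   tR(2,3) _ tR(1)])
 have hL: "lmod (tensor_ring K A ?R) L" using L by (simp add: is_lattice_def)
 have compat: "(k .[B] 1[B]) .[?HB] y = (k .[?R] 1[?R]) .[?HR] y" if k: "k : $K" and y: "y : $?HR" for k y
 proof -
  obtain l where l: "l : $?F" "y = e l" using y by (auto simp: transport_simps)
  have lg: "l g : $L" if "g : GG" for g using l(1) that by (auto simp: Fun_simps LR_def lattice_right_def)
  have l': "l : $(coind LA)" using l(1) by simp
  have "(k .[A] 1[A]) .[LA] l g = (k .[?R] 1[?R]) .[LR] l g" if "g : GG" for g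
   using tensor_algebra.module_bimodule(2)[OF TA hL k lg[OF that]]
   by (simp add: LA_def LR_def lattice_left_def lattice_right_def)
  then have "(k .[B] 1[B]) .[coind LA] l = (k .[?R] 1[?R]) .[?F] l"
   unfolding coind_scalar[OF bA.LA.lself k l'] Fun_simps(4) by (rule restrict_ext)
  then show ?thesis using l inj by (simp add: transport_def Let_def)
 qed
 obtain L' where L': "is_lattice K B d L'" and b': "bimodule B (lleft K B d L') ?R (lright K B d L')"
  and id: "(%x. x) : Hom B ?HB (lleft K B d L')" "(%x. x) : Hom B (lleft K B d L') ?HB"
   "(%x. x) : Hom ?R ?HR (lright K B d L')" "(%x. x) : Hom ?R (lright K B d L') ?HR"
  by (rule fin_dim_algebra.lattice_construction[OF fB bH compat db])
 let ?LB = "lleft K B d L'" and ?LR = "lright K B d L'"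
 let ?LA' = "rsc emb ?LB"
 have b'': "bimodule A ?LA' ?R ?LR" by (rule restrict_bimodule[OF ring_axioms emb_hom b'])
 \<comment> \<open>The embedding and the retraction of \<open>separable_retract\<close>, combined
   with the recoding \<open>e\<close> and its inverse.\<close>
 define io where "io = (%l. e (%g:GG. x g .[LA] l))"
 define pp where "pp = (%y. SUM[LA]g:GG. ?e' y g)"
 have sr: "(%l. %g:GG. x g .[LA] l) : Hom A LA (rsc emb (coind LA))"
  "(%l. SUM[LA]g:GG. l g) : Hom A (rsc emb (coind LA)) LA"
  "!!l. l : $LA ==> (SUM[LA]g:GG. (%g:GG. x g .[LA] l) g) = l"
  by (rule separable_retract[OF bA.LA.lself x]; assumption)+
 have fs: "finsum LA = finsum LR"
  by (intro ext) (simp add: finsum_def finprod_def bA.carrier_eq bA.zero_eq bA.add_eq)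
 have xl: "(%g:GG. x g .[LA] l) : $?F" if "l : $LR" for l
  using lin_closed[OF sr(1), of l] that by (simp add: Fun_simps coind_simps)
 have xA: "x g : $A" if "g : GG" for g using homogeneousD(1)[OF G.one_closed x(1)[OF that]] .
 have "(%l. %g:GG. x g .[LA] l) : Hom ?R LR ?F" by (intro fun_pointwise_lin bA.act_lin xA)
 then have ioR: "io : Hom ?R LR ?LR" unfolding io_def by (intro lin_comp[OF lin_comp[OF _ tR(2)] id(3)])
 have ioA: "io : Hom A LA ?LA'" unfolding io_def
  by (intro lin_comp[OF lin_comp[OF sr(1) lin_restrict_scalars[OF emb_hom tB(2)]] lin_restrict_scalars[OF emb_hom id(1)]])
 have "(%l. SUM[LR]g:GG. l g) : Hom ?R ?F LR"
  by (rule lin_finsum_map[OF bA.LR.lself fun_eval_lin])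
 then have ppR: "pp : Hom ?R ?LR LR" unfolding pp_def fs by (intro lin_comp[OF lin_comp[OF id(4) tR(3)]])
 have ppA: "pp : Hom A ?LA' LA" unfolding pp_def
  by (rule lin_comp[OF lin_comp[OF lin_restrict_scalars[OF emb_hom id(2)] lin_restrict_scalars[OF emb_hom tB(3), unfolded e']] sr(2)])
 have ppio: "pp (io l) = l" if l: "l : $LR" for l
 proof -
  have "l : $LA" using l by simp
  from sr(3)[OF this] show ?thesis unfolding pp_def io_def inv_into_f_f[OF inj(1) xl[OF l]] .
 qed
 have "oppermann_set K A d L <= oppermann_set K B d L'"
 proof (rule fin_dim_algebra.oppermann_set_subset[OF fA L L' fB d])
  fix aa and C :: "nat => ('k polyn, 'k polyn set) module" and f :: "nat => 'k polyn set => 'k polyn set"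
   and P :: "nat => ('a, 'k tens) module" and p :: "nat => 'k tens => 'k tens"
   and P' :: "nat => ('g => 'a, 'k tens) module" and p' :: "nat => 'k tens => 'k tens"
  let ?S = "simple_at ?R aa" and ?b = "bt ?R LA LR" and ?b' = "bt ?R ?LB ?LR"
  let ?f = "%i. tmap ?R LR (C (Suc i)) (%x. x) (f i)"
  let ?f' = "%i. tmap ?R ?LR (C (Suc i)) (%x. x) (f i)"
  assume E: "(C, f) : Defs.extensions ?R d ?S ?S"
   and P: "resolution A d (P, p)" "P (Suc d) = bt ?R (lleft K A d L) (lright K A d L) ?S"
   and P': "resolution B d (P', p')" "P' (Suc d) = ?b' ?S"
   and n: "null_via B d (P', p') (bt_seq ?R ?LB ?LR (C, f))"
  note D = extensionsD[OF E]
  have S: "lmod ?R ?S" using extension_modules[OF E] by simp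
  note EA = flat_bimodule.bt_extension[OF fl E, unfolded bt_seq_def prod.case]
  have PA: "P (Suc d) = ?b ?S" using P(2) by (simp add: LA_def LR_def)
  obtain h where h: "smor A d (P, p) (%i. ?b (C i), ?f) h" "!!x. x : $(P (Suc d)) ==> h (Suc d) x = x"
   using extension_rep[OF resolutionD(2)[OF P(1)] PA EA] by blast
  obtain I' :: "(nat => 'k) set" and b1 c1 where fl': "flat_bimodule B ?LB ?R ?LR I' b1 c1"
   using fin_dim_algebra.flat_lattice[OF fB L'] by blast
  note EB = flat_bimodule.bt_long_exact[OF fl' D(1), unfolded bt_seq_def prod.case]
  note rE = restrict_long_exact[OF ring_axioms emb_hom]
  obtain h' e1 where h': "smor B d (P', p') (%i. ?b' (C i), ?f') h'" "!!x. x : $(P' (Suc d)) ==> h' (Suc d) x = x"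
   and e1: "e1 : Hom B (P' 1) (?b' (C 0))" "!!x. x : $(P' 0) ==> h' 0 x = e1 (p' 0 x)"
   by (rule null_viaE[OF n[unfolded bt_seq_def prod.case]]) (rule that)
  note i = bt_seq_left_morphism[OF bA b'' ioR ioA D(1), unfolded bt_seq_def prod.case]
  have C0: "lmod ?R (C 0)" using D(2) S by simp
  have pp0: "tmap ?R LR (C 0) pp (%y. y) : Hom A (bt ?R ?LA' ?LR (C 0)) (?b (C 0))"
   by (rule bt_map[OF b'' bA C0 C0 ppR ppA lin_ident])
  note tp = bimodule.tp[OF bA C0] bimodule.tp[OF b'' C0]
  have ppi: "tmap ?R LR (C 0) pp (%y. y) (tmap ?R ?LR (C 0) io (%y. y) z) = z"
   if "z : $(?b (C 0))" for z
   unfolding tensor_map_comp[OF tp(1,2,1) ioR lin_ident ppR lin_ident that]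
   by (rule tensor_map_id[OF tp(1) ppio refl that])
  have P'd: "rsc emb (P' (Suc d)) = bt ?R ?LA' ?LR (C (Suc d))" using P'(2) D(3) by (simp add: restrict_bt)
  have "EX e:Hom A (P 1) (?b (C 0)). ALL x:$(P 0). h 0 x = e (p 0 x)"
   by (rule retract_null[OF resolutionD(2)[OF P(1)] extensionsD(1)[OF EA] rE[OF EB, unfolded restrict_bt]
    rE[OF resolutionD(1)[OF P'(1)]] P'd h(1) restrict_seq_morphism[OF emb_hom h'(1), unfolded restrict_bt] _
    lin_restrict_scalars[OF emb_hom e1(1), unfolded restrict_bt] _ i pp0])
    (simp_all add: h'(2) e1(2) ppi)
  then show "null_via A d (P, p) (bt_seq ?R (lleft K A d L) (lright K A d L) (C, f))"
   unfolding LA_def[symmetric] LR_def[symmetric] bt_seq_def prod.case using null_viaI[OF h] by blast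
 qed
 then show ?thesis using L' by blast
qed

lemma Odim_smash_eq:
 assumes "field K" "fin_gen K A" "separably_graded G A Agr" shows "Odim K B = Odim K A"
 using Odim_smash_le[OF assms(1,2)] oppermann_set_coind[OF assms]
  fin_dim_algebra.Odim_mono[OF fin_dim_algebras[OF assms(1,2)]] by (intro antisym) blast+

end

section \<open>Approximation by a generator-cogenerator\<close>

text \<open>A maximal subspace \<open>W\<close> meeting \<open>U\<close> in zero is a complement,
  and the projection is taken along \<open>W\<close>. Zorn's lemma also covers infinite dimension,
  which occurs for modules over a polynomial ring.\<close>

lemma subspace_projection:
 assumes K: "field K" and V: "lmod K V" and U: "smod U K V"
 obtains p where "p : Hom K V (V@[U])" "!!u. u : U ==> p u = u"
proof -
 interpret K: field K by fact
 interpret V: left_module K V by fact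
 note DU = V.submoduleD[OF U]
 let ?S = "{W. smod W K V & U \<inter> W = {0[V]}}"
 have "\<Union>C : ?S" if C: "C ~= {}" "subset.chain ?S C" for C
 proof -
  have Cm: "smod W K V" "U \<inter> W = {0[V]}" if "W : C" for W using C(2) that by (auto simp: subset.chain_def)
  have tot: "W <= W' | W' <= W" if "W : C" "W' : C" for W W' using C(2) that by (auto simp: subset.chain_def)
  have "smod (\<Union>C) K V"
  proof (rule V.submoduleI')
   fix x y assume "x : \<Union>C" "y : \<Union>C"
   then obtain W W' where W: "W : C" "W' : C" "x : W" "y : W'" by blast
   then obtain W'' where "W'' : C" "x : W''" "y : W''" using tot[OF W(1,2)] by blast
   then show "x +[V] y : \<Union>C" using V.submoduleD(3)[OF Cm(1)] by blast
  next
   fix k x assume k: "k : $K" and "x : \<Union>C"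
   then obtain W where W: "W : C" "x : W" by blast
   then show "k .[V] x : \<Union>C" using V.submoduleD(4)[OF Cm(1)[OF W(1)] k W(2)] by blast
  next
   show "\<Union>C <= $V" using V.submoduleD(1)[OF Cm(1)] by blast
   obtain W where "W : C" using C(1) by blast
   then show "0[V] : \<Union>C" using V.submoduleD(2)[OF Cm(1)] by blast
  qed
  moreover have "U \<inter> \<Union>C = {0[V]}" using C(1) Cm by blast
  ultimately show ?thesis by blast
 qed
 moreover have "?S ~= {}" using V.submodule_zero DU(2) by blast
 ultimately have "EX W:?S. ALL W':?S. W <= W' --> W' = W" by (intro subset_Zorn_nonempty)
 then obtain W where W: "smod W K V" "U \<inter> W = {0[V]}"
  and max: "!!W'. smod W' K V ==> U \<inter> W' = {0[V]} ==> W <= W' ==> W' = W" by auto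
 note DW = V.submoduleD[OF W(1)]
 \<comment> \<open>If \<open>v\<close> had no such decomposition, \<open>W + K v\<close> would still
   meet \<open>U\<close> in zero, since a nonzero coefficient of \<open>v\<close> could be divided
   out and would decompose \<open>v\<close>.\<close>
 have dec: "EX u:U. v -[V] u : W" if v: "v : $V" for v
 proof (rule ccontr)
  assume no: "~ ?thesis"
  let ?W = "{w +[V] k .[V] v | w k. w : W & k : $K}"
  have "smod ?W K V"
  proof (rule V.submoduleI')
   show "0[V] : ?W" using DW(2) v by (intro CollectI exI[of _ "0[V]"] exI[of _ "0[K]"]) (simp add: V.smult_l_null)
  next
   fix x y assume "x : ?W" "y : ?W"
   then obtain w k w' k' where *: "x = w +[V] k .[V] v" "y = w' +[V] k' .[V] v" "w : W" "w' : W" "k : $K" "k' : $K" by blast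
   then have "x +[V] y = (w +[V] w') +[V] (k +[K] k') .[V] v"
    using v DW(1) by (auto simp: V.smult_l_distr V.M.a_ac subset_iff)
   then show "x +[V] y : ?W" using * DW(3) by blast
  next
   fix a x assume a: "a : $K" and "x : ?W"
   then obtain w k where *: "x = w +[V] k .[V] v" "w : W" "k : $K" by blast
   then have "a .[V] x = a .[V] w +[V] (a *[K] k) .[V] v"
    using v a DW(1) by (auto simp: V.smult_r_distr V.smult_assoc1 subset_iff)
   then show "a .[V] x : ?W" using * a DW(4) by blast
  qed (use DW(1) v in auto)
  moreover have "U \<inter> ?W = {0[V]}"
  proof -
   have "x = 0[V]" if xU: "x : U" and x: "x = w +[V] k .[V] v" "w : W" "k : $K" for x w k
   proof (cases "k = 0[K]")
    case True
    then show ?thesis using x v DW(1) xU W(2) by (auto simp: V.smult_l_null subset_iff)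
   next
    case False
    then have ki: "inv\<^bsub>K\<^esub> k : $K" "inv\<^bsub>K\<^esub> k *[K] k = 1[K]" using x(3) K.field_Units by auto
    have wV: "w : $V" "x : $V" using x(2) xU DW(1) DU(1) by auto
    have "inv\<^bsub>K\<^esub> k .[V] x = inv\<^bsub>K\<^esub> k .[V] w +[V] v"
     using x(1,3) ki wV v by (simp add: V.smult_r_distr V.smult_assoc1[symmetric] V.smult_one)
    then have "v = inv\<^bsub>K\<^esub> k .[V] x -[V] inv\<^bsub>K\<^esub> k .[V] w"
     using ki wV v by (simp add: a_minus_def V.M.a_comm[of _ v] V.M.a_assoc V.M.r_neg)
    then have "v -[V] inv\<^bsub>K\<^esub> k .[V] x = -[V] (inv\<^bsub>K\<^esub> k .[V] w)"
     using ki wV by (simp add: a_minus_def V.M.a_comm[of _ "-[V] (inv\<^bsub>K\<^esub> k .[V] w)"] V.M.a_assoc V.M.r_neg)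
    then show ?thesis using no DU(4)[OF ki(1) xU] DW(5)[OF DW(4)[OF ki(1) x(2)]] by auto
   qed
   then show ?thesis using DU(2) calculation V.submoduleD(2) by blast
  qed
  moreover have "W <= ?W"
  proof
   fix w assume "w : W"
   then show "w : ?W" using v DW(1) by (intro CollectI exI[of _ w] exI[of _ "0[K]"]) (auto simp: V.smult_l_null)
  qed
  ultimately have "?W = W" by (rule max)
  moreover have "v : ?W" using v DW(2) by (intro CollectI exI[of _ "0[V]"] exI[of _ "1[K]"]) (auto simp: V.smult_one)
  ultimately have "v : W" by blast
  moreover have "v -[V] 0[V] = v" using V.diff_add_cancel[of v "0[V]"] v by simp
  ultimately show False using no DU(2) by force
 qed
 have uniq: "u = u'" if v: "v : $V" and u: "u : U" "v -[V] u : W" "u' : U" "v -[V] u' : W" for v u u'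
 proof -
  have c: "u : $V" "u' : $V" using u DU(1) by auto
  have "u' -[V] u = (v -[V] u) +[V] -[V] (v -[V] u')"
   using v c V.M.r_neg1[of v "-[V] u"] by (simp add: a_minus_def V.M.minus_add V.M.a_ac)
  then have "u' -[V] u : W" using DW(3)[OF u(2) DW(5)[OF u(4)]] by simp
  moreover have "u' -[V] u : U" unfolding a_minus_def by (rule DU(3)[OF u(3) DU(5)[OF u(1)]])
  ultimately have "u' -[V] u : U \<inter> W" by blast
  then show ?thesis using W(2) V.minus_zero_eq[OF c(2,1)] by auto
 qed
 define p where "p = (%v. SOME u. u : U & v -[V] u : W)"
 have p: "p v : U" "v -[V] p v : W" if "v : $V" for v
  using someI_ex[of "%u. u : U & v -[V] u : W"] dec[OF that] unfolding p_def by blast+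
 have pV: "p v : $V" if "v : $V" for v using p(1)[OF that] DU(1) by auto
 show thesis
 proof (rule that[of p])
  show "p : Hom K V (V@[U])"
  proof (rule lin_mapsI)
   fix x y assume xy: "x : $V" "y : $V"
   have "(x +[V] y) -[V] (p x +[V] p y) = (x -[V] p x) +[V] (y -[V] p y)"
    using xy pV by (simp add: a_minus_def V.M.minus_add V.M.a_ac)
   then have "p (x +[V] y) = p x +[V] p y"
    using xy p DU(3) DW(3) by (intro uniq[of "x +[V] y"]) auto
   then show "p (x +[V] y) = p x +[V@[U]] p y" by simp
  next
   fix k x assume k: "k : $K" and x: "x : $V"
   have "k .[V] x -[V] k .[V] p x = k .[V] (x -[V] p x)"
    using k x pV by (simp add: a_minus_def V.smult_r_distr V.smult_r_minus)
   then have "p (k .[V] x) = k .[V] p x"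
    using k x p DU(4) DW(4) by (intro uniq[of "k .[V] x"]) auto
   then show "p (k .[V] x) = k .[V@[U]] p x" by simp
  qed (use p in simp)
  show "p u = u" if "u : U" for u
   using that p[of u] DU(1) DW(2) by (intro uniq[of u]) (auto simp: a_minus_def V.M.r_neg subset_iff)
 qed
qed

lemma subspace_fin_gen:
 assumes K: "field K" and V: "lmod K V" and fg: "fin_gen K V" and U: "smod U K V"
 shows "fin_gen K (V@[U])"
proof -
 interpret V: left_module K V by fact
 obtain p where p: "p : Hom K V (V@[U])" "!!u. u : U ==> p u = u"
  by (rule subspace_projection[OF K V U]) blast
 have "p ` $V = U" using lin_closed[OF p(1)] p(2) V.submoduleD(1)[OF U] by (force simp: image_iff)
 then show ?thesis using V.fin_gen_image[OF fg V.submodule_left_module[OF U] p(1)] by simp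
qed

lemma regular_fin_dual_basis:
 assumes "ring R" shows "fin_dual_basis R (regm R) {()} (%_. 1[R]) (%_ x. x)"
proof -
 interpret ring R by fact
 show ?thesis by (auto simp: fin_dual_basis_def lin_ident)
qed

lemma (in left_module) fin_gen_free_cover:
 assumes "fin_gen R M"
 obtains S g where "finite S" "S <= $M" "g : Hom R (Fun S (regm R)) M"
  "g ` $(Fun S (regm R)) = $M"
proof -
 obtain S where S: "finite S" "S <= $M"
  "!!x. x : $M ==> EX c. c : S -> $R & x = (SUM[M]s:S. c s .[M] s)"
  by (rule fin_gen_combination[OF assms]) blast
 let ?F = "Fun S (regm R)" and ?g = "%c. SUM[M]s:S. c s .[M] s"
 have g: "?g : Hom R ?F M"
 proof (rule lin_finsum_map[OF lself])
  fix s assume "s : S"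
  then show "(%c. c s .[M] s) : Hom R ?F M"
   using S(2) by (intro lin_mapsI) (auto simp: Fun_simps smult_l_distr smult_assoc1 PiE_iff subset_iff smult_closed)
 qed
 have "x : ?g ` $?F" if x: "x : $M" for x
 proof -
  obtain c where c: "c : S -> $R" "x = ?g c" using S(3)[OF x] by blast
  have "?g c = ?g (restrict c S)"
   using c(1) S(2) by (intro M.finsum_cong') (auto intro!: smult_closed)
  then have "x = ?g (restrict c S)" using c(2) by (rule trans[rotated])
  then show ?thesis using c(1) by (intro image_eqI[of _ _ "restrict c S"]) (simp_all add: Fun_simps)
 qed
 then have "?g ` $?F = $M" using lin_closed[OF g] by blast
 then show thesis by (rule that[OF S(1,2) g])
qed

text \<open>A projection onto the kernel of a finite free cover splits the cover, so
  \<open>V\<close> is a retract of a power of \<open>K\<close>. The factor \<open>unit\<close> in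
  the index type comes from the one-element basis of \<open>K\<close>.\<close>

lemma fin_gen_dual_basis:
 fixes V :: "('k, 'v, 'w) module_scheme"
 assumes K: "field K" and V: "lmod K V" and fg: "fin_gen K V"
 shows "EX (I :: ('v \<times> unit) set) b c. fin_dual_basis K V I b c"
proof -
 interpret K: field K by fact
 interpret V: left_module K V by fact
 obtain S g where S: "finite S" "S <= $V" and g: "g : Hom K (Fun S (regm K)) V"
  "g ` $(Fun S (regm K)) = $V"
  by (rule V.fin_gen_free_cover[OF fg]) (rule that)
 let ?F = "Fun S (regm K)"
 note F = fun_left_module[OF regular_left_module[OF K.ring_axioms], of S]
 interpret F: left_module K ?F by (rule F)
 let ?N = "{c : $?F. g c = 0[V]}"
 obtain p where p: "p : Hom K ?F (?F@[?N])" "!!u. u : ?N ==> p u = u"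
  by (rule subspace_projection[OF K F lin_kernel[OF F V g(1)]]) blast
 have p': "p : Hom K ?F ?F" by (rule lin_enlarge[OF p(1)]) auto
 have pN: "g (p c) = 0[V]" if "c : $?F" for c using lin_closed[OF p(1) that] by simp
 have q: "(%c. c -[?F] p c) : Hom K ?F ?F" by (rule lin_minus_map[OF F lin_ident p'])
 obtain k where k: "k : Hom K (V@[g ` $?F]) ?F" "!!c. c : $?F ==> k (g c) = c -[?F] p c"
 proof (rule lin_factor[OF F V F g(1) q])
  fix c assume "c : $?F" "g c = 0[V]"
  then show "c -[?F] p c = 0[?F]" using p(2)[of c] by (simp add: a_minus_def F.M.r_neg)
 qed blast
 have k': "k : Hom K V ?F" using k(1) by (simp add: g(2))
 have gk: "g (k x) = x" if x: "x : $V" for x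
 proof -
  obtain c where c: "c : $?F" "x = g c" using x unfolding g(2)[symmetric] by (rule imageE)
  have "g (k x) = g c -[V] g (p c)"
   unfolding c(2) k(2)[OF c(1)] by (rule lin_diff[OF F V g(1) c(1) lin_closed[OF p' c(1)]])
  also have "... = (g c -[V] 0[V]) +[V] 0[V]"
   unfolding pN[OF c(1)] using lin_closed[OF g(1) c(1)] by (intro V.M.r_zero[symmetric]) simp
  also have "... = x" unfolding c(2) by (rule V.diff_add_cancel[OF lin_closed[OF g(1) c(1)] V.M.zero_closed])
  finally show ?thesis .
 qed
 have "EX b c. fin_dual_basis K V (S \<times> {()}) b c"
  by (intro exI, rule fin_dual_basis_iso[OF F fun_dual_basis[OF regular_left_module[OF K.ring_axioms]
   regular_fin_dual_basis[OF K.ring_axioms] S(1)] g(1) k' _ V]) (rule gk)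
 then show ?thesis by (rule exI[where x="S \<times> {()}"])
qed

definition scalar :: "('k, 'a, 'w) module_scheme => 'k => 'a" where
 "scalar A k = k .[A] 1[A]"

abbreviation kres :: "('k, 'a, 'w) module_scheme => ('a, 'm, 'v) module_scheme => ('k, 'm) module" where
 "kres A Y \<equiv> rsc (scalar A) Y"

lemma (in assoc_algebra) scalar:
 shows scalar_hom: "scalar A : ring_hom K A"
  and scalar_closed: "k : $K ==> scalar A k : $A"
  and scalar_mult: "k : $K ==> a : $A ==> scalar A k *[A] a = k .[A] a"
  and scalar_central: "k : $K ==> a : $A ==> scalar A k *[A] a = a *[A] scalar A k"
 by (auto intro!: ring_hom_memI simp: scalar_def smult_mult_left smult_mult_right smult_assoc1[symmetric] smult_l_distr R.m_comm)

section \<open>Finitely generated modules as finite dimensional vector spaces\<close>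

context fin_dim_algebra begin

lemma kres_module: "lmod A Y ==> lmod K (kres A Y)"
 by (rule restrict_scalars_left_module[OF K.ring_axioms A.scalar_hom])

lemma kres_submodule:
 assumes "lmod A Y" "smod N A Y" shows "smod N K (kres A Y)"
proof -
 interpret left_module A Y by fact
 interpret KY: left_module K "kres A Y" by (rule kres_module) fact
 show ?thesis using submoduleD[OF assms(2)] A.scalar_closed by (intro KY.submoduleI') auto
qed

lemma smult_lin:
 assumes Z: "lmod A Z" and f: "f : Hom A Y Z" and k: "k : $K"
 shows "(%y. scalar A k .[Z] f y) : Hom A Y Z"
proof -
 interpret Z: left_module A Z by fact
 show ?thesis
  by (rule lin_mapsI)
   (auto simp: lin_closed[OF f] lin_add[OF f] lin_smult[OF f] A.scalar_closed[OF k] Z.smult_r_distr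
    Z.smult_assoc1[symmetric] A.scalar_central[OF k])
qed

lemma kres_fin_gen:
 assumes Y: "lmod A Y" and fg: "fin_gen A Y" shows "fin_gen K (kres A Y)"
proof -
 interpret Y: left_module A Y by fact
 interpret AK: left_module K A by (rule module_imp_left_module) (rule A.module_axioms)
 obtain S g where S: "finite S" "S <= $Y" and g: "g : Hom A (Fun S (regm A)) Y"
  "g ` $(Fun S (regm A)) = $Y"
  by (rule Y.fin_gen_free_cover[OF fg]) (rule that)
 interpret F: left_module K "Fun S A" by (rule fun_left_module[OF AK.lself])
 have eq: "$(Fun S A) = $(Fun S (regm A))" by (simp add: Fun_simps)
 have "g : Hom K (Fun S A) (kres A Y)"
 proof (rule lin_mapsI)
  fix x y assume "x : $(Fun S A)" "y : $(Fun S A)"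
  then show "g (x +[Fun S A] y) = g x +[kres A Y] g y"
   using lin_add[OF g(1), of x y] by (simp add: Fun_simps)
 next
  fix k x assume k: "k : $K" and x: "x : $(Fun S A)"
  then have "k .[Fun S A] x = scalar A k .[Fun S (regm A)] x"
   by (auto simp: Fun_simps A.scalar_mult PiE_iff)
  then show "g (k .[Fun S A] x) = k .[kres A Y] g x"
   using lin_smult[OF g(1) A.scalar_closed[OF k]] x eq by simp
 qed (use lin_closed[OF g(1)] eq in simp)
 then show ?thesis
  using F.fin_gen_image[OF AK.fin_gen_fun[OF S(1) fin_gen_A] kres_module[OF Y]] g(2) eq by simp
qed

lemma fin_gen_kres:
 assumes Y: "lmod A Y" and fg: "fin_gen K (kres A Y)" shows "fin_gen A Y"
proof -
 interpret Y: left_module A Y by fact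
 interpret KY: left_module K "kres A Y" by (rule kres_module[OF Y])
 obtain S where S: "finite S" "S <= $Y" "!!N. smod N K (kres A Y) ==> S <= N ==> N = $Y"
  using fg unfolding KY.fin_gen_iff by auto
 then have "N = $Y" if "smod N A Y" "S <= N" for N using kres_submodule[OF Y that(1)] that(2) by blast
 then show ?thesis unfolding Y.fin_gen_iff using S(1,2) by (intro exI[of _ S]) simp
qed

lemma submodule_fin_gen:
 assumes Y: "lmod A Y" and fg: "fin_gen A Y" and N: "smod N A Y" shows "fin_gen A (Y@[N])"
proof -
 interpret Y: left_module A Y by fact
 have "kres A (Y@[N]) = (kres A Y)@[N]" by (simp add: restrict_scalars_def)
 then show ?thesis
  using subspace_fin_gen[OF K.field_axioms kres_module[OF Y] kres_fin_gen[OF Y fg] kres_submodule[OF Y N]]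
  by (intro fin_gen_kres Y.submodule_left_module[OF N]) simp
qed

text \<open>The component of \<open>y\<close> in a complement of \<open>N\<close> is nonzero, so
  some coordinate of it is nonzero; the functional is this coordinate of the component.\<close>

lemma separating_functional:
 assumes Y: "lmod A Y" and fg: "fin_gen A Y" and N: "smod N A Y" and y: "y : $Y" "y ~: N"
 obtains f where "f : Hom K (kres A Y) (regm K)" "!!n. n : N ==> f n = 0[K]" "f y ~= 0[K]"
proof -
 interpret Y: left_module A Y by fact
 interpret KY: left_module K "kres A Y" by (rule kres_module[OF Y])
 note reg = regular_left_module[OF K.ring_axioms]
 obtain p where p: "p : Hom K (kres A Y) (kres A Y@[N])" "!!u. u : N ==> p u = u"
  by (rule subspace_projection[OF K.field_axioms KY.lself kres_submodule[OF Y N]]) blast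
 have p': "p : Hom K (kres A Y) (kres A Y)" using Y.submoduleD(1)[OF N] by (intro lin_enlarge[OF p(1)]) simp
 let ?q = "%x. x -[kres A Y] p x"
 have q: "?q : Hom K (kres A Y) (kres A Y)" by (rule lin_minus_map[OF KY.lself lin_ident p'])
 have yK: "y : $(kres A Y)" using y(1) by simp
 obtain I :: "('b \<times> unit) set" and b c where db: "fin_dual_basis K (kres A Y) I b c"
  using fin_gen_dual_basis[OF K.field_axioms kres_module[OF Y] kres_fin_gen[OF Y fg]] by blast
 note D = fin_dual_basisD[OF db]
 have "EX i:I. c i (?q y) ~= 0[K]"
 proof (rule ccontr)
  assume "~ ?thesis"
  then have "(SUM[kres A Y]i:I. c i (?q y) .[kres A Y] b i) = (SUM[kres A Y]i:I. 0[kres A Y])"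
   using D(2) KY.smult_l_null by (intro KY.M.finsum_cong') (auto simp del: restrict_scalars_simps)
  then have "?q y = 0[kres A Y]" using D(5)[OF lin_closed[OF q yK]] KY.M.finsum_zero[of I] by (simp del: restrict_scalars_simps)
  then have "y = p y" by (rule KY.minus_zero_eq[OF yK lin_closed[OF p' yK]])
  then show False using lin_closed[OF p(1) yK] y(2) by simp
 qed
 then obtain i where i: "i : I" "c i (?q y) ~= 0[K]" by blast
 show thesis
 proof (rule that[of "%x. c i (?q x)"])
  show "(%x. c i (?q x)) : Hom K (kres A Y) (regm K)" by (rule lin_comp[OF q D(3)[OF i(1)]])
  fix n assume n: "n : N"
  then have "n : $(kres A Y)" using Y.submoduleD(1)[OF N] by auto
  then have "?q n = 0[kres A Y]" using p(2)[OF n] by (simp add: a_minus_def KY.M.r_neg del: restrict_scalars_simps)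
  then show "c i (?q n) = 0[K]" using lin_zero[OF KY.lself reg D(3)[OF i(1)]] by simp
 qed (rule i(2))
qed

end

lemma (in left_module) lin_eq_on_generators:
 assumes S: "!!Q. smod Q R M ==> S <= Q ==> Q = $M" and N: "lmod R N"
  and f: "f : Hom R M N" and g: "g : Hom R M N"
  and eq: "!!s. s : S ==> s : $M & f s = g s" and x: "x : $M"
 shows "f x = g x"
proof -
 interpret N: left_module R N by fact
 let ?Q = "{x : $M. f x = g x}"
 have "smod ?Q R M"
  by (rule submoduleI')
   (auto simp: lin_add[OF f] lin_add[OF g] lin_smult[OF f] lin_smult[OF g] lin_zero[OF lself N f]
    lin_zero[OF lself N g] smult_closed)
 then have "?Q = $M" by (rule S) (use eq in blast)
 then show ?thesis using x by blast
qed

context fin_dim_algebra begin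

text \<open>A functional \<open>f\<close> that separates \<open>y\<close> from \<open>N\<close>
  gives a map into \<open>DA\<close>, sending \<open>x\<close> to the functional with value
  \<open>f (a x)\<close> at \<open>a\<close>; it kills \<open>N\<close> because \<open>N\<close> is
  a submodule. As \<open>DA\<close> is a retract of a power of \<open>M\<close>, some coordinate of
  the image of \<open>y\<close> is nonzero.\<close>

lemma cogenerator_separates:
 assumes M: "generator_cogenerator K A M"
  and Y: "lmod A Y" and fg: "fin_gen A Y" and N: "smod N A Y" and y: "y : $Y" "y ~: N"
 obtains ph where "ph : Hom A Y M" "!!n. n : N ==> ph n = 0[M]" "ph y ~= 0[M]"
proof -
 have lm: "lmod A M" using M by (simp add: generator_cogenerator_def)
 interpret Y: left_module A Y by fact
 interpret M: left_module A M by (rule lm)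
 obtain f where f: "f : Hom K (kres A Y) (regm K)" "!!n. n : N ==> f n = 0[K]" "f y ~= 0[K]"
  by (rule separating_functional[OF Y fg N y]) (rule that)
 have f': "f x : $K" "f (x +[Y] z) = f x +[K] f z" "k : $K ==> f (scalar A k .[Y] x) = k *[K] f x"
  if "x : $Y" "z : $Y" for x z k
  using lin_closed[OF f(1), of x] lin_add[OF f(1), of x z] lin_smult[OF f(1), of k x] that by auto
 define g where "g = (%x. %a:$A. f (a .[Y] x))"
 have g: "g : Hom A Y (dual_module K A)"
 proof (rule lin_mapsI)
  fix x assume x: "x : $Y"
  have "(%a. f (a .[Y] x)) : Hom K A (regm K)"
   by (rule lin_mapsI) (use x in "auto simp: f' Y.smult_l_distr Y.smult_closed Y.smult_assoc1 A.scalar_mult[symmetric] A.scalar_closed")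
  then have "g x : Hom K A (regm K)"
   unfolding g_def by (rule lin_cong[OF module_imp_left_module[OF A.module_axioms]]) simp
  then show "g x : $(dual_module K A)"
   by (simp add: g_def dual_module_def)
 qed (auto simp: g_def dual_module_def f' Y.smult_r_distr Y.smult_closed Y.smult_assoc1 restrict_def fun_eq_iff)
 obtain n i p where i: "i : Hom A (dual_module K A) (powm M n)"
  and p: "!!x. x : $(dual_module K A) ==> p (i x) = x"
  using M unfolding generator_cogenerator_def in_add_def direct_summand_def by metis
 have P: "lmod A (powm M n)" unfolding power_module_fun by (rule fun_left_module[OF lm])
 interpret P: left_module A "powm M n" by (rule P)
 note ig = lin_comp[OF g i]
 have g0: "g 0[Y] = (%a:$A. 0[K])"
  using f(2)[OF Y.submoduleD(2)[OF N]] by (auto simp: g_def Y.smult_r_null)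
 have gN: "g x = g 0[Y]" if "x : N" for x
  unfolding g0 using f(2)[OF Y.submoduleD(4)[OF N _ that]] by (auto simp: g_def)
 have "i (g y) ~= 0[powm M n]"
 proof
  assume "i (g y) = 0[powm M n]"
  then have "p (i (g y)) = p (i (g 0[Y]))" using lin_zero[OF Y P ig] by simp
  then have "g y 1[A] = g 0[Y] 1[A]" using p[OF lin_closed[OF g]] y(1) by simp
  then show False using f(3) y(1) by (simp add: g0) (simp add: g_def Y.smult_one)
 qed
 moreover have "i (g y) : $(powm M n)" by (rule lin_closed[OF ig y(1)])
 ultimately obtain j where j: "j < n" "i (g y) j ~= 0[M]"
  unfolding power_module_def by (simp add: PiE_eq_iff fun_eq_iff) (metis PiE_arb lessThan_iff)
 have e: "(%u. u j) : Hom A (powm M n) M"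
  unfolding power_module_fun using j(1) by (intro fun_eval_lin) simp
 show thesis
 proof (rule that[of "%x. i (g x) j"])
  show *: "(%x. i (g x) j) : Hom A Y M" by (rule lin_comp[OF ig e])
  show "i (g n) j = 0[M]" if "n : N" for n
   unfolding gN[OF that] by (rule lin_zero[OF Y lm *])
 qed (rule j(2))
qed

text \<open>A left approximation by powers of \<open>M\<close> of the quotient of \<open>Y\<close>
  by \<open>N\<close>, written as a map on \<open>Y\<close>. The maps to \<open>M\<close> that kill
  \<open>N\<close> form a finite dimensional space; finitely many of them that span it are the
  coordinates of \<open>g\<close>. The kernel is no larger than \<open>N\<close> because these maps
  separate.\<close>

lemma approximation:
 assumes M: "generator_cogenerator K A M"
  and Y: "lmod A Y" and fg: "fin_gen A Y" and N: "smod N A Y"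
 obtains n g where "g : Hom A Y (powm M n)" "{x : $Y. g x = 0[powm M n]} = N"
  "!!vv. vv : Hom A Y M ==> (!!x. x : N ==> vv x = 0[M]) ==>
   EX ch : Hom A (powm M n) M. ALL x:$Y. ch (g x) = vv x"
proof -
 have lm: "lmod A M" and fgM: "fin_gen A M" using M by (simp_all add: generator_cogenerator_def)
 interpret Y: left_module A Y by fact
 interpret M: left_module A M by (rule lm)
 note KM = kres_module[OF lm]
 interpret KM: left_module K "kres A M" by (rule KM)
 obtain S where S: "finite S" "S <= $Y" "!!Q. smod Q A Y ==> S <= Q ==> Q = $Y"
  using fg unfolding Y.fin_gen_iff by blast
 let ?F = "Fun S (kres A M)"
 note F = fun_left_module[OF KM, of S]
 interpret F: left_module K ?F by (rule F)
 let ?V = "{vv : Hom A Y M. ALL x:N. vv x = 0[M]}"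
 \<comment> \<open>A map is determined by its values on the generators \<open>S\<close>, so the
   space of maps becomes a subspace of a finite power of \<open>M\<close>.\<close>
 let ?r = "%vv. %s:S. vv s"
 let ?U = "?r ` ?V"
 have NY: "x : N ==> x : $Y" for x using Y.submoduleD(1)[OF N] by blast
 have U: "smod ?U K ?F"
 proof (rule F.submoduleI')
  show "?U <= $?F" using S(2) lin_closed[of _ A Y M] by (auto simp: Fun_simps)
  have "(%x. 0[M]) : ?V" using lin_zero_map[OF lm] by simp
  then show "0[?F] : ?U" by (intro image_eqI[of _ _ "%x. 0[M]"]) (simp_all add: Fun_simps)
 next
  fix u v assume "u : ?U" "v : ?U"
  then obtain ph vv where *: "u = ?r ph" "v = ?r vv" "ph : ?V" "vv : ?V" by blast
  then have "(%x. ph x +[M] vv x) : ?V" using lin_plus[OF lm, of ph Y vv] by simp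
  then show "u +[?F] v : ?U"
   using *(1,2) by (intro image_eqI[of _ _ "%x. ph x +[M] vv x"]) (auto simp: Fun_simps)
 next
  fix k u assume k: "k : $K" and "u : ?U"
  then obtain ph where *: "u = ?r ph" "ph : ?V" by blast
  then have "(%x. scalar A k .[M] ph x) : ?V" using smult_lin[OF lm _ k, of ph Y] k by (simp add: M.smult_r_null A.scalar_closed)
  then show "k .[?F] u : ?U"
   using * by (intro image_eqI[of _ _ "%x. scalar A k .[M] ph x"]) (auto simp: Fun_simps)
 qed
 define U where "U = ?U"
 note U = U[folded U_def]
 let ?W = "?F@[U]"
 note W = F.submodule_left_module[OF U]
 interpret W: left_module K ?W by (rule W)
 have "fin_gen K ?W"
  by (rule subspace_fin_gen[OF K.field_axioms F KM.fin_gen_fun[OF S(1) kres_fin_gen[OF lm fgM]] U])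
 then obtain T where T: "finite T" "T <= $?W"
  "!!x. x : $?W ==> EX c. c : T -> $K & x = (SUM[?W]t:T. c t .[?W] t)"
  by (rule W.fin_gen_combination) (rule that)
 have "EX vv. vv : ?V & t = ?r vv" if "t : T" for t using T(2) that by (auto simp: U_def)
 then have "ALL t. EX vv. t : T --> vv : ?V & t = ?r vv" by blast
 from choice[OF this] obtain Ps where Ps: "!!t. t : T ==> Ps t : ?V & t = ?r (Ps t)" by blast
 obtain h where h: "bij_betw h {..<card T} T" using ex_bij_betw_nat_finite[OF T(1)] by (auto simp: atLeast0LessThan)
 have hT: "h i : T" if "i < card T" for i using h that by (auto simp: bij_betw_def)
 define n where "n = card T"
 let ?P = "powm M n"
 have P: "lmod A ?P" unfolding power_module_fun by (rule fun_left_module[OF lm])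
 let ?g = "%x. %i:{..<n}. Ps (h i) x"
 have g: "?g : Hom A Y ?P"
  unfolding power_module_fun using Ps hT n_def by (intro fun_pointwise_lin) auto
 have approx: "EX ch : Hom A ?P M. ALL x:$Y. ch (?g x) = vv x"
  if vv: "vv : Hom A Y M" "!!x. x : N ==> vv x = 0[M]" for vv
 proof -
  have "?r vv : $?W" using vv by (auto simp: U_def)
  then obtain c where c: "c : T -> $K" "?r vv = (SUM[?W]t:T. c t .[?W] t)" using T(3) by blast
  let ?ch = "%w. SUM[M]i:{..<n}. scalar A (c (h i)) .[M] w i"
  have ch: "?ch : Hom A ?P M"
  proof (rule lin_finsum_map[OF lm])
   fix i assume "i : {..<n}"
   then show "(%w. scalar A (c (h i)) .[M] w i) : Hom A ?P M"
    unfolding power_module_fun using c(1) hT n_def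
    by (intro smult_lin[OF lm] fun_eval_lin) auto
  qed
  have "?ch (?g x) = vv x" if x: "x : $Y" for x
  proof (rule Y.lin_eq_on_generators[OF _ lm _ vv(1) _ x])
   show "(%x. ?ch (?g x)) : Hom A Y M" by (rule lin_comp[OF g ch])
   fix s assume s: "s : S"
   have Pss: "Ps t s : $M" if "t : T" for t using lin_closed[of "Ps t" A Y M s] Ps[OF that] S(2) s by auto
   have ev: "(%u. u s) : Hom K ?W (kres A M)"
    using fun_eval_lin[OF s, of K "kres A M"] F.submoduleD(1)[OF U] by (simp add: lin_maps_def subset_iff Pi_iff)
   have "vv s = (?r vv) s" using s by simp
   also have "... = (SUM[kres A M]t:T. (c t .[?W] t) s)"
    unfolding c(2) using T(2) c(1) by (intro lin_finsum[OF W KM ev] Pi_I W.smult_closed) (auto simp del: transport_simps)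
   also have "... = (SUM[M]t:T. scalar A (c t) .[M] Ps t s)"
   proof -
    have "(c t .[?W] t) s = scalar A (c t) .[M] Ps t s" if "t : T" for t
    proof -
     have "t s = Ps t s" using conjunct2[OF Ps[OF that]] s by (metis restrict_apply')
     then show ?thesis using s by (simp add: Fun_simps)
    qed
    moreover have "scalar A (c t) .[M] Ps t s : $M" if "t : T" for t
     using c(1) that by (intro M.smult_closed A.scalar_closed Pss) auto
    ultimately show ?thesis unfolding finsum_restrict_scalars by (intro M.M.finsum_cong') auto
   qed
   also have "... = (SUM[M]i:{..<n}. scalar A (c (h i)) .[M] Ps (h i) s)"
    using h c(1) Pss M.M.finsum_reindex[of "%t. scalar A (c t) .[M] Ps t s" h "{..<n}"] unfolding n_def bij_betw_def
    by (auto intro!: M.smult_closed A.scalar_closed)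
   also have "... = ?ch (?g s)"
    using c(1) Pss hT n_def by (intro M.M.finsum_cong') (auto intro!: M.smult_closed A.scalar_closed)
   finally show "s : $Y & ?ch (?g s) = vv s" using s S(2) by auto
  qed (simp_all add: S(3))
  then show ?thesis by (intro bexI[OF _ ch] ballI)
 qed
 have "{x : $Y. ?g x = 0[?P]} = N"
 proof (intro equalityI subsetI)
  fix x assume "x : N"
  then show "x : {x : $Y. ?g x = 0[?P]}"
   using NY Ps hT n_def by (auto simp: power_module_def intro!: restrict_ext)
 next
  fix x assume x: "x : {x : $Y. ?g x = 0[?P]}"
  show "x : N"
  proof (rule ccontr)
   assume xN: "x ~: N"
   have x': "x : $Y" "?g x = 0[?P]" using x by blast+
   obtain ph where ph: "ph : Hom A Y M" "!!n. n : N ==> ph n = 0[M]" "ph x ~= 0[M]"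
    by (rule cogenerator_separates[OF M Y fg N x'(1) xN]) (rule that)
   obtain ch where ch: "ch : Hom A ?P M" "ALL x:$Y. ch (?g x) = ph x" using approx[OF ph(1,2)] by blast
   have "ph x = ch (?g x)" using bspec[OF ch(2) x'(1)] by (rule sym)
   also have "... = 0[M]" unfolding x'(2) by (rule lin_zero[OF P lm ch(1)])
   finally show False using ph(3) by simp
  qed
 qed
 then show thesis by (rule that[OF g _ approx])
qed

text \<open>\<open>A\<close> is a retract of a power of \<open>M\<close>, so a finite free cover can
  be preceded by a cover with copies of \<open>M\<close>. The double index in \<open>S\<close> and
  \<open>{..<m}\<close> is renumbered to fit \<open>powm\<close>.\<close>

lemma generator_cover:
 assumes M: "generator_cogenerator K A M" and X: "lmod A X'" and fg: "fin_gen A X'"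
 obtains n v where "v : Hom A (powm M n) X'" "v ` $(powm M n) = $X'"
proof -
 have lm: "lmod A M" using M by (simp add: generator_cogenerator_def)
 obtain m i p where i: "i : Hom A (regm A) (powm M m)"
  and p: "p : Hom A (powm M m) (regm A)" "!!x. x : $A ==> p (i x) = x"
  using M unfolding generator_cogenerator_def in_add_def direct_summand_def by (metis regular_module_simps(1))
 obtain S g where S: "finite S" "S <= $X'" and g: "g : Hom A (Fun S (regm A)) X'"
  "g ` $(Fun S (regm A)) = $X'"
  by (rule left_module.fin_gen_free_cover[OF X fg]) (rule that)
 define n where "n = card (S \<times> {..<m})"
 obtain h where h: "bij_betw h (S \<times> {..<m}) {..<n}"
  using ex_bij_betw_finite_nat[of "S \<times> {..<m}"] S(1) by (auto simp: atLeast0LessThan n_def)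
 have h': "h (s, j) : {..<n}" if "s : S" "j < m" for s j using h that by (auto simp: bij_betw_def)
 let ?q = "%w. %s:S. p (%j:{..<m}. w (h (s, j)))"
 have q: "?q : Hom A (powm M n) (Fun S (regm A))"
 proof (rule fun_pointwise_lin)
  fix s assume s: "s : S"
  have "(%w. %j:{..<m}. w (h (s, j))) : Hom A (powm M n) (powm M m)"
   unfolding power_module_fun using h' s by (intro fun_pointwise_lin fun_eval_lin) simp
  then show "(%w. p (%j:{..<m}. w (h (s, j)))) : Hom A (powm M n) (regm A)"
   by (rule lin_comp[OF _ p(1)])
 qed
 have "u : ?q ` $(powm M n)" if u: "u : $(Fun S (regm A))" for u
 proof -
  let ?k = "inv_into (S \<times> {..<m}) h"
  let ?w = "%l:{..<n}. i (u (fst (?k l))) (snd (?k l))"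
  have uA: "u s : $A" if "s : S" for s using u that by (auto simp: Fun_simps)
  have iu: "i (u s) : {..<m} \<rightarrow>\<^sub>E $M" if "s : S" for s
   using lin_closed[OF i, of "u s"] uA[OF that] by (simp add: power_module_def)
  have kl: "?k l : S \<times> {..<m}" if "l < n" for l
   using h that by (intro inv_into_into) (simp add: bij_betw_def)
  have "?w : $(powm M n)"
   using iu kl by (auto simp: power_module_def PiE_iff mem_Times_iff)
  moreover have "?q ?w = u"
  proof
   fix s
   show "?q ?w s = u s"
   proof (cases "s : S")
    case True
    have "(%j:{..<m}. ?w (h (s, j))) = i (u s)"
     using True h h' iu[OF True] by (auto simp: fun_eq_iff bij_betw_def PiE_iff extensional_def)
    then show ?thesis using True p(2)[OF uA[OF True]] by simp
   qed (use u in "auto simp: Fun_simps PiE_iff extensional_def")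
  qed
  ultimately show ?thesis by (intro image_eqI[of _ _ ?w]) simp_all
 qed
 then have qs: "?q ` $(powm M n) = $(Fun S (regm A))"
  using lin_closed[OF q] by blast
 show thesis
 proof (rule that[OF lin_comp[OF q g(1)]])
  show "(%w. g (?q w)) ` $(powm M n) = $X'"
   using image_image[of g ?q "$(powm M n)"] qs g(2) by metis
 qed
qed

end

section \<open>Modules over the endomorphism ring of a generator-cogenerator\<close>

lemma fin_dual_basis_liftable:
 fixes P :: "('r, 'm) module"
 assumes P: "lmod R P" and db: "fin_dual_basis R P I b c" shows "liftable R P"
proof -
 interpret left_module R P by fact
 note D = fin_dual_basisD[OF db]
 have "x = (SUM[P]i:{i : I. c i x ~= 0[R]}. c i x .[P] b i)" if "x : $P" for x
 proof -
  have "(SUM[P]i:I. c i x .[P] b i) = (SUM[P]i:{i : I. c i x ~= 0[R]}. c i x .[P] b i)"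
   using D that by (intro M.add.finprod_mono_neutral_cong_right) (auto simp: smult_l_null intro!: smult_closed)
  then show ?thesis using D(5)[OF that] by simp
 qed
 then have "dual_basis R P I b c" using D(1-3) by (auto simp: dual_basis_def)
 then show ?thesis by (rule dual_basis_liftable[OF P])
qed

text \<open>Chosen representatives \<open>rh x\<close> of the cosets serve as elements, which keeps
  the quotient in the type of \<open>M\<close>; congruent elements get the same representative
  because they satisfy the same defining predicate.\<close>

lemma quotient_module_exists:
 fixes M :: "('r, 'm, 'w) module_scheme"
 assumes M: "lmod R M" and N: "smod N R M"
 obtains Q :: "('r, 'm) module" and pp where "lmod R Q" "pp : Hom R M Q" "pp ` $M = $Q"
  "!!x. x : $M ==> pp x = 0[Q] \<longleftrightarrow> x : N"
proof -
 interpret left_module R M by fact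
 note D = submoduleD[OF N]
 define rh where "rh x = (SOME y. y : $M & y -[M] x : N)" for x
 have NM: "x : N ==> x : $M" for x using D(1) by blast
 have neg: "y -[M] x : N" if "x -[M] y : N" "x : $M" "y : $M" for x y
 proof -
  have "y -[M] x = -[M] (x -[M] y)" using that by (simp add: a_minus_def M.minus_add M.a_comm)
  then show ?thesis using D(5)[OF that(1)] by simp
 qed
 have tr: "x -[M] z : N" if "x -[M] y : N" "y -[M] z : N" "x : $M" "y : $M" "z : $M" for x y z
 proof -
  have "x -[M] z = (x -[M] y) +[M] (y -[M] z)"
   using that M.r_neg1[of y "-[M] z"] by (simp add: a_minus_def M.a_assoc)
  then show ?thesis using D(3)[OF that(1,2)] by simp
 qed
 have rh: "rh x : $M" "rh x -[M] x : N" if "x : $M" for x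
 proof -
  have "x : $M & x -[M] x : N" using that D(2) by (simp add: a_minus_def M.r_neg)
  then show "rh x : $M" "rh x -[M] x : N"
   using someI[of "%y. y : $M & y -[M] x : N" x] unfolding rh_def by blast+
 qed
 have eq: "rh x = rh y \<longleftrightarrow> x -[M] y : N" if xy: "x : $M" "y : $M" for x y
 proof
  assume "rh x = rh y"
  then show "x -[M] y : N" using tr[OF neg[OF rh(2)] _ _ rh(1)] rh xy by metis
 next
  assume *: "x -[M] y : N"
  have "z -[M] x : N \<longleftrightarrow> z -[M] y : N" if "z : $M" for z
   using tr[of z x y] tr[of z y x] * neg[OF * xy] xy that by blast
  then show "rh x = rh y" unfolding rh_def by metis
 qed
 have rhl: "rh (rh x +[M] y) = rh (x +[M] y)" if "x : $M" "y : $M" for x y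
 proof -
  have "(rh x +[M] y) -[M] (x +[M] y) = rh x -[M] x"
   using that rh(1)[OF that(1)] M.r_neg1[of y "-[M] x"] M.r_neg2[of y "-[M] x"]
   by (simp add: a_minus_def M.minus_add M.a_assoc) (simp add: M.a_ac)
  then show ?thesis using rh that by (subst eq) auto
 qed
 have rhr: "rh (x +[M] rh y) = rh (x +[M] y)" if "x : $M" "y : $M" for x y
  using rhl[OF that(2,1)] that rh(1)[OF that(2)] by (simp add: M.a_comm)
 have rhs: "rh (r .[M] rh x) = rh (r .[M] x)" if "r : $R" "x : $M" for r x
 proof -
  have "r .[M] rh x -[M] r .[M] x = r .[M] (rh x -[M] x)"
   using that rh(1)[OF that(2)] by (simp add: a_minus_def smult_r_distr smult_r_minus)
  then show ?thesis using rh that D(4) by (subst eq) (auto simp: smult_closed)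
 qed
 have rhrh: "rh (rh x) = rh x" if "x : $M" for x
  using rh that by (subst eq) auto
 let ?Q = "\<lparr>carrier = rh ` $M, monoid.mult = undefined, monoid.one = undefined, ring.zero = rh 0[M],
  ring.add = (%x y. rh (x +[M] y)), module.smult = (%r x. rh (r .[M] x))\<rparr> :: ('r, 'm) module"
 have Q: "lmod R ?Q"
 proof (rule left_moduleI)
  fix x assume "x : $?Q"
  then obtain z where "z : $M" "x = rh z" by auto
  then show "EX y:$?Q. y +[?Q] x = 0[?Q]"
   using rh(1) by (intro bexI[of _ "rh (-[M] z)"]) (simp_all add: rhl rhr M.l_neg)
 next
  fix x y z assume "x : $?Q" "y : $?Q" "z : $?Q"
  then obtain x' y' z' where "x' : $M" "y' : $M" "z' : $M" "x = rh x'" "y = rh y'" "z = rh z'" by auto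
  then show "x +[?Q] y +[?Q] z = x +[?Q] (y +[?Q] z)" by (simp add: rh(1) rhl rhr M.a_assoc)
 next
  fix a b x assume ab: "a : $R" "b : $R" and "x : $?Q"
  then obtain x' where x': "x' : $M" "x = rh x'" by auto
  then show "(a +[R] b) .[?Q] x = a .[?Q] x +[?Q] b .[?Q] x"
   using rhs[OF R.a_closed[OF ab] x'(1)] ab by (simp add: rh(1) rhl rhr rhs smult_closed smult_l_distr[OF ab x'(1)])
  show "(a *[R] b) .[?Q] x = a .[?Q] (b .[?Q] x)"
   using rhs[OF R.m_closed[OF ab] x'(1)] ab x' by (simp add: rh(1) rhs smult_closed smult_assoc1[OF ab x'(1)])
 qed (auto simp: rh(1) rhrh R.ring_axioms rhl rhr rhs smult_closed M.a_comm smult_r_distr smult_one)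
 have "rh x = rh 0[M] \<longleftrightarrow> x : N" if "x : $M" for x
  using that diff_add_cancel[of x "0[M]"] by (simp add: eq)
 then show thesis
  by (intro that[of ?Q rh] Q lin_mapsI) (simp_all add: rh(1) rhl rhr rhs smult_closed)
qed

text \<open>The endomorphism ring of \<open>M\<close> acts by composition after the maps, hence the
  construction is contravariant in \<open>Y\<close>. Extensional functions make equal maps equal
  elements.\<close>

definition hom_module :: "('r, 'z) ring_scheme => ('r, 'y, 'w) module_scheme => ('r, 'm, 'v) module_scheme
  => ('m => 'm, 'y => 'm) module" where
 "hom_module R Y M = \<lparr>carrier = Hom R Y M \<inter> extensional $Y, monoid.mult = undefined,
  monoid.one = undefined, ring.zero = (%x:$Y. 0[M]), ring.add = (%f g. %x:$Y. f x +[M] g x),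
  module.smult = (%ga f. compose $Y ga f)\<rparr>"

lemma hom_module_simps:
 "$(hom_module R Y M) = Hom R Y M \<inter> extensional $Y"
 "0[hom_module R Y M] = (%x:$Y. 0[M])"
 "f +[hom_module R Y M] g = (%x:$Y. f x +[M] g x)"
 "ga .[hom_module R Y M] f = compose $Y ga f"
 by (simp_all add: hom_module_def)

lemma End_ring_simps:
 "$(End_ring R M) = Hom R M M \<inter> extensional $M"
 "0[End_ring R M] = (%x:$M. 0[M])" "1[End_ring R M] = (%x:$M. x)"
 "f +[End_ring R M] g = (%x:$M. f x +[M] g x)" "f *[End_ring R M] g = compose $M f g"
 by (simp_all add: End_ring_def)

lemma restrict_lin: "lmod R Y ==> f : Hom R Y N ==> restrict f $Y : Hom R Y N \<inter> extensional $Y"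
 by (auto intro: lin_cong)

context left_module begin

lemma hom_abelian_group:
 assumes Y: "lmod R Y" and H: "$H = Hom R Y M \<inter> extensional $Y"
  "0[H] = (%x:$Y. 0[M])" "ring.add H = (%f g. %x:$Y. f x +[M] g x)"
 shows "abelian_group H"
proof (rule abelian_groupI)
 fix f assume "f : $H"
 then have f: "f : Hom R Y M" by (simp add: H)
 have "(%x. 0[M] -[M] f x) : Hom R Y M" by (intro lin_minus_map lself lin_zero_map f)
 then show "EX g:$H. g +[H] f = 0[H]"
  using restrict_lin[OF Y] unfolding H(1)
  by (intro bexI[of _ "%x:$Y. 0[M] -[M] f x"]) (auto simp: H diff_add_cancel lin_closed[OF f])
next
 fix f g assume "f : $H" "g : $H"
 then show "f +[H] g : $H"
  unfolding H by (intro restrict_lin[OF Y] lin_plus[OF lself]) simp_all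
next
 show "0[H] : $H" unfolding H by (intro restrict_lin[OF Y] lin_zero_map[OF lself])
qed (auto simp: H M.a_ac restrict_def extensional_def fun_eq_iff lin_closed)

lemma End_ring_ring: "ring (End_ring R M)"
proof -
 have "abelian_group (End_ring R M)"
  by (rule hom_abelian_group[OF lself]) (simp_all add: End_ring_def)
 moreover have "monoid (End_ring R M)"
  by (rule monoidI)
   (auto simp: End_ring_simps compose_def extensional_def restrict_def fun_eq_iff lin_closed
    intro!: lin_mapsI simp: lin_add lin_smult smult_closed)
 ultimately show ?thesis
  by (rule ringI)
   (auto simp: End_ring_simps compose_def restrict_def fun_eq_iff lin_closed lin_add)
qed

lemma hom_left_module:
 assumes Y: "lmod R Y" shows "lmod (End_ring R M) (hom_module R Y M)"
proof -
 interpret Y: left_module R Y by fact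
 show ?thesis
  unfolding left_module_def left_module_axioms_def
  by (intro conjI End_ring_ring hom_abelian_group[OF Y])
   (auto simp: hom_module_def simp: End_ring_simps hom_module_simps compose_def extensional_def restrict_def fun_eq_iff lin_closed
    intro!: lin_mapsI simp: lin_add lin_smult smult_closed Y.smult_closed)
qed

lemma hom_precompose:
 assumes Y: "lmod R Y" and y: "y : Hom R Y Z"
 shows "(%vv. %x:$Y. vv (y x)) : Hom (End_ring R M) (hom_module R Z M) (hom_module R Y M)"
proof (rule lin_mapsI)
 fix vv assume "vv : $(hom_module R Z M)"
 then show "(%x:$Y. vv (y x)) : $(hom_module R Y M)"
  unfolding hom_module_simps by (intro restrict_lin[OF Y] lin_comp[OF y]) simp
qed (auto simp: hom_module_simps End_ring_simps compose_def restrict_def fun_eq_iff lin_closed[OF y])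

text \<open>Maps from a power of \<open>M\<close> to \<open>M\<close> are tuples of endomorphisms,
  with the coordinate projections as basis. This is how powers of \<open>M\<close> become projective
  modules over the endomorphism ring.\<close>

lemma hom_power_dual_basis:
 fixes n defines "P \<equiv> powm M n"
 shows "fin_dual_basis (End_ring R M) (hom_module R P M) {..<n} (%i. %w:$P. w i)
  (%i vv. %m:$M. vv (fun_unit {..<n} M i m))"
proof -
 have P: "lmod R P" unfolding P_def power_module_fun by (rule fun_left_module[OF lself])
 interpret P: left_module R P by fact
 note H = hom_left_module[OF P]
 interpret H: left_module "End_ring R M" "hom_module R P M" by (rule H)
 have u: "fun_unit {..<n} M i : Hom R M P" for i unfolding P_def power_module_fun by (rule fun_unit_lin)
 have b: "(%w:$P. w i) : $(hom_module R P M)" if "i < n" for i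
  unfolding hom_module_simps using that by (intro restrict_lin[OF P]) (auto simp: P_def power_module_fun intro: fun_eval_lin)
 have c: "(%vv. %m:$M. vv (fun_unit {..<n} M i m)) : Hom (End_ring R M) (hom_module R P M) (regm (End_ring R M))" for i
  using hom_precompose[OF lself u, of i]
  by (auto simp: lin_maps_def hom_module_simps End_ring_simps)
 have "(SUM[hom_module R P M]i:{..<n}. (%m:$M. vv (fun_unit {..<n} M i m)) .[hom_module R P M] (%w:$P. w i)) = vv"
  (is "finsum _ ?F _ = _") if vv: "vv : $(hom_module R P M)" for vv
 proof (rule extensionalityI)
  have F: "?F i : $(hom_module R P M)" if "i < n" for i
   using lin_closed[OF c vv, of i] b[OF that] by (intro H.smult_closed) simp_all
  then show "(SUM[hom_module R P M]i:{..<n}. ?F i) : extensional $P"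
   using H.M.finsum_closed[of ?F "{..<n}"] by (auto simp: hom_module_simps)
  show "vv : extensional $P" using vv by (simp add: hom_module_simps)
  fix w assume w: "w : $P"
  have wi: "w i : $M" if "i < n" for i using w that by (auto simp: P_def power_module_def)
  have vv': "vv : Hom R P M" using vv by (simp add: hom_module_simps)
  have ev: "(SUM[hom_module R P M]i:I. G i) w = (SUM[M]i:I. G i w)"
   if "finite I" "!!i. i : I ==> G i : $(hom_module R P M)" for I :: "nat set" and G
   using that
  proof (induction I rule: finite_induct)
   case (insert i I)
   have "G j w : $M" if "j : insert i I" for j
    using lin_closed[of "G j" R P M w] insert.prems[OF that] w by (simp add: hom_module_simps)
   then show ?case using insert w by (simp add: Pi_iff) (simp add: hom_module_simps)
  qed (use w in "simp add: hom_module_simps")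
  have "(SUM[hom_module R P M]i:{..<n}. ?F i) w = (SUM[M]i:{..<n}. ?F i w)" by (rule ev) (use F in auto)
  also have "... = (SUM[M]i:{..<n}. vv (fun_unit {..<n} M i (w i)))"
   using w wi lin_closed[OF vv' lin_closed[OF u]]
   by (intro M.finsum_cong') (auto simp: hom_module_simps compose_def)
  also have "... = vv (SUM[P]i:{..<n}. fun_unit {..<n} M i (w i))"
   using wi lin_closed[OF u] by (intro lin_finsum[OF P lself vv', symmetric]) auto
  also have "... = vv w" using fun_expand[of "{..<n}" w] w by (simp add: P_def power_module_fun)
  finally show "(SUM[hom_module R P M]i:{..<n}. ?F i) w = vv w" .
 qed
 then show ?thesis using b c by (auto simp: fin_dual_basis_def)
qed

end

lemma transport_long_exact:
 assumes E: "lexact R d (C, f)" and e: "!!i. i <= Suc d ==> inj_on (e i) ($(C i))"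
 shows "lexact R d (%i. transport (e i) (C i), %i x. e (Suc i) (f i (inv_into ($(C i)) (e i) x)))"
proof -
 note D = long_exactD[OF E]
 note T = transport[OF D(1) e]
 have i: "inv_into ($(C i)) (e i) (e i x) = x" if "i <= Suc d" "x : $(C i)" for i x
  using e that by simp
 have fc: "f i x : $(C (Suc i))" if "i <= d" "x : $(C i)" for i x by (rule lin_closed[OF D(2)[OF that(1)] that(2)])
 have z: "e i x = e i 0[C i] \<longleftrightarrow> x = 0[C i]" if "i <= Suc d" "x : $(C i)" for i x
 proof -
  interpret left_module R "C i" using D(1)[OF that(1)] .
  show ?thesis using inj_onD[OF e[OF that(1)], of x "0[C i]"] that by auto
 qed
 show ?thesis
  unfolding long_exact_def
 proof (intro case_prodI conjI allI impI)
  fix j assume j: "j <= d"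
  then show "(%x. e (Suc j) (f j (inv_into ($(C j)) (e j) x))) : Hom R (transport (e j) (C j)) (transport (e (Suc j)) (C (Suc j)))"
   by (intro lin_comp[OF lin_comp[OF T(3) D(2)] T(2)]) simp_all
 next
  show "inj_on (%x. e (Suc 0) (f 0 (inv_into ($(C 0)) (e 0) x))) ($(transport (e 0) (C 0)))"
   by (rule inj_onI) (auto simp: transport_simps i fc inj_on_eq_iff[OF e] inj_on_eq_iff[OF D(3)])
  show "(%x. e (Suc d) (f d (inv_into ($(C d)) (e d) x))) ` $(transport (e d) (C d)) = $(transport (e (Suc d)) (C (Suc d)))"
   using D(4) image_image[of "e (Suc d)" "f d" "$(C d)"] by (simp add: transport_simps image_image[of _ "e d"] i cong: image_cong)
 next
  fix j assume j: "j < d"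
  show "(%x. e (Suc j) (f j (inv_into ($(C j)) (e j) x))) ` $(transport (e j) (C j)) =
   {x : $(transport (e (Suc j)) (C (Suc j))). e (Suc (Suc j)) (f (Suc j) (inv_into ($(C (Suc j))) (e (Suc j)) x)) = 0[transport (e (Suc (Suc j))) (C (Suc (Suc j)))]}"
   (is "?L = ?R")
  proof -
   have "?L = e (Suc j) ` (f j ` $(C j))" using j by (simp add: transport_simps image_image i cong: image_cong)
   also have "... = e (Suc j) ` {x : $(C (Suc j)). f (Suc j) x = 0[C (Suc (Suc j))]}" using D(5)[OF j] by simp
   also have "... = ?R" using j by (auto simp: transport_simps i z fc)
   finally show ?thesis .
  qed
 qed (use T(1) in auto)
qed

text \<open>Zero modules on the left bring a shorter projective resolution to the length of the
  sequence with which it is compared.\<close>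

lemma pad_long_exact:
 assumes E: "lexact R n (P, p)" defines "Z \<equiv> P 0@[{0[P 0]}]"
 shows "lexact R (Suc n) (case_nat Z P, case_nat (%x. 0[P 0]) p)" "liftable R Z"
proof -
 note D = long_exactD[OF E]
 interpret P0: left_module R "P 0" by (rule D(1)) simp
 have Z: "lmod R Z" unfolding Z_def by (rule P0.submodule_left_module[OF P0.submodule_zero])
 show "liftable R Z" unfolding liftable_def
 proof (intro conjI Z allI impI)
  fix U Y q ph assume U: "lmod R U" and Y: "lmod R Y" and q: "q : Hom R U Y" and ph: "ph : Hom R Z Y"
  have "ph 0[P 0] = 0[Y]" using lin_zero[OF Z Y ph] by (simp add: Z_def)
  then show "EX vv:Hom R Z U. ALL x:$Z. q (vv x) = ph x"
   using lin_zero[OF U Y q] by (intro bexI[OF _ lin_zero_map[OF U]]) (simp add: Z_def)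
 qed
 show "lexact R (Suc n) (case_nat Z P, case_nat (%x. 0[P 0]) p)"
  unfolding long_exact_def
 proof (intro case_prodI conjI allI impI)
  fix i assume i: "i <= Suc n"
  show "case_nat (%x. 0[P 0]) p i : Hom R (case_nat Z P i) (case_nat Z P (Suc i))"
   using i D(2) lin_zero_map[OF P0.lself] by (cases i) simp_all
 next
  fix i assume i: "i < Suc n"
  show "case_nat (%x. 0[P 0]) p i ` $(case_nat Z P i) =
   {x : $(case_nat Z P (Suc i)). case_nat (%x. 0[P 0]) p (Suc i) x = 0[case_nat Z P (Suc (Suc i))]}"
  proof (cases i)
   case 0
   interpret P1: left_module R "P (Suc 0)" by (rule D(1)) simp
   have p0: "p 0 : Hom R (P 0) (P (Suc 0))" by (rule D(2)) simp
   have z: "p 0 0[P 0] = 0[P (Suc 0)]" by (rule lin_zero[OF P0.lself P1.lself p0])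
   have "x = 0[P 0]" if "x : $(P 0)" "p 0 x = 0[P (Suc 0)]" for x
    using inj_onD[OF D(3), of x "0[P 0]"] that z by simp
   then have "{x : $(P 0). p 0 x = 0[P (Suc 0)]} = {0[P 0]}" using z by auto
   then show ?thesis using 0 by (simp add: Z_def)
  next
   case (Suc j)
   then show ?thesis using D(5)[of j] i by simp
  qed
 next
  show "lmod R (case_nat Z P i)" if "i <= Suc (Suc n)" for i using that Z D(1) by (cases i) simp_all
 qed (use D(4) in "simp_all add: Z_def")
qed

text \<open>Schanuel's principle: an \<open>m\<close>-th syzygy \<open>C 0\<close> of a module of
  projective dimension at most \<open>m\<close> is projective, so \<open>q\<close> splits. Comparing
  \<open>C\<close> in both directions with a projective resolution \<open>P\<close> of length
  \<open>m\<close> writes the identity of \<open>C 0\<close> as a map through \<open>P 0\<close>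
  plus a map through \<open>C 1\<close>; both are lifted along \<open>q\<close>.\<close>

lemma syzygy_section:
 fixes C :: "nat => ('r, 'm) module" and H :: "('r, 'm) module"
 assumes m: "1 <= m" and E: "lexact R m (C, f)" and C: "!!i. 1 <= i ==> i <= m ==> liftable R (C i)"
  and pd: "proj_dim R (C (Suc m)) <= enat m"
  and H: "lmod R H" and q: "q : Hom R H (C 0)" "q ` $H = $(C 0)"
 obtains sg where "sg : Hom R (C 0) H" "!!x. x : $(C 0) ==> q (sg x) = x"
proof -
 note D = long_exactD[OF E]
 let ?S = "{enat n | n. EX P f. lexact R n (P, f) & P (Suc n) = C (Suc m) & (ALL i<=n. projective R (P i))}"
 \<comment> \<open>The infimum of the empty set would be infinite, so a finite bound provides a
   resolution, and the infimum is attained.\<close>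
 have "?S ~= {}" using pd unfolding proj_dim_def by (metis Inf_enat_def infinity_ileE)
 then have "Inf ?S : ?S" unfolding Inf_enat_def by (simp only: if_False) (rule LeastI_ex, blast)
 then obtain n P p where n: "enat n = Inf ?S" and P: "lexact R n (P, p)" "P (Suc n) = C (Suc m)" "ALL i<=n. projective R (P i)"
  by (smt (verit) mem_Collect_eq)
 have nm: "n <= m" using pd unfolding proj_dim_def n[symmetric] by simp
 have lift: "liftable R Q" if "projective R Q" for Q :: "('r, 'm) module"
  using projective_dual_basis[OF that] dual_basis_liftable[of R Q] that unfolding projective_def by blast
 have "EX P p. lexact R (n + k) (P, p) & P (Suc (n + k)) = C (Suc m) & (ALL i<=n + k. liftable R (P i))" for k
 proof (induction k)
  case 0
  then show ?case using P lift by auto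
 next
  case (Suc k)
  then obtain P p where P: "lexact R (n + k) (P, p)" "P (Suc (n + k)) = C (Suc m)" "ALL i<=n + k. liftable R (P i)" by blast
  show ?case
   using pad_long_exact[OF P(1)] P(2,3)
   by (intro exI[of _ "case_nat (P 0@[{0[P 0]}]) P"] exI[of _ "case_nat (%x. 0[P 0]) p"])
    (auto split: nat.split)
 qed
 from this[of "m - n"] obtain P p where P': "lexact R m (P, p)" and last: "P (Suc m) = C (Suc m)"
  and P'l: "!!i. i <= m ==> liftable R (P i)" using nm by auto
 note pc = exact_proj_complex[OF P' P'l]
 have "EX h. smor R m (P, p) (C, f) h & h (Suc m) = (%x. x)"
  by (rule chain_lift[OF E pc]) (simp_all only: last lin_ident)
 then obtain h where h: "smor R m (P, p) (C, f) h" "h (Suc m) = (%x. x)" by blast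
 have "EX g. smor R m (C, f) (P, p) g & g (Suc m) = (%x. x)"
  by (rule chain_lift[OF P' exact_proj_complex[OF E C]]) (simp_all only: last lin_ident)
 then obtain g where g: "smor R m (C, f) (P, p) g" "g (Suc m) = (%x. x)" by blast
 note hg = seq_morphism_comp[OF g(1) h(1)]
 have id: "smor R m (C, f) (C, f) (%i x. x)" by (simp add: seq_morphism_def lin_ident)
 have diff: "smor R m (C, f) (C, f) (%i x. x -[C i] h i (g i x))"
  using seq_morphism_diff[OF E hg id] by simp
 interpret CS: left_module R "C (Suc m)" by (rule D(1)) simp
 have "EX e:Hom R (C 1) (C 0). ALL x:$(C 0). x -[C 0] h 0 (g 0 x) = e (f 0 x)"
  by (rule homotopy[OF E exact_proj_complex[OF E C] diff]) (simp_all add: h(2) g(2) a_minus_def CS.M.r_neg)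
 then obtain e where e: "e : Hom R (C 1) (C 0)" "!!x. x : $(C 0) ==> x -[C 0] h 0 (g 0 x) = e (f 0 x)" by blast
 interpret C0: left_module R "C 0" by (rule D(1)) simp
 have h0: "h 0 : Hom R (P 0) (C 0)" and g0: "g 0 : Hom R (C 0) (P 0)" and f0: "f 0 : Hom R (C 0) (C 1)"
  using seq_morphismD(1)[OF h(1), of 0] seq_morphismD(1)[OF g(1), of 0] D(2)[of 0] by simp_all
 obtain vv where vv: "vv : Hom R (P 0) H" "!!x. x : $(P 0) ==> q (vv x) = h 0 x"
  using liftableD[OF P'l H C0.lself q(1) h0] lin_closed[OF h0] q(2) by blast
 have "EX ch:Hom R (C 1) H. ALL x:$(C 1). q (ch x) = e x"
  by (rule liftableD[OF C H C0.lself q(1) e(1)]) (use lin_closed[OF e(1)] q(2) m in auto)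
 then obtain ch where ch: "ch : Hom R (C 1) H" "!!x. x : $(C 1) ==> q (ch x) = e x" by blast
 show thesis
 proof (rule that[of "%x. ch (f 0 x) +[H] vv (g 0 x)"])
  show "(%x. ch (f 0 x) +[H] vv (g 0 x)) : Hom R (C 0) H"
   by (intro lin_plus[OF H] lin_comp[OF f0 ch(1)] lin_comp[OF g0 vv(1)])
  fix x assume x: "x : $(C 0)"
  note c = lin_closed[OF f0 x] lin_closed[OF g0 x]
  have "q (ch (f 0 x) +[H] vv (g 0 x)) = (x -[C 0] h 0 (g 0 x)) +[C 0] h 0 (g 0 x)"
   using lin_add[OF q(1) lin_closed[OF ch(1) c(1)] lin_closed[OF vv(1) c(2)]] ch(2)[OF c(1)] vv(2)[OF c(2)] e(2)[OF x] by simp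
  then show "q (ch (f 0 x) +[H] vv (g 0 x)) = x" using C0.diff_add_cancel[OF x lin_closed[OF h0 c(2)]] by simp
 qed
qed

lemma fin_dual_basis_lin_eq:
 assumes P: "lmod R P" and N: "lmod R N" and db: "fin_dual_basis R P I b c"
  and f: "f : Hom R P N" and g: "g : Hom R P N" and eq: "!!i. i : I ==> f (b i) = g (b i)"
  and x: "x : $P"
 shows "f x = g x"
proof -
 interpret P: left_module R P by fact
 interpret N: left_module R N by fact
 note D = fin_dual_basisD[OF db]
 have e: "h x = (SUM[N]i:I. c i x .[N] h (b i))" if h: "h : Hom R P N" for h
 proof -
  have "h (SUM[P]i:I. c i x .[P] b i) = (SUM[N]i:I. h (c i x .[P] b i))"
   using D x by (intro lin_finsum[OF P N h] Pi_I P.smult_closed) auto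
  also have "... = (SUM[N]i:I. c i x .[N] h (b i))"
   using D x lin_closed[OF h] by (intro N.M.finsum_cong') (auto simp: lin_smult[OF h] N.smult_closed)
  finally show ?thesis using D(5)[OF x] by simp
 qed
 show ?thesis
  unfolding e[OF f] e[OF g] using D x eq lin_closed[OF g] by (intro N.M.finsum_cong') (auto simp: N.smult_closed)
qed

text \<open>\<open>gl_dim\<close> ranges over modules with carrier in
  \<open>(nat => 'e) set\<close>, where \<open>'e\<close> is here the type of endomorphisms. A
  function is stored as its graph: value and argument together form one sequence, whose entries are
  turned into constant functions.\<close>

definition graph_code :: "((nat => 'm) => 'm) => (nat => 'm => 'm) set" where
 "graph_code vv = range (%w i _. case_nat (vv w) w i)"

lemma inj_graph_code: "inj graph_code"
proof (rule injI, rule ext)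
 fix ph vv :: "(nat => 'm) => 'm" and w assume "graph_code ph = graph_code vv"
 then have "(%i (_::'m). case_nat (ph w) w i) : graph_code vv" by (auto simp: graph_code_def)
 then obtain w' where w': "(%i (_::'m). case_nat (ph w) w i) = (%i _. case_nat (vv w') w' i)"
  by (auto simp: graph_code_def)
 have c: "case_nat (ph w) w i = case_nat (vv w') w' i" for i using fun_cong[OF fun_cong[OF w', of i]] by blast
 have "w = w'" using c[of "Suc i" for i] by (auto simp: fun_eq_iff)
 then show "ph w = vv w" using c[of 0] by simp
qed

context fin_dim_algebra begin

text \<open>The \<open>z i\<close> continue each other by approximations, and \<open>y\<close>
  covers the first kernel. Maps into \<open>M\<close> turn this into an exact sequence of projective
  modules over the endomorphism ring, ending in a quotient \<open>Q\<close>. The image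
  \<open>U\<close> of \<open>p k\<close> is a syzygy of \<open>Q\<close> of order
  \<open>k + 2\<close>, so \<open>p k\<close> has a section onto it. The resulting idempotent on the
  maps from \<open>Z (Suc k)\<close> is induced by an endomorphism \<open>rh\<close> of
  \<open>Z (Suc k)\<close>, which retracts onto \<open>N (Suc k)\<close>.\<close>

lemma coresolution_retraction:
 fixes M :: "('a, 'm) module" and n :: "nat => nat" and z :: "nat => (nat => 'm) => nat => 'm"
  and N :: "nat => (nat => 'm) set"
 assumes M: "generator_cogenerator K A M" and gd: "gl_dim (End_ring A M) <= enat (Suc (Suc k))"
 defines "Z \<equiv> %i. powm M (n i)"
 assumes z: "!!i. z i : Hom A (Z i) (Z (Suc i))" and y: "y : Hom A (powm M b) (Z 0)"
  and N: "N 0 = y ` $(powm M b)" "!!i. N (Suc i) = z i ` $(Z i)"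
  and sub: "!!i. smod (N i) A (Z i)" and zN: "!!i x. x : N i ==> z i x = 0[Z (Suc i)]"
  and ext: "!!i vv. vv : Hom A (Z i) M ==> ALL x:N i. vv x = 0[M] ==>
   EX ch:Hom A (Z (Suc i)) M. ALL x:$(Z i). ch (z i x) = vv x"
 obtains rh where "rh : Hom A (Z (Suc k)) (Z (Suc k))" "!!x. x : N (Suc k) ==> rh x = x"
  "!!x. x : $(Z (Suc k)) ==> rh x : N (Suc k)"
proof -
 have lm: "lmod A M" and fg: "fin_gen A M" using M by (simp_all add: generator_cogenerator_def)
 interpret M: left_module A M by (rule lm)
 let ?G = "End_ring A M"
 have Y: "lmod A (powm M j)" for j unfolding power_module_fun by (rule fun_left_module[OF lm])
 have Zm: "lmod A (Z i)" for i unfolding Z_def by (rule Y)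
 define H where "H i = hom_module A (Z i) M" for i
 define B where "B = powm M b"
 define H' where "H' = hom_module A B M"
 have Hm: "lmod ?G (H i)" for i unfolding H_def by (rule M.hom_left_module[OF Zm])
 have H'm: "lmod ?G H'" unfolding H'_def B_def by (rule M.hom_left_module[OF Y])
 define p where "p i = (%(vv :: (nat => 'm) => 'm). %x:$(Z i). vv (z i x))" for i :: nat
 define p' where "p' = (%(vv :: (nat => 'm) => 'm). %x:$B. vv (y x))"
 have p: "p i : Hom ?G (H (Suc i)) (H i)" for i
  unfolding p_def H_def by (rule M.hom_precompose[OF Zm z])
 have p': "p' : Hom ?G (H 0) H'"
  unfolding p'_def H_def H'_def B_def by (rule M.hom_precompose[OF Y y])
 have im_p: "p i ` $(H (Suc i)) = {vv : $(H i). ALL x:N i. vv x = 0[M]}" for i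
 proof (intro equalityI subsetI)
  fix vv assume "vv : p i ` $(H (Suc i))"
  then obtain ch where ch: "ch : $(H (Suc i))" "vv = p i ch" by blast
  have "ch 0[Z (Suc i)] = 0[M]" using lin_zero[OF Zm lm, of ch] ch(1) by (simp add: H_def hom_module_simps)
  then have "ALL x:N i. vv x = 0[M]"
   using zN left_module.submoduleD(1)[OF Zm sub[of i]] by (auto simp: ch(2) p_def)
  then show "vv : {vv : $(H i). ALL x:N i. vv x = 0[M]}" using lin_closed[OF p ch(1)] ch(2) by simp
 next
  fix vv assume "vv : {vv : $(H i). ALL x:N i. vv x = 0[M]}"
  then have vv: "vv : Hom A (Z i) M" "vv : extensional ($(Z i))" "ALL x:N i. vv x = 0[M]"
   by (auto simp: H_def hom_module_simps)
  obtain ch where ch: "ch : Hom A (Z (Suc i)) M" "ALL x:$(Z i). ch (z i x) = vv x" using ext[OF vv(1,3)] by blast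
  have "restrict ch ($(Z (Suc i))) : $(H (Suc i))"
   unfolding H_def hom_module_simps by (rule restrict_lin[OF Zm ch(1)])
  moreover have "p i (restrict ch ($(Z (Suc i)))) = vv"
   using ch(2) vv(2) lin_closed[OF z] by (auto simp: p_def fun_eq_iff extensional_def)
  ultimately show "vv : p i ` $(H (Suc i))" by blast
 qed
 have ker_p: "{vv : $(H (Suc i)). p i vv = 0[H i]} = {vv : $(H (Suc i)). ALL x:N (Suc i). vv x = 0[M]}" for i
  by (auto simp: N(2) p_def H_def hom_module_simps fun_eq_iff restrict_def)
 have ker_p': "{vv : $(H 0). p' vv = 0[H']} = {vv : $(H 0). ALL x:N 0. vv x = 0[M]}"
  by (auto simp: N(1) p'_def H'_def B_def hom_module_simps fun_eq_iff restrict_def)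
 have sub': "smod (p' ` $(H 0)) ?G H'" by (rule lin_image[OF Hm H'm p'])
 obtain Q :: "('m => 'm, (nat => 'm) => 'm) module" and pp where Q: "lmod ?G Q" "pp : Hom ?G H' Q"
  "pp ` $H' = $Q" "!!x. x : $H' ==> pp x = 0[Q] \<longleftrightarrow> x : p' ` $(H 0)"
  by (rule quotient_module_exists[OF H'm sub']) (rule that)
 define U where "U = p k ` $(H (Suc k))"
 have Us: "smod U ?G (H k)" unfolding U_def by (rule lin_image[OF Hm Hm p])
 \<comment> \<open>The numbering is reversed: \<open>C 1\<close> is \<open>H k\<close> and
   \<open>C (Suc k)\<close> is \<open>H 0\<close>, followed by \<open>H'\<close> and, at
   \<open>k + 3\<close>, the cokernel \<open>Q\<close> of \<open>p'\<close>. So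
   \<open>C 0 = U\<close> is a syzygy of order \<open>k + 2\<close>.\<close>
 define C where "C i = (if i = 0 then H k@[U] else if i <= Suc k then H (Suc k - i) else
  if i = Suc (Suc k) then H' else Q)" for i
 define f where "f i = (if i = 0 then (%vv. vv) else if i <= k then p (k - i) else if i = Suc k then p' else pp)" for i
 have E: "lexact ?G (Suc (Suc k)) (C, f)"
  unfolding long_exact_def
 proof (intro case_prodI conjI allI impI)
  show "lmod ?G (C i)" for i
   using Hm H'm Q(1) left_module.submodule_left_module[OF Hm Us] by (auto simp: C_def)
  fix i assume i: "i <= Suc (Suc k)"
  show "f i : Hom ?G (C i) (C (Suc i))"
  proof -
   consider "i = 0" | "1 <= i" "i <= k" | "i = Suc k" | "i = Suc (Suc k)" using i by linarith
   then show ?thesis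
   proof cases
    case 1
    then show ?thesis
     using left_module.submoduleD(1)[OF Hm Us] by (auto simp: C_def f_def lin_maps_def)
   next
    case 2
    then show ?thesis using p[of "k - i"] by (simp add: C_def f_def Suc_diff_le)
   qed (use p' Q(2) in "auto simp: C_def f_def")
  qed
 next
  fix i assume i: "i < Suc (Suc k)"
  have 1: "f i ` $(C i) = {vv : $(H (k - i)). ALL x:N (k - i). vv x = 0[M]}" if "i <= k"
  proof (cases "i = 0")
   case False
   then show ?thesis using that im_p[of "k - i"] by (simp add: C_def f_def Suc_diff_le)
  qed (use im_p[of k] in "simp add: C_def f_def U_def")
  have 2: "{vv : $(C (Suc i)). f (Suc i) vv = 0[C (Suc (Suc i))]} = {vv : $(H (k - i)). ALL x:N (k - i). vv x = 0[M]}"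
   if ik: "i <= k"
  proof (cases "i = k")
   case True
   then show ?thesis using ker_p' by (simp add: C_def f_def)
  next
   case False
   then have "k - i = Suc (k - Suc i)" "Suc i <= k" using ik by auto
   then show ?thesis using ker_p[of "k - Suc i"] by (simp add: C_def f_def)
  qed
  show "f i ` $(C i) = {x : $(C (Suc i)). f (Suc i) x = 0[C (Suc (Suc i))]}"
  proof (cases "i <= k")
   case False
   then have "i = Suc k" using i by simp
   then show ?thesis using Q(4) lin_closed[OF p'] by (auto simp: C_def f_def)
  qed (simp only: 1 2)
 qed (use Q(3) in "auto simp: C_def f_def")
 let ?e = graph_code
 have inj: "inj_on ?e S" for S :: "((nat => 'm) => 'm) set" using inj_graph_code by (rule inj_on_subset) simp
 note T = transport[OF long_exactD(1)[OF E] inj]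
 have liftH: "liftable ?G (transport ?e (hom_module A (powm M j) M))" for j
 proof -
  note l = M.hom_left_module[OF Y, of j]
  show ?thesis
  proof (rule fin_dual_basis_liftable[OF transport(1)[OF l inj]])
   show "fin_dual_basis ?G (transport ?e (hom_module A (powm M j) M)) {..<j}
    (%i. ?e (%w:$(powm M j). w i))
    (%i y. %m:$M. inv_into ($(hom_module A (powm M j) M)) ?e y (fun_unit {..<j} M i m))"
    by (rule fin_dual_basis_iso[OF l M.hom_power_dual_basis transport(2)[OF l inj] transport(3)[OF l inj] _ transport(1)[OF l inj]])
     (auto simp: transport_simps f_inv_into_f)
  qed
 qed
 have lift: "liftable ?G (transport ?e (C i))" if "1 <= i" "i <= Suc (Suc k)" for i
  using liftH that by (auto simp: C_def H_def H'_def Z_def B_def)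
 have pd: "proj_dim ?G (transport ?e (C (Suc (Suc (Suc k))))) <= enat (Suc (Suc k))"
  by (rule order.trans[OF _ gd], unfold gl_dim_def, rule Sup_upper) (use T(1) in auto)
 have pk: "p k : Hom ?G (H (Suc k)) (C 0)"
  using p[of k] by (auto simp: C_def U_def lin_maps_def)
 let ?q = "%x. ?e (p k (inv_into ($(H (Suc k))) ?e x))"
 have TH: "lmod ?G (transport ?e (H (Suc k)))" by (rule transport(1)[OF Hm inj])
 have q: "?q : Hom ?G (transport ?e (H (Suc k))) (transport ?e (C 0))"
  by (rule lin_comp[OF lin_comp[OF transport(3)[OF Hm inj] pk] T(2)]) simp
 have ie: "inv_into $X' ?e (?e x) = x" if "x : $X'" for x and X' :: "('m => 'm, (nat => 'm) => 'm) module"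
  using inv_into_f_f[OF inj that] .
 have qs: "?q ` $(transport ?e (H (Suc k))) = $(transport ?e (C 0))"
  by (simp add: transport_simps image_image ie C_def U_def cong: image_cong)
 obtain sg' where sg': "sg' : Hom ?G (transport ?e (C 0)) (transport ?e (H (Suc k)))"
  "!!x. x : $(transport ?e (C 0)) ==> ?q (sg' x) = x"
  by (rule syzygy_section[OF _ transport_long_exact[OF E inj] lift pd TH q qs]) (simp, assumption, assumption, rule that)
 define sg where "sg u = inv_into ($(H (Suc k))) ?e (sg' (?e u))" for u
 have sg: "sg : Hom ?G (C 0) (H (Suc k))"
  unfolding sg_def by (rule lin_comp[OF lin_comp[OF T(2) sg'(1)] transport(3)[OF Hm inj]]) simp
 have psg: "p k (sg u) = u" if "u : U" for u
 proof -
  have "?e u : $(transport ?e (C 0))" using that by (simp add: transport_simps C_def)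
  from sg'(2)[OF this] show ?thesis using injD[OF inj_graph_code] unfolding sg_def by blast
 qed
 let ?c = "$(Z (Suc k))"
 have pr: "(%w:?c. w j) : $(H (Suc k))" if "j < n (Suc k)" for j
  unfolding H_def hom_module_simps using that
  by (intro restrict_lin[OF Zm]) (auto simp: Z_def power_module_fun intro: fun_eval_lin)
 define ta where "ta = (%vv. sg (p k vv))"
 have ta: "ta : Hom ?G (H (Suc k)) (H (Suc k))" unfolding ta_def by (rule lin_comp[OF pk sg])
 define rh where "rh = (%x. %j:{..<n (Suc k)}. ta (%w:?c. w j) x)"
 have rh: "rh : Hom A (Z (Suc k)) (Z (Suc k))"
  unfolding rh_def Z_def power_module_fun[of M "n (Suc k)"]
 proof (rule fun_pointwise_lin)
  fix j assume "j : {..<n (Suc k)}"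
  then show "ta (%w:$(Fun {..<n (Suc k)} M). w j) : Hom A (Fun {..<n (Suc k)} M) M"
   using lin_closed[OF ta pr[of j]] by (simp add: H_def hom_module_simps Z_def power_module_fun)
 qed
 \<comment> \<open>Both sides are linear over the endomorphism ring and agree on the coordinate
   projections, by the definition of \<open>rh\<close>.\<close>
 have tarh: "ta vv = (%x:?c. vv (rh x))" if vv: "vv : $(H (Suc k))" for vv
 proof (rule fin_dual_basis_lin_eq[OF Hm Hm _ ta _ _ vv])
  show "fin_dual_basis ?G (H (Suc k)) {..<n (Suc k)} (%i. %w:?c. w i)
   (%i vv. %m:$M. vv (fun_unit {..<n (Suc k)} M i m))"
   unfolding H_def Z_def by (rule M.hom_power_dual_basis)
  show "(%vv. %x:?c. vv (rh x)) : Hom ?G (H (Suc k)) (H (Suc k))"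
   unfolding H_def by (rule M.hom_precompose[OF Zm rh])
  fix j assume j: "j : {..<n (Suc k)}"
  have "ta (%w:?c. w j) : extensional ?c" using lin_closed[OF ta pr[of j]] j by (simp add: H_def hom_module_simps)
  then show "ta (%w:?c. w j) = (%x:?c. (%w:?c. w j) (rh x))"
   using j lin_closed[OF rh] by (auto simp: rh_def fun_eq_iff extensional_def)
 qed
 show thesis
 proof (rule that[OF rh])
  fix x assume "x : N (Suc k)"
  then obtain w where w: "w : $(Z k)" "x = z k w" unfolding N(2) by blast
  have "rh x j = x j" if j: "j < n (Suc k)" for j
  proof -
   have "p k (%w:?c. w j) : U" unfolding U_def using pr[OF j] by blast
   then have "p k (ta (%w:?c. w j)) w = p k (%w:?c. w j) w" unfolding ta_def by (simp add: psg)
   then show ?thesis using w lin_closed[OF z w(1)] j by (simp add: p_def rh_def)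
  qed
  moreover have "rh x : ?c" "x : ?c" using lin_closed[OF rh] lin_closed[OF z w(1)] w(2) by simp_all
  ultimately show "rh x = x" by (intro PiE_ext[of _ "{..<n (Suc k)}" "%_. $M"]) (simp_all add: Z_def power_module_def)
 next
  fix x assume x: "x : ?c"
  show "rh x : N (Suc k)"
  proof (rule ccontr)
   \<comment> \<open>A map \<open>ph\<close> that vanishes on \<open>N (Suc k)\<close> is killed by
     \<open>p k\<close>, hence by \<open>ta\<close>, which is composition with \<open>rh\<close>; so
     \<open>ph\<close> vanishes at \<open>rh x\<close>. The cogenerator would provide a
     \<open>ph\<close> that does not.\<close>
   assume no: "rh x ~: N (Suc k)"
   have fgZ: "fin_gen A (Z (Suc k))" unfolding Z_def power_module_fun by (rule M.fin_gen_fun[OF _ fg]) simp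
   obtain ph where ph: "ph : Hom A (Z (Suc k)) M" "!!x. x : N (Suc k) ==> ph x = 0[M]" "ph (rh x) ~= 0[M]"
    by (rule cogenerator_separates[OF M Zm fgZ sub lin_closed[OF rh x] no]) (rule that)
   let ?ph = "restrict ph ?c"
   have mem: "?ph : $(H (Suc k))" unfolding H_def hom_module_simps by (rule restrict_lin[OF Zm ph(1)])
   have "p k ?ph = 0[C 0]"
    using ph(2) lin_closed[OF z] by (auto simp: p_def C_def H_def hom_module_simps N(2) fun_eq_iff)
   then have "ta ?ph = 0[H (Suc k)]" unfolding ta_def
    using lin_zero[OF long_exactD(1)[OF E] Hm sg] by simp
   then have "(%x:?c. ?ph (rh x)) x = 0[M]" unfolding tarh[OF mem] using x by (simp add: H_def hom_module_simps)
   then show False using ph(3) x lin_closed[OF rh x] by simp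
  qed
 qed
qed

end

context fin_dim_algebra begin

text \<open>Coresolving \<open>C 0\<close> by powers of \<open>M\<close> embeds it into
  \<open>Z 1\<close>. The hypothesis \<open>ext\<close> extends this embedding to a morphism from
  \<open>C\<close> to the coresolution, and the retraction onto \<open>N d\<close> allows the latter
  to be cut off after \<open>d\<close> steps with zero at the right end. There the lift is zero, so
  the cocycle becomes a coboundary, and the embedded \<open>C 0\<close> is all of the left
  term.\<close>

lemma extendable_null:
 fixes M :: "('a, 'm) module" and C P :: "nat => ('a, 'x) module" and io :: "(nat => 'm) => 'x"
 assumes M: "generator_cogenerator K A M" and gd: "gl_dim (End_ring A M) <= enat (Suc d)" and d: "1 <= d"
  and E: "lexact A d (C, f)" and fgC: "fin_gen A (C 0)" and io: "inj io"
  and ext: "!!i t. i < d ==> t : Hom A (C i) M ==> (!!x. x : $(C i) ==> f i x = 0[C (Suc i)] ==> t x = 0[M]) ==>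
   EX t':Hom A (C (Suc i)) M. ALL x:$(C i). t' (f i x) = t x"
  and P: "proj_complex A d (P, p)" and h: "smor A d (P, p) (C, f) h"
 shows "EX e:Hom A (P 1) (C 0). ALL x:$(P 0). h 0 x = e (p 0 x)"
proof -
 note D = long_exactD[OF E]
 have lm: "lmod A M" and fg: "fin_gen A M" using M by (simp_all add: generator_cogenerator_def)
 interpret M: left_module A M by (rule lm)
 have C0: "lmod A (C 0)" by (rule D(1)) simp
 let ?Z = "powm M"
 have ZM: "lmod A (?Z j)" for j unfolding power_module_fun by (rule fun_left_module[OF lm])
 have fgZ: "fin_gen A (?Z j)" for j unfolding power_module_fun by (rule M.fin_gen_fun[OF _ fg]) simp

 \<comment> \<open>The coresolution of \<open>C 0\<close> by powers of \<open>M\<close>\<close>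
 obtain a v where v: "v : Hom A (?Z a) (C 0)" "v ` $(?Z a) = $(C 0)"
  by (rule generator_cover[OF M C0 fgC]) (rule that)
 let ?N = "{x : $(?Z a). v x = 0[C 0]}"
 have sN: "smod ?N A (?Z a)" by (rule lin_kernel[OF ZM C0 v(1)])
 obtain b y where y: "y : Hom A (?Z b) (?Z a@[?N])" "y ` $(?Z b) = $(?Z a@[?N])"
  by (rule generator_cover[OF M left_module.submodule_left_module[OF ZM sN] submodule_fin_gen[OF ZM fgZ sN]]) (rule that)
 have y': "y : Hom A (?Z b) (?Z a)" by (rule lin_enlarge[OF y(1)]) auto
 \<comment> \<open>\<open>g\<close> has kernel \<open>N\<close>, and every map killing
   \<open>N\<close> factors through it; the image of \<open>g\<close> is the next \<open>N\<close>.
   The recursion starts with the kernel of the cover \<open>v\<close>.\<close>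
 define good where "good a N n g \<longleftrightarrow> g : Hom A (?Z a) (?Z n) & {x : $(?Z a). g x = 0[?Z n]} = N &
  (ALL vv:Hom A (?Z a) M. (ALL x:N. vv x = 0[M]) --> (EX ch:Hom A (?Z n) M. ALL x:$(?Z a). ch (g x) = vv x))"
  for a N n and g :: "(nat => 'm) => nat => 'm"
 let ?P = "%i s. smod (snd s) A (?Z (fst s)) & (i = (0::nat) --> s = (a, ?N))"
 let ?Q = "%s s'. EX g. good (fst s) (snd s) (fst s') g & snd s' = g ` $(?Z (fst s))"
 have "EX s. ALL i. ?P i (s i) & ?Q (s i) (s (Suc i))"
 proof (rule dependent_nat_choice)
  show "EX s. ?P 0 s" using sN by (intro exI[of _ "(a, ?N)"]) simp
  fix s i assume s: "?P i s"
  then have s': "smod (snd s) A (?Z (fst s))" by simp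
  obtain n g where g: "g : Hom A (?Z (fst s)) (?Z n)" "{x : $(?Z (fst s)). g x = 0[?Z n]} = snd s"
   "!!vv. vv : Hom A (?Z (fst s)) M ==> ALL x:snd s. vv x = 0[M] ==>
    EX ch:Hom A (?Z n) M. ALL x:$(?Z (fst s)). ch (g x) = vv x"
   by (rule approximation[OF M ZM fgZ s']) (rule that, assumption, assumption, blast)
  have "good (fst s) (snd s) n g" unfolding good_def using g by auto
  then show "EX s'. ?P (Suc i) s' & ?Q s s'"
   using lin_image[OF ZM ZM g(1)] by (intro exI[of _ "(n, g ` $(?Z (fst s)))"]) auto
 qed
 then obtain s where s: "!!i. ?P i (s i)" "!!i. ?Q (s i) (s (Suc i))" by blast
 have "ALL i. EX g. good (fst (s i)) (snd (s i)) (fst (s (Suc i))) g & snd (s (Suc i)) = g ` $(?Z (fst (s i)))"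
  using s(2) by blast
 from choice[OF this] obtain z where zg: "!!i. good (fst (s i)) (snd (s i)) (fst (s (Suc i))) (z i)"
  "!!i. snd (s (Suc i)) = z i ` $(?Z (fst (s i)))" by blast
 have s0: "s 0 = (a, ?N)" using s(1)[of 0] by simp
 define n where "n i = fst (s i)" for i
 define Z where "Z i = ?Z (n i)" for i
 define N where "N i = snd (s i)" for i
 note zg = zg[folded n_def, folded Z_def N_def]
 have Z: "lmod A (Z i)" for i unfolding Z_def by (rule ZM)
 have z: "z i : Hom A (Z i) (Z (Suc i))" and kz: "{x : $(Z i). z i x = 0[Z (Suc i)]} = N i" for i
  using zg(1)[of i] unfolding good_def Z_def by simp_all
 have fac: "EX ch:Hom A (Z (Suc i)) M. ALL x:$(Z i). ch (z i x) = vv x"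
  if "vv : Hom A (Z i) M" "ALL x:N i. vv x = 0[M]" for i vv
  using zg(1)[of i] that unfolding good_def Z_def by blast
 have sub: "smod (N i) A (Z i)" for i using s(1)[of i] by (simp add: Z_def N_def n_def)
 have Z0: "Z 0 = ?Z a" "?N = N 0" by (simp_all add: Z_def N_def n_def s0)
 note v = v[folded Z0(1)] Z0(2)[folded Z0(1)]
 have N: "N 0 = y ` $(?Z b)" "!!i. N (Suc i) = z i ` $(Z i)" using y(2) Z0(2) zg(2) by simp_all
 have y: "y : Hom A (?Z b) (Z 0)" using y' Z0(1) by simp
 have NZ: "x : $(Z i)" if "x : N i" for i x using left_module.submoduleD(1)[OF Z sub] that by blast
 have zN: "z i x = 0[Z (Suc i)]" if "x : N i" for i x using kz[of i] that by blast
 obtain k where k: "d = Suc k" using d by (cases d) auto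
 obtain rh where rh: "rh : Hom A (Z d) (Z d)" "!!x. x : N d ==> rh x = x" "!!x. x : $(Z d) ==> rh x : N d"
  unfolding k Z_def
  by (rule coresolution_retraction[OF M gd[unfolded k], of z n y b N])
   (use z y N sub zN fac that in "simp_all only: Z_def k")
 \<comment> \<open>The kernels of \<open>v\<close> and \<open>z 0\<close> agree, so
   \<open>C 0\<close> is identified with the image \<open>N 1\<close> of \<open>z 0\<close>.\<close>
 obtain th where th: "th : Hom A (C 0@[v ` $(Z 0)]) (Z 1)" "!!w. w : $(Z 0) ==> th (v w) = z 0 w"
 proof (rule lin_factor[OF Z C0 Z v(1), where g="z 0"])
  show "z 0 : Hom A (Z 0) (Z 1)" using z[of 0] by simp
  show "z 0 x = 0[Z 1]" if "x : $(Z 0)" "v x = 0[C 0]" for x using zN[of x 0] v(3) that by auto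
 qed (rule that)
 have th': "th : Hom A (C 0) (Z 1)" using th(1) by (simp add: v(2))
 have imth: "th ` $(C 0) = N 1"
  using th(2) N(2)[of 0] unfolding v(2)[symmetric] by (simp add: image_image cong: image_cong)
 have injth: "inj_on th ($(C 0))"
 proof (rule inj_onI)
  interpret C0: left_module A "C 0" by (rule C0)
  interpret Z1: left_module A "Z (Suc 0)" by (rule Z)
  fix x x' assume *: "x : $(C 0)" "x' : $(C 0)" "th x = th x'"
  then have "x -[C 0] x' : $(C 0)" by simp
  then obtain w where w: "w : $(Z 0)" "x -[C 0] x' = v w" unfolding v(2)[symmetric] by blast
  have "z 0 w = 0[Z 1]" using lin_diff[OF C0 Z th' *(1,2)] *(3) lin_closed[OF th' *(2)] th(2)[OF w(1)] w(2)
   by (simp add: a_minus_def Z1.M.r_neg)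
  then have "v w = 0[C 0]" using kz[of 0] v(3) w(1) by auto
  then show "x = x'" using C0.minus_zero_eq[OF *(1,2)] w(2) by simp
 qed

 \<comment> \<open>The morphism to the truncated coresolution\<close>
 have extZ: "EX t':Hom A (C (Suc i)) (Z j). ALL x:$(C i). t' (f i x) = t x"
  if i: "i < d" and t: "t : Hom A (C i) (Z j)" "!!x. x : $(C i) ==> f i x = 0[C (Suc i)] ==> t x = 0[Z j]" for i j t
 proof -
  have "EX t'. t' : Hom A (C (Suc i)) M & (ALL x:$(C i). t' (f i x) = t x l)" if l: "l < n j" for l
  proof -
   have "(%u. u l) : Hom A (Z j) M" unfolding Z_def power_module_fun using l by (intro fun_eval_lin) simp
   then have "(%x. t x l) : Hom A (C i) M" by (rule lin_comp[OF t(1)])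
   then show ?thesis using ext[OF i, of "%x. t x l"] t(2) l by (auto simp: Z_def power_module_def)
  qed
  then have "ALL l. EX t'. l < n j --> t' : Hom A (C (Suc i)) M & (ALL x:$(C i). t' (f i x) = t x l)" by blast
  from choice[OF this] obtain T where T: "!!l. l < n j ==> T l : Hom A (C (Suc i)) M"
   "!!l x. l < n j ==> x : $(C i) ==> T l (f i x) = t x l" by blast
  have "(%x. %l:{..<n j}. T l x) : Hom A (C (Suc i)) (Z j)"
   unfolding Z_def power_module_fun using T(1) by (intro fun_pointwise_lin) simp
  moreover have "(%l:{..<n j}. T l (f i x)) = t x" if "x : $(C i)" for x
   using T(2) that lin_closed[OF t(1) that]
   by (intro PiE_ext[of _ "{..<n j}" "%_. $M"]) (auto simp: Z_def power_module_def)
  ultimately show ?thesis by (intro bexI ballI)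
 qed
 \<comment> \<open>Here \<open>u\<close> maps \<open>C (Suc i)\<close> to \<open>Z (Suc i)\<close>.
   Since it takes the image of \<open>f i\<close> into \<open>N (Suc i)\<close>, which
   \<open>z (Suc i)\<close> kills, the next map can again be obtained by extension.\<close>
 let ?P = "%i u. i < d --> u : Hom A (C (Suc i)) (Z (Suc i)) & (ALL x:$(C i). u (f i x) : N (Suc i)) &
  (i = 0 --> (ALL x:$(C 0). u (f 0 x) = th x))"
 let ?Q = "%i u u'. Suc i < d --> (ALL x:$(C (Suc i)). u' (f (Suc i) x) = z (Suc i) (u x))"
 have "EX u. ALL i. ?P i (u i) & ?Q i (u i) (u (Suc i))"
 proof (rule dependent_nat_choice)
  have C1: "lmod A (C 1)" "f 0 : Hom A (C 0) (C 1)" using D(1)[of 1] D(2)[of 0] by simp_all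
  have "th x = 0[Z 1]" if "x : $(C 0)" "f 0 x = 0[C (Suc 0)]" for x
  proof -
   have "x = 0[C 0]"
    using inj_onD[OF D(3), of x "0[C 0]"] that lin_zero[OF C0 C1] left_module.axioms(2)[OF C0] by (simp add: abelian_group_def abelian_monoid.zero_closed)
   then show ?thesis using lin_zero[OF C0 Z th'] by simp
  qed
  then obtain t where "t : Hom A (C (Suc 0)) (Z 1)" "ALL x:$(C 0). t (f 0 x) = th x"
   using extZ[of 0 th 1] th' d by auto
  then show "EX u. ?P 0 u" using imth by (intro exI[of _ t]) auto
 next
  fix u i assume u: "?P i u"
  show "EX u'. ?P (Suc i) u' & ?Q i u u'"
  proof (cases "Suc i < d")
   case True
   have u: "u : Hom A (C (Suc i)) (Z (Suc i))" "!!x. x : $(C i) ==> u (f i x) : N (Suc i)" using u True by auto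
   have "z (Suc i) (u x) = 0[Z (Suc (Suc i))]" if "x : $(C (Suc i))" "f (Suc i) x = 0[C (Suc (Suc i))]" for x
   proof -
    have "x : f i ` $(C i)" using D(5)[of i] that True by simp
    then show ?thesis using zN u(2) by auto
   qed
   from extZ[OF True lin_comp[OF u(1) z] this] obtain t
    where t: "t : Hom A (C (Suc (Suc i))) (Z (Suc (Suc i)))" "ALL x:$(C (Suc i)). t (f (Suc i) x) = z (Suc i) (u x)" by blast
   have "t (f (Suc i) x) : N (Suc (Suc i))" if "x : $(C (Suc i))" for x
    using t(2) that lin_closed[OF u(1) that] by (auto simp: N(2))
   then show ?thesis using t by (intro exI[of _ t]) auto
  qed simp
 qed
 then obtain u where "ALL i. ?P i (u i) & ?Q i (u i) (u (Suc i))" by (rule exE)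
 note * = this[THEN spec]
 note u = *[THEN conjunct1] *[THEN conjunct2]
 \<comment> \<open>The truncation \<open>N 1, Z 1, ..., Z (d - 1), N d, 0\<close>. The map from
   \<open>C d\<close> to \<open>Z d\<close> is pushed into \<open>N d\<close> by \<open>rh\<close>,
   which fixes \<open>N d\<close> and so preserves commutativity.\<close>
 define J where "J i = (if i = 0 then Z 1@[N 1] else if i < d then Z i else if i = d then Z d@[N d]
  else Z d@[{0[Z d]}])" for i
 define j where "j i = (if i = 0 then (%x. x) else if i < d then z i else (%x. 0[Z d]))" for i
 define ta where "ta i = (if i = 0 then th else if i < d then u (i - 1) else if i = d then (%x. rh (u k x)) else (%x. 0[Z d]))" for i
 note sm = left_module.submodule_left_module[OF Z]
 have J: "lmod A (J i)" for i
  using Z sm[OF sub] sm[OF left_module.submodule_zero[OF Z]] by (simp add: J_def)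
 have JE: "lexact A d (J, j)"
  unfolding long_exact_def
 proof (intro case_prodI conjI allI impI J)
  fix i assume "i <= d"
  then consider "i = 0" | "1 <= i" "i < d" | "i = d" by linarith
  then show "j i : Hom A (J i) (J (Suc i))"
  proof cases
   case 1
   then show ?thesis using NZ d by (intro lin_mapsI) (auto simp: J_def j_def)
  next
   case 2
   then show ?thesis using z[of i] N(2)[of i] by (cases "Suc i = d") (auto simp: J_def j_def lin_maps_def)
  next
   case 3
   then show ?thesis using lin_zero_map[OF J[of "Suc d"]] d by (simp add: J_def j_def)
  qed
 next
  fix i assume i: "i < d"
  have "j i ` $(J i) = N (Suc i)" using i N(2)[of i] by (cases "i = 0") (simp_all add: J_def j_def del: N(2))
  moreover have "{x : $(J (Suc i)). j (Suc i) x = 0[J (Suc (Suc i))]} = N (Suc i)"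
  proof (cases "Suc i = d")
   case True
   then show ?thesis using NZ[of _ d] by (auto simp: J_def j_def)
  next
   case False
   then show ?thesis using i kz[of "Suc i"] by (cases "Suc (Suc i) = d") (auto simp: J_def j_def)
  qed
  ultimately show "j i ` $(J i) = {x : $(J (Suc i)). j (Suc i) x = 0[J (Suc (Suc i))]}" by simp
 next
  have "0[Z d] : N d" by (rule left_module.submoduleD(2)[OF Z sub])
  then show "j d ` $(J d) = $(J (Suc d))" using d by (auto simp: J_def j_def)
 qed (use d in "simp add: j_def")
 have tal: "ta i : Hom A (C i) (J i)" if id: "i <= Suc d" for i
 proof -
  consider "i = 0" | i' where "i = Suc i'" "i < d" | "i = d" "i ~= 0" | "i = Suc d" using id by (cases i) (auto, metis Suc_leI order_le_less)
  then show ?thesis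
  proof cases
   case 1
   then show ?thesis using th' imth by (auto simp: ta_def J_def lin_maps_def)
  next
   case 2
   then show ?thesis using u(1)[of i'] by (simp add: ta_def J_def)
  next
   case 3
   have "(%x. rh (u k x)) : Hom A (C d) (Z d)" using u(1)[of k] by (intro lin_comp[OF _ rh(1)]) (simp add: k)
   then have "(%x. rh (u k x)) : Hom A (C d) (Z d@[N d])"
    using rh(3) lin_closed[of "u k" A "C d" "Z d"] u(1)[of k] by (auto simp: lin_maps_def k)
   then show ?thesis using 3 by (simp add: ta_def J_def)
  next
   case 4
   then show ?thesis using lin_zero_map[OF J[of "Suc d"]] by (simp add: ta_def J_def)
  qed
 qed
 have tac: "ta (Suc i) (f i x) = j i (ta i x)" if "i <= d" and x: "x : $(C i)" for i x
 proof (cases "i = d")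
  case True
  then show ?thesis using d by (simp add: ta_def j_def)
 next
  case False
  then have i: "i < d" using that(1) by simp
  have "ta (Suc i) (f i x) = u i (f i x)"
   using i rh(2) u(1)[of i] x k by (cases "Suc i = d") (auto simp: ta_def)
  also have "... = j i (ta i x)"
  proof (cases i)
   case 0
   then show ?thesis using u(1)[of 0] x d by (simp add: j_def ta_def)
  next
   case (Suc i')
   then show ?thesis using u(2)[of i'] x i by (simp add: j_def ta_def)
  qed
  finally show ?thesis .
 qed
 have inj: "inj_on io S" for S using io by (rule inj_on_subset) simp
 let ?J = "%i. transport io (J i)" and ?j = "%i x. io (j i (inv_into ($(J i)) io x))"
 have "smor A d (C, f) (?J, ?j) (%i x. io (ta i x))"
  unfolding seq_morphism_def prod.case
 proof (intro conjI allI impI ballI)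
  fix i assume "i <= Suc d"
  then show "(%x. io (ta i x)) : Hom A (C i) (?J i)" by (intro lin_comp[OF tal transport(2)[OF J inj]])
 next
  fix i x assume i: "i <= d" and x: "x : $(C i)"
  have "ta i x : $(J i)" using i x by (intro lin_closed[OF tal]) simp_all
  then show "io (ta (Suc i) (f i x)) = ?j i (io (ta i x))" using tac[OF i x] inv_into_f_f[OF inj] by simp
 qed
 note hta = seq_morphism_comp[OF h this]
 \<comment> \<open>The right end of \<open>J\<close> is zero, so \<open>homotopy\<close> applies to
   the composite from \<open>P\<close> to \<open>J\<close>.\<close>
 have "EX e:Hom A (P 1) (?J 0). ALL x:$(P 0). io (ta 0 (h 0 x)) = e (p 0 x)"
  by (rule homotopy[OF transport_long_exact[OF JE inj] P hta]) (simp add: transport_simps ta_def J_def)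
 then obtain e where e: "e : Hom A (P 1) (?J 0)" "ALL x:$(P 0). io (th (h 0 x)) = e (p 0 x)"
  by (auto simp: ta_def)
 have J0: "J 0 = Z 1@[N 1]" by (simp add: J_def)
 have th0: "th : Hom A (C 0) (J 0)" using tal[of 0] by (simp add: ta_def)
 have s: "(%x. inv_into ($(C 0)) th (inv_into ($(J 0)) io (e x))) : Hom A (P 1) (C 0)"
  by (rule lin_comp[OF lin_comp[OF e(1) transport(3)[OF J inj]] lin_inv_into[OF C0 th0 injth]]) (simp add: imth J0)
 have "inv_into ($(C 0)) th (inv_into ($(J 0)) io (e (p 0 x))) = h 0 x" if x: "x : $(P 0)" for x
 proof -
  have c: "h 0 x : $(C 0)" using seq_morphismD(1)[OF h, of 0] x by (auto intro: lin_closed)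
  then show ?thesis using e(2) x inv_into_f_f[OF inj lin_closed[OF th0 c]] inv_into_f_f[OF injth c] by auto
 qed
 then show ?thesis using s by (intro bexI[OF _ s]) auto
qed

end

section \<open>Extending maps on tensor products generically\<close>

text \<open>The vectors in \<open>V\<close> are homogeneous linear equations, possibly infinitely
  many, and \<open>I\<close> indexes the unknowns.\<close>

definition lifts_solutions ::
  "('r, 'z) ring_scheme => 'i set => ('i => 'r) set => ('r, 'n) module => ('r, 'n) module => ('n => 'n) => bool" where
 "lifts_solutions R I V N N' pp \<longleftrightarrow> (ALL x : I -> $N'. (ALL v:V. (SUM[N']i:I. v i .[N'] x i) = 0[N']) -->
  (EX y : I -> $N. (ALL i:I. pp (y i) = x i) & (ALL v:V. (SUM[N]i:I. v i .[N] y i) = 0[N])))"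

text \<open>One element has to serve all modules at once. It acts bijectively on \<open>N\<close>
  but only injectively on \<open>N'\<close>, as happens for the dual of a submodule on which it acts
  surjectively. The type argument fixes the carriers of the modules quantified over.\<close>

definition denominator :: "'n itself => ('r, 'z) ring_scheme => 'i set => ('i => 'r) set => 'r => bool" where
 "denominator _ R I V De \<longleftrightarrow> De : $R & De ~= 0[R] & (ALL (N :: ('r, 'n) module) N' pp.
  lmod R N & lmod R N' & pp : Hom R N N' & pp ` $N = $N' &
  bij_betw (module.smult N De) $N $N & inj_on (module.smult N' De) $N' -->
  lifts_solutions R I V N N' pp)"

text \<open>Gaussian elimination, by induction on the unknowns. If some equation \<open>v\<close>
  has a nonzero pivot \<open>p\<close> at \<open>i\<close>, the combinations
  \<open>p w - w_i v\<close> no longer contain the unknown \<open>i\<close>. Their denominator times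
  \<open>p\<close> works, as \<open>p\<close> can be divided by in \<open>N\<close> and cancelled in
  \<open>N'\<close>.\<close>

lemma linear_system_lift:
 fixes R :: "('r, 'z) ring_scheme" and V :: "('i => 'r) set"
 assumes R: "domain R" and I: "finite I" and V: "V <= I -> $R"
 shows "EX De. denominator TYPE('n) R I V De"
 using I V
proof (induction I arbitrary: V rule: finite_induct)
 case empty
 interpret domain R by fact
 have "finsum N f {} = 0[N]" if "lmod R N" for N :: "('r, 'n) module" and f :: "'i => 'n"
 proof -
  interpret left_module R N by fact
  show ?thesis by simp
 qed
 then show ?case by (intro exI[of _ "1[R]"]) (auto simp: denominator_def lifts_solutions_def)
next
 case (insert i I)
 interpret domain R by fact
 have VR: "v j : $R" if "v : V" "j = i | j : I" for v j using insert.prems that by blast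
 have VI: "V <= I -> $R" using VR by auto
 show ?case
 proof (cases "ALL v:V. v i = 0[R]")
  \<comment> \<open>Without a pivot the unknown \<open>i\<close> is free, and any preimage of
    \<open>x i\<close> will do.\<close>
  case True
  obtain De where De: "denominator TYPE('n) R I V De" using insert.IH[OF VI] by blast
  have "lifts_solutions R (insert i I) V N N' pp"
   if h: "lmod R N" "lmod R N'" "pp : Hom R N N'" "pp ` $N = $N'"
    "bij_betw (module.smult N De) $N $N" "inj_on (module.smult N' De) $N'"
   for N N' :: "('r, 'n) module" and pp
  proof -
   interpret N: left_module R N by (rule h(1))
   interpret N': left_module R N' by (rule h(2))
   have s: "(SUM[N]j:insert i I. v j .[N] y j) = (SUM[N]j:I. v j .[N] y j)"
    if "v : V" "y : insert i I -> $N" for v y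
   proof -
    have "(SUM[N]j:I. v j .[N] y j) : $N"
     using that VR[OF that(1)] by (intro N.M.finsum_closed) (auto intro!: N.smult_closed)
    moreover have "v i .[N] y i = 0[N]" using that True N.smult_l_null by auto
    ultimately show ?thesis
     using insert.hyps that VR[OF that(1)] by (subst N.M.finsum_insert) (auto intro!: N.smult_closed)
   qed
   have s': "(SUM[N']j:insert i I. v j .[N'] y j) = (SUM[N']j:I. v j .[N'] y j)"
    if "v : V" "y : insert i I -> $N'" for v y
   proof -
    have "(SUM[N']j:I. v j .[N'] y j) : $N'"
     using that VR[OF that(1)] by (intro N'.M.finsum_closed) (auto intro!: N'.smult_closed)
    moreover have "v i .[N'] y i = 0[N']" using that True N'.smult_l_null by auto
    ultimately show ?thesis
     using insert.hyps that VR[OF that(1)] by (subst N'.M.finsum_insert) (auto intro!: N'.smult_closed)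
   qed
   show ?thesis
    unfolding lifts_solutions_def
   proof (intro ballI impI)
    fix x assume x: "x : insert i I -> $N'" "ALL v:V. (SUM[N']i:insert i I. v i .[N'] x i) = 0[N']"
    then have "ALL v:V. (SUM[N']i:I. v i .[N'] x i) = 0[N']" using s' by simp
    then obtain y where y: "y : I -> $N" "ALL j:I. pp (y j) = x j" "ALL v:V. (SUM[N]j:I. v j .[N] y j) = 0[N]"
     using De h x(1) unfolding denominator_def lifts_solutions_def by blast
    have "x i : pp ` $N" unfolding h(4) using x(1) by auto
    then obtain u where u: "u : $N" "pp u = x i" by (elim imageE) simp
    have c: "y(i := u) : insert i I -> $N" using y(1) u(1) by auto
    have "(SUM[N]j:insert i I. v j .[N] (y(i := u)) j) = 0[N]" if v: "v : V" for v
    proof -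
     have "(SUM[N]j:I. v j .[N] (y(i := u)) j) = (SUM[N]j:I. v j .[N] y j)"
      using insert.hyps(2) y(1) VR[OF v] by (intro N.M.finsum_cong') (auto intro!: N.smult_closed)
     then show ?thesis using s[OF v c] y(3) v by simp
    qed
    then show "EX y:insert i I -> $N. (ALL j:insert i I. pp (y j) = x j) &
      (ALL v:V. (SUM[N]j:insert i I. v j .[N] y j) = 0[N])"
     using c y(2) u(2) insert.hyps(2) by (intro bexI[OF _ c]) auto
   qed
  qed
  then show ?thesis using De by (intro exI[of _ De]) (simp add: denominator_def)
 next
  case False
  then obtain v where v: "v : V" "v i ~= 0[R]" by blast
  define p where "p = v i"
  have p: "p : $R" "p ~= 0[R]" using v VR by (auto simp: p_def)
  let ?w = "%w j. p *[R] w j -[R] w i *[R] v j"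
  have V': "?w ` V <= I -> $R" using p VR v(1) by auto
  obtain De where D: "denominator TYPE('n) R I (?w ` V) De" using insert.IH[OF V'] by blast
  then have De: "De : $R" "De ~= 0[R]" by (simp_all add: denominator_def)
  have "lifts_solutions R (insert i I) V N N' pp"
   if h: "lmod R N" "lmod R N'" "pp : Hom R N N'" "pp ` $N = $N'"
    "bij_betw (module.smult N (p *[R] De)) $N $N" "inj_on (module.smult N' (p *[R] De)) $N'"
   for N N' :: "('r, 'n) module" and pp
  proof -
   interpret N: left_module R N by (rule h(1))
   interpret N': left_module R N' by (rule h(2))
   \<comment> \<open>If a product of commuting scalars acts injectively or surjectively, so does
     each factor.\<close>
   have injN: "inj_on (module.smult N q) $N" "inj_on (module.smult N' q) $N'"
    if q: "q = p & q' = De | q = De & q' = p" for q q'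
   proof -
    have e: "p *[R] De = q' *[R] q" "q : $R" "q' : $R" using q p De m_comm by auto
    show "inj_on (module.smult N q) $N"
     using bij_betw_imp_inj_on[OF h(5)] unfolding inj_on_def e(1) by (metis N.smult_assoc1 e(2,3))
    show "inj_on (module.smult N' q) $N'"
     using h(6) unfolding inj_on_def e(1) by (metis N'.smult_assoc1 e(2,3))
   qed
   have surjN: "EX x:$N. q .[N] x = z" if q: "q = p & q' = De | q = De & q' = p" and z: "z : $N" for q q' z
   proof -
    have e: "p *[R] De = q *[R] q'" "q : $R" "q' : $R" using q p De m_comm by auto
    obtain x where x: "x : $N" "z = (p *[R] De) .[N] x" using bij_betw_imp_surj_on[OF h(5)] z by blast
    then show ?thesis using e by (intro bexI[of _ "q' .[N] x"]) (simp_all add: N.smult_assoc1 N.smult_closed)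
   qed
   have "bij_betw (module.smult N De) $N $N"
    unfolding bij_betw_def using injN(1)[of De p] surjN[of De p] De(1) N.smult_closed by (auto simp: image_iff)
   then have L: "lifts_solutions R I (?w ` V) N N' pp" using D h(1-4) injN(2)[of De p] unfolding denominator_def by blast
   \<comment> \<open>The elimination identity, stated for any module since it is applied to
     solutions in \<open>N\<close> and in \<open>N'\<close>.\<close>
   have red: "p .[M] (SUM[M]j:insert i I. w j .[M] y j) =
     (SUM[M]j:I. ?w w j .[M] y j) +[M] w i .[M] (SUM[M]j:insert i I. v j .[M] y j)"
    if M: "lmod R M" and w: "w : V" and y: "y : insert i I -> $M" for M :: "('r, 'n) module" and w y
   proof -
    interpret M: left_module R M by (rule M)
    have wR: "w j : $R" "v j : $R" "y j : $M" if "j = i | j : I" for j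
     using VR[OF w that] VR[OF v(1) that] y that by auto
    have a: "(SUM[M]j:I. p .[M] (w j .[M] y j)) = (SUM[M]j:I. ?w w j .[M] y j) +[M] (SUM[M]j:I. w i .[M] (v j .[M] y j))"
    proof (subst M.M.finsum_addf[symmetric])
     have "p .[M] (w j .[M] y j) = ?w w j .[M] y j +[M] w i .[M] (v j .[M] y j)" if "j : I" for j
     proof -
      have "p *[R] w j = ?w w j +[R] w i *[R] v j" using wR that p by (simp add: a_minus_def a_assoc l_neg)
      then show ?thesis using wR that p
       by (simp add: M.smult_assoc1[symmetric] M.smult_l_distr[symmetric])
     qed
     then show "(SUM[M]j:I. p .[M] (w j .[M] y j)) = (SUM[M]j:I. ?w w j .[M] y j +[M] w i .[M] (v j .[M] y j))"
      using wR p by (intro M.M.finsum_cong') (auto intro!: M.smult_closed)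
    qed (use wR p in "auto intro!: M.smult_closed")
    have b: "w i .[M] (v i .[M] y i) = p .[M] (w i .[M] y i)"
     using wR p m_comm[of p "w i"] by (simp add: p_def M.smult_assoc1[symmetric])
    have cl: "(SUM[M]j:I. u j .[M] y j) : $M" if "!!j. j : I ==> u j : $R" for u
     using that wR by (intro M.M.finsum_closed) (auto intro!: M.smult_closed)
    show ?thesis
     using insert.hyps wR p a b cl[of w] cl[of v] cl[of "?w w"]
     by (simp add: M.smult_closed Pi_iff M.smult_r_distr M.smult_finsum M.M.a_ac)
   qed
   show ?thesis
    unfolding lifts_solutions_def
   proof (intro ballI impI)
    fix x assume x: "x : insert i I -> $N'" "ALL w:V. (SUM[N']j:insert i I. w j .[N'] x j) = 0[N']"
    have "(SUM[N']j:I. ?w w j .[N'] x j) = 0[N']" if "w : V" for w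
    proof -
     have "(SUM[N']j:I. ?w w j .[N'] x j) : $N'"
      using V' that x(1) by (intro N'.M.finsum_closed) (auto intro!: N'.smult_closed)
     then show ?thesis
      using red[OF h(2) that x(1)] x(2) that v(1) p VR[OF that] by (simp add: N'.smult_r_null)
    qed
    then obtain y where y: "y : I -> $N" "ALL j:I. pp (y j) = x j" "ALL w:V. (SUM[N]j:I. ?w w j .[N] y j) = 0[N]"
     using L x(1) unfolding lifts_solutions_def by auto
    let ?s = "SUM[N]j:I. v j .[N] y j"
    have s: "?s : $N" using y(1) VR[OF v(1)] by (intro N.M.finsum_closed) (auto intro!: N.smult_closed)
    \<comment> \<open>The remaining unknown is computed from the pivot equation by dividing by
      \<open>p\<close>.\<close>
    obtain u where u: "u : $N" "p .[N] u = -[N] ?s" using surjN[of p De "-[N] ?s"] s by auto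
    let ?y = "y(i := u)"
    have c: "?y : insert i I -> $N" using y(1) u(1) by auto
    have yI: "(SUM[N]j:I. w j .[N] ?y j) = (SUM[N]j:I. w j .[N] y j)" if "w : I -> $R" for w
     using insert.hyps(2) y(1) that by (intro N.M.finsum_cong') (auto intro!: N.smult_closed)
    have v0: "(SUM[N]j:insert i I. v j .[N] ?y j) = 0[N]"
    proof -
     have "(SUM[N]j:insert i I. v j .[N] ?y j) = v i .[N] ?y i +[N] (SUM[N]j:I. v j .[N] ?y j)"
      using insert.hyps c VR[OF v(1)] by (intro N.M.finsum_insert) (auto intro!: N.smult_closed)
     also have "... = -[N] ?s +[N] ?s" using u yI[of v] VI v(1) by (auto simp: p_def)
     also have "... = 0[N]" by (rule N.M.l_neg[OF s])
     finally show ?thesis .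
    qed
    have w0: "(SUM[N]j:insert i I. w j .[N] ?y j) = 0[N]" if w: "w : V" for w
    proof (rule inj_onD[OF injN(1)[of p De]])
     show "p .[N] (SUM[N]j:insert i I. w j .[N] ?y j) = p .[N] 0[N]"
      using red[OF h(1) w c] v0 yI[of "?w w"] V' y(3) w p VR[OF w] by (simp add: N.smult_r_null image_subset_iff)
    qed (use c VR[OF w] in "auto intro!: N.M.finsum_closed N.smult_closed")
    \<comment> \<open>Both elements satisfy the pivot equation with the same other unknowns, and
      \<open>p\<close> is cancellable on \<open>N'\<close>.\<close>
    have "pp u = x i"
    proof (rule inj_onD[OF injN(2)[of p De]])
     have xi: "x i : $N'" and xI: "x : I -> $N'" using x(1) by auto
     let ?t = "SUM[N']j:I. v j .[N'] x j"
     have t: "?t : $N'" using xI VR[OF v(1)] by (intro N'.M.finsum_closed) (auto intro!: N'.smult_closed)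
     have "pp ?s = (SUM[N']j:I. pp (v j .[N] y j))"
      using y(1) VR[OF v(1)] by (intro lin_finsum[OF h(1,2,3)]) (auto intro!: N.smult_closed)
     also have "... = ?t"
      using y VR[OF v(1)] xI by (intro N'.M.finsum_cong') (auto simp: lin_smult[OF h(3)] Pi_iff intro!: N'.smult_closed)
     finally have "p .[N'] pp u = -[N'] ?t"
      using lin_smult[OF h(3) p(1) u(1)] u(2) lin_minus[OF h(1,2,3) s] by simp
     moreover have "p .[N'] x i +[N'] ?t = 0[N']"
      using bspec[OF x(2) v(1)] insert.hyps xi xI VR[OF v(1)]
      by (subst (asm) N'.M.finsum_insert) (auto simp: p_def intro!: N'.smult_closed)
     then have "-[N'] ?t = p .[N'] x i" using t xi p(1) by (intro N'.M.minus_equality) (simp_all add: N'.smult_closed)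
     ultimately show "p .[N'] pp u = p .[N'] x i" by simp
    qed (use x(1) lin_closed[OF h(3) u(1)] in auto)
    then show "EX y:insert i I -> $N. (ALL j:insert i I. pp (y j) = x j) &
      (ALL w:V. (SUM[N]j:insert i I. w j .[N] y j) = 0[N])"
     using w0 c y(2) insert.hyps(2) by (intro bexI[OF _ c]) auto
   qed
  qed
  moreover have "p *[R] De : $R" "p *[R] De ~= 0[R]" using p De integral_iff by auto
  ultimately show ?thesis by (intro exI[of _ "p *[R] De"]) (simp add: denominator_def)
 qed
qed

text \<open>The shape of the equations used below: coefficients supported on the cross formed by the
  column \<open>s'\<close> and the row \<open>j\<close>.\<close>

lemma (in left_module) finsum_split_cross:
 assumes fin: "finite I" "finite S" and j: "j : I" "s' : S" and P: "P : I -> $M" and Q: "Q : S -> $M"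
 shows "(SUM[M]p:I \<times> S. (if s' = snd p then P (fst p) else 0[M]) -[M] (if j = fst p then Q (snd p) else 0[M])) =
  (SUM[M]i:I. P i) -[M] (SUM[M]s:S. Q s)"
proof -
 have "(%x. -[M] x) : Hom R M M" by (rule lin_mapsI) (auto simp: M.minus_add M.a_comm smult_r_minus smult_closed)
 note m = lin_finsum[OF lself lself this]
 have c: "(if s' = snd p then P (fst p) else 0[M]) : $M" "(if j = fst p then Q (snd p) else 0[M]) : $M"
  if "p : I \<times> S" for p using that P Q by auto
 have "(SUM[M]p:I \<times> S. if s' = snd p then P (fst p) else 0[M]) = (SUM[M]i:I. SUM[M]s:S. if s' = s then P i else 0[M])"
  by (rule finsum_double[symmetric]) (use fin P in auto)
 also have "... = (SUM[M]i:I. P i)"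
  using P fin j by (intro M.finsum_cong' M.add.finprod_singleton) auto
 finally have e1: "(SUM[M]p:I \<times> S. if s' = snd p then P (fst p) else 0[M]) = (SUM[M]i:I. P i)" .
 have "(SUM[M]p:I \<times> S. if j = fst p then Q (snd p) else 0[M]) = (SUM[M]i:I. SUM[M]s:S. if j = i then Q s else 0[M])"
  by (rule finsum_double[symmetric]) (use fin Q in auto)
 also have "... = (SUM[M]i:I. if j = i then SUM[M]s:S. Q s else 0[M])"
  using Q by (intro M.finsum_cong') (auto intro!: M.finsum_closed)
 also have "... = (SUM[M]s:S. Q s)" using Q fin j by (intro M.add.finprod_singleton) auto
 finally have e2: "(SUM[M]p:I \<times> S. if j = fst p then Q (snd p) else 0[M]) = (SUM[M]s:S. Q s)" .
 show ?thesis
  unfolding e1[symmetric] e2[symmetric] a_minus_def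
  by (subst m) (use c in "auto intro!: M.finsum_addf")
qed

lemma minus_regular: "x -[regm R] y = x -[R] y" "x -[rsc ph M] y = x -[M] y"
 by (simp_all add: a_minus_def a_inv_def m_inv_def)

text \<open>The \<open>K\<close>-dual of an \<open>R\<close>-module. Dualizing turns the extension
  of functionals along an inclusion into lifting along a surjective restriction, the form handled by
  \<open>linear_system_lift\<close>.\<close>

definition functionals ::
  "('k, 'z) ring_scheme => ('k, 'r, 'v) module_scheme => ('r, 'y) module => ('r, 'y => 'k) module" where
 "functionals K R Y = \<lparr>carrier = Hom K (kres R Y) (regm K) \<inter> extensional $Y,
  monoid.mult = undefined, monoid.one = undefined, ring.zero = (%x:$Y. 0[K]),
  ring.add = (%f g. %x:$Y. f x +[K] g x), module.smult = (%r f. %x:$Y. f (r .[Y] x))\<rparr>"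

lemma functionals_simps:
 "$(functionals K R Y) = Hom K (kres R Y) (regm K) \<inter> extensional $Y"
 "0[functionals K R Y] = (%x:$Y. 0[K])"
 "f +[functionals K R Y] g = (%x:$Y. f x +[K] g x)"
 "r .[functionals K R Y] f = (%x:$Y. f (r .[Y] x))"
 by (simp_all add: functionals_def)

locale scalar_algebra = K: field K + R: assoc_algebra K R + Rc: cring R
 for K :: "('k, 'z) ring_scheme" and R :: "('k, 'r, 'v) module_scheme"
begin

abbreviation "FM \<equiv> functionals K R"

lemma kres_left_module: "lmod R Y ==> lmod K (kres R Y)"
 by (rule restrict_scalars_left_module[OF K.ring_axioms R.scalar_hom])

lemma functional_memI:
 assumes "lmod R Y" "f : Hom K (kres R Y) (regm K)"
 shows "restrict f $Y : $(FM Y)"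
 using restrict_lin[OF kres_left_module[OF assms(1)] assms(2)] by (simp add: functionals_simps)

lemma functional_left_module:
 assumes Y: "lmod R Y" shows "lmod R (FM Y)"
proof -
 interpret Y: left_module R Y by fact
 interpret reg: left_module K "regm K" by (rule regular_left_module[OF K.ring_axioms])
 note [simp] = functionals_simps Y.smult_closed
 have "abelian_group (FM Y)"
  by (rule reg.hom_abelian_group[OF kres_left_module[OF Y]]) (simp_all add: functionals_def)
 moreover have "r .[FM Y] f : $(FM Y)"
  if r: "r : $R" and f: "f : $(FM Y)" for r f
 proof -
  have "(%x. r .[Y] x) : Hom K (kres R Y) (kres R Y)"
   by (rule lin_mapsI) (use r R.scalar_closed in "auto simp: Y.smult_r_distr Y.smult_assoc1[symmetric] R.scalar_central")
  then show ?thesis using functional_memI[OF Y lin_comp] f by fastforce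
 qed
 moreover have "f (x +[Y] y) = f x +[K] f y"
  if "f : $(FM Y)" "x : $Y" "y : $Y" for f x y
  using lin_add[of f K "kres R Y" "regm K"] that by simp
 ultimately show ?thesis
  unfolding left_module_def left_module_axioms_def
  by (auto simp: Y.smult_l_distr Y.smult_one Y.smult_assoc1[symmetric] Rc.m_comm restrict_def fun_eq_iff extensional_def
   intro!: R.ring_axioms)
qed

lemma functional_finsum:
 assumes Y: "lmod R Y" and x: "x : J -> $(FM Y)" and y: "y : $Y"
 shows "(SUM[FM Y]j:J. x j) y = (SUM[K]j:J. x j y)"
proof -
 let ?F = "FM Y"
 note F = functional_left_module[OF Y]
 have "(%f. f y) : Hom K (kres R ?F) (regm K)"
 proof (rule lin_mapsI)
  fix k f assume k: "k : $K" "f : $(kres R ?F)"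
  then show "(k .[kres R ?F] f) y = k .[regm K] f y"
   using lin_smult[of f K "kres R Y" "regm K" k y] y by (simp add: functionals_simps)
 qed (use y lin_closed[of _ K "kres R Y" "regm K" y] in "auto simp: functionals_simps")
 then have "(SUM[kres R ?F]j:J. x j) y = (SUM[regm K]j:J. x j y)"
  by (rule lin_finsum[OF kres_left_module[OF F] regular_left_module[OF K.ring_axioms]]) (use x in simp)
 then show ?thesis by simp
qed

text \<open>Restriction is onto because a projection onto the subspace extends functionals.\<close>

lemma functional_restrict:
 assumes Y: "lmod R Y" and U: "smod U R Y"
 defines "Y' \<equiv> Y@[U]"
 shows "(%f. restrict f U) : Hom R (FM Y) (FM Y')"
  "(%f. restrict f U) ` $(FM Y) = $(FM Y')"
proof -
 interpret Y: left_module R Y by fact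
 note D = Y.submoduleD[OF U]
 have Y': "lmod R Y'" unfolding Y'_def by (rule Y.submodule_left_module[OF U])
 have kr: "kres R Y' = kres R Y@[U]" by (simp add: Y'_def restrict_scalars_def)
 have c: "restrict f U : $(FM Y')" if "f : $(FM Y)" for f
 proof -
  have "f : Hom K (kres R Y') (regm K)"
   using that D(1) unfolding kr by (simp add: functionals_simps lin_maps_def subset_iff Pi_iff)
  from functional_memI[OF Y' this] show ?thesis by (simp add: Y'_def)
 qed
 then show "(%f. restrict f U) : Hom R (FM Y) (FM Y')"
  by (intro lin_mapsI) (use D in "auto simp: functionals_simps Y'_def fun_eq_iff restrict_def subset_iff")
 have sU: "smod U K (kres R Y)"
  using D R.scalar_closed by (intro left_module.submoduleI'[OF kres_left_module[OF Y]]) auto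
 obtain p where p: "p : Hom K (kres R Y) (kres R Y@[U])" "!!u. u : U ==> p u = u"
  by (rule subspace_projection[OF K.field_axioms kres_left_module[OF Y] sU]) (rule that)
 have "f : (%f. restrict f U) ` $(FM Y)" if f: "f : $(FM Y')" for f
 proof (rule image_eqI)
  have "f : Hom K (kres R Y@[U]) (regm K)" using f unfolding functionals_simps kr by blast
  then show "(%x:$Y. f (p x)) : $(FM Y)" by (rule functional_memI[OF Y lin_comp[OF p(1)]])
  show "f = restrict (%x:$Y. f (p x)) U"
   using f D(1) p(2) by (auto simp: functionals_simps Y'_def fun_eq_iff extensional_def)
 qed
 then show "(%f. restrict f U) ` $(FM Y) = $(FM Y')" using c by blast
qed

lemma functional_inj:
 assumes Y: "lmod R Y" and r: "r : $R" "module.smult Y r ` $Y = $Y"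
 shows "inj_on (module.smult (FM Y) r) ($(FM Y))"
proof (rule inj_onI)
 fix f g assume fg: "f : $(FM Y)" "g : $(FM Y)"
  "r .[FM Y] f = r .[FM Y] g"
 have "f y = g y" if y: "y : $Y" for y
 proof -
  obtain x where x: "x : $Y" "y = r .[Y] x" using y r(2) by blast
  then show ?thesis using fun_cong[OF fg(3), of x] by (simp add: functionals_simps)
 qed
 then show "f = g" using fg by (intro extensionalityI[of f "$Y"]) (auto simp: functionals_simps)
qed

lemma functional_bij:
 assumes Y: "lmod R Y" and r: "r : $R" "bij_betw (module.smult Y r) $Y $Y"
 shows "bij_betw (module.smult (FM Y) r) ($(FM Y)) ($(FM Y))"
proof -
 interpret Y: left_module R Y by fact
 interpret F: left_module R "FM Y" by (rule functional_left_module[OF Y])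
 have s: "module.smult Y r ` $Y = $Y" and i: "inj_on (module.smult Y r) $Y" using r(2) by (auto simp: bij_betw_def)
 let ?i = "inv_into $Y (module.smult Y r)"
 have "module.smult Y r : Hom K (kres R Y) (kres R Y)"
  by (rule lin_mapsI)
   (use r(1) R.scalar_closed in "auto simp: Y.smult_r_distr Y.smult_assoc1[symmetric] R.scalar_central Y.smult_closed")
 then have inv: "?i : Hom K (kres R Y) (kres R Y)"
  using lin_inv_into[OF kres_left_module[OF Y], of "module.smult Y r" "kres R Y"] i s by simp
 have "f : module.smult (FM Y) r ` $(FM Y)"
  if f: "f : $(FM Y)" for f
 proof (rule image_eqI)
  show "(%y:$Y. f (?i y)) : $(FM Y)"
   by (rule functional_memI[OF Y lin_comp[OF inv]]) (use f in "simp add: functionals_simps")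
  show "f = r .[FM Y] (%y:$Y. f (?i y))"
   using f inv_into_f_f[OF i] r(1) by (auto simp: functionals_simps fun_eq_iff extensional_def Y.smult_closed)
 qed
 then show ?thesis
  using functional_inj[OF Y r(1) s] F.smult_closed[OF r(1)] unfolding bij_betw_def by blast
qed

end

text \<open>With a dual basis \<open>b\<close>, \<open>c\<close> of the lattice over
  \<open>R\<close> and a dual basis \<open>m\<close>, \<open>mu\<close> of \<open>M\<close> over
  \<open>K\<close>, a map \<open>t\<close> from the tensor product to \<open>M\<close> is given by
  the functionals sending \<open>y\<close> to \<open>mu s (t (b i >< y))\<close>. Linearity over
  \<open>A\<close> is a system of equations for these functionals whose coefficients in
  \<open>R\<close> depend on the lattice and on \<open>M\<close> only. Hence one denominator serves
  all \<open>Y\<close>, \<open>Y''\<close>, \<open>f\<close> and \<open>t\<close>.\<close>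

lemma (in fin_dim_algebra) generic_extension:
 fixes LA :: "('a, 'l) module" and LR :: "('r, 'l) module" and R :: "('k, 'r) module" and M :: "('a, 'm) module"
  and b :: "'i => 'l"
 assumes RA: "assoc_algebra K R" and dom: "domain R" and B: "flat_bimodule A LA R LR I b c"
  and compat: "!!k l. k : $K ==> l : $LR ==> scalar A k .[LA] l = scalar R k .[LR] l"
  and M: "lmod A M" "fin_gen A M"
 shows "EX De:$R. De ~= 0[R] & (ALL (Y :: ('r, 'y) module) (Y'' :: ('r, 'y) module) f t. lmod R Y --> lmod R Y'' -->
  f : Hom R Y Y'' --> bij_betw (module.smult Y'' De) $Y'' $Y'' -->
  module.smult Y De ` $Y = $Y --> t : Hom A (bt R LA LR Y) M -->
  (ALL z:$(bt R LA LR Y). tmap R LR Y'' (%x. x) f z = 0[bt R LA LR Y''] --> t z = 0[M]) -->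
  (EX t':Hom A (bt R LA LR Y'') M. ALL z:$(bt R LA LR Y). t' (tmap R LR Y'' (%x. x) f z) = t z))"
proof -
 interpret dom: domain R by fact
 interpret scalar_algebra K R by (intro scalar_algebra.intro K.field_axioms RA dom.is_cring)
 interpret B: flat_bimodule A LA R LR I b c by fact
 interpret M: left_module A M by (rule M(1))
 interpret KM: left_module K "kres A M" by (rule kres_module[OF M(1)])
 note D = B.dbD

 \<comment> \<open>The linear system that expresses linearity over \<open>A\<close>\<close>
 obtain S :: "('m \<times> unit) set" and m mu where db: "fin_dual_basis K (kres A M) S m mu"
  using fin_gen_dual_basis[OF K.field_axioms kres_module[OF M(1)] kres_fin_gen[OF M]] by blast
 note E = fin_dual_basisD[OF db, simplified] and mK = fin_dual_basisD(2)[OF db]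
 note [simp] = A.scalar_closed R.scalar_closed
 \<comment> \<open>The equation for \<open>a\<close>, \<open>j\<close>, \<open>s'\<close> compares
   two expansions of the coordinate \<open>s'\<close> of \<open>t (a b_j >< y)\<close>: one in the
   dual basis of the lattice, with entries \<open>c i (a b_j)\<close>, and one with \<open>a\<close>
   acting on \<open>M\<close>, with entries \<open>mu s' (a m_s)\<close>.\<close>
 define w where "w = (%a j s' (i, s). (if s = s' then c i (a .[LA] b j) else 0[R]) -[R]
  (if i = j then scalar R (mu s' (a .[M] m s)) else 0[R]))"
 have cab: "c i (a .[LA] b j) : $R" if "a : $A" "j : I" "i : I" for a i j using D that by simp
 have muam: "mu s' (a .[M] m s) : $K" if "a : $A" "s : S" "s' : S" for a s s'
  using E M.smult_closed that by simp
 have wR: "w a j s' p : $R" if "a : $A" "j : I" "s' : S" "p : I \<times> S" for a j s' p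
  using that cab[OF that(1,2)] muam[OF that(1) _ that(3)] by (cases p) (simp add: w_def)
 define V where "V = {w a j s' | a j s'. a : $A & j : I & s' : S}"
 have V: "V <= I \<times> S -> $R" using wR by (auto simp: V_def)
 \<comment> \<open>\<open>R\<close> acts on functionals through their argument, which is why the
   lattice coefficients appear inside \<open>x (i, s')\<close>.\<close>
 have solution_iff: "(SUM[FM Y]p:I \<times> S. w a j s' p .[FM Y] x p) = 0[FM Y] \<longleftrightarrow>
  (ALL y:$Y. (SUM[K]i:I. x (i, s') (c i (a .[LA] b j) .[Y] y)) = (SUM[K]s:S. mu s' (a .[M] m s) *[K] x (j, s) y))"
  if Y: "lmod R Y" and x: "x : I \<times> S -> $(FM Y)" and ajs: "a : $A" "j : I" "s' : S"
  for Y :: "('r, 'y) module" and a j s' x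
 proof -
  interpret Y: left_module R Y by (rule Y)
  interpret F: left_module R "FM Y" by (rule functional_left_module[OF Y])
  let ?F = "FM Y"
  have wx: "(%p. w a j s' p .[?F] x p) : I \<times> S -> $?F" using x wR[OF ajs] by (auto intro!: F.smult_closed)
  have xl: "x p : Hom K (kres R Y) (regm K)" if "p : I \<times> S" for p using x that by (auto simp: functionals_simps)
  have xc: "x p y : $K" if "p : I \<times> S" "y : $Y" for p y using lin_closed[OF xl[OF that(1)]] that(2) by simp
  have "(SUM[?F]p:I \<times> S. w a j s' p .[?F] x p) y =
   (SUM[K]i:I. x (i, s') (c i (a .[LA] b j) .[Y] y)) -[K] (SUM[K]s:S. mu s' (a .[M] m s) *[K] x (j, s) y)"
   if y: "y : $Y" for y
  proof -
   let ?P = "%i. x (i, s') (c i (a .[LA] b j) .[Y] y)" and ?Q = "%s. mu s' (a .[M] m s) *[K] x (j, s) y"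
   let ?g = "%p. if s' = snd p then ?P (fst p) else 0[K]" and ?h = "%p. if j = fst p then ?Q (snd p) else 0[K]"
   have P: "?P : I -> $K" and Q: "?Q : S -> $K"
    using xc y cab[OF ajs(1,2)] muam[OF ajs(1) _ ajs(3)] ajs by (auto intro!: Y.smult_closed K.m_closed)
   have gh: "?g p : $K" "?h p : $K" if "p : I \<times> S" for p using that P Q by auto
   have "(SUM[?F]p:I \<times> S. w a j s' p .[?F] x p) y = (SUM[K]p:I \<times> S. (w a j s' p .[?F] x p) y)"
    by (rule functional_finsum[OF Y wx y])
   also have "... = (SUM[K]p:I \<times> S. ?g p -[K] ?h p)"
   proof (rule K.finsum_cong')
    fix p assume p: "p : I \<times> S"
    obtain i s where ps: "p = (i, s)" "i : I" "s : S" using p by auto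
    note l = xl[OF p] and ci = cab[OF ajs(1,2) ps(2)] and mui = muam[OF ajs(1) ps(3) ajs(3)]
    have z: "x p 0[Y] = 0[K]" using lin_zero[OF kres_left_module[OF Y] regular_left_module[OF K.ring_axioms] l] by simp
    have sm: "x p (scalar R k .[Y] y) = k *[K] x p y" if "k : $K" for k using lin_smult[OF l that] y by simp
    have "(w a j s' p .[?F] x p) y = x p (w a j s' p .[Y] y)" using y by (simp add: functionals_simps)
    also have "w a j s' p .[Y] y = (if s = s' then c i (a .[LA] b j) .[Y] y else 0[Y]) -[Y]
      (if i = j then scalar R (mu s' (a .[M] m s)) .[Y] y else 0[Y])"
     using ci mui y by (simp add: w_def ps(1) a_minus_def Y.smult_l_distr Y.smult_l_minus Y.smult_l_null Y.smult_closed)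
    also have "x p ... = x p (if s = s' then c i (a .[LA] b j) .[Y] y else 0[Y]) -[K]
      x p (if i = j then scalar R (mu s' (a .[M] m s)) .[Y] y else 0[Y])"
     using lin_diff[OF kres_left_module[OF Y] regular_left_module[OF K.ring_axioms] l] ci mui y
     by (simp add: minus_regular Y.smult_closed)
    also have "... = ?g p -[K] ?h p" using z sm[OF mui] by (auto simp: ps(1))
    finally show "(w a j s' p .[?F] x p) y = ?g p -[K] ?h p" .
   qed (use gh in auto)
   also have "... = (SUM[K]i:I. ?P i) -[K] (SUM[K]s:S. ?Q s)"
    using left_module.finsum_split_cross[OF regular_left_module[OF K.ring_axioms], of I S j s' ?P ?Q] P Q D(1) E(1) ajs
    by (simp add: minus_regular cong: if_cong)
   finally show ?thesis .
  qed
  note val = this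
  have cl: "(SUM[K]i:I. x (i, s') (c i (a .[LA] b j) .[Y] y)) : $K" "(SUM[K]s:S. mu s' (a .[M] m s) *[K] x (j, s) y) : $K"
   if "y : $Y" for y
   using that xc cab[OF ajs(1,2)] muam[OF ajs(1) _ ajs(3)] ajs by (auto intro!: K.finsum_closed simp: Y.smult_closed)
  have ext: "(SUM[?F]p:I \<times> S. w a j s' p .[?F] x p) : extensional $Y"
   using F.M.finsum_closed[OF wx] by (simp add: functionals_simps)
  show ?thesis
  proof
   assume z: "(SUM[?F]p:I \<times> S. w a j s' p .[?F] x p) = 0[?F]"
   show "ALL y:$Y. (SUM[K]i:I. x (i, s') (c i (a .[LA] b j) .[Y] y)) = (SUM[K]s:S. mu s' (a .[M] m s) *[K] x (j, s) y)"
   proof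
    fix y assume y: "y : $Y"
    have "(SUM[?F]p:I \<times> S. w a j s' p .[?F] x p) y = 0[K]" unfolding z using y by (simp add: functionals_simps(2))
    then show "(SUM[K]i:I. x (i, s') (c i (a .[LA] b j) .[Y] y)) = (SUM[K]s:S. mu s' (a .[M] m s) *[K] x (j, s) y)"
     unfolding val[OF y] K.r_right_minus_eq[OF cl[OF y]] .
   qed
  next
   assume "ALL y:$Y. (SUM[K]i:I. x (i, s') (c i (a .[LA] b j) .[Y] y)) = (SUM[K]s:S. mu s' (a .[M] m s) *[K] x (j, s) y)"
   then have "(SUM[?F]p:I \<times> S. w a j s' p .[?F] x p) y = 0[?F] y" if "y : $Y" for y
    using val[OF that] cl[OF that] that by (simp add: functionals_simps K.r_right_minus_eq)
   then show "(SUM[?F]p:I \<times> S. w a j s' p .[?F] x p) = 0[?F]"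
    using ext by (intro extensionalityI[of _ "$Y"]) (auto simp: functionals_simps)
  qed
 qed
 obtain De where den: "denominator TYPE('y => 'k) R (I \<times> S) V De"
  using linear_system_lift[OF dom finite_cartesian_product[OF D(1) E(1)] V] by blast
 then have De: "De : $R" "De ~= 0[R]" by (simp_all add: denominator_def)

 \<comment> \<open>Extension of one given map by lifting its functionals\<close>
 have "EX t':Hom A (bt R LA LR Y'') M. ALL z:$(bt R LA LR Y). t' (tmap R LR Y'' (%x. x) f z) = t z"
  if Y: "lmod R Y" and Y'': "lmod R Y''" and f: "f : Hom R Y Y''"
   and bij: "bij_betw (module.smult Y'' De) $Y'' $Y''" and surj: "module.smult Y De ` $Y = $Y"
   and t: "t : Hom A (bt R LA LR Y) M"
   and kt: "ALL z:$(bt R LA LR Y). tmap R LR Y'' (%x. x) f z = 0[bt R LA LR Y''] --> t z = 0[M]"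
  for Y Y'' :: "('r, 'y) module" and f t
 proof -
  interpret Y: left_module R Y by (rule Y)
  interpret Y'': left_module R Y'' by (rule Y'')
  interpret TY: tensor_product R LR Y "bt R LA LR Y" by (rule B.tp[OF Y])
  interpret TY'': tensor_product R LR Y'' "bt R LA LR Y''" by (rule B.tp[OF Y''])
  let ?T = "bt R LA LR Y" and ?e = "etens R LR Y" and ?f = "tmap R LR Y'' (%x. x) f"
  note T = B.bt_left_module[OF Y] and sm = B.bt_smult[OF Y] and fe = tensor_map(3)[OF B.tp[OF Y] B.tp[OF Y''] lin_ident f]
  have mu: "mu s : Hom K (kres A M) (regm K)" "!!x. x : $M ==> mu s x : $K" if "s : S" for s
   using E(3,4) that by simp_all
  have te: "t (?e l y) : $M" if "l : $LR" "y : $Y" for l y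
   by (rule lin_closed[OF t TY.tensor_closed[OF that]])
  define th where "th = (%(i, s) y. mu s (t (?e (b i) y)))"
  have th: "th (i, s) : Hom K (kres R Y) (regm K)" if "i : I" "s : S" for i s
  proof (rule lin_mapsI)
   fix k y assume k: "k : $K" and y: "y : $(kres R Y)"
   have "?e (b i) (scalar R k .[Y] y) = scalar A k .[?T] ?e (b i) y"
    using k y D(2)[OF that(1)] compat[OF k D(2)[OF that(1)]] by (simp add: sm TY.tensor_smult[symmetric])
   then show "th (i, s) (k .[kres R Y] y) = k .[regm K] th (i, s) y"
    using k y D(2)[OF that(1)] lin_smult[OF t, of "scalar A k" "?e (b i) y"] lin_smult[OF mu(1)[OF that(2)] k, of "t (?e (b i) y)"] te
    by (simp add: th_def)
  next
   fix y y' assume "y : $(kres R Y)" "y' : $(kres R Y)"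
   then show "th (i, s) (y +[kres R Y] y') = th (i, s) y +[regm K] th (i, s) y'"
    using D(2)[OF that(1)] te lin_add[OF mu(1)[OF that(2)]] by (simp add: th_def TY.tensor_add_right lin_add[OF t])
  qed (use that D(2) te mu in "simp add: th_def")
  have mS: "m s : $M" if "s : S" for s using E(2)[OF that] by simp
  have mexp: "x = (SUM[kres A M]s:S. mu s x .[kres A M] m s)" if "x : $M" for x
   using E(5)[of x] that by simp
  have texp: "t z = (SUM[M]i:I. t (?e (b i) (B.coord Y i z)))" if z: "z : $?T" for z
  proof -
   have "t (SUM[?T]i:I. ?e (b i) (B.coord Y i z)) = (SUM[M]i:I. t (?e (b i) (B.coord Y i z)))"
    using D(2) B.coord(1)[OF Y _ z] by (intro lin_finsum[OF T M(1) t]) auto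
   then show ?thesis unfolding B.coord_expand[OF Y z] .
  qed
  have thsys: "(SUM[K]i:I. th (i, s') (c i (a .[LA] b j) .[Y] y)) = (SUM[K]s:S. mu s' (a .[M] m s) *[K] th (j, s) y)"
   if a: "a : $A" and j: "j : I" and s': "s' : S" and y: "y : $Y" for a j s' y
  proof -
   note l = D(2)[OF j] and regK = regular_left_module[OF K.ring_axioms]
   have abl: "a .[LA] b j : $LR" using a l by simp
   have "t (?e (a .[LA] b j) y) = (SUM[M]i:I. t (?e (b i) (c i (a .[LA] b j) .[Y] y)))"
    unfolding texp[OF TY.tensor_closed[OF abl y]] using B.coord(3)[OF Y _ abl y] te D(2) cab[OF a j] y
    by (intro M.M.finsum_cong') (auto simp: Y.smult_closed)
   then have "mu s' (t (?e (a .[LA] b j) y)) = mu s' (SUM[kres A M]i:I. t (?e (b i) (c i (a .[LA] b j) .[Y] y)))" by simp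
   also have "... = (SUM[regm K]i:I. mu s' (t (?e (b i) (c i (a .[LA] b j) .[Y] y))))"
    using te D(2) cab[OF a j] y by (intro lin_finsum[OF KM.lself regK mu(1)[OF s']]) (auto simp: Y.smult_closed)
   finally have e1: "mu s' (t (?e (a .[LA] b j) y)) = (SUM[K]i:I. th (i, s') (c i (a .[LA] b j) .[Y] y))" by (simp add: th_def)
   have act: "(%x. a .[M] x) : Hom K (kres A M) (kres A M)"
    by (rule lin_mapsI) (use a in "auto simp: M.smult_r_distr M.smult_assoc1[symmetric] A.scalar_central M.smult_closed")
   have "t (?e (a .[LA] b j) y) = a .[M] t (?e (b j) y)"
    using sm[OF a l y] lin_smult[OF t a TY.tensor_closed[OF l y]] by simp
   also have "t (?e (b j) y) = (SUM[kres A M]s:S. th (j, s) y .[kres A M] m s)"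
    using mexp[OF te[OF l y]] by (simp add: th_def)
   finally have "mu s' (t (?e (a .[LA] b j) y)) = mu s' (a .[M] (SUM[kres A M]s:S. th (j, s) y .[kres A M] m s))" by simp
   also have "... = (SUM[regm K]s:S. mu s' (a .[M] (th (j, s) y .[kres A M] m s)))"
    using mS lin_closed[OF th[OF j]] y
    by (intro lin_finsum[OF KM.lself regK lin_comp[OF act mu(1)[OF s']]]) (auto intro!: M.smult_closed)
   also have "... = (SUM[K]s:S. mu s' (a .[M] m s) *[K] th (j, s) y)"
    unfolding finsum_regular
   proof (rule K.finsum_cong')
    fix s assume s: "s : S"
    have k: "th (j, s) y : $K" using lin_closed[OF th[OF j s], of y] y by simp
    show "mu s' (a .[M] (th (j, s) y .[kres A M] m s)) = mu s' (a .[M] m s) *[K] th (j, s) y"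
     using lin_smult[OF lin_comp[OF act mu(1)[OF s']] k, of "m s"] mS[OF s] K.m_comm[OF k muam[OF a s s']] by simp
   qed (use lin_closed[OF th[OF j]] y muam[OF a _ s'] in auto)
   finally show ?thesis using e1 by simp
  qed
  \<comment> \<open>The functionals of \<open>t\<close> vanish on the kernel of \<open>f\<close>, so
    they descend to the submodule \<open>f(Y)\<close> of \<open>Y''\<close>. There \<open>De\<close>
    acts surjectively, hence injectively on the dual, as \<open>denominator\<close> demands.\<close>
  let ?U = "f ` $Y"
  have U: "smod ?U R Y''" by (rule lin_image[OF Y Y'' f])
  let ?Y = "Y''@[?U]"
  have Y1: "lmod R ?Y" by (rule Y''.submodule_left_module[OF U])
  have kr: "kres R ?Y = kres R Y''@[?U]" by (simp add: restrict_scalars_def)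
  have "EX k. k : Hom K (kres R ?Y) (regm K) & (ALL y:$Y. k (f y) = th p y)" if p: "p : I \<times> S" for p
  proof -
   obtain i s where ps: "p = (i, s)" "i : I" "s : S" using p by auto
   have ker: "th p y = 0[regm K]" if y: "y : $(kres R Y)" "f y = 0[kres R Y'']" for y
   proof -
    have "?f (?e (b i) y) = 0[bt R LA LR Y'']" using y fe[OF D(2)[OF ps(2)], of y] TY''.tensor_zero_right[OF D(2)[OF ps(2)]] by simp
    then have "t (?e (b i) y) = 0[M]" using kt D(2)[OF ps(2)] y(1) by simp
    then show ?thesis
     using lin_zero[OF KM.lself regular_left_module[OF K.ring_axioms] mu(1)[OF ps(3)]] by (simp add: ps(1) th_def)
   qed
   have thp: "th p : Hom K (kres R Y) (regm K)" unfolding ps(1) by (rule th[OF ps(2,3)])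
   have fK: "f : Hom K (kres R Y) (kres R Y'')" by (rule lin_restrict_scalars[OF R.scalar_hom f])
   obtain k where "k : Hom K (kres R Y''@[f ` $(kres R Y)]) (regm K)"
     "!!y. y : $(kres R Y) ==> k (f y) = th p y"
    by (rule lin_factor[OF kres_left_module[OF Y] kres_left_module[OF Y''] regular_left_module[OF K.ring_axioms] fK thp ker])
     (assumption, assumption, rule that)
   then show ?thesis unfolding kr by (intro exI[of _ k]) simp
  qed
  then have "ALL p:I \<times> S. EX k. k : Hom K (kres R ?Y) (regm K) & (ALL y:$Y. k (f y) = th p y)" by (rule ballI)
  from bchoice[OF this] obtain k where *: "ALL p:I \<times> S. k p : Hom K (kres R ?Y) (regm K) & (ALL y:$Y. k p (f y) = th p y)"
   by (rule exE)
  note k = bspec[OF *, THEN conjunct1] bspec[OF *, THEN conjunct2, THEN bspec]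
  define x where "x p = restrict (k p) ?U" for p
  have x: "x : I \<times> S -> $(FM ?Y)"
   using functional_memI[OF Y1 k(1)] by (auto simp: x_def)
  have xf: "x p (f y) = th p y" if "p : I \<times> S" "y : $Y" for p y using that k(2) by (simp add: x_def)
  have sol: "(SUM[FM ?Y]p:I \<times> S. v p .[FM ?Y] x p) = 0[FM ?Y]" if v: "v : V" for v
  proof -
   obtain a j s' where ajs: "v = w a j s'" "a : $A" "j : I" "s' : S" using v by (auto simp: V_def)
   show ?thesis
    unfolding ajs(1) solution_iff[OF Y1 x ajs(2-4)]
   proof
    fix u assume "u : $?Y"
    then obtain y where y: "y : $Y" "u = f y" by auto
    have "(SUM[K]i:I. x (i, s') (c i (a .[LA] b j) .[?Y] u)) = (SUM[K]i:I. th (i, s') (c i (a .[LA] b j) .[Y] y))"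
     using y ajs cab[OF ajs(2,3)] lin_closed[OF th] xf
     by (intro K.finsum_cong') (auto simp: lin_smult[OF f, symmetric] Y.smult_closed)
    also have "... = (SUM[K]s:S. mu s' (a .[M] m s) *[K] x (j, s) u)"
     unfolding thsys[OF ajs(2-4) y(1)] using y ajs xf lin_closed[OF th] muam[OF ajs(2) _ ajs(4)]
     by (intro K.finsum_cong') auto
    finally show "(SUM[K]i:I. x (i, s') (c i (a .[LA] b j) .[?Y] u)) = (SUM[K]s:S. mu s' (a .[M] m s) *[K] x (j, s) u)" .
   qed
  qed
  have sU: "module.smult ?Y De ` $?Y = $?Y"
  proof -
   have "module.smult Y'' De ` f ` $Y = f ` module.smult Y De ` $Y"
    using De(1) by (simp add: image_image lin_smult[OF f, symmetric] cong: image_cong)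
   then show ?thesis using surj by simp
  qed
  have "lifts_solutions R (I \<times> S) V (FM Y'') (FM ?Y) (%f. restrict f ?U)"
   using den functional_left_module[OF Y''] functional_left_module[OF Y1] functional_restrict[OF Y'' U]
    functional_bij[OF Y'' De(1) bij] functional_inj[OF Y1 De(1) sU] unfolding denominator_def by blast
  then obtain x' where x': "x' : I \<times> S -> $(FM Y'')" "ALL p:I \<times> S. restrict (x' p) ?U = x p"
   "ALL v:V. (SUM[FM Y'']p:I \<times> S. v p .[FM Y''] x' p) = 0[FM Y'']"
   using x sol unfolding lifts_solutions_def by blast
  have xl: "x' p : Hom K (kres R Y'') (regm K)" if "p : I \<times> S" for p using x'(1) that by (auto simp: functionals_simps)
  have x'c: "x' (i, s) y : $K" if "i : I" "s : S" "y : $Y''" for i s y using lin_closed[OF xl[of "(i, s)"]] that by simp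
  have x'f: "x' (i, s) (f y) = th (i, s) y" if "i : I" "s : S" "y : $Y" for i s y
   using fun_cong[OF bspec[OF x'(2)], of "(i, s)" "f y"] that xf[of "(i, s)" y] by simp
  \<comment> \<open>The lifted functionals are reassembled into maps from \<open>Y''\<close> to
    \<open>M\<close>; \<open>ta i y\<close> is meant as the value of the extension at
    \<open>b i >< y\<close>.\<close>
  define ta where "ta i y = (SUM[kres A M]s:S. x' (i, s) y .[kres A M] m s)" for i y
  have ta: "ta i : Hom K (kres R Y'') (kres A M)" if i: "i : I" for i
   unfolding ta_def
  proof (rule lin_finsum_map[OF KM.lself])
   fix s assume s: "s : S"
   note l = xl[of "(i, s)"]
   show "(%y. x' (i, s) y .[kres A M] m s) : Hom K (kres R Y'') (kres A M)"
   proof (rule lin_mapsI)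
    fix y y' assume "y : $(kres R Y'')" "y' : $(kres R Y'')"
    then show "x' (i, s) (y +[kres R Y''] y') .[kres A M] m s = x' (i, s) y .[kres A M] m s +[kres A M] x' (i, s) y' .[kres A M] m s"
     using lin_add[OF l, of y y'] i s E(2)[OF s] x'c[OF i s] KM.smult_l_distr[of "x' (i, s) y" "x' (i, s) y'" "m s"] by simp
   next
    fix r y assume "r : $K" "y : $(kres R Y'')"
    then show "x' (i, s) (r .[kres R Y''] y) .[kres A M] m s = r .[kres A M] (x' (i, s) y .[kres A M] m s)"
     using lin_smult[OF l, of r y] i s E(2)[OF s] x'c[OF i s] KM.smult_assoc1[of r "x' (i, s) y" "m s"] by simp
   qed (use x'c[OF i s] mS[OF s] in "auto intro!: M.smult_closed")
  qed
  have tac: "ta i y : $M" if "i : I" "y : $Y''" for i y using lin_closed[OF ta[OF that(1)]] that(2) by simp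
  have tarel: "a .[M] ta j y = (SUM[M]i:I. ta i (c i (a .[LA] b j) .[Y''] y))"
   if a: "a : $A" and j: "j : I" and y: "y : $Y''" for a j y
  proof -
   have act: "(%x. a .[M] x) : Hom K (kres A M) (kres A M)"
    by (rule lin_mapsI) (use a in "auto simp: M.smult_r_distr M.smult_assoc1[symmetric] A.scalar_central M.smult_closed")
   have ry: "c i (a .[LA] b j) .[Y''] y : $Y''" if "i : I" for i using cab[OF a j that] y by (rule Y''.smult_closed)
   have coef: "mu s' (a .[M] ta j y) = (SUM[K]i:I. x' (i, s') (c i (a .[LA] b j) .[Y''] y))" if s': "s' : S" for s'
   proof -
    have "mu s' (a .[M] ta j y) = (SUM[regm K]s:S. mu s' (a .[M] (x' (j, s) y .[kres A M] m s)))"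
     unfolding ta_def using mS x'c[OF j] y
     by (intro lin_finsum[OF KM.lself regular_left_module[OF K.ring_axioms] lin_comp[OF act mu(1)[OF s']]])
      (auto intro!: M.smult_closed)
    also have "... = (SUM[K]s:S. mu s' (a .[M] m s) *[K] x' (j, s) y)"
     unfolding finsum_regular
    proof (rule K.finsum_cong')
     fix s assume s: "s : S"
     show "mu s' (a .[M] (x' (j, s) y .[kres A M] m s)) = mu s' (a .[M] m s) *[K] x' (j, s) y"
      using lin_smult[OF lin_comp[OF act mu(1)[OF s']] x'c[OF j s y], of "m s"] mS[OF s] K.m_comm[OF x'c[OF j s y] muam[OF a s s']] by simp
    qed (use x'c[OF j _ y] muam[OF a _ s'] in auto)
    also have "... = (SUM[K]i:I. x' (i, s') (c i (a .[LA] b j) .[Y''] y))"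
    proof -
     have "w a j s' : V" unfolding V_def using a j s' by blast
     note * = bspec[OF x'(3) this]
     show ?thesis by (rule sym, rule bspec[OF iffD1[OF solution_iff[OF Y'' x'(1) a j s'] *] y])
    qed
    finally show ?thesis .
   qed
   have "a .[M] ta j y = (SUM[kres A M]s:S. mu s (a .[M] ta j y) .[kres A M] m s)"
    by (rule mexp[OF M.smult_closed[OF a tac[OF j y]]])
   also have "... = (SUM[kres A M]s:S. (SUM[K]i:I. x' (i, s) (c i (a .[LA] b j) .[Y''] y)) .[kres A M] m s)"
    using coef x'c ry mK
    by (intro KM.M.finsum_cong') (auto intro!: KM.smult_closed K.finsum_closed simp del: restrict_scalars_simps finsum_restrict_scalars)
   also have "... = (SUM[kres A M]s:S. SUM[kres A M]i:I. x' (i, s) (c i (a .[LA] b j) .[Y''] y) .[kres A M] m s)"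
    using x'c ry mK by (intro KM.M.finsum_cong' KM.finsum_smult)
     (auto intro!: KM.smult_closed KM.M.finsum_closed simp del: restrict_scalars_simps finsum_restrict_scalars)
   also have "... = (SUM[kres A M]i:I. ta i (c i (a .[LA] b j) .[Y''] y))"
    unfolding ta_def using x'c ry mK E(1) D(1)
    by (intro KM.finsum_swap) (auto intro!: KM.smult_closed simp del: restrict_scalars_simps finsum_restrict_scalars)
   finally show ?thesis by simp
  qed

  \<comment> \<open>Linearity of the extension\<close>
  define t' where "t' z = (SUM[M]i:I. ta i (B.coord Y'' i z))" for z
  have cl: "B.coord Y'' i z : $Y''" if "i : I" "z : $(bt R LA LR Y'')" for i z by (rule B.coord(1)[OF Y'' that])
  have t'c: "t' z : $M" if "z : $(bt R LA LR Y'')" for z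
   unfolding t'_def using tac cl that by (intro M.M.finsum_closed) auto
  have t'add: "t' (z +[bt R LA LR Y''] z') = t' z +[M] t' z'"
   if "z : $(bt R LA LR Y'')" "z' : $(bt R LA LR Y'')" for z z'
  proof -
   have "ta i (B.coord Y'' i (z +[bt R LA LR Y''] z')) = ta i (B.coord Y'' i z) +[M] ta i (B.coord Y'' i z')" if i: "i : I" for i
    using B.coord(2)[OF Y'' i] lin_add[OF ta[OF i], of "B.coord Y'' i z" "B.coord Y'' i z'"] cl[OF i] that `z : _` `z' : _` by simp
   then have "t' (z +[bt R LA LR Y''] z') = (SUM[M]i:I. ta i (B.coord Y'' i z) +[M] ta i (B.coord Y'' i z'))"
    unfolding t'_def using tac cl that by (intro M.M.finsum_cong') auto
   also have "... = t' z +[M] t' z'" unfolding t'_def using tac cl that by (intro M.M.finsum_addf) auto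
   finally show ?thesis .
  qed
  \<comment> \<open>\<open>tarel\<close> is linearity over \<open>A\<close> at the basis vectors
    \<open>b j\<close>; a general \<open>l\<close> is expanded in the dual basis.\<close>
  have t'sm: "t' (a .[bt R LA LR Y''] z) = a .[M] t' z" if a: "a : $A" and z: "z : $(bt R LA LR Y'')" for a z
   using z
  proof (rule TY''.additive_eqI[where pl = "%x y. x +[M] y" and ph = "%z. t' (a .[bt R LA LR Y''] z)" and vv = "%z. a .[M] t' z"])
   interpret T'': left_module A "bt R LA LR Y''" by (rule B.bt_left_module[OF Y''])
   fix z w assume zw: "z : $(bt R LA LR Y'')" "w : $(bt R LA LR Y'')"
   show "t' (a .[bt R LA LR Y''] (z +[bt R LA LR Y''] w)) = t' (a .[bt R LA LR Y''] z) +[M] t' (a .[bt R LA LR Y''] w)"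
    using zw a by (simp add: T''.smult_r_distr t'add T''.smult_closed)
   show "a .[M] t' (z +[bt R LA LR Y''] w) = a .[M] t' z +[M] a .[M] t' w"
    using zw a by (simp add: t'add t'c M.smult_r_distr)
  next
   fix l y assume l: "l : $LR" and y: "y : $Y''"
   have al: "a .[LA] l : $LR" using a l by simp
   have cl: "c i l : $R" if "i : I" for i using D(4)[OF that l] .
   have cly: "c j l .[Y''] y : $Y''" if "j : I" for j using cl[OF that] y by (rule Y''.smult_closed)
   have ry: "c i (a .[LA] b j) .[Y''] (c j l .[Y''] y) : $Y''" if "i : I" "j : I" for i j
    using cab[OF a that(2,1)] cly[OF that(2)] by (rule Y''.smult_closed)
   have cal: "c i (a .[LA] l) .[Y''] y = (SUM[Y'']j:I. c i (a .[LA] b j) .[Y''] (c j l .[Y''] y))" if i: "i : I" for i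
   proof -
    note h = lin_comp[OF B.act_lin[OF a] D(3)[OF i]]
    have "c i (a .[LA] (SUM[LR]j:I. c j l .[LR] b j)) = (SUM[regm R]j:I. c i (a .[LA] (c j l .[LR] b j)))"
     using D(2) cl by (intro lin_finsum[OF B.LR.lself regular_left_module[OF dom.ring_axioms] h]) (auto intro!: B.LR.smult_closed)
    also have "... = (SUM[R]j:I. c i (a .[LA] b j) *[R] c j l)"
     unfolding finsum_regular using D(2) cl cab[OF a _ i] lin_smult[OF h] dom.m_comm by (intro dom.finsum_cong') auto
    finally have "c i (a .[LA] l) = (SUM[R]j:I. c i (a .[LA] b j) *[R] c j l)" unfolding D(5)[OF l] .
    then have "c i (a .[LA] l) .[Y''] y = (SUM[Y'']j:I. (c i (a .[LA] b j) *[R] c j l) .[Y''] y)"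
     using Y''.finsum_smult[OF y, of "%j. c i (a .[LA] b j) *[R] c j l" I] cab[OF a _ i] cl by auto
    also have "... = (SUM[Y'']j:I. c i (a .[LA] b j) .[Y''] (c j l .[Y''] y))"
     using cab[OF a _ i] cl y ry[OF i] by (intro Y''.M.finsum_cong') (auto simp: Y''.smult_assoc1)
    finally show ?thesis .
   qed
   have "t' (a .[bt R LA LR Y''] etens R LR Y'' l y) = (SUM[M]i:I. ta i (c i (a .[LA] l) .[Y''] y))"
    unfolding t'_def B.bt_smult[OF Y'' a l y] using B.coord(3)[OF Y'' _ al y] tac D(4)[OF _ al] y
    by (intro M.M.finsum_cong') (auto intro!: tac Y''.smult_closed)
   also have "... = (SUM[M]i:I. SUM[M]j:I. ta i (c i (a .[LA] b j) .[Y''] (c j l .[Y''] y)))"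
   proof (rule M.M.finsum_cong')
    fix i assume i: "i : I"
    have "ta i (SUM[kres R Y'']j:I. c i (a .[LA] b j) .[Y''] (c j l .[Y''] y)) = (SUM[kres A M]j:I. ta i (c i (a .[LA] b j) .[Y''] (c j l .[Y''] y)))"
     using ry[OF i] by (intro lin_finsum[OF kres_left_module[OF Y''] KM.lself ta[OF i]]) auto
    then show "ta i (c i (a .[LA] l) .[Y''] y) = (SUM[M]j:I. ta i (c i (a .[LA] b j) .[Y''] (c j l .[Y''] y)))"
     unfolding cal[OF i] by simp
   qed (use ry tac in "auto intro!: M.M.finsum_closed")
   also have "... = (SUM[M]j:I. SUM[M]i:I. ta i (c i (a .[LA] b j) .[Y''] (c j l .[Y''] y)))"
    using D(1) ry tac by (intro M.finsum_swap) auto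
   also have "... = (SUM[M]j:I. a .[M] ta j (c j l .[Y''] y))"
    using tarel[OF a _ cly] tac cly a by (intro M.M.finsum_cong') (auto intro!: M.smult_closed)
   also have "... = a .[M] (SUM[M]j:I. ta j (c j l .[Y''] y))"
    using a tac cly by (intro M.smult_finsum[symmetric]) auto
   also have "(SUM[M]j:I. ta j (c j l .[Y''] y)) = t' (etens R LR Y'' l y)"
    unfolding t'_def using B.coord(3)[OF Y'' _ l y] tac cly by (intro M.M.finsum_cong') auto
   finally show "t' (a .[bt R LA LR Y''] etens R LR Y'' l y) = a .[M] t' (etens R LR Y'' l y)" .
  qed
  have "t' (?f z) = t z" if z: "z : $?T" for z
  proof -
   have "ta i (f (B.coord Y i z)) = t (?e (b i) (B.coord Y i z))" if i: "i : I" for i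
   proof -
    have cY: "B.coord Y i z : $Y" by (rule B.coord(1)[OF Y i z])
    have "th (i, s) (B.coord Y i z) : $K" if "s : S" for s
     using lin_closed[OF th[OF i that], of "B.coord Y i z"] cY by simp
    then have "ta i (f (B.coord Y i z)) = (SUM[kres A M]s:S. th (i, s) (B.coord Y i z) .[kres A M] m s)"
     unfolding ta_def using x'f[OF i _ cY] mK
     by (intro KM.M.finsum_cong') (auto intro!: KM.smult_closed simp del: restrict_scalars_simps finsum_restrict_scalars)
    then show ?thesis using mexp[OF te[OF D(2)[OF i] cY]] by (simp add: th_def)
   qed
   then show ?thesis
    unfolding t'_def texp[OF z] using B.coord_natural[OF Y Y'' f _ z] te D(2) B.coord(1)[OF Y _ z]
    by (intro M.M.finsum_cong') auto
  qed
  moreover have "t' : Hom A (bt R LA LR Y'') M" by (intro lin_mapsI t'c t'add t'sm)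
  ultimately show ?thesis by blast
 qed
 note main = this
 show ?thesis
 proof (intro bexI[OF _ De(1)] conjI allI impI De(2))
  fix Y Y'' :: "('r, 'y) module" and f t
  assume "lmod R Y" "lmod R Y''" "f : Hom R Y Y''" "bij_betw (module.smult Y'' De) $Y'' $Y''"
   "module.smult Y De ` $Y = $Y" "t : Hom A (bt R LA LR Y) M"
   "ALL z:$(bt R LA LR Y). tmap R LR Y'' (%x. x) f z = 0[bt R LA LR Y''] --> t z = 0[M]"
  then show "EX t':Hom A (bt R LA LR Y'') M. ALL z:$(bt R LA LR Y). t' (tmap R LR Y'' (%x. x) f z) = t z"
   by (rule main)
 qed
qed

section \<open>The sequences representing the generators\<close>

lemma unit_smult_bij:
 assumes N: "lmod R N" and u: "u : $R" "v : $R" "u *[R] v = 1[R]" "v *[R] u = 1[R]"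
 shows "bij_betw (module.smult N v) $N $N"
proof -
 interpret left_module R N by fact
 show ?thesis
  by (rule bij_betwI[of _ _ _ "module.smult N u"]) (use u in "auto simp: smult_closed smult_assoc1[symmetric] smult_one")
qed

text \<open>The inverse of \<open>r/1\<close> is \<open>1/r\<close>. In a domain, equality of
  fractions is cross multiplication, and this shows that the union defining a product of fractions
  is the expected fraction.\<close>

lemma loc_hom_unit:
 assumes R: "domain R" and aa: "primeideal aa R" and r: "r : $R" "r ~: aa"
 defines "S \<equiv> $R - aa"
 shows "loc_hom R aa r : $(localization_at R aa)" "loc_frac R S 1[R] r : $(localization_at R aa)"
  "loc_frac R S 1[R] r *[localization_at R aa] loc_hom R aa r = 1[localization_at R aa]"
  "loc_hom R aa r *[localization_at R aa] loc_frac R S 1[R] r = 1[localization_at R aa]"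
proof -
 interpret domain R by fact
 interpret aa: primeideal aa R by fact
 have S: "s : $R" "s ~= 0[R]" if "s : S" for s using that aa.zero_closed by (auto simp: S_def)
 have SS: "s *[R] t : S" if "s : S" "t : S" for s t using that aa.I_prime by (auto simp: S_def)
 have 1: "1[R] : S" using aa.I_notcarr aa.one_imp_carrier by (auto simp: S_def)
 have rS: "r : S" using r by (simp add: S_def)
 have rel: "((a, s), (b, t)) : loc_rel R S \<longleftrightarrow> a : $R & b : $R & s : S & t : S & a *[R] t = b *[R] s" for a s b t
  unfolding loc_rel_def using S 1 m_lcancel by auto
 have frac_eq: "loc_frac R S a s = loc_frac R S b t"
  if "a : $R" "b : $R" "s : S" "t : S" "a *[R] t = b *[R] s" for a b s t
 proof -
  have "a *[R] w = c *[R] s \<longleftrightarrow> b *[R] w = c *[R] t" if "c : $R" "w : S" for c w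
  proof -
   have "t *[R] (a *[R] w) = s *[R] (b *[R] w)"
    using that `a *[R] t = b *[R] s` `a : _` `b : _` S[OF `s : S`] S[OF `t : S`] S[OF `w : S`] by (metis m_assoc m_comm)
   moreover have "t *[R] (c *[R] s) = s *[R] (c *[R] t)"
    using that S[OF `s : S`] S[OF `t : S`] by (metis m_lcomm m_comm)
   ultimately show ?thesis
    using that `a : _` `b : _` S[OF `s : S`] S[OF `t : S`] S[OF `w : S`] by (metis m_closed m_lcancel)
  qed
  then show ?thesis using that unfolding loc_frac_def by (auto simp: rel)
 qed
 have mult: "loc_frac R S a s *[localization R S] loc_frac R S b t = loc_frac R S (a *[R] b) (s *[R] t)"
  if ab: "a : $R" "b : $R" "s : S" "t : S" for a b s t
 proof -
  have e: "loc_frac R S (a' *[R] b') (s' *[R] t') = loc_frac R S (a *[R] b) (s *[R] t)"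
   if "(a', s') : loc_frac R S a s" "(b', t') : loc_frac R S b t" for a' s' b' t'
  proof -
   have h: "a' : $R" "s' : S" "a *[R] s' = a' *[R] s" "b' : $R" "t' : S" "b *[R] t' = b' *[R] t"
    using that by (auto simp: loc_frac_def rel)
   have "(a' *[R] b') *[R] (s *[R] t) = (a' *[R] s) *[R] (b' *[R] t)"
    using h ab S by (simp add: m_ac)
   also have "... = (a *[R] b) *[R] (s' *[R] t')" using h ab S by (simp add: h(3,6)[symmetric] m_ac)
   finally show ?thesis using h ab SS by (intro frac_eq) auto
  qed
  have ne: "(a, s) : loc_frac R S a s" "(b, t) : loc_frac R S b t" using ab by (auto simp: loc_frac_def rel)
  have "loc_frac R S a s *[localization R S] loc_frac R S b t =
    (UN (a, s):loc_frac R S a s. UN (b, t):loc_frac R S b t. loc_frac R S (a *[R] b) (s *[R] t))"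
   by (simp add: localization_def)
  also have "... = loc_frac R S (a *[R] b) (s *[R] t)"
  proof (rule SUP_eq_const)
   show "loc_frac R S a s ~= {}" using ne by blast
   fix p assume p: "p : loc_frac R S a s"
   show "(case p of (a, s) => UN (b, t):loc_frac R S b t. loc_frac R S (a *[R] b) (s *[R] t)) = loc_frac R S (a *[R] b) (s *[R] t)"
    unfolding case_prod_beta
    by (rule SUP_eq_const) (use ne p e[of "fst p" "snd p"] in "auto split: prod.split")
  qed
  finally show ?thesis .
 qed
 have c: "loc_frac R S a s : $(localization R S)" if "a : $R" "s : S" for a s
  using that by (auto simp: localization_def loc_frac_def quotient_def)
 have l: "localization_at R aa = localization R S" by (simp add: localization_at_def S_def)
 have h: "loc_hom R aa r = loc_frac R S r 1[R]" by (simp add: loc_hom_def S_def)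
 have o: "1[localization R S] = loc_frac R S 1[R] 1[R]" by (simp add: localization_def)
 show "loc_hom R aa r : $(localization_at R aa)" "loc_frac R S 1[R] r : $(localization_at R aa)"
  unfolding l h using c r 1 rS by auto
 show "loc_frac R S 1[R] r *[localization_at R aa] loc_hom R aa r = 1[localization_at R aa]"
  "loc_hom R aa r *[localization_at R aa] loc_frac R S 1[R] r = 1[localization_at R aa]"
  unfolding l h o using r 1 rS frac_eq[of r "1[R]" r "1[R]"] by (simp_all add: mult)
qed

lemma simple_at_smult_bij:
 assumes R: "cring R" and aa: "maximalideal aa R" and r: "r : $R" "r ~: aa"
 shows "bij_betw (module.smult (simple_at R aa) r) ($(simple_at R aa)) ($(simple_at R aa))"
proof -
 interpret aa: maximalideal aa R by fact
 interpret Q: field "R Quot aa" by (rule aa.quotient_is_field[OF R])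
 let ?r = "aa +>\<^bsub>R\<^esub> r"
 have rc: "?r : $(R Quot aa)" using r(1) by (auto simp: FactRing_def A_RCOSETS_def')
 have "?r ~= 0[R Quot aa]"
 proof
  assume "?r = 0[R Quot aa]"
  then have "?r = aa" by (simp add: FactRing_def)
  then show False using aa.a_rcos_self[OF r(1)] r(2) by simp
 qed
 then have "?r : Units (R Quot aa)" using rc Q.field_Units by simp
 note v = Q.Units_inv_closed[OF this] Q.Units_l_inv [OF this] Q.Units_r_inv [OF this]
 have "bij_betw (module.smult (regm (R Quot aa)) ?r) ($(R Quot aa)) ($(R Quot aa))"
  using unit_smult_bij[OF regular_left_module[OF Q.ring_axioms] v(1) rc v(2,3)] by simp
 then show ?thesis by (simp add: simple_at_def restrict_scalars_def)
qed

text \<open>Equivalent sequences have cohomologous cocycles. This refines the invariance of nullity,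
  because multiples of a nonzero class are to be compared.\<close>

lemma extension_rep_yoneda_rel:
 fixes P :: "nat => ('r, 'm) module"
 assumes P: "proj_complex R d (P, p)" "P (Suc d) = M" and E: "((C, f), E') : yoneda_rel R d M N"
  and h: "smor R d (P, p) (C, f) h" "!!x. x : $M ==> h (Suc d) x = x"
 shows "EX h' e. smor R d (P, p) E' h' & (ALL x:$M. h' (Suc d) x = x) & e : Hom R (P 1) N &
  (ALL x:$(P 0). h 0 x = h' 0 x +[N] e (p 0 x))"
proof -
 have E0: "(C, f) : extensions R d M N" and s: "((C, f), E') : (yoneda_step R d M N \<union> (yoneda_step R d M N)\<inverse>)\<^sup>*"
  using E by (auto simp: yoneda_rel_def)
 note N = extension_modules(2)[OF E0]
 interpret N: left_module R N by (rule N)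
 have cl: "k 0 x : $N" if "(Y, g) : extensions R d M N" "smor R d (P, p) (Y, g) k" "x : $(P 0)" for Y g k x
  using lin_closed[OF seq_morphismD(1)[OF that(2), of 0] that(3)] extensionsD(2)[OF that(1)] by simp
 have pc: "p 0 x : $(P 1)" if "x : $(P 0)" for x using lin_closed[OF proj_complexD(2)[OF P(1), of 0] that] by simp
 from s show ?thesis
 proof induction
  case base
  then show ?case
   using h cl[OF E0 h(1)] by (intro exI[of _ h] exI[of _ "%_. 0[N]"]) (auto simp: lin_zero_map[OF N])
 next
  case (step E1 E2)
  then obtain h' e where h': "smor R d (P, p) E1 h'" "!!x. x : $M ==> h' (Suc d) x = x"
   and e: "e : Hom R (P 1) N" "!!x. x : $(P 0) ==> h 0 x = h' 0 x +[N] e (p 0 x)" by blast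
  from step(2) show ?case
  proof
   assume "(E1, E2) : yoneda_step R d M N"
   then obtain Y g Y' g' k where k: "E1 = (Y, g)" "E2 = (Y', g')" "(Y, g) : extensions R d M N"
    "smor R d (Y, g) (Y', g') k" "!!x. x : $N ==> k 0 x = x" "!!x. x : $M ==> k (Suc d) x = x"
    unfolding yoneda_step_def by (cases E1; cases E2) auto
   show ?case
    using seq_morphism_comp[OF h'(1)[unfolded k(1)] k(4)] h'(2) k(5,6) e cl[OF k(3) h'(1)[unfolded k(1)]]
    by (intro exI[of _ "%i x. k i (h' i x)"] exI[of _ e]) (auto simp: k(2))
  next
   assume "(E1, E2) : (yoneda_step R d M N)\<inverse>"
   moreover obtain Y g Y' g' where E: "E1 = (Y, g)" "E2 = (Y', g')" by (cases E1; cases E2) blast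
   ultimately obtain k where "(Y, g) : extensions R d M N" "(Y', g') : extensions R d M N"
    "smor R d (Y', g') (Y, g) k" "!!x. x : $N ==> k 0 x = x" "!!x. x : $M ==> k (Suc d) x = x"
    unfolding yoneda_step_def by auto
   note k = E this
   obtain l where l: "smor R d (P, p) (Y', g') l" "!!x. x : $M ==> l (Suc d) x = x"
    using extension_rep[OF P k(4)] P(2) by auto
   note D = extensionsD[OF k(3)] and h1 = h'(1)[unfolded k(1)] and kl = seq_morphism_comp[OF l(1) k(5)]
   interpret MM: left_module R M by (rule extension_modules(1)[OF k(3)])
   have "EX e':Hom R (P 1) (Y 0). ALL x:$(P 0). h' 0 x -[Y 0] k 0 (l 0 x) = e' (p 0 x)"
    by (rule homotopy[OF D(1) P(1) seq_morphism_diff[OF D(1) kl h1]])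
     (use h'(2) l(2) k(7) P(2) D(3) in "simp add: a_minus_def MM.M.r_neg")
   then obtain e' where e': "e' : Hom R (P 1) N" "!!x. x : $(P 0) ==> h' 0 x -[N] l 0 x = e' (p 0 x)"
    using k(6) cl[OF k(4) l(1)] D(2) by auto
   have "h 0 x = l 0 x +[N] (e' (p 0 x) +[N] e (p 0 x))" if x: "x : $(P 0)" for x
   proof -
    note c = cl[OF k(3) h1 x] cl[OF k(4) l(1) x] lin_closed[OF e'(1) pc[OF x]] lin_closed[OF e(1) pc[OF x]]
    have "h' 0 x = l 0 x +[N] e' (p 0 x)"
     using N.diff_add_cancel[OF c(1,2)] c unfolding e'(2)[OF x] by (simp add: N.M.a_comm)
    then show ?thesis using e(2)[OF x] c by (simp add: N.M.a_assoc)
   qed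
   then show ?case
    using l k(2) lin_plus[OF N e'(1) e(1)] by (intro exI[of _ l] exI[of _ "%y. e' y +[N] e y"]) auto
  qed
 qed
qed

text \<open>A null extension receives a step from a pushout whose first map has a retraction.
  Tensoring preserves both the retraction and the step, so the tensored sequence is null
  again.\<close>

lemma (in flat_bimodule) bt_null:
 fixes P :: "nat => ('r, 'm) module" and pr :: "'m \<times> 'm => 'm"
 assumes P: "resolution R d (P, p)" "P (Suc d) = M" and d: "1 <= d" and pr: "inj pr"
  and E: "(C, f) : extensions R d M N" and null: "null_via R d (P, p) (C, f)"
  and Q: "proj_complex A d (Q, q)" "Q (Suc d) = bt R LA LR M"
 shows "null_via A d (Q, q) (bt_seq R LA LR (C, f))"
proof -
 note NM = extension_modules[OF E]
 obtain F g where F: "(F, g) : extensions R d M N" "EX r:Hom R (F 1) N. ALL x:$N. r (g 0 x) = x"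
  "((F, g), (C, f)) : yoneda_step R d M N"
  by (rule null_pushout[OF P d NM(2) pr]) (use E null in blast)
 then obtain r where r: "r : Hom R (F 1) N" "!!x. x : $N ==> r (g 0 x) = x" by blast
 note FD = extensionsD[OF F(1)] and F' = bt_extension[OF F(1)]
 have F1: "lmod R (F 1)" "g 0 : Hom R N (F 1)" using long_exactD(1,2)[OF FD(1)] FD(2) by auto
 have "tmap R LR N (%x. x) r (tmap R LR (F 1) (%x. x) (g 0) z) = z" if z: "z : $(bt R LA LR N)" for z
  unfolding bt_map_comp[OF NM(2) F1(1) NM(2) F1(2) r(1) z]
  by (rule tensor_map_id[OF tp[OF NM(2)] _ _ z]) (simp_all add: r(2))
 then have "null_via A d (Q, q) (bt_seq R LA LR (F, g))"
  using F' bt_map_right[OF F1(1) NM(2) r(1)] unfolding bt_seq_def prod.case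
  by (intro retraction_null[OF Q d, of _ _ "bt R LA LR N" "tmap R LR N (%x. x) r"]) auto
 then show ?thesis using yoneda_step_null[OF Q bt_yoneda_step[OF F(3)]] by simp
qed

context fin_dim_algebra begin

text \<open>A scalar outside \<open>aa\<close> becomes a unit in the residue field, which settles
  the two ends, and in the localization, which settles the middle terms.\<close>

lemma eps_smult_bij:
 assumes E: "(C, f) : eps_sequences K d aa" and aa: "maximalideal aa (poly d)" and r: "r : $(poly d)" "r ~: aa"
  and i: "i <= Suc d"
 shows "bij_betw (module.smult (C i) r) ($(C i)) ($(C i))"
proof -
 interpret P: cring "poly d" by (rule K.poly_cring)
 have S: "C i = simple_at (poly d) aa" if "i = 0 | i = Suc d"
  using that extensionsD(2,3)[OF eps_extension[OF E]] by auto
 show ?thesis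
 proof (cases "i = 0 | i = Suc d")
  case True
  then show ?thesis unfolding S[OF True] by (intro simple_at_smult_bij[OF K.poly_cring aa r])
 next
  case False
  then have "i : {1..d}" using i by simp
  then obtain N :: "(('k polyn \<times> 'k polyn) set, 'k polyn set) module" where N: "lmod (localization_at (poly d) aa) N" "C i = rsc (loc_hom (poly d) aa) N"
   using E[unfolded eps_sequences_def Let_def mem_Collect_eq prod.case, THEN conjunct2, THEN conjunct1, THEN bspec, OF `i : {1..d}`]
   by (elim exE conjE) (rule that)
  have "bij_betw (module.smult N (loc_hom (poly d) aa r)) $N $N"
   by (rule unit_smult_bij[OF N(1)]) (rule loc_hom_unit[OF K.poly_domain P.maximalideal_prime[OF aa] r])+
  then show ?thesis by (simp add: N(2) restrict_scalars_def)
 qed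
qed

text \<open>
 Multiplying \<open>f 0\<close> by the inverse of a unit \<open>r\<close> of the residue field represents the \<open>r\<close>-fold of the
 class. It is also a \<open>K\<close>-multiple, so the residue field is \<open>K\<close> unless the class vanishes.
\<close>

lemma eps_residue:
 assumes E: "(C, f) : eps_sequences K d aa" and aa: "maximalideal aa (poly d)"
  and P: "resolution (poly d) d (P, p)" "P (Suc d) = simple_at (poly d) aa"
  and nn: "~ null_via (poly d) d (P, p) (C, f)" and r: "r : $(poly d)"
 shows "EX c:$K. r -[poly d] ring.indexed_const K c : aa"
proof -
 interpret R: cring "poly d" by (rule K.poly_cring)
 interpret aa: maximalideal aa "poly d" by (rule aa)
 let ?S = "simple_at (poly d) aa" and ?R = "poly d"
 note Ex = eps_extension[OF E] and PC = resolutionD(2)[OF P(1)]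
 note D = extensionsD[OF Ex] and L = long_exactD[OF extensionsD(1)[OF Ex]]
 have Sm: "lmod ?R ?S" by (rule extension_modules(1)[OF Ex])
 interpret S: left_module ?R ?S by (rule Sm)
 have sl: "(%x. q .[?S] x) : Hom ?R ?S ?S" if "q : $?R" for q
  by (rule lin_mapsI) (use that in "auto simp: S.smult_closed S.smult_r_distr S.smult_assoc1[symmetric] R.m_comm")
 have unit: "EX v:Hom ?R ?S ?S. (ALL x:$?S. v (q .[?S] x) = x & q .[?S] v x = x)" if q: "q : $?R" "q ~: aa" for q
 proof -
  note b = simple_at_smult_bij[OF K.poly_cring aa q]
  have "inv_into ($?S) (%x. q .[?S] x) : Hom ?R ?S ?S"
   by (rule lin_inv_into[OF Sm sl[OF q(1)]]) (use b in "auto simp: bij_betw_def")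
  then show ?thesis
   using b by (intro bexI[where x="inv_into ($?S) (%x. q .[?S] x)"])
    (auto simp: bij_betw_def inv_into_f_f f_inv_into_f)
 qed
 have const: "ring.indexed_const K c : $?R" if "c : $K" for c
  using that by (simp add: K.poly_algebra_simps K.indexed_pset.indexed_const)
 show ?thesis
 proof (cases "r : aa")
  case True
  then have "r -[?R] ring.indexed_const K 0[K] : aa"
   using r unfolding K.poly_algebra_simps(4)[of d, symmetric] by (simp add: a_minus_def)
  then show ?thesis by blast
 next
  case False
  obtain v where *: "v : Hom ?R ?S ?S" "ALL x:$?S. v (r .[?S] x) = x & r .[?S] v x = x"
   by (rule bexE[OF unit[OF r False]]) (rule that)
  note v = *(1) bspec[OF *(2), THEN conjunct1] bspec[OF *(2), THEN conjunct2]
  have f0: "f 0 : Hom ?R ?S (C 1)" using L(2)[of 0] D(2) by simp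
  \<comment> \<open>Precomposing \<open>f 0\<close> with the inverse \<open>v\<close> of
    multiplication by \<open>r\<close> changes no kernel or image, so the twisted sequence is again
    exact.\<close>
  define g where "g i = (if i = 0 then (%x. f 0 (v x)) else f i)" for i
  have vi: "v ` $?S = $?S" using lin_closed[OF v(1)] v(2) S.smult_closed[OF r] by (force simp: image_iff)
  have gi: "g i ` $(C i) = f i ` $(C i)" for i
   using D(2) vi by (cases "i = 0") (simp_all add: g_def image_image[symmetric])
  have d0: "f i ` $(C i) = {x : $(C (Suc i)). g (Suc i) x = 0[C (Suc (Suc i))]}" if "i < d" for i
   using L(5)[OF that] by (simp add: g_def)
  have "lexact ?R d (C, g)"
   unfolding long_exact_def
  proof (intro case_prodI conjI allI impI)
   fix i assume i: "i <= d"
   show "g i : Hom ?R (C i) (C (Suc i))"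
    using L(2)[OF i] lin_comp[OF v(1) f0] D(2) by (cases "i = 0") (simp_all add: g_def)
  next
   have "inj_on v ($?S)" using v(3) by (metis inj_onI)
   then show "inj_on (g 0) ($(C 0))"
    using L(3) D(2) vi comp_inj_on[of v "$?S" "f 0"] by (simp add: g_def comp_def)
  qed (use L(1,4) gi d0 in auto)
  then have Eg: "(C, g) : extensions ?R d ?S ?S" using D(2,3) by (simp add: Defs.extensions_def)
  note eq = yoneda_rel_equiv[of ?R d ?S ?S]
  have "yoneda_rel ?R d ?S ?S `` {(C, g)} : Ext ?R d ?S ?S" unfolding Ext_def by (rule quotientI[OF Eg])
  \<comment> \<open>The membership in \<open>eps_sequences\<close> makes every class a
    \<open>K\<close>-multiple of that of \<open>(C, f)\<close>, the class of the twist
    included.\<close>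
  then obtain c where c: "c : $K"
   "yoneda_rel ?R d ?S ?S `` {(C, g)} = ext_smult ?R d ?S ?S (ring.indexed_const K c) (C, f)"
   using E unfolding eps_sequences_def Let_def by blast
  let ?c = "ring.indexed_const K c"
  have "(C, g) : yoneda_rel ?R d ?S ?S `` {(C, g)}" by (rule equiv_class_self[OF eq Eg])
  then obtain Y y h where h: "((Y, y), (C, g)) : yoneda_rel ?R d ?S ?S" "smor ?R d (C, f) (Y, y) h"
   "!!x. x : $?S ==> h 0 x = ?c .[?S] x" "!!x. x : $?S ==> h (Suc d) x = x"
   unfolding c(2) ext_smult_def by auto
  obtain k where k: "smor ?R d (P, p) (C, f) k" "!!x. x : $?S ==> k (Suc d) x = x"
   using extension_rep[OF PC P(2) Ex] P(2) by auto
  have kS: "k 0 x : $?S" if "x : $(P 0)" for x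
   using lin_closed[OF seq_morphismD(1)[OF k(1), of 0] that] D(2) by simp
  \<comment> \<open>This morphism is \<open>r\<close> at the left end and the identity at the right
    end, so the twist represents the \<open>r\<close>-fold class.\<close>
  have tw: "smor ?R d (C, f) (C, g) (%i x. if i = 0 then r .[?S] x else x)"
   unfolding seq_morphism_def prod.case
  proof (intro conjI allI impI ballI)
   show "(%x. if i = 0 then r .[?S] x else x) : Hom ?R (C i) (C i)" for i
    using sl[OF r] lin_ident D(2) by (cases "i = 0") simp_all
   show "(if Suc i = 0 then r .[?S] f i x else f i x) = g i (if i = 0 then r .[?S] x else x)" if "x : $(C i)" for i x
    using that v(2) D(2) by (cases "i = 0") (simp_all add: g_def)
  qed
  obtain l e where l: "smor ?R d (P, p) (C, g) l" "ALL x:$?S. l (Suc d) x = x"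
   and e: "e : Hom ?R (P 1) ?S" "ALL x:$(P 0). h 0 (k 0 x) = l 0 x +[?S] e (p 0 x)"
   using extension_rep_yoneda_rel[OF PC P(2) h(1) seq_morphism_comp[OF k(1) h(2)]] h(4) k(2) by auto
  have lS: "l 0 x : $?S" if "x : $(P 0)" for x
   using lin_closed[OF seq_morphismD(1)[OF l(1), of 0] that] D(2) by simp
  have "EX e':Hom ?R (P 1) (C 0). ALL x:$(P 0). (if (0::nat) = 0 then r .[?S] k 0 x else k 0 x) -[C 0] l 0 x = e' (p 0 x)"
   by (rule homotopy[OF extensionsD(1)[OF Eg] PC seq_morphism_diff[OF extensionsD(1)[OF Eg] l(1) seq_morphism_comp[OF k(1) tw]]])
    (use P(2) D(3) k(2) l(2) in "simp add: a_minus_def S.M.r_neg")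
  then obtain e' where e': "e' : Hom ?R (P 1) ?S" "!!x. x : $(P 0) ==> r .[?S] k 0 x -[?S] l 0 x = e' (p 0 x)"
   using D(2) by auto
  let ?q = "r -[?R] ?c" and ?e = "%y. e' y -[?S] e y"
  have q: "?q : $?R" using r const[OF c(1)] by simp
  have e0: "?e : Hom ?R (P 1) ?S" by (rule lin_minus_map[OF Sm e'(1) e(1)])
  \<comment> \<open>The cocycle multiplied by \<open>r\<close> and multiplied by \<open>c\<close> is
    cohomologous to the cocycle \<open>l 0\<close> of the twist in both cases, so its
    \<open>(r - c)\<close>-fold is a coboundary.\<close>
  have qk: "?q .[?S] k 0 x = ?e (p 0 x)" if x: "x : $(P 0)" for x
  proof -
   have px: "p 0 x : $(P 1)" using lin_closed[OF proj_complexD(2)[OF PC, of 0] x] by simp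
   note cl = kS[OF x] lS[OF x] lin_closed[OF e(1) px] lin_closed[OF e'(1) px] S.smult_closed[OF r kS[OF x]]
   have "?c .[?S] k 0 x = l 0 x +[?S] e (p 0 x)" using e(2) x h(3)[OF kS[OF x]] by simp
   then have "?q .[?S] k 0 x = r .[?S] k 0 x -[?S] (l 0 x +[?S] e (p 0 x))"
    using r const[OF c(1)] cl(1) by (simp add: a_minus_def S.smult_l_distr S.smult_l_minus)
   also have "... = (r .[?S] k 0 x -[?S] l 0 x) -[?S] e (p 0 x)"
    using cl by (simp add: a_minus_def S.M.minus_add S.M.a_assoc)
   finally show ?thesis unfolding e'(2)[OF x] .
  qed
  have "?q : aa"
  proof (rule ccontr)
   assume "?q ~: aa"
   from unit[OF q this] obtain w where *: "w : Hom ?R ?S ?S" "ALL x:$?S. w (?q .[?S] x) = x & ?q .[?S] w x = x"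
    by (rule bexE) (rule that)
   note w = *(1) bspec[OF *(2), THEN conjunct1]
   have "null_via ?R d (P, p) (C, f)"
   proof (rule null_viaI[OF k(1)])
    show "(%y. w (?e y)) : Hom ?R (P 1) (C 0)" using lin_comp[OF e0 w(1)] D(2) by simp
    show "k 0 x = w (?e (p 0 x))" if "x : $(P 0)" for x
     using w(2)[OF kS[OF that]] qk[OF that] by simp
   qed (use k(2) P(2) in simp)
   then show False using nn by simp
  qed
  then show ?thesis using c(1) by blast
 qed
qed

end

section \<open>The representation dimension\<close>

context fin_dim_algebra begin

lemma lattice_scalar:
 assumes L: "is_lattice K A d L" and k: "k : $K"
 shows "scalar A k .[lleft K A d L] l = scalar (poly d) k .[lright K A d L] l"
proof -
 interpret TA: tensor_algebra K A "poly d" by (rule poly_tensor_algebra)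
 have "etens K A (poly d) (scalar A k) 1[poly d] = etens K A (poly d) 1[A] (scalar (poly d) k)"
  unfolding scalar_def using k by (intro TA.TP.tensor_smult) simp_all
 then show ?thesis by (simp add: lattice_left_def lattice_right_def)
qed

text \<open>If the residue field is \<open>K\<close>, the simple module is spanned over
  \<open>K\<close> by the class \<open>?u\<close> of \<open>1\<close>, and the finitely many
  \<open>b i >< ?u\<close> generate over \<open>A\<close>. Covering the left term by copies of
  \<open>M\<close> in \<open>extendable_null\<close> rests on this finiteness.\<close>

lemma simple_tensor_fin_gen:
 assumes L: "is_lattice K A d L" and aa: "maximalideal aa (poly d)"
  and res: "!!r. r : $(poly d) ==> EX c:$K. r -[poly d] ring.indexed_const K c : aa"
 shows "fin_gen A (bt (poly d) (lleft K A d L) (lright K A d L) (simple_at (poly d) aa))"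
proof -
 let ?R = "poly d" and ?S = "simple_at (poly d) aa" and ?LA = "lleft K A d L" and ?LR = "lright K A d L"
 interpret R: cring ?R by (rule K.poly_cring)
 obtain I :: "(nat => 'k) set" and b c where "flat_bimodule A ?LA ?R ?LR I b c" by (rule flat_lattice[OF L])
 then interpret B: flat_bimodule A ?LA ?R ?LR I b c .
 interpret aa: maximalideal aa ?R by (rule aa)
 interpret Q: ring "?R Quot aa" by (rule aa.quotient_is_ring)
 have S: "lmod ?R ?S"
  unfolding simple_at_def
  by (rule restrict_scalars_left_module[OF cring.axioms(1)[OF K.poly_cring] aa.rcos_ring_hom regular_left_module[OF Q.ring_axioms]])
 interpret S: left_module ?R ?S by (rule S)
 interpret T: tensor_product ?R ?LR ?S "bt ?R ?LA ?LR ?S" by (rule B.tp[OF S])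
 interpret TM: left_module A "bt ?R ?LA ?LR ?S" by (rule B.bt_left_module[OF S])
 let ?u = "aa +>\<^bsub>?R\<^esub> 1[?R]"
 have u1: "?u : $?S" by (auto simp: simple_at_def FactRing_def A_RCOSETS_def')
 have gen: "EX k:$K. x = scalar ?R k .[?S] ?u" if x: "x : $?S" for x
 proof -
  obtain r where r: "r : $?R" "x = aa +>\<^bsub>?R\<^esub> r" using x by (auto simp: simple_at_def FactRing_def A_RCOSETS_def')
  obtain k where k: "k : $K" "r -[?R] ring.indexed_const K k : aa" using res[OF r(1)] by blast
  have sk: "scalar ?R k = ring.indexed_const K k"
   using k(1) by (auto simp: scalar_def K.poly_algebra_simps K.indexed_const_def)
  have kc: "scalar ?R k : $?R" using k(1) by (simp add: sk K.poly_algebra_simps K.indexed_pset.indexed_const)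
  have "scalar ?R k .[?S] ?u = (aa +>\<^bsub>?R\<^esub> scalar ?R k) *[?R Quot aa] (aa +>\<^bsub>?R\<^esub> 1[?R])" by (simp add: simple_at_def)
  also have "... = aa +>\<^bsub>?R\<^esub> (scalar ?R k *[?R] 1[?R])" using aa.rcoset_mult_add[OF kc R.one_closed] by (simp add: FactRing_def)
  also have "... = aa +>\<^bsub>?R\<^esub> scalar ?R k" using kc by simp
  also have "... = x" using R.quotient_eq_iff_same_a_r_cos[OF aa.is_ideal r(1) kc] k(2) sk r(2) by simp
  finally show ?thesis using k(1) by blast
 qed
 let ?G = "(%i. etens ?R ?LR ?S (b i) ?u) ` I"
 have "N = $(bt ?R ?LA ?LR ?S)" if N: "smod N A (bt ?R ?LA ?LR ?S)" "?G <= N" for N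
 proof (intro equalityI subsetI)
  fix z assume z: "z : $(bt ?R ?LA ?LR ?S)"
  have "etens ?R ?LR ?S (b i) (B.coord ?S i z) : N" if i: "i : I" for i
  proof -
   obtain k where k: "k : $K" "B.coord ?S i z = scalar ?R k .[?S] ?u" using gen[OF B.coord(1)[OF S i z]] by blast
   have kc: "scalar ?R k : $?R"
    using assoc_algebra.scalar_closed[OF K.poly_assoc_algebra k(1)] .
   have "etens ?R ?LR ?S (b i) (B.coord ?S i z) = scalar A k .[bt ?R ?LA ?LR ?S] etens ?R ?LR ?S (b i) ?u"
    unfolding k(2) B.bt_smult[OF S A.scalar_closed[OF k(1)] B.dbD(2)[OF i] u1] lattice_scalar[OF L k(1)]
    by (rule T.tensor_smult[OF kc B.dbD(2)[OF i] u1, symmetric])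
   then show ?thesis using TM.submoduleD(4)[OF N(1) A.scalar_closed[OF k(1)]] N(2) i by auto
  qed
  then have "(SUM[bt ?R ?LA ?LR ?S]i:I. etens ?R ?LR ?S (b i) (B.coord ?S i z)) : N"
   by (intro TM.submodule_finsum[OF N(1)]) auto
  then show "z : N" unfolding B.coord_expand[OF S z] .
 qed (use TM.submoduleD(1)[OF N(1)] in blast)
 then show ?thesis
  unfolding TM.fin_gen_iff using B.dbD(1,2) u1 by (intro exI[of _ ?G]) auto
qed

text \<open>Room for powers of \<open>M\<close> in the carrier type of the tensor products: a
  function of two naturals is stored on the monomials in the variables \<open>0\<close> and
  \<open>1\<close>.\<close>

lemma inj_tensor_code:
 "inj (%w :: nat => nat => 'k. {frag_of (undefined :: nat => 'k, {%mu. w (count mu 0) (count mu 1)})} :: 'k tens)"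
proof (rule injI, intro ext)
 fix v w :: "nat => nat => 'k" and i j
 assume "{frag_of (undefined :: nat => 'k, {%mu. v (count mu 0) (count mu 1)})} = ({frag_of (undefined, {%mu. w (count mu 0) (count mu 1)})} :: 'k tens)"
 then have "(%mu :: nat multiset. v (count mu 0) (count mu 1)) = (%mu. w (count mu 0) (count mu 1))" by (simp add: frag_of_eq)
 from fun_cong[OF this, of "replicate_mset i 0 + replicate_mset j 1"] show "v i j = w i j" by simp
qed

lemma infinite_polyn_set: "infinite (UNIV :: 'k polyn set set)"
proof -
 have "inj (%n. {(%mu. if mu = replicate_mset n 0 then 1[K] else 0[K]) :: 'k polyn})"
 proof (rule injI)
  fix m n assume "{(%mu. if mu = replicate_mset m 0 then 1[K] else 0[K]) :: 'k polyn} = {(%mu. if mu = replicate_mset n 0 then 1[K] else 0[K])}"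
  then have "(%mu. if mu = replicate_mset m 0 then 1[K] else 0[K]) = ((%mu. if mu = replicate_mset n 0 then 1[K] else 0[K]) :: 'k polyn)" by simp
  from fun_cong[OF this, of "replicate_mset m 0"] show "m = n" by (auto split: if_splits dest: arg_cong[of _ _ size])
 qed
 then show ?thesis using infinite_iff_countable_subset by blast
qed

text \<open>Suppose the global dimension is at most \<open>d + 1\<close>. At a point
  \<open>aa\<close> of the Oppermann set with \<open>De\<close> outside \<open>aa\<close>, the
  scalar \<open>De\<close> acts invertibly on all terms of the sequence, so maps to \<open>M\<close>
  extend and \<open>extendable_null\<close> makes the tensored sequence null, against the choice of
  the point.\<close>

lemma gl_dim_End_ring_ge:
 fixes L :: "('k, 'a) lattice" and M :: "('a, nat => 'k) module"
 assumes O: "oppermann_lattice K A d L" and d: "1 <= d" and M: "generator_cogenerator K A M"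
 shows "enat (d + 2) <= gl_dim (End_ring A M)"
proof (rule ccontr)
 assume "~ ?thesis"
 then have gd: "gl_dim (End_ring A M) <= enat (Suc d)" by (cases "gl_dim (End_ring A M)") auto
 let ?R = "poly d" and ?LA = "lleft K A d L" and ?LR = "lright K A d L"
 have lm: "lmod A M" "fin_gen A M" using M by (simp_all add: generator_cogenerator_def)
 have L: "is_lattice K A d L" and dense: "Abstract_Topology.closure_of (zariski ?R) (oppermann_set K A d L) = max_spec ?R"
  using O by (simp_all add: oppermann_lattice_def)
 obtain I :: "(nat => 'k) set" and b c where B: "flat_bimodule A ?LA ?R ?LR I b c" by (rule flat_lattice[OF L])
 then interpret B: flat_bimodule A ?LA ?R ?LR I b c .
 obtain De where De: "De : $?R" "De ~= 0[?R]" and ext: "!!(Y :: ('k polyn, 'k polyn set) module) (Y'' :: ('k polyn, 'k polyn set) module) f t.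
  lmod ?R Y ==> lmod ?R Y'' ==>
  f : Hom ?R Y Y'' ==> bij_betw (module.smult Y'' De) $Y'' $Y'' ==>
  module.smult Y De ` $Y = $Y ==> t : Hom A (bt ?R ?LA ?LR Y) M ==>
  (ALL z:$(bt ?R ?LA ?LR Y). tmap ?R ?LR Y'' (%x. x) f z = 0[bt ?R ?LA ?LR Y''] --> t z = 0[M]) ==>
  EX t':Hom A (bt ?R ?LA ?LR Y'') M. ALL z:$(bt ?R ?LA ?LR Y). t' (tmap ?R ?LR Y'' (%x. x) f z) = t z"
  using generic_extension[OF K.poly_assoc_algebra K.poly_domain B lattice_scalar[OF L] lm, where 'y="'k polyn set"]
  by blast
 \<comment> \<open>The points avoiding \<open>De\<close> form an open set, nonempty by
   \<open>poly_jacobson\<close>, and the Oppermann set is dense.\<close>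
 have "EX aa:oppermann_set K A d L. De ~: aa"
 proof -
  obtain aa0 where aa0: "maximalideal aa0 ?R" "De ~: aa0" using K.poly_jacobson[OF d De] by blast
  let ?U = "max_spec ?R - {aa : max_spec ?R. {De} <= aa}"
  have op: "openin (zariski ?R) ?U" unfolding openin_zariski[OF K.poly_cring] using De(1) by (intro exI[of _ "{De}"]) simp
  have c: "aa0 : Abstract_Topology.closure_of (zariski ?R) (oppermann_set K A d L)" and u: "aa0 : ?U"
   using aa0 unfolding dense by (auto simp: max_spec_def)
  from c[unfolded in_closure_of, THEN conjunct2, THEN spec, of ?U] op u show ?thesis by auto
 qed
 then obtain aa where aa: "aa : oppermann_set K A d L" "De ~: aa" by blast
 then have aam: "maximalideal aa ?R" by (simp add: oppermann_set_def max_spec_def)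
 let ?S = "simple_at ?R aa" and ?bt = "bt ?R ?LA ?LR"
 obtain C0 f0 where "(C0, f0) : eps_sequences K d aa" using aa(1) by (auto simp: oppermann_set_def)
 note S = extension_modules(1)[OF eps_extension[OF this]]
 obtain P p where P: "resolution A d (P, p)" "P (Suc d) = ?bt ?S" by (rule resolution_exists[OF B.bt_left_module[OF S]])
 obtain E where "E : eps_sequences K d aa" "~ null_via A d (P, p) (bt_seq ?R ?LA ?LR E)"
  using aa(1) oppermann_set_iff[OF L d P] by blast
 then obtain C f where E: "(C, f) : eps_sequences K d aa" and nn: "~ null_via A d (P, p) (bt_seq ?R ?LA ?LR (C, f))" by (cases E) blast
 note Ex = eps_extension[OF E] and PC = resolutionD(2)[OF P(1)]
 note D = extensionsD[OF Ex] and LE = long_exactD[OF extensionsD(1)[OF Ex]]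
 obtain Q q where Q: "resolution ?R d (Q, q)" "Q (Suc d) = ?S"
  by (rule projective_resolution_exists[OF S infinite_polyn_set, of "%r. {r}"]) (simp, rule that)
 obtain pr :: "'k polyn set \<times> 'k polyn set => 'k polyn set" where pr: "inj pr" by (rule infinite_pairing[OF infinite_polyn_set])
 \<comment> \<open>A sequence that is null over the polynomial ring stays null after tensoring;
   \<open>eps_residue\<close> is about sequences that are not null.\<close>
 have nnR: "~ null_via ?R d (Q, q) (C, f)" using B.bt_null[OF Q d pr Ex _ PC P(2)] nn by blast
 have fg: "fin_gen A (?bt ?S)" by (rule simple_tensor_fin_gen[OF L aam eps_residue[OF E aam Q nnR]])
 let ?C = "%i. ?bt (C i)" and ?f = "%i. tmap ?R ?LR (C (Suc i)) (%x. x) (f i)"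
 have bs: "bt_seq ?R ?LA ?LR (C, f) = (?C, ?f)" by (simp add: bt_seq_def)
 note Ex' = B.bt_extension[OF Ex, unfolded bs]
 obtain h where h: "smor A d (P, p) (?C, ?f) h" "!!x. x : $(P (Suc d)) ==> h (Suc d) x = x"
  using extension_rep[OF PC P(2) Ex'] by blast
 have bij: "bij_betw (module.smult (C i) De) ($(C i)) ($(C i))" if "i <= Suc d" for i
  by (rule eps_smult_bij[OF E aam De(1) aa(2) that])
 have "EX e:Hom A (P 1) (?C 0). ALL x:$(P 0). h 0 x = e (p 0 x)"
 proof (rule extendable_null[OF M gd d extensionsD(1)[OF Ex'] _ inj_tensor_code _ PC h(1)])
  show "fin_gen A (?C 0)" using fg D(2) by simp
  fix i t assume i: "i < d" and t: "t : Hom A (?C i) M"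
   "!!x. x : $(?C i) ==> ?f i x = 0[?C (Suc i)] ==> t x = 0[M]"
  show "EX t':Hom A (?C (Suc i)) M. ALL x:$(?C i). t' (?f i x) = t x"
   by (rule ext[OF LE(1) LE(1) LE(2) bij _ t(1)]) (use i t(2) bij[of i] in "auto simp: bij_betw_def")
 qed
 then obtain e where "e : Hom A (P 1) (?C 0)" "!!x. x : $(P 0) ==> h 0 x = e (p 0 x)" by blast
 then have "null_via A d (P, p) (?C, ?f)" by (intro null_viaI[OF h(1)] h(2))
 then show False using nn bs by simp
qed

text \<open>With representation dimension \<open>n\<close>, every Oppermann lattice has dimension at
  most the real number \<open>n - 2\<close>, and so has their supremum. Without such lattices the
  supremum is minus infinity, and an infinite representation dimension makes the bound
  trivial.\<close>

lemma rep_dim_ge: "Odim K A + 2 <= ereal_of_enat (rep_dim K A)"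
proof (cases "rep_dim K A")
 case (enat n)
 have "ereal (real d) <= ereal (real n - 2)" if d: "1 <= d" and L: "oppermann_lattice K A d L" for d L
 proof -
  have "enat (d + 2) <= rep_dim K A"
   unfolding rep_dim_def by (rule Inf_greatest) (elim CollectE exE conjE, simp only:, rule gl_dim_End_ring_ge[OF L d])
  then show ?thesis using enat by simp
 qed
 then have "Odim K A <= ereal (real n - 2)" unfolding Odim_def by (intro Sup_least) auto
 then have "Odim K A + 2 <= ereal (real n - 2) + 2" by (intro add_right_mono)
 then show ?thesis using enat by simp
qed simp

end


theorem theorem1p2:
  fixes K :: "'k ring" and G :: "'g monoid" and A :: "('k, 'a) module" and Agr :: "'g \<Rightarrow> 'a set"
  assumes "algebraically_closed K"
    and "group G" and "finite (carrier G)"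
    and "graded_algebra K G A Agr"
    and "fin_gen K A"
  shows "Odim K (smash_product G A Agr) \<le> Odim K A \<and>
    (separably_graded G A Agr \<longrightarrow>
      Odim K (smash_product G A Agr) = Odim K A \<and>
      ereal_of_enat (rep_dim K (smash_product G A Agr)) \<ge> Odim K A + 2)"
proof -
 have K: "field K" using assms(1) by (rule algebraically_closed.axioms(1))
 interpret graded_algebra K G A Agr by fact
 \<comment> \<open>The bound \<open>rep_dim_ge\<close> is taken for the smash product, whose
   Oppermann dimension is that of \<open>A\<close> in the separable case.\<close>
 show ?thesis
  using Odim_smash_le[OF K assms(5)] Odim_smash_eq[OF K assms(5)] fin_dim_algebra.rep_dim_ge[OF fin_dim_algebras(2)[OF K assms(5)]]
  by auto
qed

end
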